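(* The following hold for saturated FDFAs using duo-normalized acceptance. Complementation (given $\mathcal F$, produce a saturated duo-normalized FDFA for the complement of its language) can be computed in constant space. Intersection and union (given $\mathcal F,\mathcal F'$, produce a saturated duo-normalized FDFA for the intersection, respectively union, of their languages) and membership (given $\mathcal F$ and $(u,v)\in\Sigma^*\times\Sigma^+$, decide whether $(u,v)\in[\![\mathcal F]\!]$) can be computed in logarithmic space. Emptiness, universality, containment and equivalence (of the recognized languages of given FDFAs) can be computed in non-deterministic logarithmic space.
   Context: $\Sigma$ is a finite alphabet. An automaton structure is a complete deterministic finite automaton without acceptance condition; for an automaton (structure) $\mathcal A$ and $w\in\Sigma^*$, $\mathcal A(w)$ is the state reached from the initial state on reading $w$. $[\![\mathcal D]\!]$ is the language of a DFA $\mathcal D$. A family of DFAs (FDFA) is a pair $\mathcal F=(\mathcal Q,\{\mathcal P_q\}_{q\in Q})$ consisting of a leading automaton structure $\mathcal Q$ with state set $Q$ and a progress DFA $\mathcal P_q$ (complete, deterministic) for each state $q$ of $\mathcal Q$. For $u\in\Sigma^*$ write $\mathcal P_u=\mathcal P_{\mathcal Q(u)}$. For $u\in\Sigma^*,v\in\Sigma^+$: $(u,v)$ is a decomposition of $w\in\Sigma^\omega$ if $uv^\omega=w$; it is normalized if $\mathcal Q(uv)=\mathcal Q(u)$; it is duo-normalized if it is normalized and $\mathcal P_u(vv)=\mathcal P_u(v)$. Under duo-normalized acceptance, $(u,v)\in[\![\mathcal F]\!]$ iff there is a duo-normalized decomposition $(x,y)$ of $uv^\omega$ with $y\in[\![\mathcal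 P_x]\!]$. $\mathcal F$ is saturated (for duo-normalized acceptance) if for every ultimately periodic word $w$, all duo-normalized decompositions $(x,y)$ of $w$ agree on whether $y\in[\![\mathcal P_x]\!]$. The language of $\mathcal F$ is viewed as a set of ultimately periodic words $uv^\omega$; complement, union, intersection, emptiness, universality, containment and equality refer to this set (relative to all ultimately periodic words over $\Sigma$). *)

theory Defs
  imports Complex_Main "HOL-Library.Omega_Words_Fun" "HOL-Library.Landau_Symbols"
begin

section \<open>Families of DFAs\<close>

text \<open>
  The alphabet is the finite type \<open>'a\<close>. Since automata are going to be inputs and outputs of
  machines, the states of an automaton with \<open>n\<close> states are the numbers below \<open>n\<close>; the transition
  function is unconstrained on other arguments.
\<close>

record 'a aut =
  nstates :: nat
  initial :: nat
  delta :: "nat \<Rightarrow> 'a \<Rightarrow> nat"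

record 'a dfa = "'a aut" +
  final :: "nat set"

record 'a fdfa =
  leading :: "'a aut"
  progress :: "nat \<Rightarrow> 'a dfa"

definition wf_aut :: "('a, 'z) aut_scheme \<Rightarrow> bool" where
  "wf_aut A \<longleftrightarrow> initial A < nstates A \<and> (\<forall>q < nstates A. \<forall>a. delta A q a < nstates A)"

definition wf_dfa :: "'a dfa \<Rightarrow> bool" where
  "wf_dfa D \<longleftrightarrow> wf_aut D \<and> final D \<subseteq> {..<nstates D}"

definition wf_fdfa :: "'a fdfa \<Rightarrow> bool" where
  "wf_fdfa F \<longleftrightarrow> wf_aut (leading F) \<and> (\<forall>q < nstates (leading F). wf_dfa (progress F q))"

definition reached :: "('a, 'z) aut_scheme \<Rightarrow> 'a list \<Rightarrow> nat" where
  "reached A w = foldl (delta A) (initial A) w"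

definition dfa_lang :: "'a dfa \<Rightarrow> 'a list set" where
  "dfa_lang D = {w. reached D w \<in> final D}"

definition progress_of :: "'a fdfa \<Rightarrow> 'a list \<Rightarrow> 'a dfa" where
  "progress_of F u = progress F (reached (leading F) u)"

definition decomposition :: "'a word \<Rightarrow> 'a list \<Rightarrow> 'a list \<Rightarrow> bool" where
  "decomposition w u v \<longleftrightarrow> v \<noteq> [] \<and> u \<frown> v\<^sup>\<omega> = w"

definition up_words :: "'a word set" where
  "up_words = {w. \<exists>u v. decomposition w u v}"

definition normalized :: "'a fdfa \<Rightarrow> 'a list \<Rightarrow> 'a list \<Rightarrow> bool" where
  "normalized F u v \<longleftrightarrow> reached (leading F) (u @ v) = reached (leading F) u"

definition duo_normalized :: "'a fdfa \<Rightarrow> 'a list \<Rightarrow> 'a list \<Rightarrow> bool" where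
  "duo_normalized F u v \<longleftrightarrow>
     normalized F u v \<and> reached (progress_of F u) (v @ v) = reached (progress_of F u) v"

definition accepted :: "'a fdfa \<Rightarrow> ('a list \<times> 'a list) set" where
  "accepted F = {(u, v). v \<noteq> [] \<and>
     (\<exists>x y. decomposition (u \<frown> v\<^sup>\<omega>) x y \<and> duo_normalized F x y \<and> y \<in> dfa_lang (progress_of F x))}"

definition fdfa_lang :: "'a fdfa \<Rightarrow> 'a word set" where
  "fdfa_lang F = {u \<frown> v\<^sup>\<omega> |u v. (u, v) \<in> accepted F}"

definition saturated :: "'a fdfa \<Rightarrow> bool" where
  "saturated F \<longleftrightarrow> (\<forall>w \<in> up_words. \<forall>x y x' y'.
     decomposition w x y \<and> duo_normalized F x y \<and>
     decomposition w x' y' \<and> duo_normalized F x' y' \<longrightarrow>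
     (y \<in> dfa_lang (progress_of F x) \<longleftrightarrow> y' \<in> dfa_lang (progress_of F x')))"

definition sat_fdfas :: "'a fdfa set" where
  "sat_fdfas = {F. wf_fdfa F \<and> saturated F}"


section \<open>Space-bounded Turing machines\<close>

text \<open>
  A machine has a read-only two-way input tape with end markers, a fixed number of one-way infinite
  read-write work tapes, and a write-only one-way output tape. Control states and work symbols are
  initial segments of \<open>nat\<close>; state \<open>0\<close> is initial and work symbol \<open>0\<close> is the blank. An action
  consists of the next state, the move of the input head, the symbol written and the move on each
  work tape, and at most one symbol to append to the output. The machine halts when no action
  is available.
\<close>

datatype move = MoveLeft | Stay | MoveRight

datatype 's cell = LeftEnd | Sym 's | RightEnd

type_synonym 'o action = "nat \<times> move \<times> (nat \<times> move) list \<times> 'o option"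

record ('i, 'o) tm =
  tm_states :: nat
  tm_symbols :: nat
  tm_tapes :: nat
  tm_accept :: "nat set"
  tm_trans :: "nat \<Rightarrow> 'i cell \<Rightarrow> nat list \<Rightarrow> 'o action set"

definition wf_tm :: "('i, 'o) tm \<Rightarrow> bool" where
  "wf_tm M \<longleftrightarrow> 0 < tm_states M \<and> 0 < tm_symbols M \<and>
     (\<forall>q < tm_states M. \<forall>i. \<forall>ws. length ws = tm_tapes M \<and> set ws \<subseteq> {..<tm_symbols M} \<longrightarrow>
        (\<forall>(q', d, acts, out) \<in> tm_trans M q i ws.
           q' < tm_states M \<and> length acts = tm_tapes M \<and> (\<forall>(b, m) \<in> set acts. b < tm_symbols M)))"

definition deterministic :: "('i, 'o) tm \<Rightarrow> bool" where
  "deterministic M \<longleftrightarrow> (\<forall>q i ws. \<forall>a \<in> tm_trans M q i ws. \<forall>b \<in> tm_trans M q i ws. a = b)"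

text \<open>A work tape is given by its contents and the position of its head.\<close>

record 'o conf =
  cf_state :: nat
  cf_input :: nat
  cf_work :: "((nat \<Rightarrow> nat) \<times> nat) list"
  cf_output :: "'o list"

definition init_conf :: "('i, 'o) tm \<Rightarrow> 'o conf" where
  "init_conf M = \<lparr>cf_state = 0, cf_input = 0,
     cf_work = replicate (tm_tapes M) (\<lambda>_. 0, 0), cf_output = []\<rparr>"

text \<open>The input \<open>x\<close> occupies cells \<open>1, \<dots>, length x\<close>.\<close>

definition scan :: "'i list \<Rightarrow> nat \<Rightarrow> 'i cell" where
  "scan x p = (if p = 0 then LeftEnd else if p \<le> length x then Sym (x ! (p - 1)) else RightEnd)"

text \<open>Moving left in cell \<open>0\<close> has no effect.\<close>

fun move_head :: "move \<Rightarrow> nat \<Rightarrow> nat" where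
  "move_head MoveLeft p = p - 1"
| "move_head Stay p = p"
| "move_head MoveRight p = p + 1"

definition act_tape :: "(nat \<Rightarrow> nat) \<times> nat \<Rightarrow> nat \<times> move \<Rightarrow> (nat \<Rightarrow> nat) \<times> nat" where
  "act_tape = (\<lambda>(t, h) (b, m). (t(h := b), move_head m h))"

definition tm_step :: "('i, 'o) tm \<Rightarrow> 'i list \<Rightarrow> 'o conf \<Rightarrow> 'o conf \<Rightarrow> bool" where
  "tm_step M x c c' \<longleftrightarrow>
     (\<exists>q d acts out.
        (q, d, acts, out) \<in>
          tm_trans M (cf_state c) (scan x (cf_input c)) (map (\<lambda>(t, h). t h) (cf_work c)) \<and>
        c' = \<lparr>cf_state = q,
              cf_input = min (length x + 1) (move_head d (cf_input c)),
              cf_work = map2 act_tape (cf_work c) acts,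
              cf_output = cf_output c @ (case out of None \<Rightarrow> [] | Some s \<Rightarrow> [s])\<rparr>)"

definition reachable :: "('i, 'o) tm \<Rightarrow> 'i list \<Rightarrow> 'o conf \<Rightarrow> bool" where
  "reachable M x c \<longleftrightarrow> (tm_step M x)\<^sup>*\<^sup>* (init_conf M) c"

definition halting :: "('i, 'o) tm \<Rightarrow> 'i list \<Rightarrow> 'o conf \<Rightarrow> bool" where
  "halting M x c \<longleftrightarrow> (\<nexists>c'. tm_step M x c c')"

text \<open>
  Only work tapes count towards space: on no computation path does \<open>M\<close> leave the first \<open>s\<close> cells
  of any of them.
\<close>

definition within_space :: "('i, 'o) tm \<Rightarrow> 'i list \<Rightarrow> nat \<Rightarrow> bool" where
  "within_space M x s \<longleftrightarrow> (\<forall>c. reachable M x c \<longrightarrow> (\<forall>(t, h) \<in> set (cf_work c). h < s))"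

text \<open>
  Problems are given by the set \<open>I\<close> of admissible instances, the encoding of instances (and of
  results) as strings, and a specification. Machines are only required to behave well on encodings
  of admissible instances.
\<close>

definition computable_in_space ::
  "(nat \<Rightarrow> real) \<Rightarrow> ('x \<Rightarrow> 's list) \<Rightarrow> ('y \<Rightarrow> 's list) \<Rightarrow> 'x set \<Rightarrow> ('x \<Rightarrow> 'y \<Rightarrow> bool) \<Rightarrow> bool" where
  "computable_in_space g enc enc' I R \<longleftrightarrow>
     (\<exists>(M :: ('s, 's) tm) (s :: nat \<Rightarrow> nat).
        wf_tm M \<and> deterministic M \<and> (\<lambda>n. real (s n)) \<in> O(g) \<and>
        (\<forall>i \<in> I. within_space M (enc i) (s (length (enc i))) \<and>
           (\<exists>c. reachable M (enc i) c \<and> halting M (enc i) c \<and>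
              (\<exists>r. cf_output c = enc' r \<and> R i r))))"

definition decidable_in_space ::
  "(nat \<Rightarrow> real) \<Rightarrow> ('x \<Rightarrow> 's list) \<Rightarrow> 'x set \<Rightarrow> ('x \<Rightarrow> bool) \<Rightarrow> bool" where
  "decidable_in_space g enc I P \<longleftrightarrow>
     (\<exists>(M :: ('s, 's) tm) (s :: nat \<Rightarrow> nat).
        wf_tm M \<and> deterministic M \<and> (\<lambda>n. real (s n)) \<in> O(g) \<and>
        (\<forall>i \<in> I. within_space M (enc i) (s (length (enc i))) \<and>
           (\<exists>c. reachable M (enc i) c \<and> halting M (enc i) c \<and>
              (cf_state c \<in> tm_accept M \<longleftrightarrow> P i))))"

text \<open>
  A nondeterministic machine accepts if some computation path halts in an accepting state; as is
  usual for space classes, the remaining paths need not halt but must respect the space bound.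
\<close>

definition nondet_decidable_in_space ::
  "(nat \<Rightarrow> real) \<Rightarrow> ('x \<Rightarrow> 's list) \<Rightarrow> 'x set \<Rightarrow> ('x \<Rightarrow> bool) \<Rightarrow> bool" where
  "nondet_decidable_in_space g enc I P \<longleftrightarrow>
     (\<exists>(M :: ('s, 's) tm) (s :: nat \<Rightarrow> nat).
        wf_tm M \<and> (\<lambda>n. real (s n)) \<in> O(g) \<and>
        (\<forall>i \<in> I. within_space M (enc i) (s (length (enc i))) \<and>
           ((\<exists>c. reachable M (enc i) c \<and> halting M (enc i) c \<and> cf_state c \<in> tm_accept M)
              \<longleftrightarrow> P i)))"

abbreviation const_space :: "nat \<Rightarrow> real" where
  "const_space \<equiv> \<lambda>_. 1"

abbreviation log_space :: "nat \<Rightarrow> real" where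
  "log_space \<equiv> \<lambda>n. ln (real n)"


section \<open>Encodings\<close>

text \<open>
  Automata are written down as transition tables, with rows in the order of the states and columns
  in the order of the enumeration \<open>\<sigma>\<close> of the alphabet. States are numbered in unary: a state of an
  \<open>n\<close>-state automaton takes at most \<open>n\<close> symbols, so the length of the encoding is polynomial in
  the total number of states and logarithmic space is the same as for binary numbering.
\<close>

datatype 'a symbol = Tick | Stop | Accepting | Rejecting | Separator | Letter 'a

definition enc_nat :: "nat \<Rightarrow> 'a symbol list" where
  "enc_nat n = replicate n Tick @ [Stop]"

definition enc_aut :: "'a list \<Rightarrow> ('a, 'z) aut_scheme \<Rightarrow> 'a symbol list" where
  "enc_aut \<sigma> A = enc_nat (nstates A) @ enc_nat (initial A) @
     concat (map (\<lambda>q. concat (map (\<lambda>a. enc_nat (delta A q a)) \<sigma>)) [0..<nstates A])"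

definition enc_dfa :: "'a list \<Rightarrow> 'a dfa \<Rightarrow> 'a symbol list" where
  "enc_dfa \<sigma> D = enc_aut \<sigma> D @
     map (\<lambda>q. if q \<in> final D then Accepting else Rejecting) [0..<nstates D]"

definition enc_fdfa :: "'a list \<Rightarrow> 'a fdfa \<Rightarrow> 'a symbol list" where
  "enc_fdfa \<sigma> F = enc_aut \<sigma> (leading F) @
     concat (map (\<lambda>q. enc_dfa \<sigma> (progress F q)) [0..<nstates (leading F)])"

definition enc_fdfa_pair :: "'a list \<Rightarrow> 'a fdfa \<times> 'a fdfa \<Rightarrow> 'a symbol list" where
  "enc_fdfa_pair \<sigma> = (\<lambda>(F, F'). enc_fdfa \<sigma> F @ [Separator] @ enc_fdfa \<sigma> F')"

definition enc_fdfa_words :: "'a list \<Rightarrow> 'a fdfa \<times> 'a list \<times> 'a list \<Rightarrow> 'a symbol list" where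
  "enc_fdfa_words \<sigma> = (\<lambda>(F, u, v).
     enc_fdfa \<sigma> F @ [Separator] @ map Letter u @ [Separator] @ map Letter v)"

end

theory Submission
  imports Defs "HOL-Library.Sublist"
begin

text \<open>
  A head position on an input of length \<open>n\<close> is a number below \<open>n + 2\<close>, and a work tape can hold it in
  binary. So every program with boundedly many such counters, which move along the input, runs in
  logarithmic space, and the algorithms are given as programs of this kind.

  Complementation flips the flags in the encoding symbol by symbol, since the duo-normalized
  decompositions do not depend on the accepting states. For union and intersection, a decomposition is
  duo-normalized for the product FDFA iff it is so for both factors; as every ultimately periodic word
  has a duo-normalized decomposition, by idempotent powers of the transition functions, saturation
  lets each factor be evaluated on that common decomposition. For membership of \<open>(u, v)\<close> one searches the
  powers \<open>u v^K\<close> and \<open>(v^K)^M\<close> that make the decomposition duo-normalized; both exponents are bounded by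
  the numbers of states.

  The remaining problems ask whether some duo-normalized \<open>(x, y)\<close> for both FDFAs gives a forbidden
  pair of answers. A path in a graph of polynomial size guesses \<open>x\<close>, then progress states \<open>p\<close>, and then
  runs \<open>y\<close> from the initial states and from the states \<open>p\<close>; the pair is duo-normalized with
  \<open>p\<close> reached by \<open>y\<close> iff all runs end in \<open>p\<close> and the leading states return. Unreachability of such
  vertices is decided nondeterministically by inductive counting (Immerman and Szelepcsenyi).
\<close>

text \<open>Emptiness, universality, containment and equality all say that no word of some kind
  exists. A nondeterministic machine can find such a word, but here it has to certify that there is
  none; this is the reason for the counting argument.

  Idempotence, P_x(yy) = P_x(y), mentions y twice, while y is guessed letter by letter and never
  stored. So a state p is fixed in advance, and y is run from the initial state and from p in
  parallel. Only states p = P_x(z) with some word z are tried, with the same z for both FDFAs. This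
  loses nothing, because z = y is among the choices, and it lets every vertex of the graph be
  described by at most three words x, z, y.

  A vertex has twelve components, two flags and five states for each FDFA. Neither its code nor the
  number of vertices need fit into one head position; but with n the length of the input, twelve
  heads hold the digits in base n + 2 of any number below (n + 2)^12. Vertices, level indices and
  cardinalities are all kept in such registers.\<close>

fun bits_val :: "bool list \<Rightarrow> nat" where
  "bits_val [] = 0"
| "bits_val (b # bs) = of_bool b + 2 * bits_val bs"

fun bits_inc :: "bool list \<Rightarrow> bool list" where
  "bits_inc [] = [True]"
| "bits_inc (False # bs) = True # bs"
| "bits_inc (True # bs) = False # bits_inc bs"

fun bits_dec :: "bool list \<Rightarrow> bool list option" where
  "bits_dec [] = None"
| "bits_dec (True # bs) = Some (False # bs)"
| "bits_dec (False # bs) = map_option (Cons True) (bits_dec bs)"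

lemma bits_val_inc: "bits_val (bits_inc bs) = Suc (bits_val bs)"
  by (induction bs rule: bits_inc.induct) auto

lemma bits_val_dec: "bits_dec bs = Some bs' \<Longrightarrow> bits_val bs = Suc (bits_val bs') \<and> length bs' = length bs"
  by (induction bs arbitrary: bs' rule: bits_dec.induct) auto

lemma bits_dec_None: "bits_dec bs = None \<longleftrightarrow> bits_val bs = 0"
  by (induction bs rule: bits_dec.induct) auto

lemma bits_val_replicate_False [simp]: "bits_val (replicate m False) = 0"
  by (induction m) auto

text \<open>A carry out of the last bit occurs only when all bits are 1. So the list grows only when
  the value becomes a new power of two, and although decrements keep leading zeros, the length stays
  bounded by the largest value so far.\<close>

lemma bits_inc_length:
  "length (bits_inc bs) = length bs \<or> length (bits_inc bs) = Suc (length bs) \<and> Suc (bits_val bs) = 2 ^ length bs"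
  by (induction bs rule: bits_inc.induct) auto

text \<open>The second condition says that all counter values so far were at most \<open>N\<close>.\<close>

definition represents :: "nat \<Rightarrow> bool list \<Rightarrow> nat \<Rightarrow> bool" where
  "represents N bs v \<longleftrightarrow> bits_val bs = v \<and> (bs = [] \<or> 2 ^ (length bs - 1) \<le> N)"

lemma represents_Nil: "represents N [] 0"
  by (simp add: represents_def)

lemma represents_inc: "represents N bs v \<Longrightarrow> Suc v \<le> N \<Longrightarrow> represents N (bits_inc bs) (Suc v)"
  using bits_inc_length[of bs]
  by (cases bs) (auto simp: represents_def bits_val_inc)

lemma represents_same_length:
  "represents N bs v \<Longrightarrow> length bs' = length bs \<Longrightarrow> bits_val bs' = v' \<Longrightarrow> represents N bs' v'"
  by (auto simp: represents_def)

lemma represents_length: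
  assumes "represents N bs v" shows "real (length bs) \<le> 1 + log 2 (real N + 1)"
proof (cases "bs = []")
  case True
  then show ?thesis by (simp add: zero_le_log_cancel_iff)
next
  case False
  with assms have "2 ^ (length bs - 1) \<le> N" by (simp add: represents_def)
  then have "(2::real) ^ (length bs - 1) \<le> real N + 1"
    by (metis add.commute add_increasing numeral_power_le_of_nat_cancel_iff zero_le_one)
  then have "real (length bs - 1) \<le> log 2 (real N + 1)"
    by (simp add: le_log_iff powr_realpow)
  then show ?thesis using False by (cases bs) auto
qed

text \<open>Work symbol \<open>0\<close> is the blank behind the last bit and \<open>2\<close> is
  the left marker, which leaves \<open>1\<close> and \<open>3\<close> for the bits.\<close>

definition digit :: "bool \<Rightarrow> nat" where
  "digit b = (if b then 1 else 3)"

lemma digit_eq [simp]: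
  "digit b = 1 \<longleftrightarrow> b" "digit b = 3 \<longleftrightarrow> \<not> b" "digit b \<noteq> 0" "digit b \<noteq> 2" "digit True = Suc 0" "digit False = 3" "digit b < 4"
    "digit b = Suc 0 \<longleftrightarrow> b"
  by (auto simp: digit_def)

definition tape :: "bool list \<Rightarrow> nat \<Rightarrow> nat" where
  "tape bs p = (if p = 0 then 2 else if p \<le> length bs then digit (bs ! (p - 1)) else 0)"

lemma tape_0 [simp]: "tape bs 0 = 2"
  by (simp add: tape_def)

lemma tape_eq_2 [simp]: "tape bs p = 2 \<longleftrightarrow> p = 0"
  by (simp add: tape_def)

lemma tape_update: "p < length bs \<Longrightarrow> (tape bs)(Suc p := digit b) = tape (bs[p := b])"
  by (auto simp: tape_def fun_eq_iff nth_list_update)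

lemma tape_append: "(tape bs)(Suc (length bs) := digit b) = tape (bs @ [b])"
  by (auto simp: tape_def fun_eq_iff nth_append)

lemma tape_append_Cons [simp]: "tape (pre @ b # bs) (Suc (length pre)) = digit b"
  by (simp add: tape_def)

lemma tape_end [simp]: "tape bs (Suc (length bs)) = 0"
  by (simp add: tape_def)

section \<open>Multihead automata\<close>

type_synonym ('q, 'i, 'o) mtrans = "'q \<Rightarrow> 'i cell \<Rightarrow> ('q \<times> move \<times> 'o option) set"

type_synonym ('q, 'h, 'o) mconf = "'q \<times> ('h \<Rightarrow> nat) \<times> 'o list"

abbreviation emit :: "'o option \<Rightarrow> 'o list" where
  "emit out \<equiv> (case out of None \<Rightarrow> [] | Some s \<Rightarrow> [s])"

text \<open>Only the head chosen by the control state is read and moved in a step, because the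
  machine has a single input head and can bring it to one stored position at a time.\<close>

definition mstep ::
  "('q \<Rightarrow> 'h) \<Rightarrow> ('q, 'i, 'o) mtrans \<Rightarrow> 'i list \<Rightarrow> ('q, 'h, 'o) mconf \<Rightarrow> ('q, 'h, 'o) mconf \<Rightarrow> bool" where
  "mstep sel \<delta> x = (\<lambda>(q, h, w) a'. \<exists>q' d out. (q', d, out) \<in> \<delta> q (scan x (h (sel q))) \<and>
     a' = (q', h(sel q := min (length x + 1) (move_head d (h (sel q)))), w @ emit out))"

definition mhalting ::
  "('q \<Rightarrow> 'h) \<Rightarrow> ('q, 'i, 'o) mtrans \<Rightarrow> 'i list \<Rightarrow> ('q, 'h, 'o) mconf \<Rightarrow> bool" where
  "mhalting sel \<delta> x a \<longleftrightarrow> (\<nexists>a'. mstep sel \<delta> x a a')"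

text \<open>
  The position of each head is a binary counter on a work tape, least significant bit first, after
  a marker in cell \<open>0\<close>. To access head \<open>j\<close>, the machine counts the counter down to zero while moving
  the input head right (phases \<open>D0\<close>, \<open>D1\<close>, \<open>D2\<close>; \<open>Wipe\<close> detects zero), performs the transition in
  phase \<open>Fire\<close>, and counts the counter up again while moving the input head back to the left end
  (phases \<open>C0\<close>, \<open>C1\<close>, \<open>C2\<close>).
\<close>

datatype 'q ctrl = Init | D0 'q | D1 'q | D2 'q | Wipe 'q | Fire 'q | C0 nat 'q | C1 nat 'q | C2 nat 'q

text \<open>\<open>S\<close> bounds the control states that occur, since their type may be infinite.
  The list \<open>hs\<close> assigns work tapes to the heads in use: the tape of a head is its index
  in \<open>hs\<close>.\<close>

locale simulation =
  fixes sel :: "'q \<Rightarrow> 'h" and \<delta> :: "('q, 'i, 'o) mtrans" and S :: "'q set" and q0 :: 'q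
    and hs :: "'h list" and acc :: "'q set"
  assumes q0: "q0 \<in> S"
    and closed: "\<And>q c q' d out. q \<in> S \<Longrightarrow> (q', d, out) \<in> \<delta> q c \<Longrightarrow> q' \<in> S"
    and hs: "distinct hs" "sel ` S \<subseteq> set hs"
begin

definition ctrls :: "'q ctrl set" where
  "ctrls = insert Init (D0 ` S \<union> D1 ` S \<union> D2 ` S \<union> Wipe ` S \<union> Fire ` S \<union>
     (\<lambda>(j, q). C0 j q) ` ({..<length hs} \<times> S) \<union> (\<lambda>(j, q). C1 j q) ` ({..<length hs} \<times> S) \<union>
     (\<lambda>(j, q). C2 j q) ` ({..<length hs} \<times> S))"

definition ix :: "'q \<Rightarrow> nat" where
  "ix q = (THE j. j < length hs \<and> hs ! j = sel q)"

lemma ix: assumes "q \<in> S" shows "ix q < length hs" "hs ! ix q = sel q"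
proof -
  have "sel q \<in> set hs" using hs(2) assms by auto
  then have "\<exists>!j. j < length hs \<and> hs ! j = sel q"
    using hs(1) by (metis in_set_conv_nth nth_eq_iff_index_eq)
  from theI'[OF this] show "ix q < length hs" "hs ! ix q = sel q" unfolding ix_def by blast+
qed

lemma ctrls_iff [simp]:
  "Init \<in> ctrls" "D0 q \<in> ctrls \<longleftrightarrow> q \<in> S" "D1 q \<in> ctrls \<longleftrightarrow> q \<in> S" "D2 q \<in> ctrls \<longleftrightarrow> q \<in> S"
  "Wipe q \<in> ctrls \<longleftrightarrow> q \<in> S" "Fire q \<in> ctrls \<longleftrightarrow> q \<in> S" "C0 j q \<in> ctrls \<longleftrightarrow> j < length hs \<and> q \<in> S"
  "C1 j q \<in> ctrls \<longleftrightarrow> j < length hs \<and> q \<in> S" "C2 j q \<in> ctrls \<longleftrightarrow> j < length hs \<and> q \<in> S"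
  by (auto simp: ctrls_def)

lemma finite_ctrls: "finite S \<Longrightarrow> finite ctrls"
  by (simp add: ctrls_def)

definition act :: "nat list \<Rightarrow> nat \<Rightarrow> nat \<Rightarrow> move \<Rightarrow> (nat \<times> move) list" where
  "act ws j b m = map (\<lambda>i. if i = j then (b, m) else (ws ! i, Stay)) [0..<length hs]"

fun ctrans :: "'q ctrl \<Rightarrow> 'i cell \<Rightarrow> nat list \<Rightarrow> ('q ctrl \<times> move \<times> (nat \<times> move) list \<times> 'o option) set" where
  "ctrans Init c ws = {(D0 q0, Stay, replicate (length hs) (2, Stay), None)}"
| "ctrans (D0 q) c ws = {(D1 q, Stay, act ws (ix q) (ws ! ix q) MoveRight, None)}"
| "ctrans (D1 q) c ws =
     (if ws ! ix q = 3 then {(D1 q, Stay, act ws (ix q) 1 MoveRight, None)}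
      else if ws ! ix q = 1 then {(D2 q, Stay, act ws (ix q) 3 MoveLeft, None)}
      else {(Wipe q, Stay, act ws (ix q) (ws ! ix q) MoveLeft, None)})"
| "ctrans (D2 q) c ws =
     (if ws ! ix q = 2 then {(D0 q, MoveRight, act ws (ix q) 2 Stay, None)}
      else {(D2 q, Stay, act ws (ix q) (ws ! ix q) MoveLeft, None)})"
| "ctrans (Wipe q) c ws =
     (if ws ! ix q = 2 then {(Fire q, Stay, act ws (ix q) 2 Stay, None)}
      else {(Wipe q, Stay, act ws (ix q) 3 MoveLeft, None)})"
| "ctrans (Fire q) c ws = (\<lambda>(q', d, out). (C0 (ix q) q', d, act ws (ix q) (ws ! ix q) Stay, out)) ` \<delta> q c"
| "ctrans (C0 j q) c ws =
     (if c = LeftEnd then {(D0 q, Stay, act ws j (ws ! j) Stay, None)}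
      else {(C1 j q, MoveLeft, act ws j (ws ! j) MoveRight, None)})"
| "ctrans (C1 j q) c ws =
     (if ws ! j = 1 then {(C1 j q, Stay, act ws j 3 MoveRight, None)}
      else {(C2 j q, Stay, act ws j 1 MoveLeft, None)})"
| "ctrans (C2 j q) c ws =
     (if ws ! j = 2 then {(C0 j q, Stay, act ws j 2 Stay, None)}
      else {(C2 j q, Stay, act ws j (ws ! j) MoveLeft, None)})"

lemma ctrans_ctrls: "u \<in> ctrls \<Longrightarrow> (u', d, acts, out) \<in> ctrans u c ws \<Longrightarrow> u' \<in> ctrls"
  using q0 ix(1) closed
  by (cases u) (auto split: if_splits)

lemma ctrans_acts:
  assumes "(u', d, acts, out) \<in> ctrans u c ws" "length ws = length hs" "set ws \<subseteq> {..<4}"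
    and "u \<in> ctrls"
  shows "length acts = length hs" "(b, m) \<in> set acts \<Longrightarrow> b < 4"
proof -
  have *: "ws ! i < 4" if "i < length hs" for i
    using assms(2,3) that by (metis lessThan_iff nth_mem subsetD)
  have act: "b < 4" if "(b, m) \<in> set (act ws j b' m')" "j < length hs \<Longrightarrow> b' < 4" for b m j b' m'
    using * that by (auto simp: act_def split: if_splits)
  have len: "length (act ws j b' m') = length hs" for j b' m' by (simp add: act_def)
  show "length acts = length hs"
    using assms(1) len by (cases u) (auto split: if_splits)
  show "b < 4" if "(b, m) \<in> set acts"
  proof (cases "u = Init")
    case True
    then show ?thesis using assms(1) that by auto
  next
    case False
    with assms(1) obtain j b' m' where "acts = act ws j b' m'" "b' < 4 \<or> b' = ws ! j"
      by (cases u) (auto split: if_splits)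
    with act * that show ?thesis by metis
  qed
qed

end

text \<open>Machine states are numbers and \<open>0\<close> is the initial one, hence a numbering
  \<open>e\<close> of the control states that maps \<open>Init\<close> to \<open>0\<close>.\<close>

locale coded_simulation = simulation sel \<delta> S q0 hs acc
  for sel :: "'q \<Rightarrow> 'h" and \<delta> :: "('q, 'i, 'o) mtrans" and S q0 hs acc +
  fixes e :: "'q ctrl \<Rightarrow> nat" and ns :: nat
  assumes e: "inj_on e ctrls" "e Init = 0" "e ` ctrls \<subseteq> {..<ns}"
begin

text \<open>Every control state other than \<open>Fire\<close> has exactly one action for each
  reading. So the machine can halt only in a \<open>Fire\<close> state, and acceptance is attached
  to these.\<close>

definition M :: "('i, 'o) tm" where
  "M = \<lparr>tm_states = ns, tm_symbols = 4, tm_tapes = length hs, tm_accept = e ` Fire ` (S \<inter> acc),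
     tm_trans = (\<lambda>i c ws. {(e u', d, acts, out) | u u' d acts out.
        u \<in> ctrls \<and> e u = i \<and> (u', d, acts, out) \<in> ctrans u c ws})\<rparr>"

lemma wf_M: "wf_tm M"
proof -
  have "0 < ns" using e(2,3) ctrls_iff(1) by (metis imageI lessThan_iff subsetD)
  moreover have "q' < ns \<and> length acts = length hs \<and> (\<forall>(b, m) \<in> set acts. b < 4)"
    if "length ws = length hs" "set ws \<subseteq> {..<4}" "(q', d, acts, out) \<in> tm_trans M q i ws"
    for q i ws q' d acts out
  proof -
    from that(3) obtain u u' where u: "u \<in> ctrls" "(u', d, acts, out) \<in> ctrans u i ws" "q' = e u'"
      by (auto simp: M_def)
    with ctrans_ctrls e(3) have "q' < ns" by blast
    with ctrans_acts[OF u(2) that(1,2) u(1)] show ?thesis by auto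
  qed
  ultimately show ?thesis unfolding wf_tm_def by (simp add: M_def) fast
qed

lemma deterministic_M:
  assumes "\<And>q c a b. a \<in> \<delta> q c \<Longrightarrow> b \<in> \<delta> q c \<Longrightarrow> a = b"
  shows "deterministic M"
proof -
  have "a = b" if "a \<in> ctrans u c ws" "b \<in> ctrans u c ws" for a b u c ws
  proof (cases u)
    case (Fire q)
    then show ?thesis using assms that by (auto simp: Fire)
  qed (use that in \<open>auto split: if_splits\<close>)
  then show ?thesis
    unfolding deterministic_def M_def by (auto dest!: inj_onD[OF e(1)]) (metis prod.inject)+
qed

abbreviation readw :: "((nat \<Rightarrow> nat) \<times> nat) list \<Rightarrow> nat list" where
  "readw \<equiv> map (\<lambda>(t, h). t h)"

definition Cf :: "'q ctrl \<Rightarrow> nat \<Rightarrow> ((nat \<Rightarrow> nat) \<times> nat) list \<Rightarrow> 'o list \<Rightarrow> 'o conf" where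
  "Cf u p W w = \<lparr>cf_state = e u, cf_input = p, cf_work = W, cf_output = w\<rparr>"

lemma tm_step_Cf:
  assumes "u \<in> ctrls"
  shows "tm_step M x (Cf u p W w) c' \<longleftrightarrow>
    (\<exists>u' d acts out. (u', d, acts, out) \<in> ctrans u (scan x p) (readw W) \<and>
       c' = Cf u' (min (length x + 1) (move_head d p)) (map2 act_tape W acts) (w @ emit out))"
  using assms inj_onD[OF e(1)]
  unfolding tm_step_def M_def Cf_def by auto blast+

lemma map2_act:
  assumes "length W = length hs" "j < length hs"
  shows "map2 act_tape W (act (readw W) j b m) = W[j := act_tape (W ! j) (b, m)]"
  using assms by (intro nth_equalityI)
    (auto simp: act_def act_tape_def nth_list_update split: prod.splits)

section \<open>Forced runs between two simulated transitions\<close>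

definition fits :: "nat \<Rightarrow> 'o conf \<Rightarrow> bool" where
  "fits s c \<longleftrightarrow> (\<forall>(t, h) \<in> set (cf_work c). h < s)"

text \<open>A forced step: the configuration respects the space bound and has exactly one successor.
  All bookkeeping on the counters consists of such steps, even if the simulated automaton is
  nondeterministic; only the step out of \<open>Fire\<close> may branch.\<close>

definition fstep :: "'i list \<Rightarrow> nat \<Rightarrow> 'o conf \<Rightarrow> 'o conf \<Rightarrow> bool" where
  "fstep x s c c' \<longleftrightarrow> fits s c \<and> (\<forall>c''. tm_step M x c c'' \<longleftrightarrow> c'' = c')"

abbreviation fsteps where "fsteps x s \<equiv> (fstep x s)\<^sup>*\<^sup>*"

lemma fsteps_tm: "fsteps x s c c' \<Longrightarrow> (tm_step M x)\<^sup>*\<^sup>* c c'"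
  by (erule rtranclp_mono[THEN predicate2D, rotated]) (auto simp: fstep_def)

text \<open>Forced steps leave no choice, so a run that starts with a forced segment either stops
  inside it, where the space bound holds and halting is impossible, or passes through its end. The
  bound \<open>m \<le> n\<close> makes the induction on the length of runs in
  \<open>simulation_sound\<close> possible.\<close>

lemma fsteps_linear:
  assumes "fsteps x s c c'" "(tm_step M x ^^ n) c d"
  shows "(fits s d \<and> \<not> halting M x d) \<or> (\<exists>m \<le> n. (tm_step M x ^^ m) c' d)"
  using assms
proof (induction arbitrary: n rule: converse_rtranclp_induct)
  case base
  then show ?case by blast
next
  case (step c1 c2)
  show ?case
  proof (cases n)
    case 0
    with step show ?thesis by (auto simp: fstep_def halting_def)
  next
    case (Suc k)
    with step.prems obtain c3 where "tm_step M x c1 c3" "(tm_step M x ^^ k) c3 d"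
      by (metis relpowp_Suc_E2)
    with step.hyps have "(tm_step M x ^^ k) c2 d" by (auto simp: fstep_def)
    from step.IH[OF this] Suc show ?thesis by (meson le_SucI)
  qed
qed

text \<open>The bound on \<open>s\<close> leaves room for the marker in cell \<open>0\<close> and
  for the blank behind the last bit, in cell \<open>length bs + 1\<close>, which the tape head also
  visits.\<close>

context
  fixes x :: "'i list" and s N :: nat and W :: "((nat \<Rightarrow> nat) \<times> nat) list"
  assumes N: "N = length x + 1"
    and s: "\<And>bs v. represents N bs v \<Longrightarrow> length bs + 1 < s"
    and W: "length W = length hs" "\<And>t h. (t, h) \<in> set W \<Longrightarrow> h < s"
begin

lemma fstepI:
  assumes "u \<in> ctrls" "j < length hs" "h < s"
    and "\<And>ws. length ws = length hs \<Longrightarrow> ws ! j = t h \<Longrightarrow>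
      ctrans u (scan x p) ws = {(u', d, act ws j b m, None)}"
  shows "fstep x s (Cf u p (W[j := (t, h)]) w)
    (Cf u' (min (length x + 1) (move_head d p)) (W[j := (t(h := b), move_head m h)]) w)"
proof -
  let ?W = "W[j := (t, h)]"
  have tr: "ctrans u (scan x p) (readw ?W) = {(u', d, act (readw ?W) j b m, None)}"
    by (rule assms(4)) (use W assms(2) in \<open>auto simp: map_update\<close>)
  have m2: "map2 act_tape ?W (act (readw ?W) j b m) = W[j := (t(h := b), move_head m h)]"
    using map2_act[of ?W j] W assms(2) by (simp add: act_tape_def)
  have "fits s (Cf u p ?W w)"
    using W assms(3) set_update_subset_insert[of W j "(t, h)"] by (auto simp: fits_def Cf_def)
  then show ?thesis
    unfolding fstep_def tm_step_Cf[OF assms(1)] tr using m2 by simp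
qed

lemma fstep_stay:
  assumes "u \<in> ctrls" "j < length hs" "h < s" "p \<le> N"
    and "\<And>ws. length ws = length hs \<Longrightarrow> ws ! j = t h \<Longrightarrow>
      ctrans u (scan x p) ws = {(u', Stay, act ws j b m, None)}"
  shows "fstep x s (Cf u p (W[j := (t, h)]) w) (Cf u' p (W[j := (t(h := b), move_head m h)]) w)"
  using fstepI[OF assms(1-3,5)] assms(4) N by simp

lemma fstep_read:
  assumes "u \<in> ctrls" "j < length hs" "h < s" "p \<le> N" "t h = b"
    and "\<And>ws. length ws = length hs \<Longrightarrow> ws ! j = t h \<Longrightarrow>
      ctrans u (scan x p) ws = {(u', Stay, act ws j b m, None)}"
  shows "fstep x s (Cf u p (W[j := (t, h)]) w) (Cf u' p (W[j := (t, move_head m h)]) w)"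
proof -
  have "t(h := b) = t" using assms(5) by (simp add: fun_upd_idem)
  with fstep_stay[where t = t, OF assms(1-4,6)] show ?thesis by simp
qed

lemma fsteps_D2:
  assumes "q \<in> S" "h < s" "p \<le> N"
  shows "fsteps x s (Cf (D2 q) p (W[ix q := (tape bs, h)]) w) (Cf (D2 q) p (W[ix q := (tape bs, 0)]) w)"
  using assms(2)
proof (induction h)
  case (Suc h)
  have "fstep x s (Cf (D2 q) p (W[ix q := (tape bs, Suc h)]) w)
    (Cf (D2 q) p (W[ix q := (tape bs, move_head MoveLeft (Suc h))]) w)"
    by (rule fstep_read[OF _ _ _ _ refl]) (use assms ix Suc in auto)
  then show ?case using Suc by (auto intro: converse_rtranclp_into_rtranclp)
qed auto

lemma fsteps_C2:
  assumes "q \<in> S" "j < length hs" "h < s" "p \<le> N"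
  shows "fsteps x s (Cf (C2 j q) p (W[j := (tape bs, h)]) w) (Cf (C2 j q) p (W[j := (tape bs, 0)]) w)"
  using assms(3)
proof (induction h)
  case (Suc h)
  have "fstep x s (Cf (C2 j q) p (W[j := (tape bs, Suc h)]) w)
    (Cf (C2 j q) p (W[j := (tape bs, move_head MoveLeft (Suc h))]) w)"
    by (rule fstep_read[OF _ _ _ _ refl]) (use assms Suc in auto)
  then show ?case using Suc by (auto intro: converse_rtranclp_into_rtranclp)
qed auto

lemma fsteps_Wipe:
  assumes "q \<in> S" "h \<le> length bs" "length bs + 1 < s" "p \<le> N"
  shows "fsteps x s (Cf (Wipe q) p (W[ix q := (tape bs, h)]) w)
    (Cf (Wipe q) p (W[ix q := (tape (replicate h False @ drop h bs), 0)]) w)"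
  using assms(2,3)
proof (induction h arbitrary: bs)
  case (Suc h)
  have "fstep x s (Cf (Wipe q) p (W[ix q := (tape bs, Suc h)]) w)
    (Cf (Wipe q) p (W[ix q := ((tape bs)(Suc h := digit False), move_head MoveLeft (Suc h))]) w)"
    by (rule fstep_stay) (use assms ix Suc in auto)
  also have "(tape bs)(Suc h := digit False) = tape (bs[h := False])"
    using tape_update[of h bs False] Suc.prems by simp
  also have "fsteps x s (Cf (Wipe q) p (W[ix q := (tape (bs[h := False]), move_head MoveLeft (Suc h))]) w)
    (Cf (Wipe q) p (W[ix q := (tape (replicate h False @ drop h (bs[h := False])), 0)]) w)"
    using Suc.IH[of "bs[h := False]"] Suc.prems by simp
  also have "replicate h False @ drop h (bs[h := False]) = replicate (Suc h) False @ drop (Suc h) bs"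
  proof -
    have "drop h (bs[h := False]) = False # drop (Suc h) bs"
      using Suc.prems by (simp add: drop_update_swap Cons_nth_drop_Suc[symmetric])
    then show ?thesis by (simp add: replicate_app_Cons_same)
  qed
  finally show ?case .
qed auto

text \<open>The recursion is that of \<open>bits_dec\<close>: leading zeros turn into ones until the
  first one is found and turned into a zero. The prefix \<open>pre\<close> collects the bits already
  passed, so that the induction can speak about a tape head in the middle of the counter.\<close>

lemma fsteps_D1_Some:
  assumes "q \<in> S" "length pre + length bs + 1 < s" "p \<le> N" "bits_dec bs = Some bs'"
  shows "fsteps x s (Cf (D1 q) p (W[ix q := (tape (pre @ bs), Suc (length pre))]) w)
    (Cf (D2 q) p (W[ix q := (tape (pre @ bs'), 0)]) w)"
  using assms(2,4)
proof (induction bs arbitrary: pre bs' rule: bits_dec.induct)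
  case (2 bs)
  have "fstep x s (Cf (D1 q) p (W[ix q := (tape (pre @ True # bs), Suc (length pre))]) w)
    (Cf (D2 q) p (W[ix q := ((tape (pre @ True # bs))(Suc (length pre) := digit False),
       move_head MoveLeft (Suc (length pre)))]) w)"
    by (rule fstep_stay) (use assms(1,3) ix 2 in auto)
  also have "(tape (pre @ True # bs))(Suc (length pre) := digit False) = tape (pre @ False # bs)"
    by (simp add: tape_update[of _ _ False, simplified])
  also have "fsteps x s (Cf (D2 q) p (W[ix q := (tape (pre @ False # bs), move_head MoveLeft (Suc (length pre)))]) w)
     (Cf (D2 q) p (W[ix q := (tape (pre @ False # bs), 0)]) w)"
    by (rule fsteps_D2) (use 2 assms in auto)
  finally show ?case using 2 by auto
next
  case (3 bs)
  then obtain bs1 where bs1: "bits_dec bs = Some bs1" "bs' = True # bs1" by auto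
  have "fstep x s (Cf (D1 q) p (W[ix q := (tape (pre @ False # bs), Suc (length pre))]) w)
    (Cf (D1 q) p (W[ix q := ((tape (pre @ False # bs))(Suc (length pre) := digit True),
       move_head MoveRight (Suc (length pre)))]) w)"
    by (rule fstep_stay) (use assms(1,3) ix 3 in auto)
  also have "(tape (pre @ False # bs))(Suc (length pre) := digit True) = tape (pre @ True # bs)"
    by (simp add: tape_update[of _ _ True, simplified])
  also have "fsteps x s (Cf (D1 q) p (W[ix q := (tape (pre @ True # bs), move_head MoveRight (Suc (length pre)))]) w)
     (Cf (D2 q) p (W[ix q := (tape ((pre @ [True]) @ bs1), 0)]) w)"
    using "3.IH"[of "pre @ [True]"] 3 bs1 by simp
  finally show ?case using bs1 by auto
qed auto

text \<open>When the value is zero, the attempt to decrement turns all bits into ones before the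
  blank is met. The contents are left open here because \<open>Wipe\<close> writes zeros over all of
  them on its way back.\<close>

lemma fsteps_D1_None:
  assumes "q \<in> S" "length pre + length bs + 1 < s" "p \<le> N" "bits_dec bs = None"
  shows "\<exists>bs'. length bs' = length bs \<and>
    fsteps x s (Cf (D1 q) p (W[ix q := (tape (pre @ bs), Suc (length pre))]) w)
    (Cf (Wipe q) p (W[ix q := (tape (pre @ bs'), length pre + length bs)]) w)"
  using assms(2,4)
proof (induction bs arbitrary: pre rule: bits_dec.induct)
  case 1
  have "fstep x s (Cf (D1 q) p (W[ix q := (tape pre, Suc (length pre))]) w)
    (Cf (Wipe q) p (W[ix q := (tape pre, move_head MoveLeft (Suc (length pre)))]) w)"
    by (rule fstep_read[OF _ _ _ _ refl]) (use assms(1,3) ix 1 in auto)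
  then show ?case by auto
next
  case (3 bs)
  then have "bits_dec bs = None" by auto
  then obtain bs1 where bs1: "length bs1 = length bs"
    "fsteps x s (Cf (D1 q) p (W[ix q := (tape ((pre @ [True]) @ bs), Suc (length (pre @ [True])))]) w)
    (Cf (Wipe q) p (W[ix q := (tape ((pre @ [True]) @ bs1), length (pre @ [True]) + length bs)]) w)"
    using "3.IH"[of "pre @ [True]"] 3 by auto
  have "fstep x s (Cf (D1 q) p (W[ix q := (tape (pre @ False # bs), Suc (length pre))]) w)
    (Cf (D1 q) p (W[ix q := ((tape (pre @ False # bs))(Suc (length pre) := digit True),
       move_head MoveRight (Suc (length pre)))]) w)"
    by (rule fstep_stay) (use assms(1,3) ix 3 in auto)
  also have "(tape (pre @ False # bs))(Suc (length pre) := digit True) = tape (pre @ True # bs)"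
    by (simp add: tape_update[of _ _ True, simplified])
  finally show ?case using bs1
    by (intro exI[of _ "True # bs1"]) (auto intro: converse_rtranclp_into_rtranclp)
qed auto

text \<open>Each round takes one from the counter and moves the input head one cell to the right, so
  the sum of both is constant. When the counter is zero, the input head stands where the simulated
  head is, and the counter has kept its length.\<close>

lemma fsteps_dec:
  assumes "q \<in> S" "length bs + 1 < s" "p + bits_val bs \<le> N"
  shows "fsteps x s (Cf (D0 q) p (W[ix q := (tape bs, 0)]) w)
    (Cf (Fire q) (p + bits_val bs) (W[ix q := (tape (replicate (length bs) False), 0)]) w)"
  using assms(2,3)
proof (induction "bits_val bs" arbitrary: bs p)
  case 0
  have "fstep x s (Cf (D0 q) p (W[ix q := (tape bs, 0)]) w)
    (Cf (D1 q) p (W[ix q := (tape bs, move_head MoveRight 0)]) w)"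
    by (rule fstep_read[OF _ _ _ _ refl]) (use assms(1) ix 0 in auto)
  moreover obtain bs' where bs': "length bs' = length bs"
    "fsteps x s (Cf (D1 q) p (W[ix q := (tape bs, Suc 0)]) w)
    (Cf (Wipe q) p (W[ix q := (tape bs', length bs)]) w)"
    using fsteps_D1_None[of q "[]" bs p w] bits_dec_None[of bs] assms(1) 0 by auto
  moreover have "fsteps x s (Cf (Wipe q) p (W[ix q := (tape bs', length bs)]) w)
    (Cf (Wipe q) p (W[ix q := (tape (replicate (length bs) False), 0)]) w)"
    using fsteps_Wipe[of q "length bs" bs' p w] assms(1) 0 bs'(1) by simp
  moreover have "fstep x s (Cf (Wipe q) p (W[ix q := (tape (replicate (length bs) False), 0)]) w)
    (Cf (Fire q) p (W[ix q := (tape (replicate (length bs) False), move_head Stay 0)]) w)"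
    by (rule fstep_read[OF _ _ _ _ refl]) (use assms(1) ix 0 in auto)
  ultimately show ?case using 0(1)
    by (simp add: converse_rtranclp_into_rtranclp)
next
  case (Suc v)
  then obtain bs' where bs': "bits_dec bs = Some bs'"
    using bits_dec_None[of bs] by (cases "bits_dec bs") auto
  then have v: "bits_val bs' = v" "length bs' = length bs"
    using bits_val_dec[of bs bs'] Suc.hyps(2) by auto
  have "fstep x s (Cf (D0 q) p (W[ix q := (tape bs, 0)]) w)
    (Cf (D1 q) p (W[ix q := (tape bs, move_head MoveRight 0)]) w)"
    by (rule fstep_read[OF _ _ _ _ refl]) (use assms(1) ix Suc in auto)
  also have "fsteps x s (Cf (D1 q) p (W[ix q := (tape bs, move_head MoveRight 0)]) w)
    (Cf (D2 q) p (W[ix q := (tape bs', 0)]) w)"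
    using fsteps_D1_Some[of q "[]" bs p bs' w] bs' assms(1) Suc by auto
  also have "fstep x s (Cf (D2 q) p (W[ix q := (tape bs', 0)]) w)
    (Cf (D0 q) (min (length x + 1) (move_head MoveRight p))
      (W[ix q := ((tape bs')(0 := 2), move_head Stay 0)]) w)"
    by (rule fstepI) (use assms(1) ix Suc in auto)
  also have "(tape bs')(0 := 2) = tape bs'" by (simp add: fun_upd_idem)
  also have "min (length x + 1) (move_head MoveRight p) = Suc p"
    using Suc N by simp
  also have "fsteps x s (Cf (D0 q) (Suc p) (W[ix q := (tape bs', move_head Stay 0)]) w)
    (Cf (Fire q) (Suc p + bits_val bs') (W[ix q := (tape (replicate (length bs') False), 0)]) w)"
    unfolding move_head.simps
    by (rule Suc.hyps(1)) (use v Suc in auto)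
  finally show ?case using v Suc.hyps(2) by (metis add_Suc_shift)
qed

lemma fsteps_C1:
  assumes "q \<in> S" "j < length hs" "length pre + length bs + 1 < s" "p \<le> N"
    "length pre + length (bits_inc bs) < s"
  shows "fsteps x s (Cf (C1 j q) p (W[j := (tape (pre @ bs), Suc (length pre))]) w)
    (Cf (C2 j q) p (W[j := (tape (pre @ bits_inc bs), 0)]) w)"
  using assms(3,5)
proof (induction bs arbitrary: pre rule: bits_inc.induct)
  case 1
  have "fstep x s (Cf (C1 j q) p (W[j := (tape pre, Suc (length pre))]) w)
    (Cf (C2 j q) p (W[j := ((tape pre)(Suc (length pre) := digit True), move_head MoveLeft (Suc (length pre)))]) w)"
    by (rule fstep_stay) (use assms(1,2,4) 1 in auto)
  also have "(tape pre)(Suc (length pre) := digit True) = tape (pre @ [True])"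
    by (rule tape_append)
  also have "fsteps x s (Cf (C2 j q) p (W[j := (tape (pre @ [True]), move_head MoveLeft (Suc (length pre)))]) w)
    (Cf (C2 j q) p (W[j := (tape (pre @ [True]), 0)]) w)"
    by (rule fsteps_C2) (use assms(1,2,4) 1 in auto)
  finally show ?case by simp
next
  case (2 bs)
  have "fstep x s (Cf (C1 j q) p (W[j := (tape (pre @ False # bs), Suc (length pre))]) w)
    (Cf (C2 j q) p (W[j := ((tape (pre @ False # bs))(Suc (length pre) := digit True), move_head MoveLeft (Suc (length pre)))]) w)"
    by (rule fstep_stay) (use assms(1,2,4) 2 in auto)
  also have "(tape (pre @ False # bs))(Suc (length pre) := digit True) = tape (pre @ True # bs)"
    by (simp add: tape_update[of _ _ True, simplified])
  also have "fsteps x s (Cf (C2 j q) p (W[j := (tape (pre @ True # bs), move_head MoveLeft (Suc (length pre)))]) w)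
    (Cf (C2 j q) p (W[j := (tape (pre @ True # bs), 0)]) w)"
    by (rule fsteps_C2) (use assms(1,2,4) 2 in auto)
  finally show ?case by simp
next
  case (3 bs)
  have "fstep x s (Cf (C1 j q) p (W[j := (tape (pre @ True # bs), Suc (length pre))]) w)
    (Cf (C1 j q) p (W[j := ((tape (pre @ True # bs))(Suc (length pre) := digit False), move_head MoveRight (Suc (length pre)))]) w)"
    by (rule fstep_stay) (use assms(1,2,4) 3 in auto)
  also have "(tape (pre @ True # bs))(Suc (length pre) := digit False) = tape ((pre @ [False]) @ bs)"
    by (simp add: tape_update[of _ _ False, simplified])
  also have "fsteps x s (Cf (C1 j q) p (W[j := (tape ((pre @ [False]) @ bs), move_head MoveRight (Suc (length pre)))]) w)
    (Cf (C2 j q) p (W[j := (tape ((pre @ [False]) @ bits_inc bs), 0)]) w)"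
    using "3.IH"[of "pre @ [False]"] 3 by simp
  finally show ?case by simp
qed

text \<open>The converse of \<open>fsteps_dec\<close>: the sum \<open>p + v\<close> is kept while
  the input head returns to the left end. As this sum is at most \<open>N\<close>, each increment
  satisfies the hypothesis of \<open>represents_inc\<close> and the counter stays short.\<close>

lemma fsteps_inc:
  assumes "q \<in> S" "j < length hs" "represents N bs v" "p + v \<le> N"
  shows "\<exists>bs'. represents N bs' (p + v) \<and>
    fsteps x s (Cf (C0 j q) p (W[j := (tape bs, 0)]) w) (Cf (D0 q) 0 (W[j := (tape bs', 0)]) w)"
  using assms(3,4)
proof (induction p arbitrary: bs v)
  case 0
  have "fstep x s (Cf (C0 j q) 0 (W[j := (tape bs, 0)]) w) (Cf (D0 q) 0 (W[j := (tape bs, move_head Stay 0)]) w)"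
    by (rule fstep_read[OF _ _ _ _ refl]) (use assms(1,2) s[OF 0(1)] in \<open>auto simp: scan_def\<close>)
  then show ?case using 0 by auto
next
  case (Suc p)
  have inc: "represents N (bits_inc bs) (Suc v)" using represents_inc Suc.prems by simp
  note ss = s[OF Suc.prems(1)] s[OF inc]
  have "fstep x s (Cf (C0 j q) (Suc p) (W[j := (tape bs, 0)]) w)
    (Cf (C1 j q) (min (length x + 1) (move_head MoveLeft (Suc p)))
      (W[j := ((tape bs)(0 := tape bs 0), move_head MoveRight 0)]) w)"
    by (rule fstepI) (use assms(1,2) ss in \<open>auto simp: scan_def\<close>)
  also have "(tape bs)(0 := tape bs 0) = tape bs" by (rule fun_upd_triv)
  also have "min (length x + 1) (move_head MoveLeft (Suc p)) = p" using Suc.prems N by simp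
  also have "fsteps x s (Cf (C1 j q) p (W[j := (tape bs, move_head MoveRight 0)]) w)
    (Cf (C2 j q) p (W[j := (tape (bits_inc bs), 0)]) w)"
    using fsteps_C1[of q j "[]" bs p w] assms(1,2) ss Suc.prems by auto
  also have "fstep x s (Cf (C2 j q) p (W[j := (tape (bits_inc bs), 0)]) w)
    (Cf (C0 j q) p (W[j := (tape (bits_inc bs), move_head Stay 0)]) w)"
    by (rule fstep_read[OF _ _ _ _ refl]) (use assms(1,2) ss Suc.prems in auto)
  finally have *: "fsteps x s (Cf (C0 j q) (Suc p) (W[j := (tape bs, 0)]) w)
    (Cf (C0 j q) p (W[j := (tape (bits_inc bs), 0)]) w)" by simp
  from Suc.IH[OF inc] Suc.prems obtain bs' where "represents N bs' (p + Suc v)"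
    "fsteps x s (Cf (C0 j q) p (W[j := (tape (bits_inc bs), 0)]) w) (Cf (D0 q) 0 (W[j := (tape bs', 0)]) w)"
    by auto
  with * show ?case by auto
qed

end

text \<open>Configurations in which all counters are at rest, except the one of head \<open>j\<close>, which is \<open>0\<close>.\<close>

definition stores :: "nat \<Rightarrow> ('h \<Rightarrow> nat) \<Rightarrow> nat option \<Rightarrow> ((nat \<Rightarrow> nat) \<times> nat) list \<Rightarrow> bool" where
  "stores N h j W \<longleftrightarrow> length W = length hs \<and> (\<forall>i < length hs. \<exists>bs. W ! i = (tape bs, 0) \<and>
     represents N bs (if j = Some i then 0 else h (hs ! i)))"

lemma stores_upd:
  assumes "stores N h j W" "i < length hs" "represents N bs (if j' = Some i then 0 else h' (hs ! i))"
    and "\<And>k. k < length hs \<Longrightarrow> k \<noteq> i \<Longrightarrow> (j = Some k \<longleftrightarrow> j' = Some k) \<and> h (hs ! k) = h' (hs ! k)"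
  shows "stores N h' j' (W[i := (tape bs, 0)])"
  unfolding stores_def
proof safe
  show "length (W[i := (tape bs, 0)]) = length hs" using assms(1) by (simp add: stores_def)
  fix k assume k: "k < length hs"
  show "\<exists>bs'. W[i := (tape bs, 0)] ! k = (tape bs', 0) \<and>
         represents N bs' (if j' = Some k then 0 else h' (hs ! k))"
  proof (cases "k = i")
    case True
    then show ?thesis using assms k by (auto simp: stores_def)
  next
    case False
    then have "W[i := (tape bs, 0)] ! k = W ! k" by simp
    moreover have "\<exists>bs'. W ! k = (tape bs', 0) \<and> represents N bs' (if j = Some k then 0 else h (hs ! k))"
      using assms(1) k by (auto simp: stores_def)
    ultimately show ?thesis using assms(4)[OF k False] by (auto split: if_splits)
  qed
qed

text \<open>The tape of the head in use holds zero and not its position, so this position may change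
  while the tapes stay as they are.\<close>

lemma stores_same:
  assumes "stores N h (Some i) W" "i < length hs"
  shows "stores N (h(hs ! i := v)) (Some i) W"
proof -
  have "(h(hs ! i := v)) (hs ! k) = h (hs ! k)" if "k < length hs" "k \<noteq> i" for k
    using that assms(2) hs(1) by (simp add: nth_eq_iff_index_eq)
  then show ?thesis using assms(1) by (fastforce simp: stores_def)
qed

context
  fixes x :: "'i list" and s N :: nat
  assumes N: "N = length x + 1"
    and s: "\<And>bs v. represents N bs v \<Longrightarrow> length bs + 1 < s"
begin

lemma stores_heads: "stores N h j W \<Longrightarrow> (t, p) \<in> set W \<Longrightarrow> p < s"
  using s[OF represents_Nil] by (fastforce simp: stores_def in_set_conv_nth)

lemma to_Fire:
  assumes "q \<in> S" "stores N h None W" "h (sel q) \<le> N"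
  shows "\<exists>W'. stores N h (Some (ix q)) W' \<and> fsteps x s (Cf (D0 q) 0 W w) (Cf (Fire q) (h (sel q)) W' w)"
proof -
  let ?j = "ix q"
  obtain bs where bs: "W ! ?j = (tape bs, 0)" "represents N bs (h (sel q))"
    using assms ix[of q] by (auto simp: stores_def)
  let ?W' = "W[?j := (tape (replicate (length bs) False), 0)]"
  have "fsteps x s (Cf (D0 q) 0 (W[?j := (tape bs, 0)]) w) (Cf (Fire q) (0 + bits_val bs) ?W' w)"
    using assms bs s[OF bs(2)]
    by (intro fsteps_dec[OF N s]) (auto simp: stores_def represents_def stores_heads[OF assms(2)])
  moreover have "W[?j := (tape bs, 0)] = W" using bs(1) by (metis list_update_id)
  moreover have "stores N h (Some ?j) ?W'"
    using assms bs by (intro stores_upd[OF assms(2)]) (auto simp: ix intro: represents_same_length)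
  ultimately show ?thesis using bs by (auto simp: represents_def)
qed

lemma from_C0:
  assumes "q \<in> S" "j < length hs" "stores N h (Some j) W" "h (hs ! j) \<le> N"
  shows "\<exists>W'. stores N h None W' \<and> fsteps x s (Cf (C0 j q) (h (hs ! j)) W w) (Cf (D0 q) 0 W' w)"
proof -
  obtain bs where bs: "W ! j = (tape bs, 0)" "represents N bs 0"
    using assms by (auto simp: stores_def)
  have "\<exists>bs'. represents N bs' (h (hs ! j) + 0) \<and>
    fsteps x s (Cf (C0 j q) (h (hs ! j)) (W[j := (tape bs, 0)]) w) (Cf (D0 q) 0 (W[j := (tape bs', 0)]) w)"
    using assms bs s[OF bs(2)]
    by (intro fsteps_inc[OF N s]) (auto simp: stores_def represents_def stores_heads[OF assms(3)])
  moreover have "W[j := (tape bs, 0)] = W" using bs(1) by (metis list_update_id)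
  ultimately obtain bs' where bs': "represents N bs' (h (hs ! j))"
    "fsteps x s (Cf (C0 j q) (h (hs ! j)) W w) (Cf (D0 q) 0 (W[j := (tape bs', 0)]) w)" by auto
  have "stores N h None (W[j := (tape bs', 0)])"
    using assms bs' by (intro stores_upd[OF assms(3)]) auto
  with bs' show ?thesis by blast
qed

lemma step_Fire:
  assumes "q \<in> S"
  shows "tm_step M x (Cf (Fire q) p W w) c' \<longleftrightarrow> (\<exists>q' d out. (q', d, out) \<in> \<delta> q (scan x p) \<and>
      c' = Cf (C0 (ix q) q') (min (length x + 1) (move_head d p))
        (map2 act_tape W (act (readw W) (ix q) (readw W ! ix q) Stay)) (w @ emit out))"
proof -
  have "Fire q \<in> ctrls" using assms by simp
  moreover have "(u', d, acts, out) \<in> ctrans (Fire q) c ws \<longleftrightarrow> (\<exists>q'. (q', d, out) \<in> \<delta> q c \<and>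
      u' = C0 (ix q) q' \<and> acts = act ws (ix q) (ws ! ix q) Stay)" for u' d acts out c ws
    by force
  ultimately show ?thesis by (simp only: tm_step_Cf) blast
qed

lemma act_read:
  assumes "stores N h j W" "i < length hs"
  shows "map2 act_tape W (act (readw W) i (readw W ! i) Stay) = W"
  using assms by (subst map2_act)
    (auto simp: stores_def act_tape_def list_update_same_conv split: prod.splits)

lemma halting_Fire:
  assumes "q \<in> S"
  shows "halting M x (Cf (Fire q) (h (sel q)) W w) \<longleftrightarrow> mhalting sel \<delta> x (q, h, w)"
  using step_Fire[OF assms] by (fastforce simp: halting_def mhalting_def mstep_def)

lemma simulate_step:
  assumes "q \<in> S" "stores N h None W" "\<And>y. h y \<le> N" "mstep sel \<delta> x (q, h, w) (q', h', w')"
  shows "\<exists>W'. stores N h' None W' \<and> (tm_step M x)\<^sup>*\<^sup>* (Cf (D0 q) 0 W w) (Cf (D0 q') 0 W' w')"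
proof -
  from to_Fire[OF assms(1,2), of w] assms(3) obtain W1 where W1: "stores N h (Some (ix q)) W1"
    "fsteps x s (Cf (D0 q) 0 W w) (Cf (Fire q) (h (sel q)) W1 w)" by blast
  from assms(4) obtain d out where d: "(q', d, out) \<in> \<delta> q (scan x (h (sel q)))"
    "h' = h(sel q := min (length x + 1) (move_head d (h (sel q))))" "w' = w @ emit out"
    by (auto simp: mstep_def)
  have Fire: "tm_step M x (Cf (Fire q) (h (sel q)) W1 w) (Cf (C0 (ix q) q') (h' (hs ! ix q)) W1 w')"
    using d act_read[OF W1(1)] ix[OF assms(1)] by (subst step_Fire[OF assms(1)]) auto
  have "stores N h' (Some (ix q)) W1"
    using stores_same[OF W1(1)] d(2) ix[OF assms(1)] by auto
  moreover have "q' \<in> S" using closed[OF assms(1) d(1)] .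
  moreover have "h' (hs ! ix q) \<le> N" using d(2) ix[OF assms(1)] N by simp
  ultimately obtain W' where "stores N h' None W'"
    "fsteps x s (Cf (C0 (ix q) q') (h' (hs ! ix q)) W1 w') (Cf (D0 q') 0 W' w')"
    using from_C0 ix[OF assms(1)] by blast
  with fsteps_tm[OF W1(2)] Fire fsteps_tm show ?thesis
    by (meson rtranclp.rtrancl_into_rtrancl rtranclp_trans)
qed

lemma mstep_bounded: "mstep sel \<delta> x (q, h, w) (q', h', w') \<Longrightarrow> (\<And>y. h y \<le> N) \<Longrightarrow> h' y \<le> N"
  using N by (auto simp: mstep_def)

lemma mstep_S: "mstep sel \<delta> x (q, h, w) (q', h', w') \<Longrightarrow> q \<in> S \<Longrightarrow> q' \<in> S"
  using closed by (auto simp: mstep_def)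

lemma simulate_steps:
  assumes "(mstep sel \<delta> x)\<^sup>*\<^sup>* (q, h, w) (q', h', w')" "q \<in> S" "stores N h None W" "\<And>y. h y \<le> N"
  shows "q' \<in> S \<and> (\<forall>y. h' y \<le> N) \<and>
    (\<exists>W'. stores N h' None W' \<and> (tm_step M x)\<^sup>*\<^sup>* (Cf (D0 q) 0 W w) (Cf (D0 q') 0 W' w'))"
  using assms(1)
proof (induction "(q', h', w')" arbitrary: q' h' w' rule: rtranclp_induct)
  case base
  then show ?case using assms by blast
next
  case (step a q2 h2 w2)
  obtain q1 h1 w1 where a: "a = (q1, h1, w1)" by (metis prod_cases3)
  from step(3)[OF a] obtain W1 where "q1 \<in> S" "\<And>y. h1 y \<le> N" "stores N h1 None W1"
    "(tm_step M x)\<^sup>*\<^sup>* (Cf (D0 q) 0 W w) (Cf (D0 q1) 0 W1 w1)" by blast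
  with simulate_step[OF this(1,3,2)] step(2) mstep_bounded mstep_S show ?case
    unfolding a by (meson rtranclp_trans)
qed

text \<open>A run alternates between forced segments, which end in a \<open>Fire\<close> state, and
  single steps out of \<open>Fire\<close>, which match transitions of the automaton. Inside a
  segment \<open>fsteps_linear\<close> gives the space bound and excludes halting; what remains is
  shorter and is covered by the induction hypothesis.\<close>

lemma simulation_sound:
  assumes "(tm_step M x ^^ n) (Cf (D0 q) 0 W w) c" "q \<in> S" "stores N h None W" "\<And>y. h y \<le> N"
  shows "fits s c \<and> (halting M x c \<longrightarrow> (\<exists>q' h' w' p W'. (mstep sel \<delta> x)\<^sup>*\<^sup>* (q, h, w) (q', h', w') \<and>
    mhalting sel \<delta> x (q', h', w') \<and> q' \<in> S \<and> c = Cf (Fire q') p W' w'))"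
  using assms
proof (induction n arbitrary: q h w W rule: less_induct)
  case (less n)
  from to_Fire[OF less.prems(2,3), of w] less.prems(4) obtain W1 where W1: "stores N h (Some (ix q)) W1"
    "fsteps x s (Cf (D0 q) 0 W w) (Cf (Fire q) (h (sel q)) W1 w)" by blast
  from fsteps_linear[OF W1(2) less.prems(1)] show ?case
  proof (elim disjE exE conjE)
    fix m assume m: "m \<le> n" "(tm_step M x ^^ m) (Cf (Fire q) (h (sel q)) W1 w) c"
    show ?case
    proof (cases m)
      case 0
      then have c: "c = Cf (Fire q) (h (sel q)) W1 w" using m by simp
      have "fits s c" using stores_heads[OF W1(1)] by (auto simp: fits_def c Cf_def)
      then show ?thesis using less.prems(2) halting_Fire[OF less.prems(2)] c by blast
    next
      case (Suc k)
      then obtain c1 where c1: "tm_step M x (Cf (Fire q) (h (sel q)) W1 w) c1" "(tm_step M x ^^ k) c1 c"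
        using m by (metis relpowp_Suc_E2)
      define upd where "upd = (\<lambda>d. h(sel q := min (length x + 1) (move_head d (h (sel q)))))"
      from c1(1) obtain q' d out where d: "(q', d, out) \<in> \<delta> q (scan x (h (sel q)))"
        "c1 = Cf (C0 (ix q) q') (upd d (hs ! ix q)) W1 (w @ emit out)"
        using act_read[OF W1(1)] ix[OF less.prems(2)] unfolding step_Fire[OF less.prems(2)]
        by (auto simp: upd_def)
      have st: "mstep sel \<delta> x (q, h, w) (q', upd d, w @ emit out)"
        using d(1) by (auto simp: mstep_def upd_def)
      have "stores N (upd d) (Some (ix q)) W1"
        using stores_same[OF W1(1)] ix[OF less.prems(2)] by (auto simp: upd_def)
      moreover have q': "q' \<in> S" using closed[OF less.prems(2) d(1)] .
      moreover have bd: "\<And>y. upd d y \<le> N" using less.prems(4) N by (auto simp: upd_def)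
      ultimately obtain W' where W': "stores N (upd d) None W'"
        "fsteps x s c1 (Cf (D0 q') 0 W' (w @ emit out))"
        using from_C0 ix[OF less.prems(2)] d(2) by blast
      from fsteps_linear[OF W'(2) c1(2)] show ?thesis
      proof (elim disjE exE conjE)
        fix k' assume k': "k' \<le> k" "(tm_step M x ^^ k') (Cf (D0 q') 0 W' (w @ emit out)) c"
        have "k' < n" using k'(1) Suc m(1) by simp
        from less.IH[OF this k'(2) q' W'(1) bd] show ?thesis
          using converse_rtranclp_into_rtranclp[of "mstep sel \<delta> x", OF st] by blast
      qed auto
    qed
  qed auto
qed

lemma start:
  "\<exists>W. stores N (\<lambda>_. 0) None W \<and> fstep x s (init_conf M) (Cf (D0 q0) 0 W [])"
proof -
  let ?W = "replicate (length hs) (tape [], 0 :: nat)"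
  have init: "init_conf M = Cf Init 0 (replicate (length hs) (\<lambda>_. 0, 0)) []"
    by (simp add: init_conf_def Cf_def M_def e)
  have "(\<lambda>_. 0)(0 := 2) = tape []" by (auto simp: tape_def)
  then have "map2 act_tape (replicate (length hs) (\<lambda>_. 0, 0)) (replicate (length hs) (2, Stay)) = ?W"
    by (simp add: zip_replicate act_tape_def)
  moreover have "fits s (init_conf M)" using s[OF represents_Nil] by (auto simp: init_conf_def fits_def)
  ultimately have "fstep x s (init_conf M) (Cf (D0 q0) 0 ?W [])"
    unfolding fstep_def init by (subst tm_step_Cf) auto
  moreover have "stores N (\<lambda>_. 0) None ?W"
    using represents_Nil by (auto simp: stores_def)
  ultimately show ?thesis by blast
qed

text \<open>The second part provides a halting run of the machine for a halting run of the
  automaton, which is all that a deterministic machine needs. The third part excludes spurious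
  accepting runs, as nondeterministic acceptance requires.\<close>

theorem simulation:
  "within_space M x s"
  "(mstep sel \<delta> x)\<^sup>*\<^sup>* (q0, \<lambda>_. 0, []) (q, h, w) \<Longrightarrow> mhalting sel \<delta> x (q, h, w) \<Longrightarrow>
    \<exists>c. reachable M x c \<and> halting M x c \<and> cf_output c = w \<and> (cf_state c \<in> tm_accept M \<longleftrightarrow> q \<in> acc)"
  "reachable M x c \<Longrightarrow> halting M x c \<Longrightarrow> \<exists>q h w.
    (mstep sel \<delta> x)\<^sup>*\<^sup>* (q0, \<lambda>_. 0, []) (q, h, w) \<and> mhalting sel \<delta> x (q, h, w) \<and> 
    (cf_state c \<in> tm_accept M \<longleftrightarrow> q \<in> acc)"
proof -
  have acc: "cf_state (Cf (Fire q) p W w) \<in> tm_accept M \<longleftrightarrow> q \<in> acc" if "q \<in> S" for q p W w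
  proof -
    have "Fire q' = Fire q" if "e (Fire q') = e (Fire q)" "q' \<in> S" for q'
      using inj_onD[OF e(1) that(1)] that(2) \<open>q \<in> S\<close> by simp
    then show ?thesis using that by (auto simp: Cf_def M_def image_iff)
  qed
  from start obtain W where W: "stores N (\<lambda>_. 0) None W"
    "fstep x s (init_conf M) (Cf (D0 q0) 0 W [])" by blast
  have sound: "fits s c \<and> (halting M x c \<longrightarrow> (\<exists>q' h' w' p W'.
     (mstep sel \<delta> x)\<^sup>*\<^sup>* (q0, \<lambda>_. 0, []) (q', h', w') \<and>
    mhalting sel \<delta> x (q', h', w') \<and> q' \<in> S \<and> c = Cf (Fire q') p W' w'))" if c: "reachable M x c" for c
  proof -
    from c obtain n where "(tm_step M x ^^ n) (init_conf M) c"
      by (auto simp: reachable_def rtranclp_power)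
    from fsteps_linear[OF r_into_rtranclp this, OF W(2)] simulation_sound[OF _ q0 W(1)] show ?thesis
      by auto
  qed
  then show "within_space M x s" by (auto simp: within_space_def fits_def)
  show "\<exists>c. reachable M x c \<and> halting M x c \<and> cf_output c = w \<and> (cf_state c \<in> tm_accept M \<longleftrightarrow> q \<in> acc)"
    if steps: "(mstep sel \<delta> x)\<^sup>*\<^sup>* (q0, \<lambda>_. 0, []) (q, h, w)" and halt: "mhalting sel \<delta> x (q, h, w)"
  proof -
    from simulate_steps[OF steps q0 W(1)] obtain W1 where W1: "q \<in> S" "\<And>y. h y \<le> N" "stores N h None W1"
      "(tm_step M x)\<^sup>*\<^sup>* (Cf (D0 q0) 0 W []) (Cf (D0 q) 0 W1 w)" by auto
    from to_Fire[OF W1(1,3,2), of w] obtain W2 where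
      "fsteps x s (Cf (D0 q) 0 W1 w) (Cf (Fire q) (h (sel q)) W2 w)" by blast
    with W1(4) W(2) have "reachable M x (Cf (Fire q) (h (sel q)) W2 w)"
      unfolding reachable_def by (meson fsteps_tm r_into_rtranclp rtranclp_trans)
    then show ?thesis using halting_Fire[OF W1(1)] halt acc[OF W1(1)] by (metis (no_types) Cf_def conf.select_convs(4))
  qed
  show "\<exists>q h w. (mstep sel \<delta> x)\<^sup>*\<^sup>* (q0, \<lambda>_. 0, []) (q, h, w) \<and> mhalting sel \<delta> x (q, h, w) \<and> 
    (cf_state c \<in> tm_accept M \<longleftrightarrow> q \<in> acc)" if "reachable M x c" "halting M x c"
    using sound[OF that(1)] that(2) acc by blast
qed

end

end

section \<open>Logarithmic size of the counters\<close>

definition counter_space :: "nat \<Rightarrow> nat" where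
  "counter_space n = nat \<lceil>log 2 (real n + 2)\<rceil> + 4"

text \<open>By \<open>represents_length\<close> a counter for values up to \<open>n + 1\<close> has
  at most \<open>1 + log 2 (n + 2)\<close> bits. The constant \<open>4\<close> covers this bit, the
  additional cell and the strict inequality.\<close>

lemma counter_space: "represents (n + 1) bs v \<Longrightarrow> length bs + 1 < counter_space n"
  using represents_length[of "n + 1" bs v] unfolding counter_space_def
  by (simp add: add.commute) linarith

lemma counter_space_bigo: "(\<lambda>n. real (counter_space n)) \<in> O(log_space)"
proof (rule bigoI)
  \<comment> \<open>For \<open>n \<ge> 3\<close> one has \<open>1 \<le> ln n\<close> and
    \<open>n + 2 \<le> n ^ 2\<close>. With \<open>ln 2 \<ge> 1/2\<close> this gives
    \<open>log 2 (n + 2) \<le> 4 * ln n\<close>, and the additive constant, at most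
    \<open>5\<close>, is absorbed by \<open>5 * ln n\<close>.\<close>
  have "real (counter_space n) \<le> 10 * ln (real n)" if n: "n \<ge> 3" for n
  proof -
    have l1: "1 \<le> ln (real n)"
    proof -
      have "exp 1 \<le> (3::real)" using exp_le by simp
      then show ?thesis using n by (simp add: ln_ge_iff)
    qed
    have l2: "ln 2 \<ge> (1/2 :: real)" proof -
      have "exp (1/2) ^ 2 \<le> (2::real) ^ 2"
        using exp_le by (simp add: exp_of_nat_mult[symmetric])
      then have "exp (1/2) \<le> (2::real)" by (rule power2_le_imp_le) simp
      then show ?thesis by (subst ln_ge_iff) auto
    qed
    have "real (counter_space n) \<le> log 2 (real n + 2) + 5"
      unfolding counter_space_def by (auto simp: add_increasing2) linarith
    also have "log 2 (real n + 2) \<le> log 2 (real n ^ 2)"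
    proof -
      have "real n * 3 \<le> real n * real n" using n by (intro mult_left_mono) auto
      moreover have "real n + 2 \<le> real n * 3" using n by simp
      ultimately have "real n + 2 \<le> real n ^ 2" unfolding power2_eq_square by (rule order_trans[rotated])
      then show ?thesis using n by (simp add: log_le_cancel_iff)
    qed
    also have "log 2 (real n ^ 2) = 2 * ln (real n) / ln 2" using n by (simp add: log_def ln_realpow)
    also have "\<dots> \<le> 4 * ln (real n)" using l1 l2 by (simp add: field_simps mult_left_mono)
    finally show ?thesis using l1 by linarith
  qed
  then show "eventually (\<lambda>n. norm (real (counter_space n)) \<le> 10 * norm (ln (real n))) at_top"
    by (intro eventually_sequentiallyI[of 3]) force
qed

theorem multihead_simulation:
  fixes sel :: "'q \<Rightarrow> 'h" and \<delta> :: "('q, 'i, 'o) mtrans"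
  assumes "finite S" "q0 \<in> S" "\<forall>q c q' d out. q \<in> S \<longrightarrow> (q', d, out) \<in> \<delta> q c \<longrightarrow> q' \<in> S"
  shows "\<exists>M. wf_tm M \<and>
    ((\<forall>q c a b. a \<in> \<delta> q c \<longrightarrow> b \<in> \<delta> q c \<longrightarrow> a = b) \<longrightarrow> deterministic M) \<and>
    (\<forall>x. within_space M x (counter_space (length x)) \<and>
     (\<forall>q h w. (mstep sel \<delta> x)\<^sup>*\<^sup>* (q0, \<lambda>_. 0, []) (q, h, w) \<and> mhalting sel \<delta> x (q, h, w) \<longrightarrow>
       (\<exists>c. reachable M x c \<and> halting M x c \<and> cf_output c = w \<and> (cf_state c \<in> tm_accept M \<longleftrightarrow> q \<in> acc))) \<and>
     (\<forall>c. reachable M x c \<and> halting M x c \<longrightarrow>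
       (\<exists>q h w. (mstep sel \<delta> x)\<^sup>*\<^sup>* (q0, \<lambda>_. 0, []) (q, h, w) \<and> mhalting sel \<delta> x (q, h, w) \<and>
         (cf_state c \<in> tm_accept M \<longleftrightarrow> q \<in> acc))))"
proof -
  obtain hs where hs: "distinct hs" "set hs = sel ` S"
    using finite_distinct_list assms(1) by (metis finite_imageI)
  interpret simulation sel \<delta> S q0 hs acc
    by unfold_locales (use assms(1,2) assms(3)[rule_format] hs in \<open>auto | blast\<close>)
  obtain f :: "'q ctrl \<Rightarrow> nat" and n where f: "f ` (ctrls - {Init}) = {..<n}" "inj_on f (ctrls - {Init})"
    using finite_imp_inj_to_nat_seg[of "ctrls - {Init}"] finite_ctrls[OF assms(1)]
    by (auto simp: lessThan_def)
  define e where "e = (\<lambda>u. if u = Init then 0 else Suc (f u))"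
  interpret coded_simulation sel \<delta> S q0 hs acc e "Suc n"
    by unfold_locales (use f in \<open>auto simp: e_def inj_on_def\<close>)
  show ?thesis
  proof (intro exI[of _ M] conjI allI impI)
    show "wf_tm M" by (rule wf_M)
    show "deterministic M" if "\<forall>q c a b. a \<in> \<delta> q c \<longrightarrow> b \<in> \<delta> q c \<longrightarrow> a = b"
      using that by (intro deterministic_M) blast
    fix x :: "'i list"
    have cs: "length bs + 1 < counter_space (length x)" if "represents (length x + 1) bs v" for bs v
      using counter_space[OF that] .
    show "within_space M x (counter_space (length x))" by (rule simulation(1)[OF refl cs])
    show "\<exists>c. reachable M x c \<and> halting M x c \<and> cf_output c = w \<and> (cf_state c \<in> tm_accept M \<longleftrightarrow> q \<in> acc)"
      if "(mstep sel \<delta> x)\<^sup>*\<^sup>* (q0, \<lambda>_. 0, []) (q, h, w) \<and> mhalting sel \<delta> x (q, h, w)" for q h w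
      using that by (elim conjE) (rule simulation(2)[OF refl cs])
    show "\<exists>q h w. (mstep sel \<delta> x)\<^sup>*\<^sup>* (q0, \<lambda>_. 0, []) (q, h, w) \<and> mhalting sel \<delta> x (q, h, w) \<and>
         (cf_state c \<in> tm_accept M \<longleftrightarrow> q \<in> acc)" if "reachable M x c \<and> halting M x c" for c
      using that by (elim conjE) (rule simulation(3)[OF refl cs])
  qed
qed

section \<open>Programs\<close>

text \<open>The indices of \<open>Rg\<close> are a block and a register of that block; in the
  counting part they are a register and one of its digits.\<close>

datatype head = Sc nat | is_Rg: Rg nat nat

datatype 's com =
    Skip
  | Fail
  | Move head move
  | Out 's
  | Seq "'s com" "'s com" (infixr ";;" 60)
  | If head "'s cell set" "'s com" "'s com"
  | While head "'s cell set" "'s com"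
  | Choice "'s com" "'s com"

type_synonym 's state = "(head \<Rightarrow> nat) \<times> 's list"

text \<open>In this big-step semantics a path that reaches \<open>Fail\<close> or runs forever has
  no result. Nondeterministic acceptance is the existence of some result, so failing is the way to
  discard a wrong guess.\<close>

inductive exec :: "'s list \<Rightarrow> 's com \<Rightarrow> 's state \<Rightarrow> 's state \<Rightarrow> bool" for x where
  Skip: "exec x Skip s s"
| Move: "exec x (Move j d) (h, w) (h(j := min (length x + 1) (move_head d (h j))), w)"
| Out: "exec x (Out a) (h, w) (h, w @ [a])"
| Seq: "exec x c1 s1 s2 \<Longrightarrow> exec x c2 s2 s3 \<Longrightarrow> exec x (c1 ;; c2) s1 s3"
| IfTrue: "scan x (fst s j) \<in> T \<Longrightarrow> exec x c1 s t \<Longrightarrow> exec x (If j T c1 c2) s t"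
| IfFalse: "scan x (fst s j) \<notin> T \<Longrightarrow> exec x c2 s t \<Longrightarrow> exec x (If j T c1 c2) s t"
| WhileFalse: "scan x (fst s j) \<notin> T \<Longrightarrow> exec x (While j T c) s s"
| WhileTrue: "scan x (fst s1 j) \<in> T \<Longrightarrow> exec x c s1 s2 \<Longrightarrow> exec x (While j T c) s2 s3 \<Longrightarrow>
    exec x (While j T c) s1 s3"
| ChoiceL: "exec x c1 s t \<Longrightarrow> exec x (Choice c1 c2) s t"
| ChoiceR: "exec x c2 s t \<Longrightarrow> exec x (Choice c1 c2) s t"

inductive_cases SkipE [elim!]: "exec x Skip s t"
inductive_cases FailE [elim!]: "exec x Fail s t"
inductive_cases MoveE [elim!]: "exec x (Move j d) s t"
inductive_cases OutE [elim!]: "exec x (Out a) s t"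
inductive_cases SeqE: "exec x (c1 ;; c2) s t"
inductive_cases IfE: "exec x (If j T c1 c2) s t"
inductive_cases WhileE: "exec x (While j T c) s t"
inductive_cases ChoiceE: "exec x (Choice c1 c2) s t"

lemma exec_Skip_iff [simp]: "exec x Skip s t \<longleftrightarrow> t = s"
  by (auto intro: exec.intros)

lemma exec_Fail_iff [simp]: "\<not> exec x Fail s t"
  by auto

lemma exec_Seq_iff: "exec x (c1 ;; c2) s t \<longleftrightarrow> (\<exists>u. exec x c1 s u \<and> exec x c2 u t)"
  by (meson exec.Seq SeqE)

lemma exec_If_iff: "exec x (If j T c1 c2) s t \<longleftrightarrow> (if scan x (fst s j) \<in> T then exec x c1 s t else exec x c2 s t)"
  by (auto intro: exec.intros elim: IfE)

lemma exec_Choice_iff: "exec x (Choice c1 c2) s t \<longleftrightarrow> exec x c1 s t \<or> exec x c2 s t"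
  by (auto intro: exec.intros elim: ChoiceE)

lemma exec_While_unfold: "exec x (While j T c) s t \<longleftrightarrow> exec x (If j T (c ;; While j T c) Skip) s t"
proof
  show "exec x (If j T (c ;; While j T c) Skip) s t" if "exec x (While j T c) s t"
    using that by (rule WhileE) (auto simp: exec_If_iff exec_Seq_iff)
  show "exec x (While j T c) s t" if "exec x (If j T (c ;; While j T c) Skip) s t"
  proof (cases "scan x (fst s j) \<in> T")
    case True
    with that obtain u where "exec x c s u" "exec x (While j T c) u t"
      by (auto simp: exec_If_iff exec_Seq_iff)
    with True show ?thesis by (rule exec.WhileTrue)
  next
    case False
    with that have "t = s" by (simp add: exec_If_iff)
    with exec.WhileFalse[OF False] show ?thesis by simp
  qed
qed

fun det :: "'s com \<Rightarrow> bool" where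
  "det (Seq c1 c2) \<longleftrightarrow> det c1 \<and> det c2"
| "det (If j T c1 c2) \<longleftrightarrow> det c1 \<and> det c2"
| "det (While j T c) \<longleftrightarrow> det c"
| "det (Choice c1 c2) \<longleftrightarrow> False"
| "det _ \<longleftrightarrow> True"

lemma exec_det: "exec x c s t \<Longrightarrow> det c \<Longrightarrow> exec x c s u \<Longrightarrow> u = t"
proof (induction arbitrary: u rule: exec.induct)
  case (WhileTrue s1 j T c s2 s3)
  from WhileTrue.prems(2) WhileTrue.hyps(1) obtain v where v: "exec x c s1 v" "exec x (While j T c) v u"
    by (subst (asm) exec_While_unfold) (auto simp: exec_If_iff exec_Seq_iff)
  from WhileTrue.IH(1)[OF _ v(1)] WhileTrue.prems(1) have "v = s2" by simp
  with WhileTrue.IH(2)[OF WhileTrue.prems(1)] v(2) show ?case by simp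
next
  case (WhileFalse s j T c)
  then show ?case by (subst (asm) exec_While_unfold) (auto simp: exec_If_iff)
next
  case (Seq c1 s1 s2 c2 s3)
  from Seq.prems(2) obtain v where v: "exec x c1 s1 v" "exec x c2 v u" by (blast elim: SeqE)
  from Seq.IH(1)[OF _ v(1)] Seq.prems(1) have "v = s2" by simp
  with Seq.IH(2)[of u] Seq.prems(1) v(2) show ?case by simp
next
  case (IfTrue s j T c1 t c2)
  then show ?case by (simp only: exec_If_iff if_True det.simps)
next
  case (IfFalse s j T c2 t c1)
  then show ?case by (simp only: exec_If_iff if_False det.simps)
qed auto

text \<open>As a multihead automaton, a program has the commands that remain to be executed as its control states.\<close>

fun sel :: "'s com \<Rightarrow> head" where
  "sel (Move j d) = j"
| "sel (If j T c1 c2) = j"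
| "sel (While j T c) = j"
| "sel (c1 ;; c2) = sel c1"
| "sel _ = Sc 0"

fun step :: "('s com, 's, 's) mtrans" where
  "step Skip a = {}"
| "step Fail a = {}"
| "step (Move j d) a = {(Skip, d, None)}"
| "step (Out s) a = {(Skip, Stay, Some s)}"
| "step (c1 ;; c2) a = (if c1 = Skip then {(c2, Stay, None)}
     else (\<lambda>(c1', d, out). (c1' ;; c2, d, out)) ` step c1 a)"
| "step (If j T c1 c2) a = {(if a \<in> T then c1 else c2, Stay, None)}"
| "step (While j T c) a = {(if a \<in> T then c ;; While j T c else Skip, Stay, None)}"
| "step (Choice c1 c2) a = {(c1, Stay, None), (c2, Stay, None)}"

text \<open>A finite set of commands that contains \<open>c\<close> and is closed under
  \<open>step\<close>, like the set of partial derivatives of a regular expression. It provides the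
  finitely many control states of the machine for \<open>c\<close>.\<close>

fun detsub :: "'s com \<Rightarrow> 's com set" where
  "detsub (c1 ;; c2) = (\<lambda>c. c ;; c2) ` detsub c1 \<union> detsub c2"
| "detsub (If j T c1 c2) = insert (If j T c1 c2) (detsub c1 \<union> detsub c2)"
| "detsub (While j T c) = {While j T c, Skip} \<union> (\<lambda>c'. c' ;; While j T c) ` detsub c"
| "detsub (Choice c1 c2) = insert (Choice c1 c2) (detsub c1 \<union> detsub c2)"
| "detsub c = {c, Skip}"

lemma detsub_self: "c \<in> detsub c"
  by (induction c) auto

lemma finite_detsub: "finite (detsub c)"
  by (induction c) auto

lemma detsub_step: "c' \<in> detsub c \<Longrightarrow> (c'', d, out) \<in> step c' a \<Longrightarrow> c'' \<in> detsub c"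
proof (induction c arbitrary: c' c'')
  case (Seq c1 c2)
  then show ?case using detsub_self[of c2] by (fastforce split: if_splits)
next
  case (If j T c1 c2)
  then show ?case using detsub_self[of c1] detsub_self[of c2] by (auto split: if_splits)
next
  case (While j T c)
  then show ?case using detsub_self[of c] by (fastforce split: if_splits)
next
  case (Choice c1 c2)
  then show ?case using detsub_self[of c1] detsub_self[of c2] by auto
qed auto

lemma step_det: "det c \<Longrightarrow> u \<in> step c a \<Longrightarrow> v \<in> step c a \<Longrightarrow> u = v"
  by (induction c arbitrary: u v) (fastforce split: if_splits)+

lemma det_detsub: "det c \<Longrightarrow> c' \<in> detsub c \<Longrightarrow> det c'"
proof (induction c arbitrary: c')
  case (Seq c1 c2)
  from Seq.prems(2) consider c where "c \<in> detsub c1" "c' = c ;; c2" | "c' \<in> detsub c2" by auto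
  then show ?case
  proof cases
    case 1
    with Seq.IH(1)[OF _ 1(1)] Seq.prems(1) show ?thesis by (simp only: det.simps)
  next
    case 2
    with Seq.IH(2)[of c'] Seq.prems(1) show ?thesis by (simp only: det.simps simp_thms)
  qed
next
  case (If j T c1 c2)
  from If.prems(2) consider "c' = If j T c1 c2" | "c' \<in> detsub c1" | "c' \<in> detsub c2" by auto
  then show ?case using If.IH[of c'] If.prems(1) by cases (simp_all only: det.simps simp_thms)
next
  case (While j T c)
  from While.prems(2) consider "c' = While j T c" | "c' = Skip"
    | c1 where "c1 \<in> detsub c" "c' = c1 ;; While j T c" by auto
  then show ?case
  proof cases
    case 3
    with While.IH[OF _ 3(1)] While.prems(1) show ?thesis by (simp only: det.simps)
  qed (use While.prems(1) in auto)
next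
  case (Choice c1 c2)
  from Choice.prems(1) show ?case by (simp only: det.simps)
qed auto

section \<open>Agreement of the small-step and the big-step semantics\<close>

abbreviation cstep :: "'s list \<Rightarrow> 's com \<times> 's state \<Rightarrow> 's com \<times> 's state \<Rightarrow> bool" where
  "cstep x \<equiv> mstep sel step x"

lemma cstep_detsub: "cstep x (c1, s) (c1', s') \<Longrightarrow> c1 \<in> detsub c \<Longrightarrow> c1' \<in> detsub c"
  by (cases s) (auto simp: mstep_def dest: detsub_step)

lemma clip_same: "h j \<le> Suc (length x) \<Longrightarrow> h(j := min (Suc (length x)) (h j)) = h"
  by (simp add: fun_upd_idem)

definition bounded :: "'s list \<Rightarrow> 's state \<Rightarrow> bool" where
  "bounded x s \<longleftrightarrow> (\<forall>j. fst s j \<le> length x + 1)"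

lemma exec_bounded: "exec x c s t \<Longrightarrow> bounded x s \<Longrightarrow> bounded x t"
  by (induction rule: exec.induct) (auto simp: bounded_def)

lemma cstep_Seq: "cstep x (c1, s) (c1', s') \<Longrightarrow> cstep x (c1 ;; c2, s) (c1' ;; c2, s')"
  by (cases s; cases s') (fastforce simp: mstep_def)

lemma csteps_Seq: "(cstep x)\<^sup>*\<^sup>* (c1, s) (c1', s') \<Longrightarrow> (cstep x)\<^sup>*\<^sup>* (c1 ;; c2, s) (c1' ;; c2, s')"
  by (induction "(c1', s')" arbitrary: c1' s' rule: rtranclp_induct)
    (auto intro: rtranclp.rtrancl_into_rtrancl cstep_Seq)

lemma cstep_quiet:
  assumes "bounded x s" "(c', Stay, None) \<in> step c (scan x (fst s (sel c)))"
  shows "cstep x (c, s) (c', s)"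
proof -
  have "(fst s)(sel c := min (length x + 1) (move_head Stay (fst s (sel c)))) = fst s"
    using assms(1) clip_same[of "fst s" "sel c" x] by (simp add: bounded_def)
  then show ?thesis using assms(2) by (cases s) (force simp: mstep_def)
qed

lemma exec_csteps: "exec x c s t \<Longrightarrow> bounded x s \<Longrightarrow> (cstep x)\<^sup>*\<^sup>* (c, s) (Skip, t)"
proof (induction rule: exec.induct)
  case (Move j d h w)
  have "cstep x (Move j d, h, w) (Skip, h(j := min (length x + 1) (move_head d (h j))), w)"
    by (simp add: mstep_def)
  then show ?case by blast
next
  case (Out a h w)
  have "cstep x (Out a, h, w) (Skip, h, w @ [a])"
    using Out clip_same[of h "Sc 0" x] by (simp add: mstep_def bounded_def)
  then show ?case by blast
next
  case (Seq c1 s1 s2 c2 s3)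
  have b: "bounded x s2" using exec_bounded Seq by blast
  have "(cstep x)\<^sup>*\<^sup>* (c1 ;; c2, s1) (Skip ;; c2, s2)" using Seq csteps_Seq by blast
  also have "cstep x (Skip ;; c2, s2) (c2, s2)" by (rule cstep_quiet[OF b]) simp
  finally show ?case using Seq b by (meson rtranclp_trans)
next
  case (IfTrue s j T c1 t c2)
  have "cstep x (If j T c1 c2, s) (c1, s)" by (rule cstep_quiet) (use IfTrue in auto)
  then show ?case using IfTrue by (meson converse_rtranclp_into_rtranclp)
next
  case (IfFalse s j T c2 t c1)
  have "cstep x (If j T c1 c2, s) (c2, s)" by (rule cstep_quiet) (use IfFalse in auto)
  then show ?case using IfFalse by (meson converse_rtranclp_into_rtranclp)
next
  case (WhileFalse s j T c)
  have "cstep x (While j T c, s) (Skip, s)" by (rule cstep_quiet) (use WhileFalse in auto)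
  then show ?case by blast
next
  case (WhileTrue s1 j T c s2 s3)
  have b: "bounded x s2" using exec_bounded WhileTrue by blast
  have "cstep x (While j T c, s1) (c ;; While j T c, s1)"
    by (rule cstep_quiet) (use WhileTrue in auto)
  also have "(cstep x)\<^sup>*\<^sup>* (c ;; While j T c, s1) (Skip ;; While j T c, s2)"
    using WhileTrue csteps_Seq by blast
  also have "cstep x (Skip ;; While j T c, s2) (While j T c, s2)" by (rule cstep_quiet[OF b]) simp
  finally show ?case using WhileTrue b by (meson rtranclp_trans)
next
  case (ChoiceL c1 s t c2)
  have "cstep x (Choice c1 c2, s) (c1, s)" by (rule cstep_quiet) (use ChoiceL in auto)
  then show ?case using ChoiceL by (meson converse_rtranclp_into_rtranclp)
next
  case (ChoiceR c2 s t c1)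
  have "cstep x (Choice c1 c2, s) (c2, s)" by (rule cstep_quiet) (use ChoiceR in auto)
  then show ?case using ChoiceR by (meson converse_rtranclp_into_rtranclp)
qed blast

lemma clip_Stay: "(\<And>j. h j \<le> length x + 1) \<Longrightarrow> h(j := min (length x + 1) (move_head Stay (h j))) = h"
  by (simp add: fun_upd_idem)

lemma cstep_exec:
  "(c', d, out) \<in> step c (scan x (h (sel c))) \<Longrightarrow> (\<And>j. h j \<le> length x + 1) \<Longrightarrow>
   exec x c' (h(sel c := min (length x + 1) (move_head d (h (sel c)))), w @ emit out) t \<Longrightarrow> exec x c (h, w) t"
proof (induction c arbitrary: c' t)
  case (Seq c1 c2)
  show ?case
  proof (cases "c1 = Skip")
    case True
    with Seq.prems(1) have "c' = c2" "d = Stay" "out = None" by auto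
    note c' = this
    have "h(sel (c1 ;; c2) := min (length x + 1) (move_head Stay (h (sel (c1 ;; c2))))) = h"
      by (rule clip_Stay[of h x, OF Seq.prems(2)])
    from Seq.prems(3)[unfolded c' this] have "exec x c2 (h, w) t" by simp
    with True show ?thesis by (auto simp: exec_Seq_iff)
  next
    case False
    with Seq.prems obtain c1' where "c' = c1' ;; c2" "(c1', d, out) \<in> step c1 (scan x (h (sel c1)))"
      by auto
    with Seq.IH(1)[OF this(2) Seq.prems(2)] Seq.prems(3) show ?thesis
      by (auto simp: exec_Seq_iff)
  qed
next
  case (Move j d')
  then have c': "c' = Skip" "d = d'" "out = None" by auto
  from Move(3)[unfolded c' exec_Skip_iff] show ?case by (simp only: sel.simps option.case append_Nil2 exec.Move)
next
  case (Out s)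
  then have c': "c' = Skip" "d = Stay" "out = Some s" by auto

  from Out(3) have "t = (h, w @ [s])" unfolding c' clip_Stay[of h x, OF Out(2)] by simp
  then show ?case by (simp add: exec.Out)
next
  case (If j T c1 c2)
  then have c': "c' = (if scan x (h j) \<in> T then c1 else c2)" "d = Stay" "out = None" by auto
  from If.prems(3) have "exec x c' (h, w) t" unfolding c'(2,3) clip_Stay[of h x, OF If.prems(2)] by simp
  with c'(1) show ?case by (simp add: exec_If_iff split: if_splits)
next
  case (While j T c)
  then have c': "c' = (if scan x (h j) \<in> T then c ;; While j T c else Skip)" "d = Stay" "out = None"
    by auto
  from While.prems(3) have "exec x c' (h, w) t" unfolding c'(2,3) clip_Stay[of h x, OF While.prems(2)] by simp
  with c'(1) show ?case by (subst exec_While_unfold) (simp add: exec_If_iff split: if_splits)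
next
  case (Choice c1 c2)
  then have c': "c' = c1 \<or> c' = c2" "d = Stay" "out = None" by auto
  from Choice.prems(3) have "exec x c' (h, w) t"
    unfolding c'(2,3) clip_Stay[of h x, OF Choice.prems(2)] by simp
  with c'(1) show ?case by (auto simp: exec_Choice_iff)
qed auto

lemma cstep_bounded: "cstep x (c, s) (c', s') \<Longrightarrow> bounded x s \<Longrightarrow> bounded x s'"
  by (cases s; cases s') (auto simp: mstep_def bounded_def)

lemma csteps_exec:
  assumes "(cstep x)\<^sup>*\<^sup>* (c, s) (Skip, t)" "bounded x s"
  shows "exec x c s t"
  using assms
proof (induction "(c, s)" arbitrary: c s rule: converse_rtranclp_induct)
  case (step u)
  obtain c' s' where u: "u = (c', s')" by (cases u)
  have "exec x c' s' t" using step u cstep_bounded by blast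
  then show ?case using step(1,4) cstep_exec[of c' _ _ c x "fst s" "snd s" t] u
    by (cases s; cases s') (auto simp: mstep_def bounded_def)
qed (auto intro: exec.intros)

fun stuck :: "'s com \<Rightarrow> bool" where
  "stuck (c1 ;; c2) \<longleftrightarrow> stuck c1 \<and> c1 \<noteq> Skip"
| "stuck Skip \<longleftrightarrow> True"
| "stuck Fail \<longleftrightarrow> True"
| "stuck c \<longleftrightarrow> False"

text \<open>Whether a command has a step does not depend on the scanned cell, so halting is a
  property of the remaining command alone: it is \<open>Skip\<close>, or it is blocked by
  \<open>Fail\<close>.\<close>

lemma stuck_step: "stuck c \<longleftrightarrow> step c a = {}"
  by (induction c) auto

lemma mhalting_stuck: "mhalting sel step x (c, s) \<longleftrightarrow> stuck c"
  by (cases s) (auto simp: mhalting_def mstep_def stuck_step[of c "scan x (fst s (sel c))"])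

abbreviation start :: "'s state" where
  "start \<equiv> (\<lambda>_. 0, [])"

theorem program_machine:
  "\<exists>M :: ('s, 's) tm. wf_tm M \<and> (det c \<longrightarrow> deterministic M) \<and>
    (\<forall>x. within_space M x (counter_space (length x)) \<and>
     (\<forall>c' h w. (cstep x)\<^sup>*\<^sup>* (c, start) (c', h, w) \<and> stuck c' \<longrightarrow>
       (\<exists>cf. reachable M x cf \<and> halting M x cf \<and> cf_output cf = w \<and> (cf_state cf \<in> tm_accept M \<longleftrightarrow> c' = Skip))) \<and>
     (\<forall>cf. reachable M x cf \<and> halting M x cf \<and> cf_state cf \<in> tm_accept M \<longrightarrow> (\<exists>t. exec x c start t)))"
proof -
  \<comment> \<open>Determinism is asked of all control states, also of those that never occur.
    Outside of \<open>detsub c\<close> there are no transitions, and inside of it determinism is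
    inherited from \<open>c\<close>.\<close>
  define \<delta> where "\<delta> = (\<lambda>c' a. if c' \<in> detsub c then step c' a else {})"
  have ms: "mstep sel \<delta> x (c', s) b \<longleftrightarrow> cstep x (c', s) b" if "c' \<in> detsub c" for x c' s b
    using that by (cases s) (auto simp: mstep_def \<delta>_def)
  have to: "c' \<in> detsub c \<and> (cstep x)\<^sup>*\<^sup>* (c, start) (c', s)"
    if "(mstep sel \<delta> x)\<^sup>*\<^sup>* (c, start) (c', s)" for x c' s
    using that
  proof (induction "(c', s)" arbitrary: c' s rule: rtranclp_induct)
    case (step u)
    obtain c1 s1 where u: "u = (c1, s1)" by (cases u)
    then have "c1 \<in> detsub c" "(cstep x)\<^sup>*\<^sup>* (c, start) (c1, s1)" "cstep x (c1, s1) (c', s)"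
      using step ms by auto
    then show ?case using cstep_detsub by (metis rtranclp.rtrancl_into_rtrancl)
  qed (use detsub_self in auto)
  have conv: "c' \<in> detsub c \<and> (mstep sel \<delta> x)\<^sup>*\<^sup>* (c, start) (c', s)"
    if "(cstep x)\<^sup>*\<^sup>* (c, start) (c', s)" for x c' s
    using that
  proof (induction "(c', s)" arbitrary: c' s rule: rtranclp_induct)
    case (step u)
    obtain c1 s1 where u: "u = (c1, s1)" by (cases u)
    then have *: "c1 \<in> detsub c" "(mstep sel \<delta> x)\<^sup>*\<^sup>* (c, start) (c1, s1)" "cstep x (c1, s1) (c', s)"
      using step by auto
    then have "c' \<in> detsub c" using cstep_detsub by blast
    with * ms show ?case by (metis rtranclp.rtrancl_into_rtrancl)
  qed (use detsub_self in auto)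
  have halt: "mhalting sel \<delta> x (c', s) \<longleftrightarrow> stuck c'" if "c' \<in> detsub c" for x c' s
    using mhalting_stuck[of x c' s] ms[OF that] by (simp add: mhalting_def)
  have "\<forall>q a q' d out. q \<in> detsub c \<longrightarrow> (q', d, out) \<in> \<delta> q a \<longrightarrow> q' \<in> detsub c"
    using detsub_step by (auto simp: \<delta>_def split: if_splits)
  from multihead_simulation[where \<delta> = \<delta> and sel = sel and acc = "{Skip}",
      OF finite_detsub detsub_self, OF this]
  obtain M :: "('s, 's) tm" where M: "wf_tm M \<and>
    ((\<forall>q c a b. a \<in> \<delta> q c \<longrightarrow> b \<in> \<delta> q c \<longrightarrow> a = b) \<longrightarrow> deterministic M) \<and>
    (\<forall>x. within_space M x (counter_space (length x)) \<and>
     (\<forall>q h w. (mstep sel \<delta> x)\<^sup>*\<^sup>* (c, start) (q, h, w) \<and> mhalting sel \<delta> x (q, h, w) \<longrightarrow>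
       (\<exists>cf. reachable M x cf \<and> halting M x cf \<and> cf_output cf = w \<and> (cf_state cf \<in> tm_accept M \<longleftrightarrow> q \<in> {Skip}))) \<and>
     (\<forall>cf. reachable M x cf \<and> halting M x cf \<longrightarrow>
       (\<exists>q h w. (mstep sel \<delta> x)\<^sup>*\<^sup>* (c, start) (q, h, w) \<and> mhalting sel \<delta> x (q, h, w) \<and>
         (cf_state cf \<in> tm_accept M \<longleftrightarrow> q \<in> {Skip}))))"
    by - (elim exE, iprover)
  note M2 = M[THEN conjunct2, THEN conjunct1]
    and M3 = M[THEN conjunct2, THEN conjunct2, rule_format, THEN conjunct1]
    and M4 = M[THEN conjunct2, THEN conjunct2, rule_format, THEN conjunct2, THEN conjunct1, rule_format, OF conjI]
    and M5 = M[THEN conjunct2, THEN conjunct2, rule_format, THEN conjunct2, THEN conjunct2, rule_format, OF conjI]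
  show ?thesis
  proof (intro exI[of _ M] conjI allI impI)
    show "deterministic M" if "det c"
    proof -
      have "a = b" if "a \<in> \<delta> q d" "b \<in> \<delta> q d" for q d a b
        using that step_det[OF det_detsub[OF \<open>det c\<close>]] by (auto simp: \<delta>_def split: if_splits)
      then show ?thesis using M2 by blast
    qed
    fix x
    show "\<exists>t. exec x c start t"
      if cf: "reachable M x cf \<and> halting M x cf \<and> cf_state cf \<in> tm_accept M" for cf
    proof -
      from M5[of x cf] cf obtain h w where "(mstep sel \<delta> x)\<^sup>*\<^sup>* (c, start) (Skip, h, w)" by auto
      from to[OF this] have "exec x c start (h, w)" by (intro csteps_exec) (auto simp: bounded_def)
      then show ?thesis by blast
    qed
    show "\<exists>cf. reachable M x cf \<and> halting M x cf \<and> cf_output cf = w \<and> (cf_state cf \<in> tm_accept M \<longleftrightarrow> c' = Skip)"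
      if st: "(cstep x)\<^sup>*\<^sup>* (c, start) (c', h, w) \<and> stuck c'" for c' h w
    proof -
      from st conv have "c' \<in> detsub c" "(mstep sel \<delta> x)\<^sup>*\<^sup>* (c, start) (c', h, w)" by auto
      with M4[OF this(2)] halt st show ?thesis by auto
    qed
  qed (use M M3 in auto)
qed

lemma bounded_start: "bounded x start"
  by (simp add: bounded_def)

lemma computable_by_program:
  fixes c :: "'s com"
  assumes "det c" "\<And>i. i \<in> I \<Longrightarrow> \<exists>h r. exec (enc i) c start (h, enc' r) \<and> R i r"
  shows "computable_in_space log_space enc enc' I R"
proof -
  from program_machine[of c] obtain M :: "('s, 's) tm" where M: "wf_tm M" "deterministic M"
    "\<And>x. within_space M x (counter_space (length x))"
    "\<And>x c' h w. (cstep x)\<^sup>*\<^sup>* (c, start) (c', h, w) \<and> stuck c' \<Longrightarrow>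
       (\<exists>cf. reachable M x cf \<and> halting M x cf \<and> cf_output cf = w \<and> (cf_state cf \<in> tm_accept M \<longleftrightarrow> c' = Skip))"
    using assms(1) by blast
  show ?thesis unfolding computable_in_space_def
  proof (intro exI[of _ M] exI[of _ counter_space] conjI ballI)
    fix i assume "i \<in> I"
    from assms(2)[OF this] obtain h r where r: "exec (enc i) c start (h, enc' r)" "R i r" by blast
    from M(4) exec_csteps[OF r(1) bounded_start]
    show "\<exists>cf. reachable M (enc i) cf \<and> halting M (enc i) cf \<and> (\<exists>r. cf_output cf = enc' r \<and> R i r)"
      using r(2) by fastforce
  qed (use M counter_space_bigo in auto)
qed

lemma decidable_by_program:
  fixes c :: "'s com"
  assumes "det c"
    "\<And>i. i \<in> I \<Longrightarrow> \<exists>h w. exec (enc i) c start (h, w) \<and> (h j = (0 :: nat) \<longleftrightarrow> P i)"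
  shows "decidable_in_space log_space enc I P"
proof -
  \<comment> \<open>The program leaves its answer as a head position, \<open>0\<close> meaning yes.
    The test appended here turns this into the difference between halting at \<open>Skip\<close> and
    halting at \<open>Fail\<close>.\<close>
  let ?if = "If j {LeftEnd} Skip Fail"
  have "det (c ;; ?if)" using assms(1) by simp
  from program_machine[of "c ;; ?if"] obtain M :: "('s, 's) tm" where M: "wf_tm M" "deterministic M"
    "\<And>x. within_space M x (counter_space (length x))"
    "\<And>x c' h w. (cstep x)\<^sup>*\<^sup>* (c ;; ?if, start) (c', h, w) \<and> stuck c' \<Longrightarrow>
       (\<exists>cf. reachable M x cf \<and> halting M x cf \<and> cf_output cf = w \<and> (cf_state cf \<in> tm_accept M \<longleftrightarrow> c' = Skip))"
    using \<open>det (c ;; ?if)\<close> by blast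
  show ?thesis unfolding decidable_in_space_def
  proof (intro exI[of _ M] exI[of _ counter_space] conjI ballI)
    fix i assume "i \<in> I"
    from assms(2)[OF this] obtain h w where r: "exec (enc i) c start (h, w)" "h j = 0 \<longleftrightarrow> P i" by metis
    define e where "e = (if P i then Skip else Fail :: 's com)"
    have b: "bounded (enc i) (h, w)" using exec_bounded[OF r(1) bounded_start] .
    have "(cstep (enc i))\<^sup>*\<^sup>* (c ;; ?if, start) (Skip ;; ?if, h, w)"
      using csteps_Seq exec_csteps[OF r(1) bounded_start] by blast
    also have "cstep (enc i) (Skip ;; ?if, h, w) (?if, h, w)" by (rule cstep_quiet[OF b]) simp
    also have "cstep (enc i) (?if, h, w) (e, h, w)"
      by (rule cstep_quiet[OF b]) (use r(2) in \<open>auto simp: e_def scan_def\<close>)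
    finally have "(cstep (enc i))\<^sup>*\<^sup>* (c ;; ?if, start) (e, h, w)" .
    moreover have "stuck e" "e = Skip \<longleftrightarrow> P i" by (auto simp: e_def)
    ultimately show "\<exists>cf. reachable M (enc i) cf \<and> halting M (enc i) cf \<and> (cf_state cf \<in> tm_accept M) = P i"
      using M(4)[of "enc i" e h w] by auto
  qed (use M counter_space_bigo in auto)
qed

lemma nondet_decidable_by_program:
  fixes c :: "'s com"
  assumes "\<And>i. i \<in> I \<Longrightarrow> (\<exists>t. exec (enc i) c start t) \<longleftrightarrow> P i"
  shows "nondet_decidable_in_space log_space enc I P"
proof -
  from program_machine[of c] obtain M :: "('s, 's) tm" where M: "wf_tm M"
    "\<And>x. within_space M x (counter_space (length x))"
    "\<And>x c' h w. (cstep x)\<^sup>*\<^sup>* (c, start) (c', h, w) \<and> stuck c' \<Longrightarrow>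
       (\<exists>cf. reachable M x cf \<and> halting M x cf \<and> cf_output cf = w \<and> (cf_state cf \<in> tm_accept M \<longleftrightarrow> c' = Skip))"
    "\<And>x cf. reachable M x cf \<and> halting M x cf \<and> cf_state cf \<in> tm_accept M \<Longrightarrow> (\<exists>t. exec x c start t)"
    by blast
  show ?thesis unfolding nondet_decidable_in_space_def
  proof (intro exI[of _ M] exI[of _ counter_space] conjI ballI)
    fix i assume i: "i \<in> I"
    have "\<exists>cf. reachable M (enc i) cf \<and> halting M (enc i) cf \<and> cf_state cf \<in> tm_accept M"
      if "exec (enc i) c start t" for t
      using M(3)[of "enc i" Skip "fst t" "snd t"] exec_csteps[OF that bounded_start] by auto
    then show "(\<exists>cf. reachable M (enc i) cf \<and> halting M (enc i) cf \<and> cf_state cf \<in> tm_accept M) \<longleftrightarrow> P i"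
      using assms[OF i] M(4) by blast
  qed (use M counter_space_bigo in auto)
qed

section \<open>Macros\<close>

text \<open>The loop rule behind most macros. The family \<open>f\<close> lists the intermediate
  states by the number of rounds still to go, so a loop is verified by giving this family and
  checking one round.\<close>

lemma exec_countdown:
  assumes "\<And>k. k < n \<Longrightarrow> exec x c (f (Suc k)) (f k)"
    and "\<And>k. k \<le> n \<Longrightarrow> scan x (fst (f k) j) \<in> T \<longleftrightarrow> 0 < k"
  shows "exec x (While j T c) (f n) (f 0)"
  using assms
proof (induction n)
  case 0
  then show ?case by (auto intro: exec.WhileFalse)
next
  case (Suc n)
  show ?case
    by (rule exec.WhileTrue[where ?s2.0 = "f n"]) (use Suc in auto)
qed

lemma scan_LeftEnd [simp]: "scan x p = LeftEnd \<longleftrightarrow> p = 0"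
  by (simp add: scan_def)

lemma exec_MoveRight: "h j \<le> length x \<Longrightarrow> v = Suc (h j) \<Longrightarrow> exec x (Move j MoveRight) (h, w) (h(j := v), w)"
  using exec.Move[of x j MoveRight h w] by simp

lemma exec_MoveLeft: "h j \<le> Suc (length x) \<Longrightarrow> v = h j - 1 \<Longrightarrow> exec x (Move j MoveLeft) (h, w) (h(j := v), w)"
  using exec.Move[of x j MoveLeft h w] by (simp add: min_absorb2)

lemma exec_target: "exec x c s t \<Longrightarrow> t = t' \<Longrightarrow> exec x c s t'"
  by simp

abbreviation nonzero :: "'s cell set" where
  "nonzero \<equiv> - {LeftEnd}"

definition reset :: "head \<Rightarrow> 's com" where
  "reset j = While j nonzero (Move j MoveLeft)"

lemma det_reset [simp]: "det (reset j)"
  by (simp add: reset_def)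

lemma exec_reset: "h j \<le> Suc (length x) \<Longrightarrow> exec x (reset j) (h, w) (h(j := 0), w)"
  using exec_countdown[of "h j" x "Move j MoveLeft" "\<lambda>k. (h(j := k), w)" j nonzero]
    exec_MoveLeft[of "h(j := Suc _)" j x _ w]
  by (simp add: reset_def)

definition set1 :: "head \<Rightarrow> 's com" where
  "set1 j = (reset j ;; Move j MoveRight)"

lemma det_set1 [simp]: "det (set1 j)"
  by (simp add: set1_def)

lemma exec_set1: "h j \<le> Suc (length x) \<Longrightarrow> exec x (set1 j) (h, w) (h(j := 1), w)"
  using exec.Seq[OF exec_reset[of h j x w] exec_MoveRight[of "h(j := 0)" j x 1 w]]
  by (simp add: set1_def)

definition drain :: "head \<Rightarrow> head \<Rightarrow> 's com" where
  "drain a b = While a nonzero (Move a MoveLeft ;; Move b MoveRight)"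

lemma det_drain [simp]: "det (drain a b)"
  by (simp add: drain_def)

lemma exec_drain:
  assumes "a \<noteq> b" "h b = 0" "h a \<le> Suc (length x)"
  shows "exec x (drain a b) (h, w) (h(a := 0, b := h a), w)"
proof -
  let ?f = "\<lambda>k. (h(a := k, b := h a - k), w)"
  have "exec x (Move a MoveLeft ;; Move b MoveRight) (?f (Suc k)) (?f k)" if "k < h a" for k
  proof (rule exec.Seq)
    show "exec x (Move a MoveLeft) (?f (Suc k)) (h(a := k, b := h a - Suc k), w)"
      by (rule exec_target[OF exec_MoveLeft]) (use assms that in auto)
    show "exec x (Move b MoveRight) (h(a := k, b := h a - Suc k), w) (?f k)"
      by (rule exec_target[OF exec_MoveRight]) (use assms that in auto)
  qed
  then have "exec x (drain a b) (?f (h a)) (?f 0)"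
    unfolding drain_def by (rule exec_countdown) (use assms in auto)
  moreover have "h(a := h a, b := h a - h a) = h" using assms by auto
  ultimately show ?thesis by simp
qed

definition drain2 :: "head \<Rightarrow> head \<Rightarrow> head \<Rightarrow> 's com" where
  "drain2 a b c = While a nonzero (Move a MoveLeft ;; Move b MoveRight ;; Move c MoveRight)"

lemma det_drain2 [simp]: "det (drain2 a b c)"
  by (simp add: drain2_def)

lemma exec_drain2:
  assumes "distinct [a, b, c]" "h b = 0" "h c = 0" "h a \<le> Suc (length x)"
  shows "exec x (drain2 a b c) (h, w) (h(a := 0, b := h a, c := h a), w)"
proof -
  let ?f = "\<lambda>k. (h(a := k, b := h a - k, c := h a - k), w)"
  have "exec x (Move a MoveLeft ;; Move b MoveRight ;; Move c MoveRight) (?f (Suc k)) (?f k)" if "k < h a" for k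
  proof (intro exec.Seq)
    show "exec x (Move a MoveLeft) (?f (Suc k)) (h(a := k, b := h a - Suc k, c := h a - Suc k), w)"
      by (rule exec_target[OF exec_MoveLeft]) (use assms that in auto)
    show "exec x (Move b MoveRight) (h(a := k, b := h a - Suc k, c := h a - Suc k), w)
      (h(a := k, b := h a - k, c := h a - Suc k), w)"
      by (rule exec_target[OF exec_MoveRight]) (use assms that in \<open>auto simp: fun_eq_iff\<close>)
    show "exec x (Move c MoveRight) (h(a := k, b := h a - k, c := h a - Suc k), w) (?f k)"
      by (rule exec_target[OF exec_MoveRight]) (use assms that in \<open>auto simp: fun_eq_iff\<close>)
  qed
  then have "exec x (drain2 a b c) (?f (h a)) (?f 0)"
    unfolding drain2_def by (rule exec_countdown) (use assms in auto)
  moreover have "h(a := h a, b := h a - h a, c := h a - h a) = h" using assms by auto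
  ultimately show ?thesis by simp
qed

text \<open>
  Between macros the scratch heads \<open>Sc i\<close> are at the left end; \<open>Sc 0\<close> serves as a pointer
  into the input.
\<close>

definition ok :: "'s list \<Rightarrow> (head \<Rightarrow> nat) \<Rightarrow> bool" where
  "ok x h \<longleftrightarrow> (\<forall>j. h j \<le> Suc (length x)) \<and> (\<forall>i. h (Sc i) = 0)"

lemma ok_upd: "ok x h \<Longrightarrow> is_Rg a \<Longrightarrow> v \<le> Suc (length x) \<Longrightarrow> ok x (h(a := v))"
  by (cases a) (auto simp: ok_def)

lemma is_Rg_neq [simp]: "is_Rg a \<Longrightarrow> a \<noteq> Sc i" "is_Rg a \<Longrightarrow> Sc i \<noteq> a"
  by auto

text \<open>No head can see another one, so a position can be transferred only by running the source
  down to the left end. It is drained into the target and a scratch head at the same time, and then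
  restored from the scratch head.\<close>

definition copy :: "head \<Rightarrow> head \<Rightarrow> 's com" where
  "copy a b = (reset b ;; drain2 a (Sc 3) b ;; drain (Sc 3) a)"

lemma det_copy [simp]: "det (copy a b)"
  by (simp add: copy_def)

lemma exec_copy:
  assumes "h (Sc 3) = 0" "\<And>j. h j \<le> Suc (length x)" "a \<noteq> b" "a \<noteq> Sc 3" "b \<noteq> Sc 3"
  shows "exec x (copy a b) (h, w) (h(b := h a), w)"
  unfolding copy_def
proof (intro exec.Seq)
  show "exec x (reset b) (h, w) (h(b := 0), w)" by (rule exec_reset) (rule assms)
  show "exec x (drain2 a (Sc 3) b) (h(b := 0), w) (h(b := h a, a := 0, Sc 3 := h a), w)"
    by (rule exec_target[OF exec_drain2]) (use assms in \<open>auto simp: fun_eq_iff\<close>)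
  show "exec x (drain (Sc 3) a) (h(b := h a, a := 0, Sc 3 := h a), w) (h(b := h a), w)"
    by (rule exec_target[OF exec_drain]) (use assms in \<open>auto simp: fun_eq_iff\<close>)
qed

text \<open>The flag \<open>f\<close> is raised on a difference and otherwise left alone, so that
  consecutive comparisons with the same flag compute the disjunction of the differences.\<close>

definition neq :: "head \<Rightarrow> head \<Rightarrow> head \<Rightarrow> 's com" where
  "neq a b f = (copy a (Sc 1) ;; copy b (Sc 2) ;;
     While (Sc 1) nonzero (Move (Sc 1) MoveLeft ;; If (Sc 2) nonzero (Move (Sc 2) MoveLeft) (set1 f)) ;;
     If (Sc 2) nonzero (reset (Sc 2) ;; set1 f) Skip)"

lemma det_neq [simp]: "det (neq a b f)"
  by (simp add: neq_def)

lemma exec_neq: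
  assumes "ok x h" "is_Rg a" "is_Rg b" "is_Rg f"
  shows "exec x (neq a b f) (h, w) (h(f := if h a = h b then h f else 1), w)"
  unfolding neq_def
proof (intro exec.Seq)
  have bd: "h j \<le> Suc (length x)" "h (Sc i) = 0" for i j using assms(1) by (auto simp: ok_def)
  note n = assms(2-4)[THEN is_Rg_neq(1)] assms(2-4)[THEN is_Rg_neq(2)]
  show "exec x (copy a (Sc 1)) (h, w) (h(Sc 1 := h a), w)"
    by (rule exec_target[OF exec_copy]) (use bd n in auto)
  show "exec x (copy b (Sc 2)) (h(Sc 1 := h a), w) (h(Sc 1 := h a, Sc 2 := h b), w)"
    by (rule exec_target[OF exec_copy]) (use bd n in auto)
  \<comment> \<open>With \<open>k\<close> rounds to go, \<open>h a - k\<close> rounds are over. By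
    truncated subtraction the second scratch head stays at \<open>0\<close> once \<open>h b\<close>
    is exhausted, and from the next round on the flag is raised.\<close>
  let ?f = "\<lambda>k. (h(f := if h a - k > h b then 1 else h f, Sc 1 := k, Sc 2 := h b - (h a - k)), w)"
  have "exec x (Move (Sc 1) MoveLeft ;; If (Sc 2) nonzero (Move (Sc 2) MoveLeft) (set1 f)) (?f (Suc k)) (?f k)"
    if "k < h a" for k
  proof (rule exec.Seq)
    show "exec x (Move (Sc 1) MoveLeft) (?f (Suc k))
      (h(f := if h a - Suc k > h b then 1 else h f, Sc 1 := k, Sc 2 := h b - (h a - Suc k)), w)"
      by (rule exec_target[OF exec_MoveLeft]) (use bd(1)[of a] n that in \<open>auto simp: fun_eq_iff\<close>)
    show "exec x (If (Sc 2) nonzero (Move (Sc 2) MoveLeft) (set1 f))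
      (h(f := if h a - Suc k > h b then 1 else h f, Sc 1 := k, Sc 2 := h b - (h a - Suc k)), w) (?f k)"
    proof (cases "h b - (h a - Suc k) = 0")
      case True
      then show ?thesis
        by (intro exec.IfFalse exec_target[OF exec_set1]) (use bd n that in \<open>auto simp: fun_eq_iff\<close>)
    next
      case False
      then show ?thesis
        by (intro exec.IfTrue exec_target[OF exec_MoveLeft])
          (use bd(1)[of b] n that in \<open>auto simp: fun_eq_iff\<close>)
    qed
  qed
  then have "exec x (While (Sc 1) nonzero (Move (Sc 1) MoveLeft ;;
      If (Sc 2) nonzero (Move (Sc 2) MoveLeft) (set1 f))) (?f (h a)) (?f 0)"
    by (rule exec_countdown) (use n in auto)
  then show "exec x (While (Sc 1) nonzero (Move (Sc 1) MoveLeft ;;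
      If (Sc 2) nonzero (Move (Sc 2) MoveLeft) (set1 f))) (h(Sc 1 := h a, Sc 2 := h b), w) (?f 0)"
    by simp
  show "exec x (If (Sc 2) nonzero (reset (Sc 2) ;; set1 f) Skip) (?f 0)
     (h(f := if h a = h b then h f else 1), w)"
  proof (cases "h b - h a = 0")
    case True
    then show ?thesis
      by (intro exec.IfFalse exec_target[OF exec.Skip]) (use bd n in \<open>auto simp: fun_eq_iff\<close>)
  next
    case False
    then show ?thesis
      by (intro exec.IfTrue exec_target[OF exec.Seq[OF exec_reset exec_set1]])
        (use bd n in \<open>auto simp: fun_eq_iff intro: le_trans[OF diff_le_self]\<close>)
  qed
qed

subsection \<open>Reading encoded automata\<close>

text \<open>The head position at which the rest of the input is \<open>ys\<close>.\<close>

definition pos :: "'s list \<Rightarrow> 's list \<Rightarrow> nat" where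
  "pos x ys = Suc (length x) - length ys"

lemma pos_self: "pos x x = 1"
  by (simp add: pos_def)

lemma pos_le [simp]: "pos x ys \<le> Suc (length x)"
  by (simp add: pos_def)

lemma suffix_ConsD2: "suffix (c # ys) x \<Longrightarrow> suffix ys x"
  by (metis suffix_ConsD suffix_order.trans suffix_order.eq_refl)

lemma suffix_appD2: "suffix (zs @ ys) x \<Longrightarrow> suffix ys x"
  by (metis suffix_appendD)

lemma pos_Cons:
  assumes "suffix (c # ys) x"
  shows "scan x (pos x (c # ys)) = Sym c" "pos x ys = Suc (pos x (c # ys))" "pos x (c # ys) \<le> length x"
    "pos x (c # ys) > 0"
proof -
  obtain zs where x: "x = zs @ c # ys" using assms by (auto simp: suffix_def)
  show "scan x (pos x (c # ys)) = Sym c" "pos x ys = Suc (pos x (c # ys))" "pos x (c # ys) \<le> length x"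
    "pos x (c # ys) > 0"
    by (auto simp: x pos_def scan_def)
qed

lemma pos_Nil: "scan x (pos x []) = RightEnd"
  by (simp add: pos_def scan_def)

abbreviation P :: head where "P \<equiv> Sc 0"

lemma exec_next:
  "suffix (c # ys) x \<Longrightarrow> exec x (Move P MoveRight) (h(P := pos x (c # ys)), w) (h(P := pos x ys), w)"
  by (rule exec_target[OF exec_MoveRight]) (auto simp: pos_Cons)

definition scanwhile :: "'s set \<Rightarrow> 's com" where
  "scanwhile S = While P (Sym ` S) (Move P MoveRight)"

lemma det_scanwhile [simp]: "det (scanwhile S)"
  by (simp add: scanwhile_def)

lemma exec_scanwhile:
  assumes "suffix (zs @ ys) x" "set zs \<subseteq> S" "ys = [] \<or> List.hd ys \<notin> S"
  shows "exec x (scanwhile S) (h(P := pos x (zs @ ys)), w) (h(P := pos x ys), w)"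
  using assms
proof (induction zs)
  case Nil
  have "scan x (pos x ys) \<notin> Sym ` S"
    using Nil by (cases ys) (auto simp: pos_Nil pos_Cons(1))
  then show ?case by (auto simp: scanwhile_def intro: exec.WhileFalse)
next
  case (Cons z zs)
  have s: "suffix (z # zs @ ys) x" using Cons.prems by simp
  have "exec x (scanwhile S) (h(P := pos x (zs @ ys)), w) (h(P := pos x ys), w)"
    by (rule Cons.IH) (use Cons.prems suffix_ConsD2[OF s] in auto)
  moreover have "scan x (fst (h(P := pos x (z # zs @ ys)), w) P) \<in> Sym ` S"
    using Cons.prems by (simp add: pos_Cons(1)[OF s])
  ultimately show ?case
    unfolding scanwhile_def append_Cons using exec.WhileTrue[OF _ exec_next[OF s]] by blast
qed

definition skipnat :: "'a symbol com" where
  "skipnat = (scanwhile {Tick} ;; Move P MoveRight)"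

lemma det_skipnat [simp]: "det skipnat"
  by (simp add: skipnat_def)

lemma exec_skipnat:
  assumes "suffix (enc_nat m @ ys) x"
  shows "exec x skipnat (h(P := pos x (enc_nat m @ ys)), w) (h(P := pos x ys), w)"
proof -
  have s: "suffix (replicate m Tick @ Stop # ys) x" using assms by (simp add: enc_nat_def)
  then have "suffix (Stop # ys) x" by (rule suffix_appD2)
  have "enc_nat m @ ys = replicate m Tick @ Stop # ys" by (simp add: enc_nat_def)
  moreover have "exec x (scanwhile {Tick}) (h(P := pos x (replicate m Tick @ Stop # ys)), w)
      (h(P := pos x (Stop # ys)), w)"
    by (rule exec_scanwhile[OF s]) auto
  ultimately show ?thesis
    using exec_next[OF \<open>suffix (Stop # ys) x\<close>] unfolding skipnat_def by (metis exec.Seq)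
qed

fun skipnats :: "nat \<Rightarrow> 'a symbol com" where
  "skipnats 0 = Skip"
| "skipnats (Suc k) = (skipnat ;; skipnats k)"

lemma det_skipnats [simp]: "det (skipnats k)"
  by (induction k) auto

lemma exec_skipnats:
  "suffix (concat (map enc_nat ns) @ ys) x \<Longrightarrow>
   exec x (skipnats (length ns)) (h(P := pos x (concat (map enc_nat ns) @ ys)), w) (h(P := pos x ys), w)"
proof (induction ns)
  case (Cons n ns)
  then have s: "suffix (enc_nat n @ concat (map enc_nat ns) @ ys) x" by simp
  have eq: "concat (map enc_nat (n # ns)) @ ys = enc_nat n @ concat (map enc_nat ns) @ ys" by simp
  show ?case unfolding list.size add_0_right add_Suc_right skipnats.simps eq
    by (rule exec.Seq[OF exec_skipnat[OF s] Cons.IH[OF suffix_appD2[OF s]]])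
qed (simp add: exec.Skip)

definition readnat :: "head \<Rightarrow> 'a symbol com" where
  "readnat r = (While P {Sym Tick} (Move P MoveRight ;; Move r MoveRight) ;; Move P MoveRight)"

lemma det_readnat [simp]: "det (readnat r)"
  by (simp add: readnat_def)

lemma exec_readnat:
  assumes "suffix (enc_nat m @ ys) x" "r \<noteq> P" "h r = 0"
  shows "exec x (readnat r) (h(P := pos x (enc_nat m @ ys)), w) (h(P := pos x ys, r := m), w)"
proof -
  let ?rest = "\<lambda>k. replicate k Tick @ Stop # ys"
  have m: "m \<le> length x" using suffix_length_le[OF assms(1)] by (simp add: enc_nat_def)
  let ?f = "\<lambda>k. (h(P := pos x (?rest k), r := m - k), w)"
  have suf: "suffix (?rest k) x" if "k \<le> m" for k
  proof -
    have "enc_nat m @ ys = replicate (m - k) Tick @ ?rest k"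
      using that by (simp add: enc_nat_def flip: append_assoc replicate_add)
    then show ?thesis using assms(1) by (metis suffix_appD2)
  qed
  have "exec x (Move P MoveRight ;; Move r MoveRight) (?f (Suc k)) (?f k)" if "k < m" for k
  proof (rule exec.Seq)
    have s: "suffix (Tick # ?rest k) x" using suf[of "Suc k"] that by simp
    show "exec x (Move P MoveRight) (?f (Suc k)) (h(P := pos x (?rest k), r := m - Suc k), w)"
      by (rule exec_target[OF exec_MoveRight]) (use assms pos_Cons[OF s] that in auto)
    show "exec x (Move r MoveRight) (h(P := pos x (?rest k), r := m - Suc k), w) (?f k)"
      by (rule exec_target[OF exec_MoveRight]) (use assms m that in auto)
  qed
  moreover have "scan x (fst (?f k) P) \<in> {Sym Tick} \<longleftrightarrow> 0 < k" if "k \<le> m" for k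
    using pos_Cons(1)[of _ _ x] suf[OF that] assms(2) by (cases k) auto
  ultimately have "exec x (While P {Sym Tick} (Move P MoveRight ;; Move r MoveRight)) (?f m) (?f 0)"
    by (rule exec_countdown)
  moreover have "exec x (Move P MoveRight) (?f 0) (h(P := pos x ys, r := m), w)"
    using suf[of 0] assms(2)
    by (intro exec_target[OF exec_MoveRight]) (auto simp: pos_Cons)
  moreover have "?f m = (h(P := pos x (enc_nat m @ ys)), w)"
    using assms by (auto simp: enc_nat_def fun_eq_iff)
  ultimately show ?thesis unfolding readnat_def by (metis exec.Seq)
qed

definition row :: "'a list \<Rightarrow> ('a, 'z) aut_scheme \<Rightarrow> nat \<Rightarrow> 'a symbol list" where
  "row \<sigma> A q = concat (map enc_nat (map (delta A q) \<sigma>))"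

definition rows :: "'a list \<Rightarrow> ('a, 'z) aut_scheme \<Rightarrow> nat \<Rightarrow> 'a symbol list" where
  "rows \<sigma> A i = concat (map (row \<sigma> A) [i..<nstates A])"

lemma rows_Cons: "i < nstates A \<Longrightarrow> rows \<sigma> A i = row \<sigma> A i @ rows \<sigma> A (Suc i)"
  by (simp add: rows_def upt_conv_Cons)

lemma rows_end: "rows \<sigma> A (nstates A) = []"
  by (simp add: rows_def)

lemma enc_aut_rows: "enc_aut \<sigma> A = enc_nat (nstates A) @ enc_nat (initial A) @ rows \<sigma> A 0"
proof -
  have "row \<sigma> A q = concat (map (\<lambda>a. enc_nat (delta A q a)) \<sigma>)" for q
    by (simp add: row_def comp_def)
  then have "row \<sigma> A = (\<lambda>q. concat (map (\<lambda>a. enc_nat (delta A q a)) \<sigma>))" by blast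
  then show ?thesis by (simp only: enc_aut_def rows_def)
qed

definition flags :: "'a dfa \<Rightarrow> 'a symbol list" where
  "flags D = map (\<lambda>q. if q \<in> final D then Accepting else Rejecting) [0..<nstates D]"

abbreviation flag_symbols :: "'a symbol set" where
  "flag_symbols \<equiv> {Accepting, Rejecting}"

lemma enc_dfa_flags: "enc_dfa \<sigma> D = enc_aut \<sigma> D @ flags D"
  by (simp add: enc_dfa_def flags_def)

definition dfas :: "'a list \<Rightarrow> 'a fdfa \<Rightarrow> nat \<Rightarrow> 'a symbol list" where
  "dfas \<sigma> F i = concat (map (\<lambda>q. enc_dfa \<sigma> (progress F q)) [i..<nstates (leading F)])"

lemma dfas_Cons: "i < nstates (leading F) \<Longrightarrow> dfas \<sigma> F i = enc_dfa \<sigma> (progress F i) @ dfas \<sigma> F (Suc i)"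
  by (simp add: dfas_def upt_conv_Cons)

lemma enc_fdfa_dfas: "enc_fdfa \<sigma> F = enc_aut \<sigma> (leading F) @ dfas \<sigma> F 0"
  by (simp add: enc_fdfa_def dfas_def)

lemma set_enc_nat: "set (enc_nat m) \<subseteq> {Tick, Stop}"
  by (auto simp: enc_nat_def)

lemma set_enc_aut: "set (enc_aut \<sigma> A) \<subseteq> {Tick, Stop}"
  using set_enc_nat by (fastforce simp: enc_aut_def)

lemma set_flags: "set (flags D) \<subseteq> flag_symbols"
  by (auto simp: flags_def)

lemma set_enc_dfa: "set (enc_dfa \<sigma> D) \<subseteq> {Tick, Stop, Accepting, Rejecting}"
  using set_enc_aut[of \<sigma> D] set_flags[of D] by (auto simp: enc_dfa_flags)

lemma set_enc_fdfa: "set (enc_fdfa \<sigma> F) \<subseteq> {Tick, Stop, Accepting, Rejecting}"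
  using set_enc_aut[of \<sigma> "leading F"] set_enc_dfa by (fastforce simp: enc_fdfa_def)

lemma nstates_le: "suffix (enc_aut \<sigma> A @ ys) x \<Longrightarrow> nstates A \<le> length x"
  using suffix_length_le[of "enc_aut \<sigma> A @ ys" x] by (simp add: enc_aut_def enc_nat_def)

definition skiprows :: "nat \<Rightarrow> 'a symbol com" where
  "skiprows k = While (Sc 1) nonzero (Move (Sc 1) MoveLeft ;; skipnats k)"

lemma det_skiprows [simp]: "det (skiprows k)"
  by (simp add: skiprows_def)

lemma exec_skiprows:
  assumes "suffix (rows \<sigma> A i @ ys) x" "i + m \<le> nstates A" "m \<le> Suc (length x)"
  shows "exec x (skiprows (length \<sigma>)) (h(P := pos x (rows \<sigma> A i @ ys), Sc 1 := m), w)
    (h(P := pos x (rows \<sigma> A (i + m) @ ys), Sc 1 := 0), w)"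
proof -
  let ?rest = "\<lambda>k. rows \<sigma> A (i + (m - k)) @ ys"
  let ?f = "\<lambda>k. (h(P := pos x (?rest k), Sc 1 := k), w)"
  have suf: "suffix (rows \<sigma> A (i + j) @ ys) x" if "j \<le> m" for j
    using that
  proof (induction j)
    case (Suc j)
    then have "rows \<sigma> A (i + j) = row \<sigma> A (i + j) @ rows \<sigma> A (i + Suc j)"
      using rows_Cons assms(2) by (metis add_Suc_right add_less_cancel_left le_trans less_eq_Suc_le)
    with Suc show ?case by (metis Suc_leD append_assoc suffix_appD2)
  qed (use assms in simp)
  have "exec x (Move (Sc 1) MoveLeft ;; skipnats (length \<sigma>)) (?f (Suc k)) (?f k)" if "k < m" for k
  proof (rule exec.Seq)
    let ?h = "h(Sc 1 := k)"
    have eq: "?rest (Suc k) = concat (map enc_nat (map (delta A (i + (m - Suc k))) \<sigma>)) @ ?rest k"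
      using rows_Cons[of "i + (m - Suc k)" A \<sigma>] that assms(2) by (simp add: row_def Suc_diff_Suc)
    show "exec x (Move (Sc 1) MoveLeft) (?f (Suc k)) (?h(P := pos x (?rest (Suc k))), w)"
      by (rule exec_target[OF exec_MoveLeft]) (use assms that in \<open>auto simp: fun_eq_iff\<close>)
    have "exec x (skipnats (length (map (delta A (i + (m - Suc k))) \<sigma>)))
      (?h(P := pos x (?rest (Suc k))), w) (?h(P := pos x (?rest k)), w)"
      using suf[of "m - Suc k"] unfolding eq by (rule exec_skipnats[rotated]) simp
    then show "exec x (skipnats (length \<sigma>)) (?h(P := pos x (?rest (Suc k))), w) (?f k)"
      by (simp add: fun_upd_twist)
  qed
  then have "exec x (skiprows (length \<sigma>)) (?f m) (?f 0)"
    unfolding skiprows_def by (rule exec_countdown) auto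
  then show ?thesis by simp
qed

definition skip_aut :: "nat \<Rightarrow> 'a symbol com" where
  "skip_aut k = (readnat (Sc 1) ;; skipnat ;; skiprows k)"

lemma det_skip_aut [simp]: "det (skip_aut k)"
  by (simp add: skip_aut_def)

lemma exec_skip_aut:
  assumes "suffix (enc_aut \<sigma> A @ ys) x" "h (Sc 1) = 0"
  shows "exec x (skip_aut (length \<sigma>)) (h(P := pos x (enc_aut \<sigma> A @ ys)), w) (h(P := pos x ys), w)"
  unfolding skip_aut_def
proof (intro exec.Seq)
  let ?r1 = "enc_nat (initial A) @ rows \<sigma> A 0 @ ys" and ?r2 = "rows \<sigma> A 0 @ ys"
  have s1: "suffix (enc_nat (nstates A) @ ?r1) x" using assms(1) by (simp add: enc_aut_rows)
  note s2 = suffix_appD2[OF s1] and s3 = suffix_appD2[OF suffix_appD2[OF s1]]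
  show "exec x (readnat (Sc 1)) (h(P := pos x (enc_aut \<sigma> A @ ys)), w) (h(P := pos x ?r1, Sc 1 := nstates A), w)"
    using exec_readnat[OF s1, of "Sc 1" h w] assms by (simp add: enc_aut_rows)
  have "exec x skipnat ((h(Sc 1 := nstates A))(P := pos x ?r1), w) ((h(Sc 1 := nstates A))(P := pos x ?r2), w)"
    by (rule exec_skipnat[OF s2])
  then show "exec x skipnat (h(P := pos x ?r1, Sc 1 := nstates A), w) (h(P := pos x ?r2, Sc 1 := nstates A), w)"
    by (simp add: fun_upd_twist)
  have "exec x (skiprows (length \<sigma>)) (h(P := pos x ?r2, Sc 1 := nstates A), w)
      (h(P := pos x (rows \<sigma> A (0 + nstates A) @ ys), Sc 1 := 0), w)"
    by (rule exec_skiprows) (use s3 nstates_le[OF assms(1)] in auto)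
  then show "exec x (skiprows (length \<sigma>)) (h(P := pos x ?r2, Sc 1 := nstates A), w) (h(P := pos x ys), w)"
    by (rule exec_target) (use assms in \<open>auto simp: rows_end fun_eq_iff\<close>)
qed

text \<open>Flags occur only at the end of an encoded DFA. So a DFA can be skipped without counting
  its rows, provided that it has a state and that what follows does not start with another flag, as
  \<open>flagless\<close> says.\<close>

definition skip_dfa :: "'a symbol com" where
  "skip_dfa = (scanwhile (- flag_symbols) ;; scanwhile flag_symbols)"

lemma det_skip_dfa [simp]: "det skip_dfa"
  by (simp add: skip_dfa_def)

definition flagless :: "'a symbol list \<Rightarrow> bool" where
  "flagless ys \<longleftrightarrow> ys = [] \<or> List.hd ys \<notin> flag_symbols"

lemma wf_dfa_flags: "wf_dfa D \<Longrightarrow> flags D \<noteq> [] \<and> List.hd (flags D) \<in> flag_symbols"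
  by (auto simp: flags_def wf_dfa_def wf_aut_def upt_conv_Cons)

lemma exec_to_flags:
  assumes "suffix (enc_dfa \<sigma> D @ ys) x" "wf_dfa D"
  shows "exec x (scanwhile (- flag_symbols)) (h(P := pos x (enc_dfa \<sigma> D @ ys)), w) (h(P := pos x (flags D @ ys)), w)"
proof -
  have "suffix (enc_aut \<sigma> D @ flags D @ ys) x" using assms by (simp add: enc_dfa_flags)
  from exec_scanwhile[OF this, of "- flag_symbols" h w] show ?thesis
    using set_enc_aut[of \<sigma> D] wf_dfa_flags[OF assms(2)] by (force simp: enc_dfa_flags)
qed

lemma exec_skip_dfa:
  assumes "suffix (enc_dfa \<sigma> D @ ys) x" "wf_dfa D" "flagless ys"
  shows "exec x skip_dfa (h(P := pos x (enc_dfa \<sigma> D @ ys)), w) (h(P := pos x ys), w)"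
  unfolding skip_dfa_def
proof (rule exec.Seq)
  show "exec x (scanwhile (- flag_symbols)) (h(P := pos x (enc_dfa \<sigma> D @ ys)), w) (h(P := pos x (flags D @ ys)), w)"
    by (rule exec_to_flags[OF assms(1,2)])
  show "exec x (scanwhile flag_symbols) (h(P := pos x (flags D @ ys)), w) (h(P := pos x ys), w)"
    by (rule exec_scanwhile) (use assms set_flags[of D] in \<open>auto simp: enc_dfa_flags flagless_def dest: suffix_appD2\<close>)
qed

lemma flagless_enc_aut: "flagless (enc_aut \<sigma> A @ ys)"
  by (cases "nstates A") (auto simp: flagless_def enc_aut_def enc_nat_def)

lemma flagless_dfas: "flagless ys \<Longrightarrow> flagless (dfas \<sigma> F i @ ys)"
  using dfas_Cons[of i F \<sigma>] flagless_enc_aut[of \<sigma> "progress F i"]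
  by (cases "i < nstates (leading F)") (auto simp: dfas_def enc_dfa_flags)

text \<open>Macros that read an automaton take as parameter a command \<open>go\<close> that brings
  the pointer to its encoding. The same macros then serve for leading automata and progress DFAs of
  either input. As \<open>go\<close> may depend on registers, the property is stated for the current
  positions \<open>h\<close>.\<close>

definition locates :: "'a list \<Rightarrow> 'a symbol list \<Rightarrow> 'a symbol com \<Rightarrow> (head \<Rightarrow> nat) \<Rightarrow>
    ('a, 'z) aut_scheme \<Rightarrow> 'a symbol list \<Rightarrow> bool" where
  "locates \<sigma> x go h A ys \<longleftrightarrow> suffix (enc_aut \<sigma> A @ ys) x \<and>
     (\<forall>w. exec x go (h, w) (h(P := pos x (enc_aut \<sigma> A @ ys)), w))"

definition go_progress :: "nat \<Rightarrow> 'a symbol com \<Rightarrow> head \<Rightarrow> 'a symbol com" where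
  "go_progress k go q = (go ;; skip_aut k ;; copy q (Sc 1) ;;
     While (Sc 1) nonzero (Move (Sc 1) MoveLeft ;; skip_dfa))"

lemma det_go_progress [simp]: "det (go_progress k go q) \<longleftrightarrow> det go"
  by (simp add: go_progress_def)

lemma locates_progress:
  assumes loc: "locates \<sigma> x go h (leading F) (dfas \<sigma> F 0 @ ys)"
    and "wf_fdfa F" "ok x h" "is_Rg q" "h q < nstates (leading F)" "flagless ys"
  shows "locates \<sigma> x (go_progress (length \<sigma>) go q) h (progress F (h q))
    (flags (progress F (h q)) @ dfas \<sigma> F (Suc (h q)) @ ys)"
proof -
  let ?m = "h q" and ?N = "nstates (leading F)"
  have suf0: "suffix (dfas \<sigma> F 0 @ ys) x"
    using loc unfolding locates_def by (metis suffix_appD2)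
  have suf: "suffix (dfas \<sigma> F j @ ys) x" if "j \<le> ?m" for j
    using that
  proof (induction j)
    case (Suc j)
    then have "dfas \<sigma> F j = enc_dfa \<sigma> (progress F j) @ dfas \<sigma> F (Suc j)"
      using dfas_Cons[of j F \<sigma>] assms(5) Suc.prems by auto
    with Suc show ?case by (metis Suc_leD append_assoc suffix_appD2)
  qed (rule suf0)
  have target: "enc_aut \<sigma> (progress F ?m) @ flags (progress F ?m) @ dfas \<sigma> F (Suc ?m) @ ys = dfas \<sigma> F ?m @ ys"
    using dfas_Cons[OF assms(5), of \<sigma>] by (simp add: enc_dfa_flags)
  have bd: "h j \<le> Suc (length x)" "h (Sc i) = 0" for i j using assms(3) by (auto simp: ok_def)
  have "exec x (go_progress (length \<sigma>) go q) (h, w) (h(P := pos x (dfas \<sigma> F ?m @ ys)), w)" for w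
    unfolding go_progress_def
  proof (intro exec.Seq)
    show "exec x go (h, w) (h(P := pos x (enc_aut \<sigma> (leading F) @ dfas \<sigma> F 0 @ ys)), w)"
      using loc by (simp add: locates_def)
    show "exec x (skip_aut (length \<sigma>)) (h(P := pos x (enc_aut \<sigma> (leading F) @ dfas \<sigma> F 0 @ ys)), w)
      (h(P := pos x (dfas \<sigma> F 0 @ ys)), w)"
      by (rule exec_skip_aut) (use loc bd in \<open>auto simp: locates_def\<close>)
    show "exec x (copy q (Sc 1)) (h(P := pos x (dfas \<sigma> F 0 @ ys)), w)
      (h(P := pos x (dfas \<sigma> F 0 @ ys), Sc 1 := ?m), w)"
      by (rule exec_target[OF exec_copy]) (use bd assms(4) in auto)
    let ?f = "\<lambda>k. (h(P := pos x (dfas \<sigma> F (?m - k) @ ys), Sc 1 := k), w)"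
    have "exec x (Move (Sc 1) MoveLeft ;; skip_dfa) (?f (Suc k)) (?f k)" if "k < ?m" for k
    proof (rule exec.Seq)
      let ?h = "h(Sc 1 := k)" and ?j = "?m - Suc k"
      have eq: "dfas \<sigma> F ?j @ ys = enc_dfa \<sigma> (progress F ?j) @ dfas \<sigma> F (?m - k) @ ys"
        using dfas_Cons[of ?j F \<sigma>] that assms(5) by (simp add: Suc_diff_Suc)
      show "exec x (Move (Sc 1) MoveLeft) (?f (Suc k)) (?h(P := pos x (dfas \<sigma> F ?j @ ys)), w)"
        by (rule exec_target[OF exec_MoveLeft]) (use bd(1)[of q] that in \<open>auto simp: fun_eq_iff\<close>)
      have "exec x skip_dfa (?h(P := pos x (dfas \<sigma> F ?j @ ys)), w) (?h(P := pos x (dfas \<sigma> F (?m - k) @ ys)), w)"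
        unfolding eq
        by (rule exec_skip_dfa) (use suf[of ?j] eq assms(2,5,6) flagless_dfas in \<open>auto simp: wf_fdfa_def\<close>)
      then show "exec x skip_dfa (?h(P := pos x (dfas \<sigma> F ?j @ ys)), w) (?f k)"
        by (simp add: fun_upd_twist)
    qed
    then have *: "exec x (While (Sc 1) nonzero (Move (Sc 1) MoveLeft ;; skip_dfa)) (?f ?m) (?f 0)"
      by (rule exec_countdown) auto
    show "exec x (While (Sc 1) nonzero (Move (Sc 1) MoveLeft ;; skip_dfa))
      (h(P := pos x (dfas \<sigma> F 0 @ ys), Sc 1 := ?m), w) (h(P := pos x (dfas \<sigma> F ?m @ ys)), w)"
    proof (rule exec_target)
      show "exec x (While (Sc 1) nonzero (Move (Sc 1) MoveLeft ;; skip_dfa))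
        (h(P := pos x (dfas \<sigma> F 0 @ ys), Sc 1 := ?m), w) (?f 0)"
        using * by simp
    qed (use bd in \<open>auto simp: fun_eq_iff\<close>)
  qed
  then show ?thesis using suf[of ?m] by (simp add: locates_def target)
qed

text \<open>A value read from the input is collected in \<open>Sc 2\<close> and moved to the
  register \<open>r\<close> only at the end, so \<open>r\<close> may coincide with a register that
  the macro reads, as in an update of a state by its successor.\<close>

definition finish :: "head \<Rightarrow> 's com" where
  "finish r = (reset P ;; reset r ;; drain (Sc 2) r)"

lemma det_finish [simp]: "det (finish r)"
  by (simp add: finish_def)

lemma exec_finish:
  assumes "ok x h" "is_Rg r" "p \<le> Suc (length x)" "m \<le> Suc (length x)"
  shows "exec x (finish r) (h(P := p, Sc 2 := m), w) (h(r := m), w)"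
  unfolding finish_def
proof (intro exec.Seq)
  have bd: "h j \<le> Suc (length x)" "h (Sc i) = 0" for i j using assms(1) by (auto simp: ok_def)
  show "exec x (reset P) (h(P := p, Sc 2 := m), w) (h(Sc 2 := m), w)"
    by (rule exec_target[OF exec_reset]) (use assms bd in \<open>auto simp: fun_eq_iff\<close>)
  show "exec x (reset r) (h(Sc 2 := m), w) (h(Sc 2 := m, r := 0), w)"
    by (rule exec_reset) (use assms bd in auto)
  show "exec x (drain (Sc 2) r) (h(Sc 2 := m, r := 0), w) (h(r := m), w)"
    by (rule exec_target[OF exec_drain]) (use assms bd in \<open>auto simp: fun_eq_iff\<close>)
qed

definition get_nstates :: "'a symbol com \<Rightarrow> head \<Rightarrow> 'a symbol com" where
  "get_nstates go r = (go ;; readnat (Sc 2) ;; finish r)"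

definition get_initial :: "'a symbol com \<Rightarrow> head \<Rightarrow> 'a symbol com" where
  "get_initial go r = (go ;; skipnat ;; readnat (Sc 2) ;; finish r)"

definition get_delta :: "nat \<Rightarrow> 'a symbol com \<Rightarrow> head \<Rightarrow> nat \<Rightarrow> head \<Rightarrow> 'a symbol com" where
  "get_delta k go q i r = (go ;; skipnat ;; skipnat ;; copy q (Sc 1) ;; skiprows k ;;
     skipnats i ;; readnat (Sc 2) ;; finish r)"

definition get_final :: "'a symbol com \<Rightarrow> head \<Rightarrow> head \<Rightarrow> 'a symbol com" where
  "get_final go p r = (go ;; scanwhile (- flag_symbols) ;; copy p (Sc 1) ;;
     While (Sc 1) nonzero (Move (Sc 1) MoveLeft ;; Move P MoveRight) ;;
     If P {Sym Accepting} (Move (Sc 2) MoveRight) Skip ;; finish r)"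

lemma det_get [simp]:
  "det (get_nstates go r) \<longleftrightarrow> det go" "det (get_initial go r) \<longleftrightarrow> det go"
  "det (get_delta k go q i r) \<longleftrightarrow> det go" "det (get_final go p r) \<longleftrightarrow> det go"
  by (simp_all add: get_nstates_def get_initial_def get_delta_def get_final_def)

lemma suffix_nat_le: "suffix (enc_nat m @ ys) x \<Longrightarrow> m \<le> Suc (length x)"
  using suffix_length_le[of "enc_nat m @ ys" x] by (simp add: enc_nat_def)

lemma exec_get_nstates:
  assumes "locates \<sigma> x go h A ys" "ok x h" "is_Rg r"
  shows "exec x (get_nstates go r) (h, w) (h(r := nstates A), w)"
  unfolding get_nstates_def
proof (intro exec.Seq)
  let ?r1 = "enc_nat (initial A) @ rows \<sigma> A 0 @ ys"
  have s1: "suffix (enc_nat (nstates A) @ ?r1) x" using assms(1) by (simp add: locates_def enc_aut_rows)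
  show "exec x go (h, w) (h(P := pos x (enc_nat (nstates A) @ ?r1)), w)"
    using assms(1) by (simp add: locates_def enc_aut_rows)
  show "exec x (readnat (Sc 2)) (h(P := pos x (enc_nat (nstates A) @ ?r1)), w) (h(P := pos x ?r1, Sc 2 := nstates A), w)"
    by (rule exec_readnat[OF s1]) (use assms in \<open>auto simp: ok_def\<close>)
  show "exec x (finish r) (h(P := pos x ?r1, Sc 2 := nstates A), w) (h(r := nstates A), w)"
    by (rule exec_finish) (use assms suffix_nat_le[OF s1] in auto)
qed

lemma exec_get_initial:
  assumes "locates \<sigma> x go h A ys" "ok x h" "is_Rg r"
  shows "exec x (get_initial go r) (h, w) (h(r := initial A), w)"
  unfolding get_initial_def
proof (intro exec.Seq)
  let ?r1 = "enc_nat (initial A) @ rows \<sigma> A 0 @ ys" and ?r2 = "rows \<sigma> A 0 @ ys"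
  have s1: "suffix (enc_nat (nstates A) @ ?r1) x" using assms(1) by (simp add: locates_def enc_aut_rows)
  note s2 = suffix_appD2[OF s1]
  show "exec x go (h, w) (h(P := pos x (enc_nat (nstates A) @ ?r1)), w)"
    using assms(1) by (simp add: locates_def enc_aut_rows)
  show "exec x skipnat (h(P := pos x (enc_nat (nstates A) @ ?r1)), w) (h(P := pos x ?r1), w)"
    by (rule exec_skipnat[OF s1])
  show "exec x (readnat (Sc 2)) (h(P := pos x ?r1), w) (h(P := pos x ?r2, Sc 2 := initial A), w)"
    by (rule exec_readnat[OF s2]) (use assms in \<open>auto simp: ok_def\<close>)
  show "exec x (finish r) (h(P := pos x ?r2, Sc 2 := initial A), w) (h(r := initial A), w)"
    by (rule exec_finish) (use assms suffix_nat_le[OF s2] in auto)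
qed

lemma exec_get_delta:
  assumes "locates \<sigma> x go h A ys" "ok x h" "is_Rg r" "is_Rg q" "h q < nstates A" "i < length \<sigma>"
  shows "exec x (get_delta (length \<sigma>) go q i r) (h, w) (h(r := delta A (h q) (\<sigma> ! i)), w)"
  unfolding get_delta_def
proof (intro exec.Seq)
  let ?r1 = "enc_nat (initial A) @ rows \<sigma> A 0 @ ys" and ?r2 = "rows \<sigma> A 0 @ ys"
  let ?r3 = "rows \<sigma> A (h q) @ ys"
  let ?ns = "map (delta A (h q)) \<sigma>" and ?m = "delta A (h q) (\<sigma> ! i)"
  let ?r5 = "concat (map enc_nat (drop (Suc i) ?ns)) @ rows \<sigma> A (Suc (h q)) @ ys"
  let ?r4 = "enc_nat ?m @ ?r5"
  have bd: "h j \<le> Suc (length x)" "h (Sc i) = 0" for i j using assms(2) by (auto simp: ok_def)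
  have s1: "suffix (enc_nat (nstates A) @ ?r1) x" using assms(1) by (simp add: locates_def enc_aut_rows)
  note s2 = suffix_appD2[OF s1] and s3 = suffix_appD2[OF suffix_appD2[OF s1]]
  have "?ns = take i ?ns @ ?m # drop (Suc i) ?ns"
    using id_take_nth_drop[of i ?ns] assms(6) by simp
  then have "concat (map enc_nat ?ns) = concat (map enc_nat (take i ?ns)) @ enc_nat ?m @ concat (map enc_nat (drop (Suc i) ?ns))"
    by (metis concat.simps(2) concat_append list.map(2) map_append)
  then have r3: "?r3 = concat (map enc_nat (take i ?ns)) @ ?r4"
    using rows_Cons[OF assms(5), of \<sigma>] by (simp add: row_def)
  show "exec x go (h, w) (h(P := pos x (enc_nat (nstates A) @ ?r1)), w)"
    using assms(1) by (simp add: locates_def enc_aut_rows)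
  show "exec x skipnat (h(P := pos x (enc_nat (nstates A) @ ?r1)), w) (h(P := pos x ?r1), w)"
    by (rule exec_skipnat[OF s1])
  show "exec x skipnat (h(P := pos x ?r1), w) (h(P := pos x ?r2), w)"
    by (rule exec_skipnat[OF s2])
  show "exec x (copy q (Sc 1)) (h(P := pos x ?r2), w) (h(P := pos x ?r2, Sc 1 := h q), w)"
    by (rule exec_target[OF exec_copy]) (use bd assms(4) in auto)
  have "exec x (skiprows (length \<sigma>)) (h(P := pos x ?r2, Sc 1 := h q), w)
      (h(P := pos x (rows \<sigma> A (0 + h q) @ ys), Sc 1 := 0), w)"
    by (rule exec_skiprows) (use s3 assms bd in auto)
  then show "exec x (skiprows (length \<sigma>)) (h(P := pos x ?r2, Sc 1 := h q), w) (h(P := pos x ?r3), w)"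
    by (rule exec_target) (use bd in \<open>auto simp: fun_eq_iff\<close>)
  have "rows \<sigma> A 0 = concat (map (row \<sigma> A) [0..<h q]) @ rows \<sigma> A (h q)"
    unfolding rows_def using upt_add_eq_append[of 0 "h q" "nstates A - h q"] assms(5) by simp
  then have s4: "suffix ?r3 x" using s3 by (metis append_assoc suffix_appD2)
  then have s5: "suffix ?r4 x" unfolding r3 by (rule suffix_appD2)
  have "exec x (skipnats (length (take i ?ns))) (h(P := pos x ?r3), w) (h(P := pos x ?r4), w)"
    unfolding r3 by (rule exec_skipnats) (use s4 r3 in simp)
  then show "exec x (skipnats i) (h(P := pos x ?r3), w) (h(P := pos x ?r4), w)"
    using assms(6) by simp
  show "exec x (readnat (Sc 2)) (h(P := pos x ?r4), w) (h(P := pos x ?r5, Sc 2 := ?m), w)"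
    by (rule exec_readnat[OF s5]) (use bd in auto)
  show "exec x (finish r) (h(P := pos x ?r5, Sc 2 := ?m), w) (h(r := ?m), w)"
    by (rule exec_finish) (use assms suffix_nat_le[OF s5] in auto)
qed

lemma exec_get_final:
  assumes "locates \<sigma> x go h D (flags D @ ys)" "ok x h" "is_Rg r" "is_Rg p" "h p < nstates D" "wf_dfa D"
  shows "exec x (get_final go p r) (h, w) (h(r := if h p \<in> final D then 1 else 0), w)"
  unfolding get_final_def
proof (intro exec.Seq)
  have bd: "h j \<le> Suc (length x)" "h (Sc i) = 0" for i j using assms(2) by (auto simp: ok_def)
  have s1: "suffix (enc_dfa \<sigma> D @ ys) x" using assms(1) by (simp add: locates_def enc_dfa_flags)
  show "exec x go (h, w) (h(P := pos x (enc_dfa \<sigma> D @ ys)), w)"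
    using assms(1) by (simp add: locates_def enc_dfa_flags)
  show "exec x (scanwhile (- flag_symbols)) (h(P := pos x (enc_dfa \<sigma> D @ ys)), w) (h(P := pos x (flags D @ ys)), w)"
    by (rule exec_to_flags[OF s1 assms(6)])
  show "exec x (copy p (Sc 1)) (h(P := pos x (flags D @ ys)), w) (h(P := pos x (flags D @ ys), Sc 1 := h p), w)"
    by (rule exec_target[OF exec_copy]) (use bd assms(4) in auto)
  let ?f = "\<lambda>k. (h(P := pos x (drop (h p - k) (flags D) @ ys), Sc 1 := k), w)"
  have s2: "suffix (flags D @ ys) x" using s1 by (simp add: enc_dfa_flags) (metis suffix_appD2)
  have suf: "suffix (drop j (flags D) @ ys) x" for j
    using s2 by (metis append_take_drop_id append_assoc suffix_appD2)
  have len: "length (flags D) = nstates D" by (simp add: flags_def)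
  have "exec x (Move (Sc 1) MoveLeft ;; Move P MoveRight) (?f (Suc k)) (?f k)" if "k < h p" for k
  proof (rule exec.Seq)
    let ?j = "h p - Suc k"
    have dr: "drop ?j (flags D) = flags D ! ?j # drop (h p - k) (flags D)"
      using Cons_nth_drop_Suc[of ?j "flags D"] that assms(5) len by (simp add: Suc_diff_Suc)
    show "exec x (Move (Sc 1) MoveLeft) (?f (Suc k)) (h(P := pos x (drop ?j (flags D) @ ys), Sc 1 := k), w)"
      by (rule exec_target[OF exec_MoveLeft]) (use bd(1)[of p] that in \<open>auto simp: fun_eq_iff\<close>)
    show "exec x (Move P MoveRight) (h(P := pos x (drop ?j (flags D) @ ys), Sc 1 := k), w) (?f k)"
      by (rule exec_target[OF exec_MoveRight])
        (use pos_Cons[of "flags D ! ?j" "drop (h p - k) (flags D) @ ys" x] suf[of ?j] dr in \<open>auto simp: fun_eq_iff\<close>)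
  qed
  then have "exec x (While (Sc 1) nonzero (Move (Sc 1) MoveLeft ;; Move P MoveRight)) (?f (h p)) (?f 0)"
    by (rule exec_countdown) auto
  then show "exec x (While (Sc 1) nonzero (Move (Sc 1) MoveLeft ;; Move P MoveRight))
     (h(P := pos x (flags D @ ys), Sc 1 := h p), w) (h(P := pos x (drop (h p) (flags D) @ ys), Sc 1 := 0), w)"
    by simp
  let ?v = "if h p \<in> final D then 1 else 0 :: nat"
  have "drop (h p) (flags D) = flags D ! h p # drop (Suc (h p)) (flags D)"
    using Cons_nth_drop_Suc[of "h p" "flags D"] assms(5) len by simp
  then have "scan x (pos x (drop (h p) (flags D) @ ys)) = Sym (flags D ! h p)"
    using pos_Cons(1) suf[of "h p"] by (metis append_Cons)
  then have sc: "scan x (pos x (drop (h p) (flags D) @ ys)) = Sym Accepting \<longleftrightarrow> h p \<in> final D"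
    using assms(5) by (simp add: flags_def)
  let ?h = "h(P := pos x (drop (h p) (flags D) @ ys), Sc 1 := 0)"
  have h: "?h = h(P := pos x (drop (h p) (flags D) @ ys))" using bd by (auto simp: fun_eq_iff)
  show "exec x (If P {Sym Accepting} (Move (Sc 2) MoveRight) Skip) (?h, w)
     (h(P := pos x (drop (h p) (flags D) @ ys), Sc 2 := ?v), w)"
  proof (cases "h p \<in> final D")
    case True
    then show ?thesis
      unfolding h by (intro exec.IfTrue exec_target[OF exec_MoveRight]) (use sc bd in auto)
  next
    case False
    then show ?thesis
      unfolding h by (intro exec.IfFalse exec_target[OF exec.Skip]) (use sc bd in \<open>auto simp: fun_eq_iff\<close>)
  qed
  show "exec x (finish r) (h(P := pos x (drop (h p) (flags D) @ ys), Sc 2 := ?v), w) (h(r := ?v), w)"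
    by (rule exec_finish) (use assms in auto)
qed

section \<open>Duo-normalized decompositions\<close>

text \<open>Among the first \<open>n + 1\<close> points of the orbit of \<open>s\<close> two
  coincide, at indices \<open>i < j\<close>; from \<open>i\<close> on the orbit has period
  \<open>c = j - i\<close>. An exponent that is a positive multiple of \<open>c\<close> and at least
  \<open>i\<close> is idempotent at \<open>s\<close>, and one of these is at most \<open>j\<close>.
  Only the orbit of \<open>s\<close> matters, and this keeps the exponent below \<open>n\<close> or
  equal to it, so that a head position can hold it.\<close>

lemma idempotent_power:
  fixes f :: "nat \<Rightarrow> nat"
  assumes "\<And>q. q < n \<Longrightarrow> f q < n" "s < n"
  shows "\<exists>k. 0 < k \<and> k \<le> n \<and> (f ^^ k) ((f ^^ k) s) = (f ^^ k) s"
proof -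
  have "(f ^^ i) s < n" for i using assms by (induction i) auto
  then have "(\<lambda>i. (f ^^ i) s) ` {..n} \<subseteq> {..<n}" by auto
  then have "card ((\<lambda>i. (f ^^ i) s) ` {..n}) \<le> n"
    by (metis card_lessThan card_mono finite_lessThan)
  then have "\<not> inj_on (\<lambda>i. (f ^^ i) s) {..n}"
    using card_image by fastforce
  then obtain i j where ij: "i < j" "j \<le> n" "(f ^^ i) s = (f ^^ j) s"
    unfolding inj_on_def by (metis atMost_iff linorder_neqE_nat)
  define c where "c = j - i"
  have per1: "(f ^^ (m + c)) s = (f ^^ m) s" if "i \<le> m" for m
  proof -
    have "(f ^^ (m + c)) s = (f ^^ (m - i)) ((f ^^ j) s)"
      using that ij by (simp add: c_def flip: funpow_add[THEN fun_cong, unfolded comp_def])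
    also have "\<dots> = (f ^^ m) s"
      using that ij(3) by (simp flip: ij(3) funpow_add[THEN fun_cong, unfolded comp_def])
    finally show ?thesis .
  qed
  have per: "(f ^^ (m + d * c)) s = (f ^^ m) s" if "i \<le> m" for m d
    using that by (induction d) (auto simp: per1 algebra_simps simp flip: add.assoc, metis add.commute add.left_commute per1 trans_le_add1)
  \<comment> \<open>The ceiling of \<open>i / c\<close>, raised to \<open>1\<close> when
    \<open>i = 0\<close>, since the exponent must be positive.\<close>
  define d where "d = (if i = 0 then 1 else (i + c - 1) div c)"
  have c: "0 < c" using ij by (simp add: c_def)
  have d: "i \<le> d * c" "d * c \<le> j" "0 < d * c"
  proof -
    have j: "j = i + c" using ij by (simp add: c_def)
    define X r where "X = (i + c - 1) div c * c" and "r = (i + c - 1) mod c"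
    have "X + r = i + c - 1" "r < c" using c by (simp_all add: X_def r_def)
    moreover have "d * c = (if i = 0 then c else X)" by (simp add: d_def X_def)
    ultimately show "i \<le> d * c" "d * c \<le> j" "0 < d * c" using c j by (auto split: if_splits)
  qed
  have "(f ^^ (d * c)) ((f ^^ (d * c)) s) = (f ^^ (d * c)) s"
    using per[OF d(1), of d] by (simp add: funpow_add)
  then show ?thesis using d ij by (intro exI[of _ "d * c"]) auto
qed

definition run :: "('a, 'z) aut_scheme \<Rightarrow> nat \<Rightarrow> 'a list \<Rightarrow> nat" where
  "run A q w = foldl (delta A) q w"

lemma run_Nil [simp]: "run A q [] = q"
  and run_Cons [simp]: "run A q (a # w) = run A (delta A q a) w"
  and run_append: "run A q (v @ w) = run A (run A q v) w"
  by (simp_all add: run_def)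

lemma reached_run: "reached A w = run A (initial A) w"
  by (simp add: run_def reached_def)

lemma reached_append: "reached A (v @ w) = run A (reached A v) w"
  by (simp add: reached_run run_append)

lemma run_less: "wf_aut A \<Longrightarrow> q < nstates A \<Longrightarrow> run A q w < nstates A"
  by (induction w arbitrary: q) (auto simp: wf_aut_def)

lemma reached_less: "wf_aut A \<Longrightarrow> reached A w < nstates A"
  using run_less[of A "initial A" w] by (simp add: reached_run wf_aut_def)

abbreviation rep :: "nat \<Rightarrow> 'a list \<Rightarrow> 'a list" where
  "rep k v \<equiv> concat (replicate k v)"

lemma run_rep: "run A q (rep k v) = ((\<lambda>q. run A q v) ^^ k) q"
  by (induction k arbitrary: q) (simp_all add: run_append funpow_Suc_right del: funpow.simps(2))

lemma rep_rep: "rep k (rep m v) = rep (k * m) v"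
  by (induction k) (auto simp: replicate_add)

lemma omega_rep: "v \<noteq> [] \<Longrightarrow> 0 < k \<Longrightarrow> (rep k v)\<^sup>\<omega> = v\<^sup>\<omega>"
proof -
  assume v: "v \<noteq> []" and k: "0 < k"
  have nth: "rep k v ! i = v ! (i mod length v)" if "i < k * length v" for i k
    using that
  proof (induction k arbitrary: i)
    case (Suc k)
    then show ?case
      using Suc.IH[of "i - length v"] v by (auto simp: nth_append le_mod_geq)
  qed simp
  have len: "length (rep k v) = k * length v" for k by (induction k) auto
  show ?thesis
  proof
    fix i
    have "i mod (k * length v) < k * length v" using v k by simp
    then show "((rep k v)\<^sup>\<omega>) i = (v\<^sup>\<omega>) i"
      using nth[of "i mod (k * length v)" k] v k
      by (auto simp: iter_def len mod_mod_cancel)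
  qed
qed

lemma conc_rep_omega: "v \<noteq> [] \<Longrightarrow> rep k v \<frown> v\<^sup>\<omega> = v\<^sup>\<omega>"
  by (induction k) (auto simp: conc_conc[symmetric] simp flip: iter_unroll)

lemma decomposition_rep:
  assumes "v \<noteq> []" "0 < m"
  shows "decomposition (u \<frown> v\<^sup>\<omega>) (u @ rep k v) (rep m v)"
  using assms by (auto simp: decomposition_def omega_rep conc_rep_omega simp flip: conc_conc)

lemma duo_normalized_run:
  "duo_normalized F u v \<longleftrightarrow> run (leading F) (reached (leading F) u) v = reached (leading F) u \<and>
     run (progress_of F u) (reached (progress_of F u) v) v = reached (progress_of F u) v"
  by (simp add: duo_normalized_def normalized_def reached_append)

text \<open>The exponent \<open>k\<close> comes first because it determines the leading state
  \<open>q1\<close> and thereby the progress DFA. The second exponent repeats the whole block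
  \<open>rep k v\<close>, which loops at \<open>q1\<close>, so the leading state stays in place for
  every \<open>m\<close>.\<close>

lemma duo_normalized_rep:
  assumes "((\<lambda>q. run (leading F) q v) ^^ k) q1 = q1" "q1 = ((\<lambda>q. run (leading F) q v) ^^ k) (reached (leading F) u)"
    and "((\<lambda>q. run (progress F q1) q (rep k v)) ^^ m) p1 = p1"
    and "p1 = ((\<lambda>q. run (progress F q1) q (rep k v)) ^^ m) (initial (progress F q1))"
  shows "duo_normalized F (u @ rep k v) (rep m (rep k v))"
    "reached (progress_of F (u @ rep k v)) (rep m (rep k v)) = p1"
proof -
  have q1: "reached (leading F) (u @ rep k v) = q1"
    using assms(2) by (simp add: reached_append run_rep)
  then have pr: "progress_of F (u @ rep k v) = progress F q1" by (simp add: progress_of_def)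
  show p1: "reached (progress_of F (u @ rep k v)) (rep m (rep k v)) = p1"
    using assms(4) unfolding pr by (simp add: reached_run run_rep)
  have "((\<lambda>q. run (leading F) q (rep k v)) ^^ j) q1 = q1" for j
    using assms(1) by (induction j) (auto simp: run_rep)
  then show "duo_normalized F (u @ rep k v) (rep m (rep k v))"
    unfolding duo_normalized_run q1 p1 run_rep[of _ _ m] using assms(3) pr by auto
qed

lemma duo_normalized_exists:
  assumes "wf_fdfa F" "w \<in> up_words"
  shows "\<exists>x y. decomposition w x y \<and> duo_normalized F x y"
proof -
  obtain u v where w: "v \<noteq> []" "w = u \<frown> v\<^sup>\<omega>"
    using assms(2) by (auto simp: up_words_def decomposition_def)
  let ?L = "leading F"
  have L: "wf_aut ?L" "reached ?L u < nstates ?L"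
    using assms(1) reached_less[of ?L] by (auto simp: wf_fdfa_def)
  then obtain k where k: "0 < k"
    "((\<lambda>q. run ?L q v) ^^ k) (((\<lambda>q. run ?L q v) ^^ k) (reached ?L u)) = ((\<lambda>q. run ?L q v) ^^ k) (reached ?L u)"
    using idempotent_power[of "nstates ?L" "\<lambda>q. run ?L q v" "reached ?L u"] run_less[of ?L] by blast
  define q1 where "q1 = ((\<lambda>q. run ?L q v) ^^ k) (reached ?L u)"
  have "q1 = run ?L (reached ?L u) (rep k v)" by (simp add: q1_def run_rep)
  then have "q1 < nstates ?L" using run_less L by simp
  then have Pr: "wf_aut (progress F q1)" "initial (progress F q1) < nstates (progress F q1)"
    using assms(1) by (auto simp: wf_fdfa_def wf_dfa_def wf_aut_def)
  let ?g = "\<lambda>q. run (progress F q1) q (rep k v)"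
  obtain m where m: "0 < m" "(?g ^^ m) ((?g ^^ m) (initial (progress F q1))) = (?g ^^ m) (initial (progress F q1))"
    using idempotent_power[of "nstates (progress F q1)" ?g "initial (progress F q1)"] run_less[OF Pr(1)] Pr(2) by blast
  have "duo_normalized F (u @ rep k v) (rep m (rep k v))"
    using duo_normalized_rep(1)[OF _ q1_def m(2) refl] k(2) by (simp add: q1_def)
  moreover have "decomposition w (u @ rep k v) (rep m (rep k v))"
    using decomposition_rep[OF w(1), of "m * k" u k] k m by (simp add: w rep_rep)
  ultimately show ?thesis by blast
qed

lemma fdfa_lang_iff:
  "w \<in> fdfa_lang F \<longleftrightarrow> (\<exists>x y. decomposition w x y \<and> duo_normalized F x y \<and> y \<in> dfa_lang (progress_of F x))"
proof
  assume "\<exists>x y. decomposition w x y \<and> duo_normalized F x y \<and> y \<in> dfa_lang (progress_of F x)"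
  then obtain x y where xy: "decomposition w x y" "duo_normalized F x y" "y \<in> dfa_lang (progress_of F x)"
    by blast
  then have "(x, y) \<in> accepted F" "w = x \<frown> y\<^sup>\<omega>" by (auto simp: accepted_def decomposition_def)
  then show "w \<in> fdfa_lang F" by (auto simp: fdfa_lang_def)
qed (auto simp: fdfa_lang_def accepted_def)

lemma fdfa_lang_up: "fdfa_lang F \<subseteq> up_words"
  unfolding up_words_def using fdfa_lang_iff by blast

lemma accepted_iff: "(u, v) \<in> accepted F \<longleftrightarrow> v \<noteq> [] \<and> u \<frown> v\<^sup>\<omega> \<in> fdfa_lang F"
  by (auto simp: accepted_def fdfa_lang_iff)

text \<open>The language is defined by the existence of an accepted duo-normalized decomposition;
  under saturation each of them gives the same answer, so whichever is at hand can be
  tested.\<close>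

lemma saturated_lang:
  assumes "saturated F" "decomposition w x y" "duo_normalized F x y"
  shows "y \<in> dfa_lang (progress_of F x) \<longleftrightarrow> w \<in> fdfa_lang F"
proof -
  have "w \<in> up_words" using assms(2) by (auto simp: up_words_def)
  then show ?thesis using assms unfolding saturated_def fdfa_lang_iff by blast
qed

lemma sat_fdfas_D: "F \<in> sat_fdfas \<Longrightarrow> wf_fdfa F" "F \<in> sat_fdfas \<Longrightarrow> saturated F"
  by (auto simp: sat_fdfas_def)

section \<open>Complements and products of FDFAs\<close>

definition co_dfa :: "'a dfa \<Rightarrow> 'a dfa" where
  "co_dfa D = D\<lparr>final := {..<nstates D} - final D\<rparr>"

definition co_fdfa :: "'a fdfa \<Rightarrow> 'a fdfa" where
  "co_fdfa F = F\<lparr>progress := \<lambda>q. co_dfa (progress F q)\<rparr>"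

lemma co_simps [simp]:
  "leading (co_fdfa F) = leading F" "progress (co_fdfa F) q = co_dfa (progress F q)"
  "progress_of (co_fdfa F) u = co_dfa (progress_of F u)"
  "nstates (co_dfa D) = nstates D" "initial (co_dfa D) = initial D" "delta (co_dfa D) = delta D"
  "final (co_dfa D) = {..<nstates D} - final D" "reached (co_dfa D) w = reached D w"
  by (simp_all add: co_fdfa_def co_dfa_def progress_of_def reached_def)

lemma wf_co: "wf_fdfa F \<Longrightarrow> wf_fdfa (co_fdfa F)"
  by (auto simp: wf_fdfa_def wf_dfa_def wf_aut_def)

lemma duo_normalized_co: "duo_normalized (co_fdfa F) x y \<longleftrightarrow> duo_normalized F x y"
  by (simp add: duo_normalized_def normalized_def)

lemma wf_progress_of: "wf_fdfa F \<Longrightarrow> wf_dfa (progress_of F x)"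
  using reached_less[of "leading F" x] by (auto simp: wf_fdfa_def progress_of_def)

lemma dfa_lang_co:
  assumes "wf_fdfa F"
  shows "y \<in> dfa_lang (progress_of (co_fdfa F) x) \<longleftrightarrow> y \<notin> dfa_lang (progress_of F x)"
  using reached_less[of "progress_of F x" y] wf_progress_of[OF assms, of x]
  by (auto simp: dfa_lang_def wf_dfa_def)

text \<open>The flipped FDFA accepts the words with some rejected duo-normalized decomposition. By
  saturation no such word is in the language of \<open>F\<close>, and by
  \<open>duo_normalized_exists\<close> every other ultimately periodic word has a decomposition,
  which is then rejected by \<open>F\<close>.\<close>

lemma co_fdfa:
  assumes "F \<in> sat_fdfas"
  shows "co_fdfa F \<in> sat_fdfas" "fdfa_lang (co_fdfa F) = up_words - fdfa_lang F"
proof -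
  note F = sat_fdfas_D[OF assms]
  show "co_fdfa F \<in> sat_fdfas"
    using F(2) wf_co[OF F(1)]
    by (simp only: sat_fdfas_def mem_Collect_eq saturated_def duo_normalized_co dfa_lang_co[OF F(1)]) blast
  have "w \<in> fdfa_lang (co_fdfa F) \<longleftrightarrow> w \<in> up_words \<and> w \<notin> fdfa_lang F" for w
    unfolding fdfa_lang_iff[of w "co_fdfa F"] duo_normalized_co dfa_lang_co[OF F(1)]
    using saturated_lang[OF F(2)] duo_normalized_exists[OF F(1)] fdfa_lang_up
    by (fastforce simp: up_words_def)
  then show "fdfa_lang (co_fdfa F) = up_words - fdfa_lang F" by blast
qed

text \<open>States must form an initial segment of the numbers, so the pair of states
  \<open>i\<close> and \<open>j\<close> becomes the number \<open>i * nstates B + j\<close>, decoded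
  by quotient and remainder.\<close>

definition prod_aut :: "('a, 'y) aut_scheme \<Rightarrow> ('a, 'z) aut_scheme \<Rightarrow> 'a aut" where
  "prod_aut A B = \<lparr>nstates = nstates A * nstates B, initial = initial A * nstates B + initial B,
     delta = (\<lambda>q a. delta A (q div nstates B) a * nstates B + delta B (q mod nstates B) a)\<rparr>"

definition prod_dfa :: "(bool \<Rightarrow> bool \<Rightarrow> bool) \<Rightarrow> 'a dfa \<Rightarrow> 'a dfa \<Rightarrow> 'a dfa" where
  "prod_dfa \<beta> D E = aut.extend (prod_aut D E) \<lparr>final = {p. p < nstates D * nstates E \<and>
     \<beta> (p div nstates E \<in> final D) (p mod nstates E \<in> final E)}\<rparr>"

definition prod_fdfa :: "(bool \<Rightarrow> bool \<Rightarrow> bool) \<Rightarrow> 'a fdfa \<Rightarrow> 'a fdfa \<Rightarrow> 'a fdfa" where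
  "prod_fdfa \<beta> F G = \<lparr>leading = prod_aut (leading F) (leading G),
     progress = (\<lambda>q. prod_dfa \<beta> (progress F (q div nstates (leading G))) (progress G (q mod nstates (leading G))))\<rparr>"

lemma prod_simps [simp]:
  "nstates (prod_aut A B) = nstates A * nstates B"
  "initial (prod_aut A B) = initial A * nstates B + initial B"
  "delta (prod_aut A B) q a = delta A (q div nstates B) a * nstates B + delta B (q mod nstates B) a"
  "nstates (prod_dfa \<beta> D E) = nstates D * nstates E"
  "initial (prod_dfa \<beta> D E) = initial D * nstates E + initial E"
  "delta (prod_dfa \<beta> D E) q a = delta D (q div nstates E) a * nstates E + delta E (q mod nstates E) a"
  "p \<in> final (prod_dfa \<beta> D E) \<longleftrightarrow> p < nstates D * nstates E \<and>
     \<beta> (p div nstates E \<in> final D) (p mod nstates E \<in> final E)"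
  "leading (prod_fdfa \<beta> F G) = prod_aut (leading F) (leading G)"
  "progress (prod_fdfa \<beta> F G) q = prod_dfa \<beta> (progress F (q div nstates (leading G))) (progress G (q mod nstates (leading G)))"
  by (simp_all add: prod_aut_def prod_dfa_def prod_fdfa_def aut.extend_def)

lemma pair_less: "(i :: nat) < m \<Longrightarrow> j < n \<Longrightarrow> i * n + j < m * n"
proof -
  assume "i < m" "j < n"
  then have "i * n + j < Suc i * n" by simp
  also have "\<dots> \<le> m * n" using \<open>i < m\<close> by (intro mult_right_mono) auto
  finally show ?thesis .
qed

lemma wf_prod_aut: "wf_aut A \<Longrightarrow> wf_aut B \<Longrightarrow> wf_aut (prod_aut A B)"
  by (auto simp: wf_aut_def less_mult_imp_div_less intro!: pair_less)

lemma wf_prod_dfa: "wf_dfa D \<Longrightarrow> wf_dfa E \<Longrightarrow> wf_dfa (prod_dfa \<beta> D E)"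
  by (auto simp: wf_dfa_def wf_aut_def less_mult_imp_div_less intro!: pair_less)

lemma wf_prod_fdfa: "wf_fdfa F \<Longrightarrow> wf_fdfa G \<Longrightarrow> wf_fdfa (prod_fdfa \<beta> F G)"
  using reached_less[of "leading G" "[]"]
  by (auto simp: wf_fdfa_def less_mult_imp_div_less intro!: wf_prod_aut wf_prod_dfa)

lemma run_prod_aut:
  "wf_aut B \<Longrightarrow> j < nstates B \<Longrightarrow> run (prod_aut A B) (i * nstates B + j) w = run A i w * nstates B + run B j w"
  by (induction w arbitrary: i j) (auto simp: wf_aut_def)

lemma run_prod_dfa:
  "wf_aut E \<Longrightarrow> j < nstates E \<Longrightarrow> run (prod_dfa \<beta> D E) (i * nstates E + j) w = run D i w * nstates E + run E j w"
  by (induction w arbitrary: i j) (auto simp: wf_aut_def)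

lemma reached_prod_aut: "wf_aut B \<Longrightarrow> reached (prod_aut A B) w = reached A w * nstates B + reached B w"
  by (simp add: reached_run run_prod_aut wf_aut_def)

lemma reached_prod_dfa: "wf_aut E \<Longrightarrow> reached (prod_dfa \<beta> D E) w = reached D w * nstates E + reached E w"
  by (simp add: reached_run run_prod_dfa wf_aut_def)

lemma pair_eq: "(j :: nat) < n \<Longrightarrow> j' < n \<Longrightarrow> i * n + j = i' * n + j' \<longleftrightarrow> i = i' \<and> j = j'"
  by (metis add.commute add_left_cancel div_mult_self1_is_m div_mult_self3 div_less gr_implies_not0 add.right_neutral mod_mult_self3 mod_less)

lemma progress_of_prod:
  assumes "wf_fdfa G"
  shows "progress_of (prod_fdfa \<beta> F G) u = prod_dfa \<beta> (progress_of F u) (progress_of G u)"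
proof -
  have "wf_aut (leading G)" using assms by (simp add: wf_fdfa_def)
  then show ?thesis using reached_less[of "leading G" u] by (simp add: progress_of_def reached_prod_aut)
qed

lemma duo_normalized_prod:
  assumes "wf_fdfa G"
  shows "duo_normalized (prod_fdfa \<beta> F G) x y \<longleftrightarrow> duo_normalized F x y \<and> duo_normalized G x y"
proof -
  have wf: "wf_aut (leading G)" "wf_aut (progress_of G x)"
    using assms wf_progress_of[OF assms, of x] by (auto simp: wf_fdfa_def wf_dfa_def)
  show ?thesis
    using wf(1)[THEN reached_less] wf(2)[THEN reached_less]
    by (auto simp: duo_normalized_def normalized_def progress_of_prod[OF assms] reached_prod_aut[OF wf(1)]
        reached_prod_dfa[OF wf(2)] pair_eq)
qed

lemma dfa_lang_prod:
  assumes "wf_fdfa F" "wf_fdfa G"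
  shows "y \<in> dfa_lang (progress_of (prod_fdfa \<beta> F G) x) \<longleftrightarrow>
     \<beta> (y \<in> dfa_lang (progress_of F x)) (y \<in> dfa_lang (progress_of G x))"
proof -
  have wf: "wf_aut (progress_of F x)" "wf_aut (progress_of G x)"
    using assms[THEN wf_progress_of, of x] by (auto simp: wf_dfa_def)
  show ?thesis
    using wf[THEN reached_less, of y] by (auto simp: dfa_lang_def progress_of_prod[OF assms(2)]
       reached_prod_dfa[OF wf(2)] pair_less)
qed

lemma prod_fdfa:
  assumes "F \<in> sat_fdfas" "G \<in> sat_fdfas"
  shows "prod_fdfa \<beta> F G \<in> sat_fdfas"
    "fdfa_lang (prod_fdfa \<beta> F G) = {w \<in> up_words. \<beta> (w \<in> fdfa_lang F) (w \<in> fdfa_lang G)}"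
proof -
  note F = sat_fdfas_D[OF assms(1)] and G = sat_fdfas_D[OF assms(2)]
  note lang = dfa_lang_prod[OF F(1) G(1)] and duo = duo_normalized_prod[OF G(1)]
  have iff: "y \<in> dfa_lang (progress_of (prod_fdfa \<beta> F G) x) \<longleftrightarrow> \<beta> (w \<in> fdfa_lang F) (w \<in> fdfa_lang G)"
    if "decomposition w x y" "duo_normalized (prod_fdfa \<beta> F G) x y" for w x y
    using that saturated_lang[OF F(2) that(1)] saturated_lang[OF G(2) that(1)] by (simp add: lang duo)
  show "prod_fdfa \<beta> F G \<in> sat_fdfas"
    using wf_prod_fdfa[OF F(1) G(1)] iff unfolding sat_fdfas_def saturated_def by blast
  show "fdfa_lang (prod_fdfa \<beta> F G) = {w \<in> up_words. \<beta> (w \<in> fdfa_lang F) (w \<in> fdfa_lang G)}"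
    using iff duo_normalized_exists[OF wf_prod_fdfa[OF F(1) G(1)]] 
    by (auto simp: fdfa_lang_iff[of _ "prod_fdfa \<beta> F G"] up_words_def) (metis+)?
qed

section \<open>Complementation\<close>

fun swap_flag :: "'a symbol \<Rightarrow> 'a symbol" where
  "swap_flag Accepting = Rejecting"
| "swap_flag Rejecting = Accepting"
| "swap_flag s = s"

lemma swap_flag_aut: "map swap_flag (enc_aut \<sigma> A) = enc_aut \<sigma> A"
  by (rule map_idI) (use set_enc_aut[of \<sigma> A] in auto)

lemma enc_co_fdfa: "enc_fdfa \<sigma> (co_fdfa F) = map swap_flag (enc_fdfa \<sigma> F)"
proof -
  have aut: "enc_aut \<sigma> (co_dfa D) = enc_aut \<sigma> D" for D :: "'a dfa"
    by (simp add: enc_aut_def)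
  have "enc_dfa \<sigma> (co_dfa D) = map swap_flag (enc_dfa \<sigma> D)" for D
    by (auto simp: enc_dfa_flags aut swap_flag_aut flags_def)
  then show ?thesis by (simp add: enc_fdfa_def swap_flag_aut map_concat comp_def)
qed

definition map_tm :: "('i \<Rightarrow> 'o) \<Rightarrow> ('i, 'o) tm" where
  "map_tm f = \<lparr>tm_states = 1, tm_symbols = 1, tm_tapes = 0, tm_accept = {},
     tm_trans = (\<lambda>q c ws. case c of LeftEnd \<Rightarrow> {(0, MoveRight, [], None)}
       | Sym a \<Rightarrow> {(0, MoveRight, [], Some (f a))} | RightEnd \<Rightarrow> {})\<rparr>"

lemma tm_step_map_tm:
  "tm_step (map_tm f) x c c' \<longleftrightarrow> scan x (cf_input c) \<noteq> RightEnd \<and>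
     c' = \<lparr>cf_state = 0, cf_input = min (length x + 1) (cf_input c + 1), cf_work = [],
       cf_output = cf_output c @ (case scan x (cf_input c) of Sym a \<Rightarrow> [f a] | _ \<Rightarrow> [])\<rparr>"
  by (cases "scan x (cf_input c)") (auto simp: tm_step_def map_tm_def simp del: scan_LeftEnd)

lemma init_conf_map_tm: "init_conf (map_tm f) = \<lparr>cf_state = 0, cf_input = 0, cf_work = [], cf_output = []\<rparr>"
  by (simp add: init_conf_def map_tm_def)

lemma map_tm_run:
  "k \<le> length x \<Longrightarrow> (tm_step (map_tm f) x)\<^sup>*\<^sup>* (init_conf (map_tm f))
     \<lparr>cf_state = 0, cf_input = k + 1, cf_work = [], cf_output = map f (take k x)\<rparr>"
proof (induction k)
  case 0
  then show ?case
    by (intro r_into_rtranclp) (auto simp: tm_step_map_tm init_conf_map_tm scan_def)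
next
  case (Suc k)
  then have "tm_step (map_tm f) x \<lparr>cf_state = 0, cf_input = k + 1, cf_work = [], cf_output = map f (take k x)\<rparr>
    \<lparr>cf_state = 0, cf_input = Suc k + 1, cf_work = [], cf_output = map f (take (Suc k) x)\<rparr>"
    unfolding tm_step_map_tm
    by (auto simp: scan_def take_Suc_conv_app_nth)
  with Suc show ?case by (meson Suc_leD rtranclp.rtrancl_into_rtrancl)
qed

lemma complement_computable:
  "computable_in_space const_space (enc_fdfa \<sigma>) (enc_fdfa \<sigma>) sat_fdfas
     (\<lambda>F G. G \<in> sat_fdfas \<and> fdfa_lang G = up_words - fdfa_lang F)"
  unfolding computable_in_space_def
proof (intro exI[of _ "map_tm swap_flag"] exI[of _ "\<lambda>_. 0"] conjI ballI)
  show "wf_tm (map_tm swap_flag)"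
    by (auto simp: wf_tm_def map_tm_def split: cell.splits)
  show "deterministic (map_tm swap_flag)"
    by (auto simp: deterministic_def map_tm_def split: cell.splits)
  show "(\<lambda>n. real 0) \<in> O(const_space)" by simp
  fix F :: "'a fdfa" assume F: "F \<in> sat_fdfas"
  let ?x = "enc_fdfa \<sigma> F" and ?M = "map_tm swap_flag :: ('a symbol, 'a symbol) tm"
  \<comment> \<open>The machine has no work tapes, so even the space bound \<open>0\<close> is
    respected.\<close>
  have "cf_work c = []" if "reachable ?M ?x c" for c
    using that unfolding reachable_def
    by (induction rule: rtranclp_induct) (auto simp: tm_step_map_tm init_conf_map_tm)
  then show "within_space ?M ?x 0" by (auto simp: within_space_def)
  let ?c = "\<lparr>cf_state = 0, cf_input = length ?x + 1, cf_work = [], cf_output = map swap_flag ?x\<rparr>"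
  have "reachable ?M ?x ?c" using map_tm_run[of "length ?x" ?x swap_flag] by (simp add: reachable_def)
  moreover have "halting ?M ?x ?c" by (auto simp: halting_def tm_step_map_tm scan_def)
  ultimately show "\<exists>c. reachable ?M ?x c \<and> halting ?M ?x c \<and> (\<exists>r. cf_output c = enc_fdfa \<sigma> r \<and>
      r \<in> sat_fdfas \<and> fdfa_lang r = up_words - fdfa_lang F)"
    using co_fdfa[OF F] enc_co_fdfa[of \<sigma> F, symmetric]
    by (intro exI[of _ ?c] conjI exI[of _ "co_fdfa F"]) auto
qed

section \<open>Products\<close>

definition emits :: "'s list \<Rightarrow> 's com \<Rightarrow> (head \<Rightarrow> nat) \<Rightarrow> 's list \<Rightarrow> bool" where
  "emits x c h out \<longleftrightarrow> (\<forall>w. exec x c (h, w) (h, w @ out))"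

definition sets :: "'s list \<Rightarrow> 's com \<Rightarrow> (head \<Rightarrow> nat) \<Rightarrow> head \<Rightarrow> nat \<Rightarrow> bool" where
  "sets x c h r v \<longleftrightarrow> (\<forall>w. exec x c (h, w) (h(r := v), w))"

lemma emits_Skip: "emits x Skip h []"
  by (auto simp: emits_def intro: exec.Skip)

lemma emits_Out: "emits x (Out a) h [a]"
  by (auto simp: emits_def intro: exec.Out)

lemma emits_Seq: "emits x c1 h out1 \<Longrightarrow> emits x c2 h out2 \<Longrightarrow> emits x (c1 ;; c2) h (out1 @ out2)"
  unfolding emits_def append_assoc[symmetric] by (meson exec.Seq)

lemma emits_If: "emits x (if h j = 0 then c2 else c1) h out \<Longrightarrow> emits x (If j nonzero c1 c2) h out"
  by (auto simp: emits_def exec_If_iff)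

fun seqs :: "'s com list \<Rightarrow> 's com" where
  "seqs [] = Skip"
| "seqs (c # cs) = (c ;; seqs cs)"

lemma det_seqs [simp]: "det (seqs cs) \<longleftrightarrow> (\<forall>c \<in> set cs. det c)"
  by (induction cs) auto

lemma emits_seqs: "(\<And>i. i \<in> set is \<Longrightarrow> emits x (c i) h (out i)) \<Longrightarrow>
    emits x (seqs (map c is)) h (concat (map out is))"
  by (induction "is") (auto intro: emits_Skip emits_Seq)

definition letin :: "head \<Rightarrow> 's com \<Rightarrow> 's com \<Rightarrow> 's com" where
  "letin r c body = (c ;; body ;; reset r)"

lemma det_letin [simp]: "det (letin r c body) \<longleftrightarrow> det c \<and> det body"
  by (simp add: letin_def)

lemma emits_letin:
  assumes "sets x c h r v" "emits x body (h(r := v)) out" "h r = 0" "v \<le> Suc (length x)"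
  shows "emits x (letin r c body) h out"
  unfolding emits_def letin_def
proof (intro allI exec.Seq)
  fix w
  show "exec x c (h, w) (h(r := v), w)" using assms(1) by (simp add: sets_def)
  show "exec x body (h(r := v), w) (h(r := v), w @ out)" using assms(2) by (simp add: emits_def)
  show "exec x (reset r) (h(r := v), w @ out) (h, w @ out)"
    by (rule exec_target[OF exec_reset]) (use assms in \<open>auto simp: fun_eq_iff\<close>)
qed

text \<open>Block \<open>9\<close> is reserved for flags, here and in the counting part; this is why
  macros with a register block \<open>b\<close> exclude \<open>b = 9\<close>.\<close>

abbreviation flag :: head where "flag \<equiv> Rg 9 0"

definition loop :: "head \<Rightarrow> head \<Rightarrow> 's com \<Rightarrow> 's com" where
  "loop i n body = (neq i n flag ;;
     While flag nonzero (reset flag ;; body ;; Move i MoveRight ;; neq i n flag) ;; reset i)"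

lemma det_loop [simp]: "det (loop i n body) \<longleftrightarrow> det body"
  by (simp add: loop_def)

text \<open>In the family \<open>h\<close> the loop register \<open>i\<close> is always
  \<open>0\<close>; the hypothesis on the body inserts its value \<open>k\<close> before and after
  the round. So the body leaves the loop register alone, and the loop as a whole restores
  it.\<close>

lemma exec_loop:
  assumes h: "ok x (h 0)" and regs: "is_Rg i" "is_Rg n" "i \<noteq> n" "i \<noteq> flag" "n \<noteq> flag"
    and hs: "\<And>k. k \<le> m \<Longrightarrow> ok x (h k)" "\<And>k. k \<le> m \<Longrightarrow> h k i = 0" "\<And>k. k \<le> m \<Longrightarrow> h k flag = 0"
      "\<And>k. k \<le> m \<Longrightarrow> h k n = m"
    and body: "\<And>k. k < m \<Longrightarrow> exec x body ((h k)(i := k), w k) ((h (Suc k))(i := k), w (Suc k))"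
  shows "exec x (loop i n body) (h 0, w 0) (h m, w m)"
  unfolding loop_def
proof (intro exec.Seq)
  let ?F = "\<lambda>k. if k = m then 0 else 1 :: nat"
  have m: "m \<le> Suc (length x)" using hs(1,4)[of 0] by (auto simp: ok_def)
  let ?f = "\<lambda>j. ((h (m - j))(i := m - j, flag := ?F (m - j)), w (m - j))"
  show "exec x (neq i n flag) (h 0, w 0) ((h 0)(i := 0, flag := ?F 0), w 0)"
    by (rule exec_target[OF exec_neq]) (use h regs hs[of 0] in \<open>auto simp: fun_eq_iff\<close>)
  have "exec x (reset flag ;; body ;; Move i MoveRight ;; neq i n flag) (?f (Suc j)) (?f j)" if "j < m" for j
  proof (intro exec.Seq)
    let ?k = "m - Suc j"
    have k: "?k < m" "m - j = Suc ?k" using that by auto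
    show "exec x (reset flag) (?f (Suc j)) ((h ?k)(i := ?k), w ?k)"
      by (rule exec_target[OF exec_reset]) (use regs k hs[of ?k] in \<open>auto simp: fun_eq_iff\<close>)
    show "exec x body ((h ?k)(i := ?k), w ?k) ((h (Suc ?k))(i := ?k), w (Suc ?k))"
      by (rule body[OF k(1)])
    show "exec x (Move i MoveRight) ((h (Suc ?k))(i := ?k), w (Suc ?k)) ((h (Suc ?k))(i := Suc ?k), w (Suc ?k))"
      by (rule exec_target[OF exec_MoveRight]) (use k m in auto)
    have "ok x ((h (Suc ?k))(i := Suc ?k))" by (rule ok_upd) (use hs[of "Suc ?k"] k m regs in auto)
    then show "exec x (neq i n flag) ((h (Suc ?k))(i := Suc ?k), w (Suc ?k)) (?f j)"
      unfolding k(2)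
      by (rule exec_target[OF exec_neq]) (use regs k hs[of "Suc ?k"] in \<open>auto simp: fun_eq_iff\<close>)
  qed
  then have "exec x (While flag nonzero (reset flag ;; body ;; Move i MoveRight ;; neq i n flag)) (?f m) (?f 0)"
    by (rule exec_countdown) auto
  then show "exec x (While flag nonzero (reset flag ;; body ;; Move i MoveRight ;; neq i n flag))
    ((h 0)(i := 0, flag := ?F 0), w 0) ((h m)(i := m, flag := ?F m), w m)" by simp
  show "exec x (reset i) ((h m)(i := m, flag := ?F m), w m) (h m, w m)"
    by (rule exec_target[OF exec_reset]) (use regs m hs[of m] in \<open>auto simp: fun_eq_iff\<close>)
qed

lemma emits_loop:
  assumes "ok x h" "is_Rg i" "is_Rg n" "i \<noteq> n" "i \<noteq> flag" "n \<noteq> flag" "h i = 0" "h flag = 0" "h n = m"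
    "\<And>k. k < m \<Longrightarrow> emits x body (h(i := k)) (out k)"
  shows "emits x (loop i n body) h (concat (map out [0..<m]))"
  unfolding emits_def
proof
  fix w
  have *: "exec x body (h(i := k), w @ concat (map out [0..<k])) (h(i := k), w @ concat (map out [0..<Suc k]))"
    if "k < m" for k
    using assms(10)[OF that] unfolding emits_def
    by (elim allE[of _ "w @ concat (map out [0..<k])"]) simp
  have "exec x (loop i n body) (h, w @ concat (map out [0..<0])) (h, w @ concat (map out [0..<m]))"
    by (rule exec_loop[where h = "\<lambda>_. h" and w = "\<lambda>k. w @ concat (map out [0..<k])"])
      (use assms(1-9) * in auto)
  then show "exec x (loop i n body) (h, w) (h, w @ concat (map out [0..<m]))" by simp
qed

abbreviation (input) "rI b \<equiv> Rg b 0"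
abbreviation (input) "rJ b \<equiv> Rg b 1"

text \<open>A state number of the product may exceed the length of the input and hence every head
  position. It is therefore never stored: nested loops emit its unary representation tick by
  tick.\<close>

definition out_muladd :: "nat \<Rightarrow> head \<Rightarrow> head \<Rightarrow> head \<Rightarrow> 'a symbol com" where
  "out_muladd b d n e =
     (loop (rI b) d (loop (rJ b) n (Out Tick)) ;; loop (rJ b) e (Out Tick) ;; Out Stop)"

lemma det_out_muladd [simp]: "det (out_muladd b d n e)"
  by (simp add: out_muladd_def)

lemma concat_replicate_upt: "concat (map (\<lambda>_. replicate n a) [0..<m]) = replicate (m * n) a"
  by (induction m) (auto simp: replicate_add[symmetric] add.commute)

lemma rep_replicate: "rep m (replicate n a) = replicate (m * n) a"
  by (induction m) (auto simp: replicate_add)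

lemma emits_out_muladd:
  assumes "ok x h" "is_Rg d" "is_Rg n" "is_Rg e" "{d, n, e} \<inter> {rI b, rJ b, flag} = {}" "b \<noteq> 9"
    "h (rI b) = 0" "h (rJ b) = 0" "h flag = 0"
  shows "emits x (out_muladd b d n e) h (enc_nat (h d * h n + h e))"
proof -
  have tick: "emits x (loop (rJ b) n (Out Tick)) (h(rI b := k)) (replicate (h n) Tick)" if "k < h d" for k
  proof -
    have "k \<le> Suc (length x)" using that assms(1) by (auto simp: ok_def intro: le_trans[OF less_imp_le])
    then have "ok x (h(rI b := k))" using assms by - (rule ok_upd; auto)
    then have "emits x (loop (rJ b) n (Out Tick)) (h(rI b := k)) (concat (map (\<lambda>_. [Tick]) [0..<h n]))"
      by (rule emits_loop) (use assms in \<open>auto intro: emits_Out\<close>)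
    then show ?thesis by (simp add: concat_replicate_upt[of 1, simplified])
  qed
  have "emits x (loop (rI b) d (loop (rJ b) n (Out Tick))) h (concat (map (\<lambda>_. replicate (h n) Tick) [0..<h d]))"
    by (rule emits_loop) (use assms tick in auto)
  moreover have "emits x (loop (rJ b) e (Out Tick)) h (concat (map (\<lambda>_. [Tick]) [0..<h e]))"
    by (rule emits_loop) (use assms in \<open>auto intro: emits_Out\<close>)
  ultimately have "emits x (out_muladd b d n e) h
    (concat (map (\<lambda>_. replicate (h n) Tick) [0..<h d]) @ concat (map (\<lambda>_. [Tick]) [0..<h e]) @ [Stop])"
    unfolding out_muladd_def by (intro emits_Seq emits_Out)
  then show ?thesis
    by (simp add: rep_replicate replicate_add concat_replicate_upt[of 1, simplified] enc_nat_def)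
qed

text \<open>Two nested loops over the factors visit the pairs in the order of their numbers, as the
  order of rows in the encoding demands.\<close>

lemma concat_upt_mult:
  "concat (map g [0..<m * n]) = concat (map (\<lambda>i. concat (map (\<lambda>j. g (i * n + j)) [0..<n])) [0..<m])"
proof (induction m)
  case (Suc m)
  have "[0..<Suc m * n] = [0..<m * n] @ map (\<lambda>j. m * n + j) [0..<n]"
    using upt_add_eq_append[of 0 "m * n" n] map_add_upt[of "m * n" n] by (simp add: add.commute)
  then show ?case using Suc by (simp add: comp_def)
qed simp

abbreviation (input) "rN1 b \<equiv> Rg b 2"
abbreviation (input) "rN2 b \<equiv> Rg b 3"
abbreviation (input) "rQ1 b \<equiv> Rg b 4"
abbreviation (input) "rQ2 b \<equiv> Rg b 5"
abbreviation (input) "rD1 b \<equiv> Rg b 6"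
abbreviation (input) "rD2 b \<equiv> Rg b 7"

text \<open>The command \<open>extra\<close> runs while the sizes of both factors are still in
  registers; for progress DFAs it emits the flags. The block \<open>b\<close> is a parameter because
  the outer loops over pairs of leading states keep their own registers in another block.\<close>

definition out_prod_aut :: "nat \<Rightarrow> 'a symbol com \<Rightarrow> 'a symbol com \<Rightarrow> nat \<Rightarrow> 'a symbol com \<Rightarrow> 'a symbol com" where
  "out_prod_aut k go1 go2 b extra =
     letin (rN1 b) (get_nstates go1 (rN1 b)) (letin (rN2 b) (get_nstates go2 (rN2 b))
       (out_muladd b (rN1 b) (rN2 b) (rQ1 b) ;;
        letin (rD1 b) (get_initial go1 (rD1 b)) (letin (rD2 b) (get_initial go2 (rD2 b))
          (out_muladd b (rD1 b) (rN2 b) (rD2 b))) ;;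
        loop (rQ1 b) (rN1 b) (loop (rQ2 b) (rN2 b) (seqs (map (\<lambda>l.
          letin (rD1 b) (get_delta k go1 (rQ1 b) l (rD1 b)) (letin (rD2 b) (get_delta k go2 (rQ2 b) l (rD2 b))
            (out_muladd b (rD1 b) (rN2 b) (rD2 b)))) [0..<k]))) ;;
        extra))"

lemma det_out_prod_aut [simp]: "det go1 \<Longrightarrow> det go2 \<Longrightarrow> det extra \<Longrightarrow> det (out_prod_aut k go1 go2 b extra)"
  by (auto simp: out_prod_aut_def)

text \<open>The macros working in block \<open>b\<close> change the registers of this block only,
  while the commands that locate the automata depend on other blocks; \<open>agree\<close>
  transports their property to the changed positions.\<close>

definition agree :: "nat \<Rightarrow> (head \<Rightarrow> nat) \<Rightarrow> (head \<Rightarrow> nat) \<Rightarrow> bool" where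
  "agree b h h' \<longleftrightarrow> (\<forall>r i. r \<noteq> b \<longrightarrow> h' (Rg r i) = h (Rg r i))"

lemma agree_simps [simp]: "agree b h h" "agree b h (h'(Rg b i := v)) \<longleftrightarrow> agree b h h'"
  by (auto simp: agree_def)

lemma agree_flag: "agree b h h' \<Longrightarrow> b \<noteq> 9 \<Longrightarrow> h flag = 0 \<Longrightarrow> h' flag = 0"
  by (simp add: agree_def)

lemma locates_nstates: "locates \<sigma> x go h A ys \<Longrightarrow> nstates A \<le> length x"
  using nstates_le by (auto simp: locates_def)

lemma emits_prod_pairs:
  assumes h: "ok x h" "b \<noteq> 9" "h flag = 0" "h (rN1 b) = m" "h (rN2 b) = n" "h (rQ1 b) = 0" "h (rQ2 b) = 0"
    and body: "\<And>i j. i < m \<Longrightarrow> j < n \<Longrightarrow> emits x body (h(rQ1 b := i, rQ2 b := j)) (out (i * n + j))"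
  shows "emits x (loop (rQ1 b) (rN1 b) (loop (rQ2 b) (rN2 b) body)) h (concat (map out [0..<m * n]))"
proof -
  have m: "m \<le> Suc (length x)" using h(1,4) by (auto simp: ok_def)
  have "emits x (loop (rQ2 b) (rN2 b) body) (h(rQ1 b := i)) (concat (map (\<lambda>j. out (i * n + j)) [0..<n]))"
    if "i < m" for i
  proof (rule emits_loop)
    show "ok x (h(rQ1 b := i))" using h m that by - (rule ok_upd; auto)
  qed (use h body that in auto)
  then have "emits x (loop (rQ1 b) (rN1 b) (loop (rQ2 b) (rN2 b) body)) h
      (concat (map (\<lambda>i. concat (map (\<lambda>j. out (i * n + j)) [0..<n])) [0..<m]))"
    by (rule emits_loop[rotated -1]) (use h in auto)
  then show ?thesis by (simp add: concat_upt_mult)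
qed

lemma emits_out_prod_aut:
  assumes h: "ok x h" "b \<noteq> 9" "\<And>i. h (Rg b i) = 0" "h flag = 0"
    and wf: "wf_aut A" "wf_aut B"
    and loc: "\<And>h'. ok x h' \<Longrightarrow> agree b h h' \<Longrightarrow> locates \<sigma> x go1 h' A ys1"
      "\<And>h'. ok x h' \<Longrightarrow> agree b h h' \<Longrightarrow> locates \<sigma> x go2 h' B ys2"
    and extra: "emits x extra (h(rN1 b := nstates A, rN2 b := nstates B)) out"
  shows "emits x (out_prod_aut (length \<sigma>) go1 go2 b extra) h (enc_aut \<sigma> (prod_aut A B) @ out)"
proof -
  have n: "nstates A \<le> Suc (length x)" "nstates B \<le> Suc (length x)"
    using locates_nstates loc h(1) by (metis agree_simps(1) le_Suc_eq)+
  let ?h = "h(rN1 b := nstates A, rN2 b := nstates B)"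
  have ok1: "ok x (h(rN1 b := nstates A))" using h n by - (rule ok_upd; auto)
  then have okh: "ok x ?h" using n by - (rule ok_upd; auto)
  have st: "i \<le> Suc (length x)" if "i < nstates A \<or> i < nstates B" for i using n that by auto
  have lt: "initial A < nstates A" "initial B < nstates B"
    "\<And>q a. q < nstates A \<Longrightarrow> delta A q a < nstates A" "\<And>q a. q < nstates B \<Longrightarrow> delta B q a < nstates B"
    using wf by (auto simp: wf_aut_def)
  have pair: "emits x (letin (rD1 b) c1 (letin (rD2 b) c2 (out_muladd b (rD1 b) (rN2 b) (rD2 b)))) h'
      (enc_nat (i * nstates B + j))"
    if "ok x h'" "agree b h h'" "h' (rI b) = 0" "h' (rJ b) = 0" "h' (rD1 b) = 0" "h' (rD2 b) = 0"
      "h' (rN2 b) = nstates B" "i < nstates A" "j < nstates B"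
      "sets x c1 h' (rD1 b) i" "sets x c2 (h'(rD1 b := i)) (rD2 b) j" for h' c1 c2 i j
  proof (rule emits_letin[where v = i, OF _ emits_letin[where v = j]])
    have fl: "h' flag = 0" using agree_flag[OF that(2) h(2,4)] .
    have "ok x (h'(rD1 b := i, rD2 b := j))" using that st by - (rule ok_upd, rule ok_upd; auto)
    then have "emits x (out_muladd b (rD1 b) (rN2 b) (rD2 b)) (h'(rD1 b := i, rD2 b := j))
      (enc_nat ((h'(rD1 b := i, rD2 b := j)) (rD1 b) * (h'(rD1 b := i, rD2 b := j)) (rN2 b) +
        (h'(rD1 b := i, rD2 b := j)) (rD2 b)))"
      by (rule emits_out_muladd) (use that h(2) fl in auto)
    then show "emits x (out_muladd b (rD1 b) (rN2 b) (rD2 b)) (h'(rD1 b := i, rD2 b := j)) (enc_nat (i * nstates B + j))"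
      using that by simp
  qed (use that st in auto)
  let ?d = "delta (prod_aut A B)"
  have delta: "emits x (seqs (map (\<lambda>l. letin (rD1 b) (get_delta (length \<sigma>) go1 (rQ1 b) l (rD1 b))
      (letin (rD2 b) (get_delta (length \<sigma>) go2 (rQ2 b) l (rD2 b))
            (out_muladd b (rD1 b) (rN2 b) (rD2 b)))) [0..<length \<sigma>])) (?h(rQ1 b := i, rQ2 b := j))
      (concat (map (\<lambda>a. enc_nat (?d (i * nstates B + j) a)) \<sigma>))"
    if ij: "i < nstates A" "j < nstates B" for i j
  proof -
    let ?g = "?h(rQ1 b := i, rQ2 b := j)"
    have "ok x (?h(rQ1 b := i))" using okh st ij by - (rule ok_upd; auto)
    then have okg: "ok x ?g" using st ij by - (rule ok_upd; auto)
    have "emits x (letin (rD1 b) (get_delta (length \<sigma>) go1 (rQ1 b) l (rD1 b))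
      (letin (rD2 b) (get_delta (length \<sigma>) go2 (rQ2 b) l (rD2 b)) (out_muladd b (rD1 b) (rN2 b) (rD2 b))))
      ?g (enc_nat (delta A i (\<sigma> ! l) * nstates B + delta B j (\<sigma> ! l)))" if l: "l < length \<sigma>" for l
    proof (rule pair)
      show "sets x (get_delta (length \<sigma>) go1 (rQ1 b) l (rD1 b)) ?g (rD1 b) (delta A i (\<sigma> ! l))"
        unfolding sets_def using exec_get_delta[OF loc(1)[OF okg] okg, of "rD1 b" "rQ1 b" l] ij l by simp
      have okg1: "ok x (?g(rD1 b := delta A i (\<sigma> ! l)))" using okg st ij lt by - (rule ok_upd; auto)
      show "sets x (get_delta (length \<sigma>) go2 (rQ2 b) l (rD2 b)) (?g(rD1 b := delta A i (\<sigma> ! l))) (rD2 b) (delta B j (\<sigma> ! l))"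
        unfolding sets_def using exec_get_delta[OF loc(2)[OF okg1] okg1, of "rD2 b" "rQ2 b" l] ij l by simp
    qed (use h okg lt ij in auto)
    then have em: "emits x (seqs (map (\<lambda>l. letin (rD1 b) (get_delta (length \<sigma>) go1 (rQ1 b) l (rD1 b))
      (letin (rD2 b) (get_delta (length \<sigma>) go2 (rQ2 b) l (rD2 b))
            (out_muladd b (rD1 b) (rN2 b) (rD2 b)))) [0..<length \<sigma>])) ?g
      (concat (map (\<lambda>l. enc_nat (delta A i (\<sigma> ! l) * nstates B + delta B j (\<sigma> ! l))) [0..<length \<sigma>]))"
      by (intro emits_seqs) auto
    have eq: "map (\<lambda>l. enc_nat (delta A i (\<sigma> ! l) * nstates B + delta B j (\<sigma> ! l))) [0..<length \<sigma>] =
        map (\<lambda>a. enc_nat (?d (i * nstates B + j) a)) (map ((!) \<sigma>) [0..<length \<sigma>])"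
      using ij by simp
    from em show ?thesis unfolding eq map_nth .
  qed
  \<comment> \<open>Outside of its loop \<open>rQ1 b\<close> is \<open>0\<close>, so it serves as
    the zero summand and the emitted number is the product of the two sizes.\<close>
  have 1: "emits x (out_muladd b (rN1 b) (rN2 b) (rQ1 b)) ?h (enc_nat (nstates (prod_aut A B)))"
    using emits_out_muladd[OF okh, of "rN1 b" "rN2 b" "rQ1 b" b] h by simp
  have ok2: "ok x (?h(rD1 b := initial A))" using okh st lt by - (rule ok_upd; auto)
  have 2: "emits x (letin (rD1 b) (get_initial go1 (rD1 b)) (letin (rD2 b) (get_initial go2 (rD2 b))
          (out_muladd b (rD1 b) (rN2 b) (rD2 b)))) ?h (enc_nat (initial (prod_aut A B)))"
    unfolding prod_simps
  proof (rule pair)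
    show "sets x (get_initial go1 (rD1 b)) ?h (rD1 b) (initial A)"
      unfolding sets_def using exec_get_initial[OF loc(1)[OF okh] okh] by simp
    show "sets x (get_initial go2 (rD2 b)) (?h(rD1 b := initial A)) (rD2 b) (initial B)"
      unfolding sets_def using exec_get_initial[OF loc(2)[OF ok2] ok2] by simp
  qed (use h okh lt in auto)
  have 3: "emits x (loop (rQ1 b) (rN1 b) (loop (rQ2 b) (rN2 b) (seqs (map (\<lambda>l.
          letin (rD1 b) (get_delta (length \<sigma>) go1 (rQ1 b) l (rD1 b)) (letin (rD2 b) (get_delta (length \<sigma>) go2 (rQ2 b) l (rD2 b))
            (out_muladd b (rD1 b) (rN2 b) (rD2 b)))) [0..<length \<sigma>])))) ?h
      (concat (map (\<lambda>q. concat (map (\<lambda>a. enc_nat (?d q a)) \<sigma>)) [0..<nstates A * nstates B]))"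
    by (rule emits_prod_pairs) (use h okh delta in auto)
  have "emits x (out_prod_aut (length \<sigma>) go1 go2 b extra) h
     (enc_nat (nstates (prod_aut A B)) @ enc_nat (initial (prod_aut A B)) @
      concat (map (\<lambda>q. concat (map (\<lambda>a. enc_nat (?d q a)) \<sigma>)) [0..<nstates A * nstates B]) @ out)"
    unfolding out_prod_aut_def
  proof (rule emits_letin[where v = "nstates A", OF _ emits_letin[where v = "nstates B",
        OF _ emits_Seq[OF 1 emits_Seq[OF 2 emits_Seq[OF 3 extra]]]]])
    show "sets x (get_nstates go1 (rN1 b)) h (rN1 b) (nstates A)"
      unfolding sets_def using exec_get_nstates[OF loc(1)[OF h(1)] h(1)] by simp
    show "sets x (get_nstates go2 (rN2 b)) (h(rN1 b := nstates A)) (rN2 b) (nstates B)"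
      unfolding sets_def using exec_get_nstates[OF loc(2)[OF ok1] ok1] by simp
  qed (use h n in auto)
  then show ?thesis by (simp add: enc_aut_def)
qed

text \<open>The connective \<open>\<beta>\<close> is evaluated when the program is built; the
  machine only branches on the two flags.\<close>

definition out_prod_flags :: "(bool \<Rightarrow> bool \<Rightarrow> bool) \<Rightarrow> 'a symbol com \<Rightarrow> 'a symbol com \<Rightarrow> nat \<Rightarrow> 'a symbol com" where
  "out_prod_flags \<beta> go1 go2 b = loop (rQ1 b) (rN1 b) (loop (rQ2 b) (rN2 b)
     (letin (rD1 b) (get_final go1 (rQ1 b) (rD1 b)) (letin (rD2 b) (get_final go2 (rQ2 b) (rD2 b))
       (If (rD1 b) nonzero
         (If (rD2 b) nonzero (Out (if \<beta> True True then Accepting else Rejecting))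
            (Out (if \<beta> True False then Accepting else Rejecting)))
         (If (rD2 b) nonzero (Out (if \<beta> False True then Accepting else Rejecting))
            (Out (if \<beta> False False then Accepting else Rejecting)))))))"

lemma det_out_prod_flags [simp]: "det go1 \<Longrightarrow> det go2 \<Longrightarrow> det (out_prod_flags \<beta> go1 go2 b)"
  by (auto simp: out_prod_flags_def)

lemma concat_singletons: "concat (map (\<lambda>i. [f i]) xs) = map f xs"
  by (induction xs) auto

lemma emits_out_prod_flags:
  assumes h: "ok x h" "b \<noteq> 9" "h flag = 0" "h (rN1 b) = nstates D" "h (rN2 b) = nstates E"
      "h (rQ1 b) = 0" "h (rQ2 b) = 0" "h (rD1 b) = 0" "h (rD2 b) = 0"
    and wf: "wf_dfa D" "wf_dfa E"
    and loc: "\<And>h'. ok x h' \<Longrightarrow> agree b h h' \<Longrightarrow> locates \<sigma> x go1 h' D (flags D @ ys1)"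
      "\<And>h'. ok x h' \<Longrightarrow> agree b h h' \<Longrightarrow> locates \<sigma> x go2 h' E (flags E @ ys2)"
  shows "emits x (out_prod_flags \<beta> go1 go2 b) h (flags (prod_dfa \<beta> D E))"
proof -
  let ?f = "\<lambda>p. if p \<in> final (prod_dfa \<beta> D E) then Accepting else Rejecting"
  have n: "nstates D \<le> Suc (length x)" "nstates E \<le> Suc (length x)"
    using h(1,4,5) by (metis ok_def)+
  have "emits x (out_prod_flags \<beta> go1 go2 b) h (concat (map (\<lambda>p. [?f p]) [0..<nstates D * nstates E]))"
    unfolding out_prod_flags_def
  proof (rule emits_prod_pairs)
    fix i j assume ij: "i < nstates D" "j < nstates E"
    let ?g = "h(rQ1 b := i, rQ2 b := j)"
    let ?v1 = "if i \<in> final D then 1 else 0 :: nat" and ?v2 = "if j \<in> final E then 1 else 0 :: nat"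
    have "ok x (h(rQ1 b := i))" using h n ij by - (rule ok_upd; auto)
    then have okg: "ok x ?g" using n ij by - (rule ok_upd; auto)
    then have okg1: "ok x (?g(rD1 b := ?v1))" by - (rule ok_upd; auto)
    have f: "?f (i * nstates E + j) = (if \<beta> (i \<in> final D) (j \<in> final E) then Accepting else Rejecting)"
      using ij pair_less[OF ij] by simp
    show "emits x (letin (rD1 b) (get_final go1 (rQ1 b) (rD1 b)) (letin (rD2 b) (get_final go2 (rQ2 b) (rD2 b))
       (If (rD1 b) nonzero
         (If (rD2 b) nonzero (Out (if \<beta> True True then Accepting else Rejecting))
            (Out (if \<beta> True False then Accepting else Rejecting)))
         (If (rD2 b) nonzero (Out (if \<beta> False True then Accepting else Rejecting))
            (Out (if \<beta> False False then Accepting else Rejecting)))))) ?g [?f (i * nstates E + j)]"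
      unfolding f
    proof (rule emits_letin[where v = ?v1, OF _ emits_letin[where v = ?v2, OF _ emits_If]])
      show "sets x (get_final go1 (rQ1 b) (rD1 b)) ?g (rD1 b) ?v1"
        unfolding sets_def
        using exec_get_final[OF loc(1)[OF okg] okg, of "rD1 b" "rQ1 b"] ij wf by simp
      show "sets x (get_final go2 (rQ2 b) (rD2 b)) (?g(rD1 b := ?v1)) (rD2 b) ?v2"
        unfolding sets_def
        using exec_get_final[OF loc(2)[OF okg1] okg1, of "rD2 b" "rQ2 b"] ij wf by simp
    qed (use h in \<open>auto intro!: emits_If emits_Out simp: emits_Out\<close>)
  qed (use h in auto)
  then show ?thesis by (simp add: flags_def concat_singletons)
qed

definition out_prod_fdfa :: "(bool \<Rightarrow> bool \<Rightarrow> bool) \<Rightarrow> nat \<Rightarrow> 'a symbol com \<Rightarrow> 'a symbol com \<Rightarrow> 'a symbol com" where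
  "out_prod_fdfa \<beta> k go1 go2 = (out_prod_aut k go1 go2 0 Skip ;;
     letin (rN1 2) (get_nstates go1 (rN1 2)) (letin (rN2 2) (get_nstates go2 (rN2 2))
       (loop (rQ1 2) (rN1 2) (loop (rQ2 2) (rN2 2)
         (out_prod_aut k (go_progress k go1 (rQ1 2)) (go_progress k go2 (rQ2 2)) 1
           (out_prod_flags \<beta> (go_progress k go1 (rQ1 2)) (go_progress k go2 (rQ2 2)) 1))))))"

lemma det_out_prod_fdfa [simp]: "det go1 \<Longrightarrow> det go2 \<Longrightarrow> det (out_prod_fdfa \<beta> k go1 go2)"
  by (auto simp: out_prod_fdfa_def)

lemma emits_out_prod_fdfa:
  assumes h: "ok x h" "\<And>r i. h (Rg r i) = 0" and wf: "wf_fdfa F" "wf_fdfa G"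
    and loc: "\<And>h'. ok x h' \<Longrightarrow> locates \<sigma> x go1 h' (leading F) (dfas \<sigma> F 0 @ ys1)"
      "\<And>h'. ok x h' \<Longrightarrow> locates \<sigma> x go2 h' (leading G) (dfas \<sigma> G 0 @ ys2)"
    and ys: "flagless ys1" "flagless ys2"
  shows "emits x (out_prod_fdfa \<beta> (length \<sigma>) go1 go2) h (enc_fdfa \<sigma> (prod_fdfa \<beta> F G))"
proof -
  let ?k = "length \<sigma>" and ?g1 = "go_progress (length \<sigma>) go1 (rQ1 2)" and ?g2 = "go_progress (length \<sigma>) go2 (rQ2 2)"
  have n: "nstates (leading F) \<le> Suc (length x)" "nstates (leading G) \<le> Suc (length x)"
    using locates_nstates[OF loc(1)[OF h(1)]] locates_nstates[OF loc(2)[OF h(1)]] by auto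
  have wfl: "wf_aut (leading F)" "wf_aut (leading G)" using wf by (auto simp: wf_fdfa_def)
  let ?h = "h(rN1 2 := nstates (leading F), rN2 2 := nstates (leading G))"
  have ok1: "ok x (h(rN1 2 := nstates (leading F)))" using h n by - (rule ok_upd; auto)
  then have okh: "ok x ?h" using n by - (rule ok_upd; auto)
  have 1: "emits x (out_prod_aut ?k go1 go2 0 Skip) h (enc_aut \<sigma> (prod_aut (leading F) (leading G)) @ [])"
    by (rule emits_out_prod_aut) (use h wfl loc in \<open>auto intro: emits_Skip\<close>)
  have 2: "emits x (out_prod_aut ?k ?g1 ?g2 1 (out_prod_flags \<beta> ?g1 ?g2 1)) (?h(rQ1 2 := i, rQ2 2 := j))
     (enc_dfa \<sigma> (progress (prod_fdfa \<beta> F G) (i * nstates (leading G) + j)))"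
    if ij: "i < nstates (leading F)" "j < nstates (leading G)" for i j
  proof -
    let ?D = "progress F i" and ?E = "progress G j" and ?g = "?h(rQ1 2 := i, rQ2 2 := j)"
    have wfp: "wf_dfa ?D" "wf_dfa ?E" using wf ij by (auto simp: wf_fdfa_def)
    have "ok x (?h(rQ1 2 := i))" using okh n ij by - (rule ok_upd; auto)
    then have okg: "ok x ?g" using n ij by - (rule ok_upd; auto)
    have loc1: "locates \<sigma> x ?g1 h' ?D (flags ?D @ dfas \<sigma> F (Suc i) @ ys1)" if "ok x h'" "agree 1 ?g h'" for h'
    proof -
      have "h' (rQ1 2) = i" using that(2) by (simp add: agree_def)
      then show ?thesis using locates_progress[OF loc(1)[OF that(1)] wf(1) that(1), of "rQ1 2"] ij ys by simp
    qed
    have loc2: "locates \<sigma> x ?g2 h' ?E (flags ?E @ dfas \<sigma> G (Suc j) @ ys2)" if "ok x h'" "agree 1 ?g h'" for h'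
    proof -
      have "h' (rQ2 2) = j" using that(2) by (simp add: agree_def)
      then show ?thesis using locates_progress[OF loc(2)[OF that(1)] wf(2) that(1), of "rQ2 2"] ij ys by simp
    qed
    have np: "nstates ?D \<le> Suc (length x)" "nstates ?E \<le> Suc (length x)"
      using locates_nstates[OF loc1[OF okg]] locates_nstates[OF loc2[OF okg]] by auto
    have "ok x (?g(rN1 1 := nstates ?D))" using okg np by - (rule ok_upd; auto)
    then have okf: "ok x (?g(rN1 1 := nstates ?D, rN2 1 := nstates ?E))" using np by - (rule ok_upd; auto)
    have "emits x (out_prod_flags \<beta> ?g1 ?g2 1) (?g(rN1 1 := nstates ?D, rN2 1 := nstates ?E)) (flags (prod_dfa \<beta> ?D ?E))"
      by (rule emits_out_prod_flags[OF okf]) (use h wfp loc1 loc2 in \<open>auto simp: agree_def\<close>)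
    then have "emits x (out_prod_aut ?k ?g1 ?g2 1 (out_prod_flags \<beta> ?g1 ?g2 1)) ?g
      (enc_aut \<sigma> (prod_aut ?D ?E) @ flags (prod_dfa \<beta> ?D ?E))"
      by (intro emits_out_prod_aut[OF okg _ _ _ _ _ loc1 loc2]) (use h wfp in \<open>auto simp: wf_dfa_def\<close>)
    moreover have "enc_aut \<sigma> (prod_dfa \<beta> ?D ?E) = enc_aut \<sigma> (prod_aut ?D ?E)" by (simp add: enc_aut_def)
    ultimately show ?thesis using ij by (simp add: enc_dfa_flags)
  qed
  have 3: "emits x (loop (rQ1 2) (rN1 2) (loop (rQ2 2) (rN2 2)
         (out_prod_aut ?k ?g1 ?g2 1 (out_prod_flags \<beta> ?g1 ?g2 1)))) ?h
     (concat (map (\<lambda>q. enc_dfa \<sigma> (progress (prod_fdfa \<beta> F G) q)) [0..<nstates (leading F) * nstates (leading G)]))"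
    by (rule emits_prod_pairs) (use h okh 2 in auto)
  have "emits x (out_prod_fdfa \<beta> ?k go1 go2) h
    ((enc_aut \<sigma> (prod_aut (leading F) (leading G)) @ []) @
     concat (map (\<lambda>q. enc_dfa \<sigma> (progress (prod_fdfa \<beta> F G) q)) [0..<nstates (leading F) * nstates (leading G)]))"
    unfolding out_prod_fdfa_def
  proof (rule emits_Seq[OF 1 emits_letin[where v = "nstates (leading F)",
        OF _ emits_letin[where v = "nstates (leading G)", OF _ 3]]])
    show "sets x (get_nstates go1 (rN1 2)) h (rN1 2) (nstates (leading F))"
      unfolding sets_def using exec_get_nstates[OF loc(1)[OF h(1)] h(1)] by simp
    show "sets x (get_nstates go2 (rN2 2)) (h(rN1 2 := nstates (leading F))) (rN2 2) (nstates (leading G))"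
      unfolding sets_def using exec_get_nstates[OF loc(2)[OF ok1] ok1] by simp
  qed (use h n in auto)
  then show ?thesis by (simp add: enc_fdfa_def)
qed

definition go_first :: "'a symbol com" where
  "go_first = Move P MoveRight"

definition go_next :: "'a symbol com \<Rightarrow> 'a symbol com" where
  "go_next go = (go ;; scanwhile (- {Separator}) ;; Move P MoveRight)"

lemma det_go [simp]: "det go_first" "det (go_next go) \<longleftrightarrow> det go"
  by (simp_all add: go_first_def go_next_def)

definition goes :: "'s list \<Rightarrow> 's com \<Rightarrow> 's list \<Rightarrow> bool" where
  "goes x go ys \<longleftrightarrow> suffix ys x \<and> (\<forall>h w. ok x h \<longrightarrow> exec x go (h, w) (h(P := pos x ys), w))"

lemma goes_first: "goes x go_first x"
proof -
  have "exec x (Move P MoveRight) (h, w) (h(P := pos x x), w)" if "ok x h" for h w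
    by (rule exec_target[OF exec_MoveRight]) (use that in \<open>auto simp: ok_def pos_self\<close>)
  then show ?thesis by (simp add: goes_def go_first_def)
qed

lemma goes_next:
  assumes "goes x go (zs @ Separator # ys)" "Separator \<notin> set zs"
  shows "goes x (go_next go) ys"
proof -
  have s: "suffix (zs @ Separator # ys) x" using assms(1) by (simp add: goes_def)
  then have s2: "suffix (Separator # ys) x" by (rule suffix_appD2)
  have "exec x (go_next go) (h, w) (h(P := pos x ys), w)" if "ok x h" for h w
    unfolding go_next_def
  proof (intro exec.Seq)
    show "exec x go (h, w) (h(P := pos x (zs @ Separator # ys)), w)" using assms(1) that by (simp add: goes_def)
    show "exec x (scanwhile (- {Separator})) (h(P := pos x (zs @ Separator # ys)), w) (h(P := pos x (Separator # ys)), w)"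
      by (rule exec_scanwhile[OF s]) (use assms(2) in auto)
    show "exec x (Move P MoveRight) (h(P := pos x (Separator # ys)), w) (h(P := pos x ys), w)"
      by (rule exec_next[OF s2])
  qed
  then show ?thesis using suffix_ConsD2[OF s2] by (simp add: goes_def)
qed

lemma locates_leading:
  "goes x go (enc_fdfa \<sigma> F @ ys) \<Longrightarrow> ok x h \<Longrightarrow> locates \<sigma> x go h (leading F) (dfas \<sigma> F 0 @ ys)"
  by (simp add: goes_def locates_def enc_fdfa_dfas)

lemma ok_start: "ok x (\<lambda>_. 0)"
  by (simp add: ok_def)

lemma Separator_enc_fdfa: "Separator \<notin> set (enc_fdfa \<sigma> F)"
  using set_enc_fdfa[of \<sigma> F] by auto

lemma product_computable:
  "computable_in_space log_space (enc_fdfa_pair \<sigma>) (enc_fdfa \<sigma>) (sat_fdfas \<times> sat_fdfas)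
     (\<lambda>(F, F') G. G \<in> sat_fdfas \<and> fdfa_lang G = {w \<in> up_words. \<beta> (w \<in> fdfa_lang F) (w \<in> fdfa_lang F')})"
proof (rule computable_by_program[where c = "out_prod_fdfa \<beta> (length \<sigma>) go_first (go_next go_first)"])
  fix FG :: "'a fdfa \<times> 'a fdfa" assume "FG \<in> sat_fdfas \<times> sat_fdfas"
  then obtain F G where FG: "FG = (F, G)" "F \<in> sat_fdfas" "G \<in> sat_fdfas" by auto
  let ?x = "enc_fdfa_pair \<sigma> FG"
  have x: "?x = enc_fdfa \<sigma> F @ Separator # enc_fdfa \<sigma> G" by (simp add: enc_fdfa_pair_def FG)
  then have g1: "goes ?x go_first (enc_fdfa \<sigma> F @ Separator # enc_fdfa \<sigma> G)" using goes_first by metis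
  from goes_next[OF this Separator_enc_fdfa] have g2: "goes ?x (go_next go_first) (enc_fdfa \<sigma> G @ [])" by simp
  have "emits ?x (out_prod_fdfa \<beta> (length \<sigma>) go_first (go_next go_first)) (\<lambda>_. 0) (enc_fdfa \<sigma> (prod_fdfa \<beta> F G))"
    by (rule emits_out_prod_fdfa[OF ok_start _ _ _ locates_leading[OF g1] locates_leading[OF g2]])
      (use FG sat_fdfas_D in \<open>auto simp: flagless_def\<close>)
  then have "exec ?x (out_prod_fdfa \<beta> (length \<sigma>) go_first (go_next go_first)) start (\<lambda>_. 0, [] @ enc_fdfa \<sigma> (prod_fdfa \<beta> F G))"
    unfolding emits_def by blast
  then show "\<exists>h r. exec ?x (out_prod_fdfa \<beta> (length \<sigma>) go_first (go_next go_first)) start (h, enc_fdfa \<sigma> r) \<and>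
    (case FG of (F, F') \<Rightarrow> \<lambda>G. G \<in> sat_fdfas \<and> fdfa_lang G = {w \<in> up_words. \<beta> (w \<in> fdfa_lang F) (w \<in> fdfa_lang F')}) r"
    using prod_fdfa[OF FG(2,3), of \<beta>] FG(1) by auto
qed simp

lemma intersection_computable:
  "computable_in_space log_space (enc_fdfa_pair \<sigma>) (enc_fdfa \<sigma>) (sat_fdfas \<times> sat_fdfas)
     (\<lambda>(F, F') G. G \<in> sat_fdfas \<and> fdfa_lang G = fdfa_lang F \<inter> fdfa_lang F')"
proof -
  have "{w \<in> up_words. w \<in> fdfa_lang F \<and> w \<in> fdfa_lang F'} = fdfa_lang F \<inter> fdfa_lang F'" for F F' :: "'a fdfa"
    using fdfa_lang_up by blast
  with product_computable[of \<sigma> "(\<and>)"] show ?thesis by simp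
qed

lemma union_computable:
  "computable_in_space log_space (enc_fdfa_pair \<sigma>) (enc_fdfa \<sigma>) (sat_fdfas \<times> sat_fdfas)
     (\<lambda>(F, F') G. G \<in> sat_fdfas \<and> fdfa_lang G = fdfa_lang F \<union> fdfa_lang F')"
proof -
  have "{w \<in> up_words. w \<in> fdfa_lang F \<or> w \<in> fdfa_lang F'} = fdfa_lang F \<union> fdfa_lang F'" for F F' :: "'a fdfa"
    using fdfa_lang_up by blast
  with product_computable[of \<sigma> "(\<or>)"] show ?thesis by simp
qed

section \<open>Membership\<close>

text \<open>The column of the transition table is a constant of the program, so there is one copy of
  the look-up for each letter, and the scanned letter selects among them.\<close>

fun switch :: "'a list \<Rightarrow> head \<Rightarrow> (nat \<Rightarrow> 'a symbol com) \<Rightarrow> nat list \<Rightarrow> 'a symbol com" where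
  "switch \<sigma> p c [] = Skip"
| "switch \<sigma> p c (i # js) = If p {Sym (Letter (\<sigma> ! i))} (c i) (switch \<sigma> p c js)"

lemma det_switch [simp]: "det (switch \<sigma> p c js) \<longleftrightarrow> (\<forall>i \<in> set js. det (c i))"
  by (induction js) auto

lemma exec_switch:
  assumes "i \<in> set js" "\<And>i'. i' \<in> set js \<Longrightarrow> \<sigma> ! i' = \<sigma> ! i \<Longrightarrow> i' = i"
    "scan x (fst s p) = Sym (Letter (\<sigma> ! i))" "exec x (c i) s t"
  shows "exec x (switch \<sigma> p c js) s t"
  using assms(1,2)
proof (induction js)
  case (Cons i' js)
  show ?case
  proof (cases "i' = i")
    case True
    then show ?thesis using assms(3,4) by (auto intro: exec.IfTrue)
  next
    case False
    with Cons have "exec x (switch \<sigma> p c js) s t" "\<sigma> ! i' \<noteq> \<sigma> ! i" by auto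
    then show ?thesis using assms(3) by (auto intro: exec.IfFalse)
  qed
qed simp

abbreviation (input) "rW \<equiv> Rg 3 0"

text \<open>The position in the word is handed over to \<open>rW\<close>, because each transition
  needs the pointer \<open>P\<close> to search the transition table.\<close>

definition read_word :: "'a list \<Rightarrow> 'a symbol com \<Rightarrow> 'a symbol com \<Rightarrow> head \<Rightarrow> 'a symbol com" where
  "read_word \<sigma> gow go q = (gow ;; drain P rW ;;
     While rW (Sym ` range Letter)
       (switch \<sigma> rW (\<lambda>i. get_delta (length \<sigma>) go q i q) [0..<length \<sigma>] ;; Move rW MoveRight) ;;
     reset rW)"

lemma det_read_word [simp]: "det gow \<Longrightarrow> det go \<Longrightarrow> det (read_word \<sigma> gow go q)"
  by (auto simp: read_word_def)

lemma exec_read_word: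
  assumes \<sigma>: "distinct \<sigma>" "set \<sigma> = UNIV" and A: "wf_aut A"
    and gow: "goes x gow (map Letter v @ ys)" "ys = [] \<or> List.hd ys \<notin> range Letter"
    and h: "ok x h" "h rW = 0" "is_Rg q" "q \<noteq> rW" "h q < nstates A"
    and loc: "\<And>h'. ok x h' \<Longrightarrow> (\<And>a. a \<noteq> q \<Longrightarrow> a \<noteq> rW \<Longrightarrow> h' a = h a) \<Longrightarrow> locates \<sigma> x go h' A zs"
  shows "exec x (read_word \<sigma> gow go q) (h, w) (h(q := run A (h q) v), w)"
proof -
  let ?body = "switch \<sigma> rW (\<lambda>i. get_delta (length \<sigma>) go q i q) [0..<length \<sigma>] ;; Move rW MoveRight"
  have n: "nstates A \<le> length x" using locates_nstates[OF loc[OF h(1)]] by simp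
  have loop: "exec x (While rW (Sym ` range Letter) ?body)
     (h(q := s, rW := pos x (map Letter v @ ys)), w) (h(q := run A s v, rW := pos x ys), w)"
    if "suffix (map Letter v @ ys) x" "s < nstates A" for s v
    using that
  proof (induction v arbitrary: s)
    case Nil
    have "scan x (pos x ys) \<notin> Sym ` range Letter"
      using gow(2) Nil by (cases ys) (auto simp: pos_Nil pos_Cons(1))
    then show ?case by (auto intro: exec.WhileFalse)
  next
    case (Cons a v)
    let ?p = "pos x (Letter a # map Letter v @ ys)" and ?p' = "pos x (map Letter v @ ys)"
    have suf: "suffix (Letter a # map Letter v @ ys) x" using Cons.prems by simp
    obtain i where i: "i < length \<sigma>" "a = \<sigma> ! i" using \<sigma>(2) by (metis UNIV_I in_set_conv_nth)
    have s': "delta A s a < nstates A" using A Cons.prems(2) by (auto simp: wf_aut_def)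
    let ?h = "h(q := s, rW := ?p)"
    have okq: "ok x (h(q := s))" using h n Cons.prems(2) by - (rule ok_upd; auto)
    then have okh: "ok x ?h" by - (rule ok_upd; auto)
    have "exec x (get_delta (length \<sigma>) go q i q) (?h, w) (?h(q := delta A (?h q) (\<sigma> ! i)), w)"
      by (rule exec_get_delta[OF loc[OF okh] okh]) (use h i Cons.prems(2) in auto)
    then have "exec x (get_delta (length \<sigma>) go q i q) (?h, w) (?h(q := delta A s a), w)"
      using h(4) i by simp
    then have 1: "exec x (switch \<sigma> rW (\<lambda>i. get_delta (length \<sigma>) go q i q) [0..<length \<sigma>]) (?h, w) (?h(q := delta A s a), w)"
      by (intro exec_switch[of i]) (use i \<sigma>(1) h(4) pos_Cons(1)[OF suf] in \<open>auto simp: nth_eq_iff_index_eq\<close>)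
    have 2: "exec x (Move rW MoveRight) (?h(q := delta A s a), w) (h(q := delta A s a, rW := ?p'), w)"
      by (rule exec_target[OF exec_MoveRight]) (use pos_Cons[OF suf] h in \<open>auto simp: fun_eq_iff\<close>)
    have 3: "exec x (While rW (Sym ` range Letter) ?body)
      (h(q := delta A s a, rW := ?p'), w) (h(q := run A (delta A s a) v, rW := pos x ys), w)"
      by (rule Cons.IH) (use suffix_ConsD2[OF suf] s' in auto)
    have "scan x (fst (?h, w) rW) \<in> Sym ` range Letter" using pos_Cons(1)[OF suf] by simp
    from exec.WhileTrue[OF this exec.Seq[OF 1 2] 3] show ?case
      unfolding list.map append_Cons run_Cons .
  qed
  show ?thesis unfolding read_word_def
  proof (intro exec.Seq)
    let ?p = "pos x (map Letter v @ ys)"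
    show "exec x gow (h, w) (h(P := ?p), w)" using gow(1) h(1) by (simp add: goes_def)
    show "exec x (drain P rW) (h(P := ?p), w) (h(q := h q, rW := ?p), w)"
      by (rule exec_target[OF exec_drain]) (use h in \<open>auto simp: fun_eq_iff ok_def\<close>)
    show "exec x (While rW (Sym ` range Letter) ?body) (h(q := h q, rW := ?p), w)
      (h(q := run A (h q) v, rW := pos x ys), w)"
      by (rule loop) (use gow(1) h in \<open>auto simp: goes_def\<close>)
    show "exec x (reset rW) (h(q := run A (h q) v, rW := pos x ys), w) (h(q := run A (h q) v), w)"
      by (rule exec_target[OF exec_reset]) (use h in \<open>auto simp: fun_eq_iff\<close>)
  qed
qed

text \<open>For \<open>k = 1, 2, ...\<close> the \<open>k\<close>-th iterate of the value in
  \<open>q0\<close> is computed in \<open>q1\<close> and iterated \<open>k\<close> more times in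
  \<open>q2\<close>, until both agree. Every attempt starts anew from \<open>q0\<close>, so only the
  exponent is carried along; it remains in \<open>k\<close>, and the idempotent value in
  \<open>q1\<close>.\<close>

definition search :: "head \<Rightarrow> head \<Rightarrow> head \<Rightarrow> head \<Rightarrow> head \<Rightarrow> (head \<Rightarrow> 's com) \<Rightarrow> 's com" where
  "search i k q0 q1 q2 st = (set1 flag ;;
     While flag nonzero (reset flag ;; Move k MoveRight ;;
       copy q0 q1 ;; loop i k (st q1) ;; copy q1 q2 ;; loop i k (st q2) ;; neq q1 q2 flag) ;;
     reset q2)"

lemma det_search [simp]: "det (st q1) \<Longrightarrow> det (st q2) \<Longrightarrow> det (search i k q0 q1 q2 st)"
  by (simp add: search_def)

lemma exec_search:
  assumes h: "ok x h" "h flag = 0" "h k = 0" "h q1 = 0" "h q2 = 0" "h i = 0" "h q0 < n"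
    and regs: "is_Rg i" "is_Rg k" "is_Rg q0" "is_Rg q1" "is_Rg q2" "distinct [i, k, q0, q1, q2, flag]"
    and n: "n \<le> length x" "\<And>q. q < n \<Longrightarrow> f q < n"
    and st: "\<And>h' w r. ok x h' \<Longrightarrow> (\<And>a. a \<notin> {k, q1, q2, i} \<Longrightarrow> h' a = h a) \<Longrightarrow> r \<in> {q1, q2} \<Longrightarrow> h' r < n \<Longrightarrow>
      exec x (st r) (h', w) (h'(r := f (h' r)), w)"
  shows "\<exists>K. 0 < K \<and> K \<le> n \<and> (f ^^ K) ((f ^^ K) (h q0)) = (f ^^ K) (h q0) \<and>
     exec x (search i k q0 q1 q2 st) (h, w) (h(k := K, q1 := (f ^^ K) (h q0)), w)"
proof -
  let ?s = "h q0"
  let ?good = "\<lambda>K. 0 < K \<and> (f ^^ K) ((f ^^ K) ?s) = (f ^^ K) ?s"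
  \<comment> \<open>The program stops at the least exponent, which is at most the one from
    \<open>idempotent_power\<close> and therefore fits into a head position.\<close>
  define K where "K = (LEAST K. ?good K)"
  obtain K0 where K0: "?good K0" "K0 \<le> n" using idempotent_power[of n f ?s] n(2) h(7) by blast
  have K: "?good K" "K \<le> n" using LeastI[of ?good K0] Least_le[of ?good K0] K0 by (auto simp: K_def)
  have notgood: "(f ^^ j) ((f ^^ j) ?s) \<noteq> (f ^^ j) ?s" if "0 < j" "j < K" for j
    using not_less_Least[of j ?good] that by (auto simp: K_def)
  have fn: "(f ^^ j) v < n" if "v < n" for j v using n(2) that by (induction j) auto
  have le: "v \<le> Suc (length x)" if "v < n" for v using that n(1) by simp
  have iter: "exec x (loop i k (st r)) (g, w) (g(r := (f ^^ g k) (g r)), w)"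
    if g: "ok x g" "\<And>a. a \<notin> {k, q1, q2} \<Longrightarrow> g a = h a" "r \<in> {q1, q2}" "g r < n" "g k \<le> Suc (length x)" for g r
  proof -
    let ?g = "\<lambda>j. g(r := (f ^^ j) (g r))"
    have r: "is_Rg r" "r \<noteq> i" "r \<noteq> k" "r \<noteq> flag" using g(3) regs by auto
    have okg: "ok x (?g j)" for j using g(1,4) r fn le by - (rule ok_upd; auto)
    have "exec x (loop i k (st r)) (?g 0, w) (?g (g k), w)"
    proof (rule exec_loop[where h = ?g and w = "\<lambda>_. w"])
      fix j assume j: "j < g k"
      have okj: "ok x ((?g j)(i := j))" using okg g(5) j regs by - (rule ok_upd; auto)
      have "exec x (st r) ((?g j)(i := j), w) (((?g j)(i := j))(r := f (((?g j)(i := j)) r)), w)"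
        by (rule st[OF okj]) (use g r fn in auto)
      then show "exec x (st r) ((?g j)(i := j), w) ((?g (Suc j))(i := j), w)"
        by (rule exec_target) (use r in \<open>auto simp: fun_eq_iff\<close>)
    qed (use g okg r regs h in auto)
    then show ?thesis by simp
  qed
  \<comment> \<open>Contents of \<open>q1\<close> and \<open>q2\<close> after \<open>j\<close>
    attempts. Before the first attempt they are \<open>0\<close> and not the zeroth iterate, which
    would be the start value.\<close>
  let ?A = "\<lambda>j. if j = 0 then 0 else (f ^^ j) ?s" and ?B = "\<lambda>j. if j = 0 then 0 else (f ^^ j) ((f ^^ j) ?s)"
  let ?F = "\<lambda>j. if j < K then 1 else 0 :: nat"
  let ?S = "\<lambda>j. (h(k := j, q1 := ?A j, q2 := ?B j, flag := ?F j), w)"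
  let ?body = "reset flag ;; Move k MoveRight ;;
       copy q0 q1 ;; loop i k (st q1) ;; copy q1 q2 ;; loop i k (st q2) ;; neq q1 q2 flag"
  have AB: "?A j < n" "?B j < n" for j using fn h(7) by auto
  have body: "exec x ?body (?S j) (?S (Suc j))" if j: "j < K" for j
  proof (intro exec.Seq)
    let ?v = "(f ^^ Suc j) ?s"
    have kl: "Suc j \<le> Suc (length x)" using j K(2) n(1) by simp
    have v: "?v < n" "(f ^^ Suc j) ?v < n" using fn h(7) by blast+
    have okB: "ok x (h(k := l, q1 := a, q2 := b))" if "l \<le> Suc (length x)" "a < n" "b < n" for l a b
      using h(1) regs that le by - (rule ok_upd, rule ok_upd, rule ok_upd; auto)
    have ok3: "ok x (h(k := Suc j, q1 := a, q2 := b))" if "a < n" "b < n" for a b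
      using okB[OF kl that] .
    show "exec x (reset flag) (?S j) (h(k := j, q1 := ?A j, q2 := ?B j), w)"
      by (rule exec_target[OF exec_reset]) (use regs h in \<open>auto simp: fun_eq_iff\<close>)
    show "exec x (Move k MoveRight) (h(k := j, q1 := ?A j, q2 := ?B j), w) (h(k := Suc j, q1 := ?A j, q2 := ?B j), w)"
      by (rule exec_target[OF exec_MoveRight]) (use regs kl in \<open>auto simp: fun_eq_iff\<close>)
    have bd: "g (Sc 3) = 0 \<and> (\<forall>a. g a \<le> Suc (length x))" if "ok x g" for g using that by (auto simp: ok_def)
    show "exec x (copy q0 q1) (h(k := Suc j, q1 := ?A j, q2 := ?B j), w) (h(k := Suc j, q1 := ?s, q2 := ?B j), w)"
      by (rule exec_target[OF exec_copy])
        (use regs bd[OF ok3[OF AB, of j j]] in \<open>auto simp: fun_eq_iff simp del: fun_upd_apply\<close>, use regs in \<open>auto simp: fun_eq_iff\<close>)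
    have "exec x (loop i k (st q1)) (h(k := Suc j, q1 := ?s, q2 := ?B j), w)
       ((h(k := Suc j, q1 := ?s, q2 := ?B j))(q1 := (f ^^ (h(k := Suc j, q1 := ?s, q2 := ?B j)) k) ((h(k := Suc j, q1 := ?s, q2 := ?B j)) q1)), w)"
      by (rule iter) (use ok3 AB h(7) regs kl in auto)
    then show "exec x (loop i k (st q1)) (h(k := Suc j, q1 := ?s, q2 := ?B j), w) (h(k := Suc j, q1 := ?v, q2 := ?B j), w)"
      by (rule exec_target) (use regs in \<open>auto simp: fun_eq_iff\<close>)
    show "exec x (copy q1 q2) (h(k := Suc j, q1 := ?v, q2 := ?B j), w) (h(k := Suc j, q1 := ?v, q2 := ?v), w)"
      by (rule exec_target[OF exec_copy])
        (use regs bd[OF ok3[OF v(1) AB(2), of j]] in \<open>auto simp: fun_eq_iff simp del: fun_upd_apply\<close>, use regs in \<open>auto simp: fun_eq_iff\<close>)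
    let ?g = "h(k := Suc j, q1 := ?v, q2 := ?v)"
    have "exec x (loop i k (st q2)) (?g, w) (?g(q2 := (f ^^ ?g k) (?g q2)), w)"
      by (rule iter) (use ok3 v regs kl in auto)
    then show "exec x (loop i k (st q2)) (?g, w) (h(k := Suc j, q1 := ?v, q2 := (f ^^ Suc j) ?v), w)"
      by (rule exec_target) (use regs in \<open>auto simp: fun_eq_iff\<close>)
    have "?F (Suc j) = (if ?v = (f ^^ Suc j) ?v then 0 else 1)"
      using notgood[of "Suc j"] K(1) j by (cases "Suc j = K") auto
    then show "exec x (neq q1 q2 flag) (h(k := Suc j, q1 := ?v, q2 := (f ^^ Suc j) ?v), w) (?S (Suc j))"
      by (intro exec_target[OF exec_neq[OF ok3[OF v]]]) (use regs h in \<open>auto simp: fun_eq_iff\<close>)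
  qed
  have "exec x (search i k q0 q1 q2 st) (h, w) (h(k := K, q1 := (f ^^ K) ?s), w)"
    unfolding search_def
  proof (intro exec.Seq)
    show "exec x (set1 flag) (h, w) (?S 0)"
      by (rule exec_target[OF exec_set1]) (use h K regs in \<open>auto simp: fun_eq_iff\<close>)
    have "exec x (While flag nonzero ?body) (?S (K - K)) (?S (K - 0))"
    proof (rule exec_countdown[where f = "\<lambda>j. ?S (K - j)"])
      fix j assume "j < K"
      then show "exec x ?body (?S (K - Suc j)) (?S (K - j))"
        using body[of "K - Suc j"] by (simp add: Suc_diff_Suc)
    qed auto
    then show "exec x (While flag nonzero ?body) (?S 0) (?S K)"
      by (simp only: diff_self_eq_0 minus_nat.diff_0)
    show "exec x (reset q2) (?S K) (h(k := K, q1 := (f ^^ K) ?s), w)"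
      by (rule exec_target[OF exec_reset]) (use le[OF AB(2)[of K]] K h regs in \<open>auto simp: fun_eq_iff\<close>)
  qed
  then show ?thesis using K by blast
qed

abbreviation (input) "rK \<equiv> Rg 4 0"
abbreviation (input) "rU \<equiv> Rg 4 1"
abbreviation (input) "rQ \<equiv> Rg 4 2"
abbreviation (input) "rQ' \<equiv> Rg 4 3"
abbreviation (input) "rM \<equiv> Rg 5 0"
abbreviation (input) "rI0 \<equiv> Rg 5 1"
abbreviation (input) "rP \<equiv> Rg 5 2"
abbreviation (input) "rP' \<equiv> Rg 5 3"
abbreviation (input) "rAns \<equiv> Rg 6 0"

text \<open>The first search finds the exponent \<open>rK\<close> and the leading state
  \<open>rQ\<close>, which selects the progress DFA. One application in the second search reads the
  word \<open>rK\<close> times. The last command inverts the answer, because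
  \<open>decidable_by_program\<close> takes \<open>0\<close> for yes.\<close>

definition membership :: "'a list \<Rightarrow> 'a symbol com" where
  "membership \<sigma> = (
     let gou = go_next go_first; gov = go_next gou; gop = go_progress (length \<sigma>) go_first rQ in
     get_initial go_first rU ;; read_word \<sigma> gou go_first rU ;;
     search (Rg 3 1) rK rU rQ rQ' (read_word \<sigma> gov go_first) ;;
     get_initial gop rI0 ;;
     search (Rg 3 2) rM rI0 rP rP' (\<lambda>r. loop (Rg 3 1) rK (read_word \<sigma> gov gop r)) ;;
     get_final gop rP rAns ;;
     If rAns nonzero (reset rAns) (set1 rAns))"

lemma det_membership: "det (membership \<sigma>)"
  by (simp add: membership_def Let_def)

lemma exec_membership:
  assumes \<sigma>: "distinct \<sigma>" "set \<sigma> = UNIV" and F: "F \<in> sat_fdfas" and v: "v \<noteq> []"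
  shows "\<exists>h. exec (enc_fdfa_words \<sigma> (F, u, v)) (membership \<sigma>) start (h, []) \<and>
     (h rAns = 0 \<longleftrightarrow> (u, v) \<in> accepted F)"
proof -
  let ?x = "enc_fdfa_words \<sigma> (F, u, v)"
  let ?ys = "Separator # map Letter u @ Separator # map Letter v"
  let ?gou = "go_next go_first" and ?gov = "go_next (go_next go_first)"
    and ?gop = "go_progress (length \<sigma>) go_first rQ"
  note wf = sat_fdfas_D(1)[OF F] and sat = sat_fdfas_D(2)[OF F]
  have x: "?x = enc_fdfa \<sigma> F @ ?ys" by (simp add: enc_fdfa_words_def)
  then have g1: "goes ?x go_first (enc_fdfa \<sigma> F @ ?ys)" using goes_first by metis
  note g2 = goes_next[OF g1 Separator_enc_fdfa]
  have g3: "goes ?x ?gov (map Letter v @ [])" using goes_next[OF g2] by auto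
  note loc = locates_leading[OF g1]
  have fl: "flagless ?ys" by (simp add: flagless_def)
  let ?L = "leading F" and ?h0 = "\<lambda>_ :: head. 0 :: nat"
  have L: "wf_aut ?L" using wf by (simp add: wf_fdfa_def)
  have nL: "nstates ?L \<le> length ?x" using locates_nstates[OF loc[OF ok_start]] .
  let ?u0 = "initial ?L" and ?q0 = "reached ?L u"
  let ?h1 = "?h0(rU := ?u0)" and ?h2 = "?h0(rU := ?q0)"
  have u0: "?u0 < nstates ?L" and q0: "?q0 < nstates ?L"
    using L reached_less[OF L] by (auto simp: wf_aut_def)
  have e1: "exec ?x (get_initial go_first rU) (?h0, []) (?h1, [])"
    by (rule exec_get_initial[OF loc[OF ok_start] ok_start]) simp
  have ok1: "ok ?x ?h1" and ok2: "ok ?x ?h2" using u0 q0 nL ok_start by - (rule ok_upd; auto)+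
  have "exec ?x (read_word \<sigma> ?gou go_first rU) (?h1, []) (?h1(rU := run ?L (?h1 rU) u), [])"
    by (rule exec_read_word[OF \<sigma> L g2 _ ok1 _ _ _ _ loc]) (use u0 in auto)
  then have e2: "exec ?x (read_word \<sigma> ?gou go_first rU) (?h1, []) (?h2, [])"
    by (simp add: reached_run)
  let ?f = "\<lambda>q. run ?L q v"
  have "\<exists>K. 0 < K \<and> K \<le> nstates ?L \<and> (?f ^^ K) ((?f ^^ K) (?h2 rU)) = (?f ^^ K) (?h2 rU) \<and>
     exec ?x (search (Rg 3 1) rK rU rQ rQ' (read_word \<sigma> ?gov go_first)) (?h2, []) (?h2(rK := K, rQ := (?f ^^ K) (?h2 rU)), [])"
  proof (rule exec_search[OF ok2, where n = "nstates ?L"])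
    fix h' :: "head \<Rightarrow> nat" and w r
    assume *: "ok ?x h'" "\<And>a. a \<notin> {rK, rQ, rQ', Rg 3 1} \<Longrightarrow> h' a = ?h2 a" "r \<in> {rQ, rQ'}" "h' r < nstates ?L"
    show "exec ?x (read_word \<sigma> ?gov go_first r) (h', w) (h'(r := run ?L (h' r) v), w)"
      by (rule exec_read_word[OF \<sigma> L g3 _ *(1) _ _ _ _ loc]) (use * in auto)
  qed (use q0 nL run_less[OF L] in auto)
  then obtain K where K: "0 < K" "K \<le> nstates ?L" "(?f ^^ K) ((?f ^^ K) ?q0) = (?f ^^ K) ?q0"
    and e3: "exec ?x (search (Rg 3 1) rK rU rQ rQ' (read_word \<sigma> ?gov go_first)) (?h2, [])
      (?h2(rK := K, rQ := (?f ^^ K) ?q0), [])" by auto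
  define q1 where "q1 = (?f ^^ K) ?q0"
  have q1r: "q1 = run ?L ?q0 (rep K v)" by (simp add: q1_def run_rep)
  then have q1: "q1 < nstates ?L" using run_less[OF L q0] by simp
  let ?h3 = "?h2(rK := K, rQ := q1)"
  have ok3: "ok ?x ?h3" using ok2 K(2) q1 nL by - (rule ok_upd, rule ok_upd; auto)
  let ?D = "progress F q1"
  let ?zs = "dfas \<sigma> F (Suc q1) @ ?ys"
  have locp: "locates \<sigma> ?x ?gop h' ?D (flags ?D @ ?zs)" if "ok ?x h'" "h' rQ = q1" for h'
    using locates_progress[OF loc[OF that(1)] wf that(1), of rQ] that q1 fl by simp
  have wfD: "wf_dfa ?D" using wf q1 by (simp add: wf_fdfa_def)
  then have D: "wf_aut ?D" by (simp add: wf_dfa_def)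
  then have i0: "initial ?D < nstates ?D" by (simp add: wf_aut_def)
  have nD: "nstates ?D \<le> length ?x" using locates_nstates[OF locp[OF ok3]] by simp
  let ?h4 = "?h3(rI0 := initial ?D)"
  have e4: "exec ?x (get_initial ?gop rI0) (?h3, []) (?h4, [])"
    by (rule exec_get_initial[OF locp[OF ok3] ok3]) auto
  have ok4: "ok ?x ?h4" using ok3 i0 nD by - (rule ok_upd; auto)
  let ?g = "\<lambda>p. run ?D p (rep K v)"
  have "\<exists>m. 0 < m \<and> m \<le> nstates ?D \<and> (?g ^^ m) ((?g ^^ m) (?h4 rI0)) = (?g ^^ m) (?h4 rI0) \<and>
     exec ?x (search (Rg 3 2) rM rI0 rP rP' (\<lambda>r. loop (Rg 3 1) rK (read_word \<sigma> ?gov ?gop r))) (?h4, [])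
       (?h4(rM := m, rP := (?g ^^ m) (?h4 rI0)), [])"
  proof (rule exec_search[OF ok4, where n = "nstates ?D"])
    fix h' :: "head \<Rightarrow> nat" and w r
    assume *: "ok ?x h'" "\<And>a. a \<notin> {rM, rP, rP', Rg 3 2} \<Longrightarrow> h' a = ?h4 a" "r \<in> {rP, rP'}" "h' r < nstates ?D"
    let ?h = "\<lambda>j. h'(r := ((\<lambda>p. run ?D p v) ^^ j) (h' r))"
    have r: "is_Rg r" "r \<noteq> rW" "r \<noteq> Rg 3 1" "r \<noteq> rK" "r \<noteq> rQ" "r \<noteq> flag" using *(3) by auto
    have h': "h' rK = K" "h' rQ = q1" "h' flag = 0" "h' rW = 0" "h' (Rg 3 1) = 0" using *(2) by auto
    have st: "((\<lambda>p. run ?D p v) ^^ j) (h' r) < nstates ?D" for j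
      using run_less[OF D *(4)] by (simp flip: run_rep)
    have okj: "ok ?x (?h j)" for j using *(1) r st[of j] nD by - (rule ok_upd; auto)
    have "exec ?x (loop (Rg 3 1) rK (read_word \<sigma> ?gov ?gop r)) (?h 0, w) (?h K, w)"
    proof (rule exec_loop[where h = ?h and w = "\<lambda>_. w"])
      fix j assume j: "j < K"
      let ?hj = "(?h j)(Rg 3 1 := j)"
      have okj': "ok ?x ?hj" using okj[of j] j K nL by - (rule ok_upd; auto)
      have "exec ?x (read_word \<sigma> ?gov ?gop r) (?hj, w) (?hj(r := run ?D (?hj r) v), w)"
        by (rule exec_read_word[OF \<sigma> D g3 _ okj' _ _ _ _ locp]) (use r h' st[of j] in auto)
      then show "exec ?x (read_word \<sigma> ?gov ?gop r) (?hj, w) ((?h (Suc j))(Rg 3 1 := j), w)"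
        by (rule exec_target) (use r in \<open>auto simp: fun_eq_iff\<close>)
    qed (use okj *(1) r h' in auto)
    then show "exec ?x (loop (Rg 3 1) rK (read_word \<sigma> ?gov ?gop r)) (h', w) (h'(r := run ?D (h' r) (rep K v)), w)"
      by (simp add: run_rep)
  qed (use i0 nD run_less[OF D] in auto)
  then obtain m where m: "0 < m" "(?g ^^ m) ((?g ^^ m) (initial ?D)) = (?g ^^ m) (initial ?D)"
    and e5: "exec ?x (search (Rg 3 2) rM rI0 rP rP' (\<lambda>r. loop (Rg 3 1) rK (read_word \<sigma> ?gov ?gop r))) (?h4, [])
       (?h4(rM := m, rP := (?g ^^ m) (initial ?D)), [])" and mn: "m \<le> nstates ?D" by auto
  define p1 where "p1 = (?g ^^ m) (initial ?D)"
  have "p1 = run ?D (initial ?D) (rep m (rep K v))" by (simp add: p1_def run_rep[of _ _ m])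
  then have p1: "p1 < nstates ?D" using run_less[OF D i0] by simp
  let ?h5 = "?h4(rM := m, rP := p1)"
  have ok5: "ok ?x ?h5" using ok4 mn p1 nD by - (rule ok_upd, rule ok_upd; auto)
  let ?b = "if p1 \<in> final ?D then 1 else 0 :: nat"
  have e6: "exec ?x (get_final ?gop rP rAns) (?h5, []) (?h5(rAns := ?b), [])"
    using exec_get_final[OF locp[OF ok5] ok5, of rAns rP] p1 wfD by simp
  let ?h6 = "?h5(rAns := 1 - ?b)"
  have ok6: "ok ?x (?h5(rAns := ?b))" using ok5 by - (rule ok_upd; auto)
  have e7: "exec ?x (If rAns nonzero (reset rAns) (set1 rAns)) (?h5(rAns := ?b), []) (?h6, [])"
  proof (cases "p1 \<in> final ?D")
    case True
    then show ?thesis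
      by (intro exec.IfTrue exec_target[OF exec_reset]) (use ok6 in \<open>auto simp: ok_def\<close>)
  next
    case False
    then show ?thesis
      by (intro exec.IfFalse exec_target[OF exec_set1]) (use ok6 in \<open>auto simp: ok_def\<close>)
  qed
  have "exec ?x (membership \<sigma>) (?h0, []) (?h6, [])"
    unfolding membership_def Let_def
    using e1 e2 e3[folded q1_def] e4 e5[folded p1_def] e6 e7 by (meson exec.Seq)
  moreover have "?h6 rAns = 0 \<longleftrightarrow> (u, v) \<in> accepted F"
  proof -
    \<comment> \<open>The exponents found yield one duo-normalized decomposition of the given word,
      and by saturation its answer is the answer for the word.\<close>
    have p1': "(?g ^^ m) p1 = p1" "(?f ^^ K) q1 = q1" using m K by (auto simp: p1_def q1_def)
    note duo = duo_normalized_rep[OF p1'(2) q1_def p1'(1) p1_def]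
    have "progress_of F (u @ rep K v) = ?D" by (simp add: progress_of_def reached_append q1r)
    then have "rep m (rep K v) \<in> dfa_lang (progress_of F (u @ rep K v)) \<longleftrightarrow> p1 \<in> final ?D"
      using duo(2) by (simp add: dfa_lang_def)
    moreover have "decomposition (u \<frown> v\<^sup>\<omega>) (u @ rep K v) (rep m (rep K v))"
      using decomposition_rep[OF v, of "m * K" u K] K m by (simp add: rep_rep)
    ultimately have "p1 \<in> final ?D \<longleftrightarrow> u \<frown> v\<^sup>\<omega> \<in> fdfa_lang F"
      using saturated_lang[OF sat _ duo(1)] by blast
    then show ?thesis using v by (simp add: accepted_iff)
  qed
  ultimately show ?thesis by (intro exI[of _ ?h6] conjI)
qed

lemma membership_decidable:
  assumes "distinct \<sigma>" "set \<sigma> = UNIV"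
  shows "decidable_in_space log_space (enc_fdfa_words \<sigma>) {(F, u, v). F \<in> sat_fdfas \<and> v \<noteq> []}
     (\<lambda>(F, u, v). (u, v) \<in> accepted F)"
proof (rule decidable_by_program[where c = "membership \<sigma>" and j = rAns])
  fix i :: "'a fdfa \<times> 'a list \<times> 'a list"
  assume "i \<in> {(F, u, v). F \<in> sat_fdfas \<and> v \<noteq> []}"
  then obtain F u v where i: "i = (F, u, v)" "F \<in> sat_fdfas" "v \<noteq> []" by auto
  from exec_membership[OF assms i(2,3), of u] obtain h where
    h: "exec (enc_fdfa_words \<sigma> (F, u, v)) (membership \<sigma>) start (h, [])"
      "h rAns = 0 \<longleftrightarrow> (u, v) \<in> accepted F" by (elim exE conjE)
  show "\<exists>h w. exec (enc_fdfa_words \<sigma> i) (membership \<sigma>) start (h, w) \<and>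
      (h rAns = 0) = (case i of (F, u, v) \<Rightarrow> (u, v) \<in> accepted F)"
    unfolding i(1) prod.case by (intro exI[of _ h] exI[of _ "[]"] conjI h)
qed (rule det_membership)

section \<open>Inductive counting\<close>

fun num :: "nat \<Rightarrow> nat list \<Rightarrow> nat" where
  "num b [] = 0"
| "num b (y # ys) = y + b * num b ys"

definition dig :: "nat \<Rightarrow> nat \<Rightarrow> nat \<Rightarrow> nat" where
  "dig b i v = v div b ^ i mod b"

definition digits :: "nat \<Rightarrow> nat \<Rightarrow> nat \<Rightarrow> nat list" where
  "digits b d v = map (\<lambda>i. dig b i v) [0..<d]"

lemma length_digits [simp]: "length (digits b d v) = d"
  by (simp add: digits_def)

lemma nth_digits [simp]: "i < d \<Longrightarrow> digits b d v ! i = dig b i v"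
  by (simp add: digits_def)

lemma dig_0: "dig b 0 v = v mod b"
  by (simp add: dig_def)

lemma dig_Suc: "dig b (Suc i) v = dig b i (v div b)"
  by (simp add: dig_def div_mult2_eq)

lemma digits_Suc: "digits b (Suc d) v = (v mod b) # digits b d (v div b)"
  by (simp add: digits_def upt_conv_Cons dig_0 dig_Suc del: upt_Suc flip: map_Suc_upt)

lemma dig_less: "0 < b \<Longrightarrow> dig b i v < b"
  by (simp add: dig_def)

lemma dig_of_0 [simp]: "dig b i 0 = 0"
  by (simp add: dig_def)

lemma dig_num: "i < length ys \<Longrightarrow> set ys \<subseteq> {..<b} \<Longrightarrow> dig b i (num b ys) = ys ! i"
proof (induction ys arbitrary: i)
  case (Cons y ys)
  then show ?case by (cases i) (auto simp: dig_0 dig_Suc)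
qed simp

lemma num_digits: "v < b ^ d \<Longrightarrow> num b (digits b d v) = v"
proof (induction d arbitrary: v)
  case (Suc d)
  then have "v div b < b ^ d" by (simp add: less_mult_imp_div_less mult.commute)
  with Suc show ?case by (simp add: digits_Suc)
qed (simp add: digits_def)

lemma num_less: "set ys \<subseteq> {..<b} \<Longrightarrow> num b ys < b ^ length ys"
proof (induction ys)
  case (Cons y ys)
  then have "y + b * num b ys < b + b * num b ys" by simp
  also have "\<dots> = b * Suc (num b ys)" by simp
  also have "\<dots> \<le> b * b ^ length ys" using Cons by (intro mult_left_mono) auto
  finally show ?case by simp
qed simp

lemma dig_eqI:
  assumes "v < b ^ d" "w < b ^ d" "\<And>i. i < d \<Longrightarrow> dig b i v = dig b i w" shows "v = w"
proof -
  have "digits b d v = digits b d w" using assms(3) by (simp add: digits_def)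
  then show ?thesis using num_digits assms(1,2) by metis
qed

abbreviation (input) "rFL \<equiv> 9 :: nat"

text \<open>A head has \<open>length x + 2\<close> possible positions, so it holds one digit in that
  base, least significant digit first. The function \<open>f\<close> gives the values of the
  registers; scratch heads are at rest and there is no output.\<close>

definition cstate :: "'s list \<Rightarrow> nat \<Rightarrow> (nat \<Rightarrow> nat) \<Rightarrow> 's state" where
  "cstate x d f = (\<lambda>a. case a of Sc i \<Rightarrow> 0 | Rg r i \<Rightarrow> if i < d then dig (length x + 2) i (f r) else 0, [])"

lemma ok_cstate: "ok x (fst (cstate x d f))"
  using dig_less[of "length x + 2"] by (auto simp: ok_def cstate_def less_Suc_eq_le split: head.splits)

lemma cstate_simps [simp]: "fst (cstate x d f) (Sc i) = 0"
  "fst (cstate x d f) (Rg r i) = (if i < d then dig (length x + 2) i (f r) else 0)"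
  "snd (cstate x d f) = []"
  by (simp_all add: cstate_def)

lemma cstate_pair: "cstate x d f = (fst (cstate x d f), [])"
  by (simp add: cstate_def)

lemma cstate_upd:
  assumes "i < d" "y < length x + 2"
  shows "((fst (cstate x d f))(Rg r i := y), []) = cstate x d (f(r := num (length x + 2) ((digits (length x + 2) d (f r))[i := y])))"
proof -
  let ?b = "length x + 2"
  let ?v = "num ?b ((digits ?b d (f r))[i := y])"
  have "set ((digits ?b d (f r))[i := y]) \<subseteq> {..<?b}"
    using assms dig_less[of ?b] by (intro set_update_subsetI) (auto simp: digits_def)
  then have dig: "dig ?b j ?v = (if j = i then y else dig ?b j (f r))" if "j < d" for j
    using that assms(1) by (subst dig_num) (auto simp: nth_list_update)
  have "((fst (cstate x d f))(Rg r i := y)) a = fst (cstate x d (f(r := ?v))) a" for a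
  proof (cases a)
    case (Rg q j)
    then show ?thesis using dig[of j] assms(1) by (cases "q = r"; cases "j < d"; simp)
  qed simp
  then have "(fst (cstate x d f))(Rg r i := y) = fst (cstate x d (f(r := ?v)))" by blast
  then show ?thesis by (simp only: cstate_pair[symmetric])
qed

text \<open>In contrast to \<open>emits\<close> and \<open>sets\<close> this is an equivalence: the
  counting program guesses, so its executions must be determined completely and not only shown to
  exist. For deterministic commands one execution suffices, by \<open>actsI\<close>.\<close>

definition acts :: "'s list \<Rightarrow> nat \<Rightarrow> 's com \<Rightarrow> (nat \<Rightarrow> nat) \<Rightarrow> (nat \<Rightarrow> nat) \<Rightarrow> bool" where
  "acts x d c f g \<longleftrightarrow> (\<forall>t. exec x c (cstate x d f) t \<longleftrightarrow> t = cstate x d g)"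

lemma actsI: "det c \<Longrightarrow> exec x c (cstate x d f) (cstate x d g) \<Longrightarrow> acts x d c f g"
  unfolding acts_def
proof (intro allI iffI)
  fix t assume "det c" "exec x c (cstate x d f) (cstate x d g)" "exec x c (cstate x d f) t"
  from exec_det[OF this(2,1,3)] show "t = cstate x d g" .
qed simp

lemma acts_Seq_iff: "acts x d c1 f g \<Longrightarrow> exec x (c1 ;; c2) (cstate x d f) t \<longleftrightarrow> exec x c2 (cstate x d g) t"
  unfolding acts_def exec_Seq_iff by (simp only: simp_thms)

lemma acts_Seq: "acts x d c1 f g \<Longrightarrow> acts x d c2 g h \<Longrightarrow> acts x d (c1 ;; c2) f h"
  unfolding acts_def exec_Seq_iff by (simp only: simp_thms)

lemma acts_exec: "acts x d c f g \<Longrightarrow> exec x c (cstate x d f) t \<longleftrightarrow> t = cstate x d g"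
  unfolding acts_def by (rule spec)

lemma acts_Skip: "acts x d Skip f f"
  by (simp add: acts_def)

lemma acts_If:
  assumes "0 < d" "f r < length x + 2" "acts x d (if f r = 0 then c2 else c1) f g"
  shows "acts x d (If (Rg r 0) nonzero c1 c2) f g"
  using assms by (auto simp: acts_def exec_If_iff dig_0 split: if_splits)

lemma exec_If_cstate:
  assumes "0 < d" "f r < length x + 2"
  shows "exec x (If (Rg r 0) nonzero c1 c2) (cstate x d f) t \<longleftrightarrow>
     (if f r = 0 then exec x c2 (cstate x d f) t else exec x c1 (cstate x d f) t)"
  using assms by (simp add: exec_If_iff dig_0)

definition reset_reg :: "nat \<Rightarrow> nat \<Rightarrow> 's com" where
  "reset_reg d r = seqs (map (\<lambda>i. reset (Rg r i)) [0..<d])"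

lemma acts_reset_reg: "acts x d (reset_reg d r) f (f(r := 0))"
proof (rule actsI)
  let ?h = "\<lambda>k. (\<lambda>a. case a of Sc i \<Rightarrow> 0 | Rg r' i \<Rightarrow> if i < d \<and> (r' = r \<longrightarrow> k \<le> i) then dig (length x + 2) i (f r') else 0, [])"
  have "exec x (seqs (map (\<lambda>i. reset (Rg r i)) [k..<d])) (?h k) (?h d)" if "k \<le> d" for k
    using that
  proof (induction k rule: inc_induct)
    case (step k)
    have 1: "exec x (reset (Rg r k)) (?h k) (?h (Suc k))"
      by (rule exec_target[OF exec_reset])
        (use dig_less[of "length x + 2" k "f r"] in \<open>auto simp: fun_eq_iff split: head.splits\<close>)
    have "[k..<d] = k # [Suc k..<d]" using step(2) by (simp add: upt_conv_Cons)
    with exec.Seq[OF 1 step(3)] show ?case by (simp only: list.map seqs.simps)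
  qed (simp add: exec.Skip)
  from this[OF le0] have "exec x (reset_reg d r) (?h 0) (?h d)" unfolding reset_reg_def .
  moreover have "?h 0 = cstate x d f" "?h d = cstate x d (f(r := 0))"
    by (auto simp: cstate_def fun_eq_iff split: head.splits)
  ultimately show "exec x (reset_reg d r) (cstate x d f) (cstate x d (f(r := 0)))" by simp
qed (simp add: reset_reg_def)

lemma acts_set1:
  assumes "0 < d" "f r \<le> 1"
  shows "acts x d (set1 (Rg r 0)) f (f(r := 1))"
proof (rule actsI)
  have dig1: "dig (length x + 2) i v = (if i = 0 then v else 0)" if "v \<le> 1" for i v
    using that by (cases i) (auto simp: dig_0 dig_Suc)
  have "exec x (set1 (Rg r 0)) (fst (cstate x d f), []) ((fst (cstate x d f))(Rg r 0 := 1), [])"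
    by (rule exec_set1) (use ok_cstate[of x d f] in \<open>simp only: ok_def\<close>)
  moreover have "((fst (cstate x d f))(Rg r 0 := 1), []) = cstate x d (f(r := 1))"
    using assms dig1[of 1] dig1[of "f r"] by (auto simp: cstate_def fun_eq_iff split: head.splits)
  ultimately show "exec x (set1 (Rg r 0)) (cstate x d f) (cstate x d (f(r := 1)))" by (simp add: cstate_def)
qed simp

definition copy_reg :: "nat \<Rightarrow> nat \<Rightarrow> nat \<Rightarrow> 's com" where
  "copy_reg d r r' = seqs (map (\<lambda>i. copy (Rg r i) (Rg r' i)) [0..<d])"

lemma acts_copy_reg:
  assumes "r \<noteq> r'" shows "acts x d (copy_reg d r r') f (f(r' := f r))"
proof (rule actsI)
  let ?h = "\<lambda>k. (\<lambda>a. case a of Sc i \<Rightarrow> 0 | Rg q i \<Rightarrow> if i < d then dig (length x + 2) i (if q = r' \<and> i < k then f r else f q) else 0, [])"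
  have "exec x (seqs (map (\<lambda>i. copy (Rg r i) (Rg r' i)) [k..<d])) (?h k) (?h d)" if "k \<le> d" for k
    using that
  proof (induction k rule: inc_induct)
    case (step k)
    have 1: "exec x (copy (Rg r k) (Rg r' k)) (?h k) (?h (Suc k))"
      by (rule exec_target[OF exec_copy])
        (use assms step(2) dig_less[of "length x + 2"] in \<open>auto simp: fun_eq_iff less_Suc_eq_le less_Suc_eq split: head.splits\<close>)
    have "[k..<d] = k # [Suc k..<d]" using step(2) by (simp add: upt_conv_Cons)
    with exec.Seq[OF 1 step(3)] show ?case by (simp only: list.map seqs.simps)
  qed (simp add: exec.Skip)
  from this[OF le0] have "exec x (copy_reg d r r') (?h 0) (?h d)" unfolding copy_reg_def .
  moreover have "?h 0 = cstate x d f" "?h d = cstate x d (f(r' := f r))"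
    by (auto simp: cstate_def fun_eq_iff split: head.splits)
  ultimately show "exec x (copy_reg d r r') (cstate x d f) (cstate x d (f(r' := f r)))" by simp
qed (simp add: copy_reg_def)

definition neq_reg :: "nat \<Rightarrow> nat \<Rightarrow> nat \<Rightarrow> 's com" where
  "neq_reg d r r' = seqs (map (\<lambda>i. neq (Rg r i) (Rg r' i) (Rg rFL 0)) [0..<d])"

lemma acts_neq_reg:
  assumes "0 < d" "f r < (length x + 2) ^ d" "f r' < (length x + 2) ^ d" "f rFL = 0" "r \<noteq> rFL" "r' \<noteq> rFL"
  shows "acts x d (neq_reg d r r') f (f(rFL := if f r = f r' then 0 else 1))"
proof (rule actsI)
  let ?b = "length x + 2"
  let ?same = "\<lambda>k. \<forall>i < k. dig ?b i (f r) = dig ?b i (f r')"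
  let ?g = "\<lambda>k. f(rFL := if ?same k then 0 else 1)"
  have dig1: "dig ?b i v = (if i = 0 then v else 0)" if "v \<le> 1" for i v
    using that by (cases i) (auto simp: dig_0 dig_Suc)
  have "exec x (seqs (map (\<lambda>i. neq (Rg r i) (Rg r' i) (Rg rFL 0)) [k..<d])) (cstate x d (?g k)) (cstate x d (?g d))"
    if "k \<le> d" for k
    using that
  proof (induction k rule: inc_induct)
    case (step k)
    have "exec x (neq (Rg r k) (Rg r' k) (Rg rFL 0)) (fst (cstate x d (?g k)), []) (cstate x d (?g (Suc k)))"
    proof (rule exec_target[OF exec_neq[OF ok_cstate]])
      show "((fst (cstate x d (?g k)))(Rg rFL 0 := if fst (cstate x d (?g k)) (Rg r k) = fst (cstate x d (?g k)) (Rg r' k)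
          then fst (cstate x d (?g k)) (Rg rFL 0) else 1), []) = cstate x d (?g (Suc k))"
        using assms step(2) dig1 by (auto simp: cstate_def fun_eq_iff less_Suc_eq split: head.splits)
    qed auto
    then have 1: "exec x (neq (Rg r k) (Rg r' k) (Rg rFL 0)) (cstate x d (?g k)) (cstate x d (?g (Suc k)))"
      by (simp only: cstate_pair[symmetric])
    have "[k..<d] = k # [Suc k..<d]" using step(2) by (simp add: upt_conv_Cons)
    with exec.Seq[OF 1 step(3)] show ?case by (simp only: list.map seqs.simps)
  qed (simp add: exec.Skip)
  from this[OF le0] have "exec x (neq_reg d r r') (cstate x d (?g 0)) (cstate x d (?g d))" unfolding neq_reg_def .
  moreover have "?g 0 = f" using assms(4) by auto
  moreover have "?same d \<longleftrightarrow> f r = f r'" using dig_eqI[OF assms(2,3)] by auto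
  ultimately show "exec x (neq_reg d r r') (cstate x d f) (cstate x d (f(rFL := if f r = f r' then 0 else 1)))" by simp
qed (simp add: neq_reg_def)

text \<open>Addition of one with carry: a head at \<open>RightEnd\<close> holds the largest digit.
  The flag is raised when some digit absorbs the carry, so it stays down exactly on overflow, where
  the register becomes \<open>0\<close>.\<close>

fun inc_digits :: "nat \<Rightarrow> nat list \<Rightarrow> 's com" where
  "inc_digits r [] = Skip"
| "inc_digits r (i # is') = If (Rg r i) {RightEnd} (reset (Rg r i) ;; inc_digits r is')
     (Move (Rg r i) MoveRight ;; set1 (Rg rFL 0))"

definition inc_reg :: "nat \<Rightarrow> nat \<Rightarrow> 's com" where
  "inc_reg d r = inc_digits r [0..<d]"

lemma det_inc_digits: "det (inc_digits r js)"
  by (induction js) auto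

lemma scan_RightEnd: "p \<le> Suc (length x) \<Longrightarrow> scan x p = RightEnd \<longleftrightarrow> p = Suc (length x)"
  by (auto simp: scan_def)

text \<open>For the induction, \<open>v\<close> is the number formed by the \<open>m\<close> digits
  from position \<open>k\<close> on. If its lowest digit is maximal, the carry goes to the remaining
  digits, whose value is \<open>v div (length x + 2)\<close>; otherwise the increment ends here and
  no overflow is possible.\<close>

lemma exec_inc_digits:
  fixes h :: "head \<Rightarrow> nat"
  assumes "\<And>i. i < m \<Longrightarrow> h (Rg r (k + i)) = dig (length x + 2) i v" "v < (length x + 2) ^ m" "h (Rg rFL 0) = 0" "r \<noteq> rFL"
  shows "exec x (inc_digits r [k..<k + m]) (h, w)
    (\<lambda>a. case a of Sc i \<Rightarrow> h a | Rg q j \<Rightarrow>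
       if q = r \<and> k \<le> j \<and> j < k + m then dig (length x + 2) (j - k) (if Suc v < (length x + 2) ^ m then Suc v else 0)
       else if q = rFL \<and> j = 0 then (if Suc v < (length x + 2) ^ m then 1 else 0) else h a, w)"
  using assms
proof (induction m arbitrary: k v h)
  case 0
  then show ?case by (auto intro!: exec_target[OF exec.Skip] simp: fun_eq_iff split: head.splits)
next
  case (Suc m)
  let ?b = "length x + 2" and ?n = "Suc (length x)"
  let ?v' = "if Suc v < ?b ^ Suc m then Suc v else 0"
  have hk: "h (Rg r k) = v mod ?b" using Suc.prems(1)[of 0] by (simp add: dig_0)
  have vd: "v div ?b < ?b ^ m" using Suc.prems(2) by (simp add: less_mult_imp_div_less mult.commute)
  have upt: "[k..<k + Suc m] = k # [Suc k..<Suc k + m]" by (simp add: upt_conv_Cons)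
  show ?case
  proof (cases "v mod ?b = ?n")
    case True
    have Sv: "Suc v = ?b * Suc (v div ?b)"
      using True mult_div_mod_eq[of ?b v] by simp
    then have lt: "Suc v < ?b ^ Suc m \<longleftrightarrow> Suc (v div ?b) < ?b ^ m"
      unfolding Sv power_Suc mult_less_cancel1 by simp
    let ?h1 = "h(Rg r k := 0)"
    let ?u = "if Suc (v div ?b) < ?b ^ m then Suc (v div ?b) else 0"
    have "exec x (inc_digits r [Suc k..<Suc k + m]) (?h1, w)
     (\<lambda>a. case a of Sc i \<Rightarrow> ?h1 a | Rg q j \<Rightarrow>
       if q = r \<and> Suc k \<le> j \<and> j < Suc k + m then dig ?b (j - Suc k) ?u
       else if q = rFL \<and> j = 0 then (if Suc (v div ?b) < ?b ^ m then 1 else 0) else ?h1 a, w)"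
    proof (rule Suc.IH)
      show "?h1 (Rg r (Suc k + i)) = dig ?b i (v div ?b)" if "i < m" for i
        using Suc.prems(1)[of "Suc i"] that by (simp add: dig_Suc)
    qed (use vd Suc.prems in auto)
    moreover have "(\<lambda>a. case a of Sc i \<Rightarrow> ?h1 a | Rg q j \<Rightarrow>
       if q = r \<and> Suc k \<le> j \<and> j < Suc k + m then dig ?b (j - Suc k) ?u
       else if q = rFL \<and> j = 0 then (if Suc (v div ?b) < ?b ^ m then 1 else 0) else ?h1 a) =
      (\<lambda>a. case a of Sc i \<Rightarrow> h a | Rg q j \<Rightarrow>
       if q = r \<and> k \<le> j \<and> j < k + Suc m then dig ?b (j - k) ?v'
       else if q = rFL \<and> j = 0 then (if Suc v < ?b ^ Suc m then 1 else 0) else h a)"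
    proof
      fix a
      have m0: "Suc v mod ?b = 0" unfolding Sv by (rule mod_mult_self1_is_0)
      have d1: "Suc v div ?b = Suc (v div ?b)" unfolding Sv by (rule nonzero_mult_div_cancel_left) simp
      have d0: "dig ?b 0 ?v' = 0"
        by (cases "Suc v < ?b ^ Suc m") (simp_all only: if_True if_False dig_0 m0 mod_0)
      have ds: "dig ?b (j - k) ?v' = dig ?b (j - Suc k) ?u" if "k < j" for j
      proof -
        have "?v' div ?b = ?u"
          by (cases "Suc v < ?b ^ Suc m") (simp_all only: if_True if_False lt[symmetric] d1 div_0)
        moreover have "j - k = Suc (j - Suc k)" using that by simp
        ultimately show ?thesis by (simp only: dig_Suc)
      qed
      show "(case a of Sc i \<Rightarrow> ?h1 a | Rg q j \<Rightarrow>
       if q = r \<and> Suc k \<le> j \<and> j < Suc k + m then dig ?b (j - Suc k) ?u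
       else if q = rFL \<and> j = 0 then (if Suc (v div ?b) < ?b ^ m then 1 else 0) else ?h1 a) =
      (case a of Sc i \<Rightarrow> h a | Rg q j \<Rightarrow>
       if q = r \<and> k \<le> j \<and> j < k + Suc m then dig ?b (j - k) ?v'
       else if q = rFL \<and> j = 0 then (if Suc v < ?b ^ Suc m then 1 else 0) else h a)"
      proof (cases a)
        case (Rg q j)
        consider "j = k" | "k < j" | "j < k" by linarith
        then show ?thesis
        proof cases
          case 1
          then show ?thesis using Rg d0 lt Suc.prems(4) by simp
        next
          case 2
          then show ?thesis using Rg ds[OF 2] lt by simp
        qed (use Rg lt in simp)
      qed simp
    qed
    moreover have "exec x (reset (Rg r k)) (h, w) (?h1, w)" by (rule exec_reset) (use hk True in simp)
    moreover have sc: "scan x (fst (h, w) (Rg r k)) \<in> {RightEnd}" using hk True by (simp add: scan_RightEnd)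
    ultimately show ?thesis unfolding upt inc_digits.simps
      by - (rule exec.IfTrue[OF sc exec.Seq], assumption, simp only:)
  next
    case False
    have vb: "v mod ?b < ?b" by simp
    then have vn: "v mod ?b < ?n" using False by linarith
    have Sm: "Suc v mod ?b = Suc (v mod ?b)" "Suc v div ?b = v div ?b"
      using vn by (simp_all add: mod_Suc div_Suc)
    have "v div ?b * ?b + ?b \<le> ?b ^ Suc m"
    proof -
      have "Suc (v div ?b) * ?b \<le> ?b ^ m * ?b" using vd by (intro mult_right_mono) auto
      then show ?thesis by (simp add: algebra_simps)
    qed
    moreover have "v div ?b * ?b + v mod ?b = v" by (rule div_mult_mod_eq)
    ultimately have lt: "Suc v < ?b ^ Suc m" using vn by linarith
    have "exec x (Move (Rg r k) MoveRight) (h, w) (h(Rg r k := Suc (v mod ?b)), w)"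
      by (rule exec_MoveRight) (use hk vn in auto)
    moreover have "exec x (set1 (Rg rFL 0)) (h(Rg r k := Suc (v mod ?b)), w) (h(Rg r k := Suc (v mod ?b), Rg rFL 0 := 1), w)"
      by (rule exec_set1) (use Suc.prems in simp)
    moreover have "h(Rg r k := Suc (v mod ?b), Rg rFL 0 := 1) = (\<lambda>a. case a of Sc i \<Rightarrow> h a | Rg q j \<Rightarrow>
       if q = r \<and> k \<le> j \<and> j < k + Suc m then dig ?b (j - k) ?v'
       else if q = rFL \<and> j = 0 then (if Suc v < ?b ^ Suc m then 1 else 0) else h a)"
    proof
      fix a
      have ds: "dig ?b (j - k) (Suc v) = h (Rg r j)" if "k < j" "j < k + Suc m" for j
      proof -
        have "j - k = Suc (j - Suc k)" using that by simp
        then have "dig ?b (j - k) (Suc v) = dig ?b (j - k) v" by (simp only: dig_Suc Sm)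
        then show ?thesis using Suc.prems(1)[of "j - k"] that by simp
      qed
      show "(h(Rg r k := Suc (v mod ?b), Rg rFL 0 := 1)) a = (case a of Sc i \<Rightarrow> h a | Rg q j \<Rightarrow>
       if q = r \<and> k \<le> j \<and> j < k + Suc m then dig ?b (j - k) ?v'
       else if q = rFL \<and> j = 0 then (if Suc v < ?b ^ Suc m then 1 else 0) else h a)"
      proof (cases a)
        case (Rg q j)
        consider "j = k" | "k < j" | "j < k" by linarith
        then show ?thesis
        proof cases
          case 1
          have "dig ?b 0 (Suc v) = Suc (v mod ?b)" unfolding dig_0 by (rule Sm(1))
          then show ?thesis using 1 Rg Suc.prems(4) lt by (simp del: power_Suc)
        next
          case 2
          then show ?thesis using Rg ds[OF 2] lt Suc.prems(4) by (simp del: power_Suc)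
        qed (use Rg lt Suc.prems(4) in \<open>simp del: power_Suc\<close>)
      qed simp
    qed
    moreover have sc: "scan x (fst (h, w) (Rg r k)) \<notin> {RightEnd}" using hk vn by (simp add: scan_RightEnd)
    ultimately show ?thesis unfolding upt inc_digits.simps
      by - (rule exec.IfFalse[OF sc exec.Seq], assumption, simp only:)
  qed
qed

lemma acts_inc_reg:
  assumes "0 < d" "f r < (length x + 2) ^ d" "f rFL = 0" "r \<noteq> rFL"
  shows "acts x d (inc_reg d r) f
    (if Suc (f r) < (length x + 2) ^ d then f(r := Suc (f r), rFL := 1) else f(r := 0))"
    (is "acts x d _ f ?g")
proof (rule actsI)
  let ?b = "length x + 2"
  have dig1: "dig ?b i 1 = (if i = 0 then 1 else 0)" for i
    by (cases i) (auto simp: dig_0 dig_Suc)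
  have "exec x (inc_digits r [0..<0 + d]) (fst (cstate x d f), [])
    (\<lambda>a. case a of Sc i \<Rightarrow> fst (cstate x d f) a | Rg q j \<Rightarrow>
       if q = r \<and> 0 \<le> j \<and> j < 0 + d then dig ?b (j - 0) (if Suc (f r) < ?b ^ d then Suc (f r) else 0)
       else if q = rFL \<and> j = 0 then (if Suc (f r) < ?b ^ d then 1 else 0) else fst (cstate x d f) a, [])"
    by (rule exec_inc_digits) (use assms in auto)
  moreover have "(\<lambda>a. case a of Sc i \<Rightarrow> fst (cstate x d f) a | Rg q j \<Rightarrow>
       if q = r \<and> 0 \<le> j \<and> j < 0 + d then dig ?b (j - 0) (if Suc (f r) < ?b ^ d then Suc (f r) else 0)
       else if q = rFL \<and> j = 0 then (if Suc (f r) < ?b ^ d then 1 else 0) else fst (cstate x d f) a, []) = cstate x d ?g"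
    using assms dig1 by (auto simp: cstate_def fun_eq_iff split: head.splits)
  ultimately show "exec x (inc_reg d r) (cstate x d f) (cstate x d ?g)"
    by (simp add: inc_reg_def cstate_pair[symmetric] del: cstate_simps)
qed (simp add: inc_reg_def det_inc_digits)

text \<open>
  At level \<open>gI\<close>, whose size is kept in \<open>gC\<close>, the register \<open>gV\<close> ranges over the candidates for the
  next level and \<open>gN\<close> counts the members found. For each candidate, \<open>gU\<close> ranges over the claimed members
  of the current level, \<open>gM\<close> counts them, and \<open>gW\<close> walks to each of them in \<open>gL\<close> guessed steps;
  \<open>gT\<close> holds a successor, and \<open>gF\<close> tells whether \<open>gV\<close> was met.
\<close>

abbreviation (input) "gU \<equiv> 0 :: nat"
abbreviation (input) "gV \<equiv> 1 :: nat"
abbreviation (input) "gW \<equiv> 2 :: nat"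
abbreviation (input) "gT \<equiv> 3 :: nat"
abbreviation (input) "gI \<equiv> 4 :: nat"
abbreviation (input) "gL \<equiv> 5 :: nat"
abbreviation (input) "gC \<equiv> 6 :: nat"
abbreviation (input) "gN \<equiv> 7 :: nat"
abbreviation (input) "gM \<equiv> 8 :: nat"
abbreviation (input) "gF \<equiv> 10 :: nat"

text \<open>Doing nothing is one of the choices. So a walk of exactly \<open>i\<close> steps may end
  in every vertex at distance at most \<open>i\<close>, in accordance with the cumulative levels
  \<open>R i\<close>.\<close>

fun choices :: "('l \<Rightarrow> 's com) \<Rightarrow> 'l list \<Rightarrow> 's com" where
  "choices c [] = Skip"
| "choices c (a # as) = Choice (c a) (choices c as)"

lemma exec_choices: "exec x (choices c as) s t \<longleftrightarrow> t = s \<or> (\<exists>a \<in> set as. exec x (c a) s t)"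
  by (induction as) (auto simp: exec_Choice_iff)

text \<open>The increment raises the flag as long as there is a next value. On overflow the flag
  stays down, which ends the loop, and the register is back at \<open>0\<close>, as it was at the
  start.\<close>

definition forall_reg :: "nat \<Rightarrow> nat \<Rightarrow> 's com \<Rightarrow> 's com" where
  "forall_reg d r body = (set1 (Rg rFL 0) ;;
     While (Rg rFL 0) nonzero (reset_reg d rFL ;; body ;; inc_reg d r))"

lemma acts_target: "acts x d c f g \<Longrightarrow> g = g' \<Longrightarrow> acts x d c f g'"
  by simp

lemma exec_While_cstate:
  assumes "0 < d" "f r < length x + 2"
  shows "exec x (While (Rg r 0) nonzero c) (cstate x d f) t \<longleftrightarrow>
    (if f r = 0 then t = cstate x d f else exec x (c ;; While (Rg r 0) nonzero c) (cstate x d f) t)"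
  using exec_If_cstate[where f = f and r = r, OF assms, of "c ;; While (Rg r 0) nonzero c" Skip t]
  by (subst exec_While_unfold) (simp only: exec_Skip_iff)

lemma exec_Seq_assoc: "exec x ((c1 ;; c2) ;; c3) s t \<longleftrightarrow> exec x (c1 ;; c2 ;; c3) s t"
  unfolding exec_Seq_iff by blast

lemma exec_Seq_set:
  assumes "\<And>u. exec x c1 s u \<longleftrightarrow> (\<exists>v \<in> S. u = g v)"
  shows "exec x (c1 ;; c2) s t \<longleftrightarrow> (\<exists>v \<in> S. exec x c2 (g v) t)"
  unfolding exec_Seq_iff assms by blast

lemma exec_Seq_cond:
  assumes "\<And>u. exec x c1 s u \<longleftrightarrow> p \<and> u = s'"
  shows "exec x (c1 ;; c2) s t \<longleftrightarrow> p \<and> exec x c2 s' t"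
  unfolding exec_Seq_iff assms by blast

lemma acts_Seq_iff2:
  "acts x d c1 f g \<Longrightarrow> exec x ((c1 ;; c2) ;; c3) (cstate x d f) t \<longleftrightarrow> exec x (c2 ;; c3) (cstate x d g) t"
  unfolding exec_Seq_assoc by (rule acts_Seq_iff)

text \<open>A strongest postcondition for a guessing loop: \<open>P u\<close> is the set of register
  contents possible before the round for the value \<open>u\<close>, and \<open>Q u g\<close> are
  those that this round can produce from \<open>g\<close>. In these sets \<open>r\<close> and the
  flag are \<open>0\<close>, and the current value of \<open>r\<close> is inserted explicitly. An
  empty set means that all paths have failed.\<close>

lemma exec_forall_reg:
  fixes x :: "'s list" and d :: nat and P :: "nat \<Rightarrow> (nat \<Rightarrow> nat) set" and Q :: "nat \<Rightarrow> (nat \<Rightarrow> nat) \<Rightarrow> (nat \<Rightarrow> nat) set"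
  defines "B \<equiv> (length x + 2) ^ d"
  assumes d: "0 < d" and r: "r \<noteq> rFL" and P0: "P 0 = {f}"
    and clean: "\<And>u g. u \<le> B \<Longrightarrow> g \<in> P u \<Longrightarrow> g r = 0 \<and> g rFL = 0"
    and body: "\<And>u g t. u < B \<Longrightarrow> g \<in> P u \<Longrightarrow>
       exec x body (cstate x d (g(r := u))) t \<longleftrightarrow> (\<exists>g' \<in> Q u g. t = cstate x d (g'(r := u)))"
    and PQ: "\<And>u. u < B \<Longrightarrow> (\<Union>g \<in> P u. Q u g) = P (Suc u)"
  shows "exec x (forall_reg d r body) (cstate x d f) t \<longleftrightarrow> (\<exists>g \<in> P B. t = cstate x d g)"
proof -
  let ?W = "While (Rg rFL 0) nonzero (reset_reg d rFL ;; body ;; inc_reg d r)"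
  have unroll: "exec x ?W (cstate x d (g(r := u, rFL := 1))) t \<longleftrightarrow>
     (\<exists>g' \<in> Q u g. if Suc u < B then exec x ?W (cstate x d (g'(r := Suc u, rFL := 1))) t else t = cstate x d g')"
    if u: "u < B" and g: "g \<in> P u" for u g
  proof -
    have "exec x ?W (cstate x d (g(r := u, rFL := 1))) t \<longleftrightarrow>
      exec x ((reset_reg d rFL ;; body ;; inc_reg d r) ;; ?W) (cstate x d (g(r := u, rFL := 1))) t"
      using exec_While_cstate[OF d, of "g(r := u, rFL := 1)" rFL x] by simp
    also have "\<dots> \<longleftrightarrow> exec x ((body ;; inc_reg d r) ;; ?W) (cstate x d (g(r := u))) t"
      by (rule acts_Seq_iff2, rule acts_target[OF acts_reset_reg]) (use clean[of u g] u g r in \<open>auto simp: fun_eq_iff\<close>)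
    also have "\<dots> \<longleftrightarrow> (\<exists>g' \<in> Q u g. exec x (inc_reg d r ;; ?W) (cstate x d (g'(r := u))) t)"
      unfolding exec_Seq_assoc exec_Seq_iff[of x body] body[OF u g] by blast
    also have "\<dots> \<longleftrightarrow> (\<exists>g' \<in> Q u g. if Suc u < B then exec x ?W (cstate x d (g'(r := Suc u, rFL := 1))) t else t = cstate x d g')"
    proof (rule bex_cong[OF refl])
      fix g' assume "g' \<in> Q u g"
      then have g': "g' r = 0" "g' rFL = 0" using clean[of "Suc u" g'] PQ[OF u] g u by auto
      let ?g1 = "if Suc u < B then g'(r := Suc u, rFL := 1) else g'"
      have "acts x d (inc_reg d r) (g'(r := u)) ?g1"
        by (rule acts_target[OF acts_inc_reg[OF d]]) (use u g' r in \<open>auto simp: fun_eq_iff B_def\<close>)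
      then have "exec x (inc_reg d r ;; ?W) (cstate x d (g'(r := u))) t \<longleftrightarrow> exec x ?W (cstate x d ?g1) t"
        by (rule acts_Seq_iff)
      then show "exec x (inc_reg d r ;; ?W) (cstate x d (g'(r := u))) t \<longleftrightarrow>
         (if Suc u < B then exec x ?W (cstate x d (g'(r := Suc u, rFL := 1))) t else t = cstate x d g')"
        using exec_While_cstate[OF d, of g' rFL x] g'(2) by simp
    qed
    finally show ?thesis .
  qed
  have "(\<exists>g \<in> P u. exec x ?W (cstate x d (g(r := u, rFL := 1))) t) \<longleftrightarrow> (\<exists>g \<in> P B. t = cstate x d g)" if "u < B" for u
    using that
  proof (induction "B - u" arbitrary: u rule: less_induct)
    case less
    have "(\<exists>g \<in> P u. exec x ?W (cstate x d (g(r := u, rFL := 1))) t) \<longleftrightarrow>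
      (\<exists>g \<in> P (Suc u). if Suc u < B then exec x ?W (cstate x d (g(r := Suc u, rFL := 1))) t else t = cstate x d g)"
      unfolding PQ[OF less.prems, symmetric] using unroll[OF less.prems] by blast
    also have "\<dots> \<longleftrightarrow> (\<exists>g \<in> P B. t = cstate x d g)"
    proof (cases "Suc u < B")
      case True
      then show ?thesis using less.hyps[of "Suc u"] by simp
    next
      case False
      then have "Suc u = B" using less.prems by simp
      then show ?thesis by simp
    qed
    finally show ?case .
  qed
  from this[of 0] have "(exec x ?W (cstate x d (f(r := 0, rFL := 1))) t) \<longleftrightarrow> (\<exists>g \<in> P B. t = cstate x d g)"
    by (simp add: P0 B_def)
  moreover have f: "f r = 0" "f rFL = 0" using clean[of 0 f] P0 by auto
  moreover have "exec x (forall_reg d r body) (cstate x d f) t \<longleftrightarrow> exec x ?W (cstate x d (f(r := 0, rFL := 1))) t"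
    unfolding forall_reg_def
    by (rule acts_Seq_iff, rule acts_target[OF acts_set1[OF d]]) (use f in \<open>auto simp: fun_eq_iff\<close>)
  ultimately show ?thesis by simp
qed

text \<open>An abstract graph with vertices \<open>Val\<close>, successors \<open>nxt a\<close>,
  start vertex \<open>v0\<close> and a set of bad vertices, together with commands that compute on
  codes of vertices. The strict bound on \<open>card Val\<close> is what lets the size of every
  level be stored in a register.\<close>

locale counting =
  fixes x :: "'s list" and d :: nat and init :: "nat \<Rightarrow> 's com" and stp :: "'l \<Rightarrow> nat \<Rightarrow> 's com"
    and badc :: "nat \<Rightarrow> 's com" and labels :: "'l list" and v0 :: nat and nxt :: "'l \<Rightarrow> nat \<Rightarrow> nat"
    and bad :: "nat \<Rightarrow> bool" and Val :: "nat set"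
  assumes d: "0 < d"
    and Val: "Val \<subseteq> {..<(length x + 2) ^ d}" "card Val < (length x + 2) ^ d" "v0 \<in> Val"
      "\<And>a v. a \<in> set labels \<Longrightarrow> v \<in> Val \<Longrightarrow> nxt a v \<in> Val"
    and init: "\<And>f. acts x d (init gW) f (f(gW := v0))"
    and stp: "\<And>a r f. a \<in> set labels \<Longrightarrow> r \<in> {gW, gT} \<Longrightarrow> f r \<in> Val \<Longrightarrow> acts x d (stp a r) f (f(r := nxt a (f r)))"
    and badc: "\<And>f. f gU \<in> Val \<Longrightarrow> f rFL = 0 \<Longrightarrow> acts x d (badc gU) f (f(rFL := if bad (f gU) then 1 else 0))"
begin

abbreviation "B \<equiv> (length x + 2) ^ d"
abbreviation "cs \<equiv> cstate x d"

fun R :: "nat \<Rightarrow> nat set" where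
  "R 0 = {v0}"
| "R (Suc i) = (\<Union>v \<in> R i. insert v ((\<lambda>a. nxt a v) ` set labels))"

lemma R_Val: "R i \<subseteq> Val"
  by (induction i) (use Val in auto)

lemma finite_R [simp]: "finite (R i)"
  using R_Val[of i] Val(1) by (meson finite_lessThan finite_subset)

lemma card_R: "card (R i) < B"
  using card_mono[OF _ R_Val[of i]] Val(1,2) finite_subset[of Val] by (meson finite_lessThan le_less_trans)

lemma R_mono: "i \<le> j \<Longrightarrow> R i \<subseteq> R j"
  by (rule lift_Suc_mono_le) auto

lemma R_less: "v \<in> R i \<Longrightarrow> v < B"
  using R_Val Val(1) by blast

definition nobad :: "nat \<Rightarrow> bool" where
  "nobad i \<longleftrightarrow> (\<forall>v \<in> R i. \<not> bad v)"

text \<open>Let \<open>n\<close> be the first level with a bad vertex. Up to \<open>n\<close> the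
  levels grow strictly, since a repeated level would stay the same forever and never contain that
  vertex. Hence \<open>n < card (R n) < B\<close>, and the levels below \<open>B\<close>
  suffice.\<close>

lemma nobad_all: "(\<forall>j < B. nobad j) \<longleftrightarrow> (\<forall>j. nobad j)"
proof
  assume nb: "\<forall>j < B. nobad j"
  show "\<forall>j. nobad j"
  proof (rule ccontr)
    assume "\<not> (\<forall>j. nobad j)"
    then obtain n where n: "\<not> nobad n" "\<And>j. j < n \<Longrightarrow> nobad j"
      using exists_least_iff[of "\<lambda>j. \<not> nobad j"] by auto
    have "j < card (R j)" if "j \<le> n" for j
      using that
    proof (induction j)
      case (Suc j)
      have "R j \<noteq> R (Suc j)"
      proof
        assume eq: "R j = R (Suc j)"
        have "R (j + k) = R j" for k
        proof (induction k)
          case (Suc k)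
          then have "R (j + Suc k) = R (Suc j)" by simp
          with eq show ?case by simp
        qed simp
        from this[of "n - j"] Suc.prems have "R n = R j" by simp
        then show False using n(1) n(2)[of j] Suc.prems by (simp add: nobad_def)
      qed
      then have "R j \<subset> R (Suc j)" using R_mono[of j "Suc j"] by auto
      then have "card (R j) < card (R (Suc j))" by (intro psubset_card_mono) auto
      then show ?case using Suc by simp
    qed simp
    from this[of n] card_R[of n] have "n < B" by simp
    then show False using nb n(1) by blast
  qed
qed simp

section \<open>Certification of the levels by guessed walks\<close>

definition verify :: "'s com" where
  "verify = (init gW ;; neq_reg d gL gI ;;
     While (Rg rFL 0) nonzero (reset_reg d rFL ;; inc_reg d gL ;; reset_reg d rFL ;;
       choices (\<lambda>a. stp a gW) labels ;; neq_reg d gL gI) ;;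
     neq_reg d gW gU ;; If (Rg rFL 0) nonzero Fail Skip ;; reset_reg d gW ;; reset_reg d gL)"

text \<open>A path survives only if its guessed walk of \<open>gI\<close> steps ends in
  \<open>gU\<close>, and then all registers are as before, so the walk leaves no trace. The flag is
  reset twice per step because both the comparison that continues the loop and the increment of
  \<open>gL\<close> raise it.\<close>

lemma exec_verify:
  assumes f: "f gW = 0" "f gL = 0" "f rFL = 0" "f gI < B" "f gU < B"
  shows "exec x verify (cs f) t \<longleftrightarrow> f gU \<in> R (f gI) \<and> t = cs f"
proof -
  let ?I = "f gI"
  let ?body = "reset_reg d rFL ;; inc_reg d gL ;; reset_reg d rFL ;;
       choices (\<lambda>a. stp a gW) labels ;; neq_reg d gL gI"
  let ?W = "While (Rg rFL 0) nonzero ?body"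
  let ?end = "neq_reg d gW gU ;; If (Rg rFL 0) nonzero Fail Skip ;; reset_reg d gW ;; reset_reg d gL"
  let ?s = "\<lambda>v l. f(gW := v, gL := l, rFL := if l = ?I then 0 else 1)"
  have unroll: "exec x ?W (cs (?s v l)) t \<longleftrightarrow>
    (\<exists>v' \<in> insert v ((\<lambda>a. nxt a v) ` set labels). exec x ?W (cs (?s v' (Suc l))) t)"
    if l: "l < ?I" and v: "v \<in> R l" for v l t
  proof -
    have "exec x ?W (cs (?s v l)) t \<longleftrightarrow> exec x (?body ;; ?W) (cs (?s v l)) t"
      using exec_While_cstate[OF d, of "?s v l" rFL x ?body t] l by simp
    also have "\<dots> \<longleftrightarrow> exec x ((inc_reg d gL ;; reset_reg d rFL ;; choices (\<lambda>a. stp a gW) labels ;; neq_reg d gL gI) ;; ?W)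
        (cs (f(gW := v, gL := l))) t"
      by (rule acts_Seq_iff2, rule acts_target[OF acts_reset_reg]) (use f in \<open>auto simp: fun_eq_iff\<close>)
    also have "\<dots> \<longleftrightarrow> exec x ((reset_reg d rFL ;; choices (\<lambda>a. stp a gW) labels ;; neq_reg d gL gI) ;; ?W)
        (cs (f(gW := v, gL := Suc l, rFL := 1))) t"
      by (rule acts_Seq_iff2, rule acts_target[OF acts_inc_reg[OF d]]) (use f l in \<open>auto simp: fun_eq_iff\<close>)
    also have "\<dots> \<longleftrightarrow> exec x ((choices (\<lambda>a. stp a gW) labels ;; neq_reg d gL gI) ;; ?W) (cs (f(gW := v, gL := Suc l))) t"
      by (rule acts_Seq_iff2, rule acts_target[OF acts_reset_reg]) (use f in \<open>auto simp: fun_eq_iff\<close>)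
    also have "\<dots> \<longleftrightarrow> (\<exists>v' \<in> insert v ((\<lambda>a. nxt a v) ` set labels).
       exec x (neq_reg d gL gI ;; ?W) (cs (f(gW := v', gL := Suc l))) t)"
    proof -
      have "exec x (stp a gW) (cs (f(gW := v, gL := Suc l))) u \<longleftrightarrow> u = cs (f(gW := nxt a v, gL := Suc l))"
        if "a \<in> set labels" for a u
      proof -
        have "acts x d (stp a gW) (f(gW := v, gL := Suc l)) (f(gW := nxt a v, gL := Suc l))"
          by (rule acts_target[OF stp[OF that]]) (use v R_Val in \<open>auto simp: fun_eq_iff\<close>)
        then show ?thesis by (rule acts_exec)
      qed
      then have "(\<exists>a \<in> set labels. exec x (stp a gW) (cs (f(gW := v, gL := Suc l))) u) \<longleftrightarrow>
          (\<exists>a \<in> set labels. u = cs (f(gW := nxt a v, gL := Suc l)))" for u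
        by (intro bex_cong[OF refl]) blast
      then have "exec x (choices (\<lambda>a. stp a gW) labels) (cs (f(gW := v, gL := Suc l))) u \<longleftrightarrow>
          (\<exists>v' \<in> insert v ((\<lambda>a. nxt a v) ` set labels). u = cs (f(gW := v', gL := Suc l)))" for u
        unfolding exec_choices by blast
      then show ?thesis unfolding exec_Seq_assoc by (rule exec_Seq_set)
    qed
    also have "\<dots> \<longleftrightarrow> (\<exists>v' \<in> insert v ((\<lambda>a. nxt a v) ` set labels). exec x ?W (cs (?s v' (Suc l))) t)"
    proof (rule bex_cong[OF refl])
      fix v'
      have "acts x d (neq_reg d gL gI) (f(gW := v', gL := Suc l)) (?s v' (Suc l))"
        by (rule acts_target[OF acts_neq_reg[OF d]]) (use f l in \<open>auto simp: fun_eq_iff\<close>)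
      then show "exec x (neq_reg d gL gI ;; ?W) (cs (f(gW := v', gL := Suc l))) t \<longleftrightarrow> exec x ?W (cs (?s v' (Suc l))) t"
        by (rule acts_Seq_iff)
    qed
    finally show ?thesis .
  qed
  \<comment> \<open>After \<open>l\<close> steps the possible endpoints of the guessed walks are
    exactly the members of \<open>R l\<close>, so the executions are followed for all these
    endpoints together.\<close>
  have loop: "(\<exists>v \<in> R l. exec x ?W (cs (?s v l)) t) \<longleftrightarrow> (\<exists>v \<in> R ?I. t = cs (f(gW := v, gL := ?I)))" if "l \<le> ?I" for l t
    using that
  proof (induction l rule: inc_induct)
    case base
    have "exec x ?W (cs (?s v ?I)) t \<longleftrightarrow> t = cs (f(gW := v, gL := ?I))" for v
    proof -
      have "?s v ?I = f(gW := v, gL := ?I)" using f(3) by (auto simp: fun_eq_iff)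
      moreover have "exec x ?W (cs (f(gW := v, gL := ?I))) t \<longleftrightarrow> t = cs (f(gW := v, gL := ?I))"
        using exec_While_cstate[OF d, of "f(gW := v, gL := ?I)" rFL x ?body t] f(3) by simp
      ultimately show ?thesis by (simp only:)
    qed
    then show ?case by blast
  next
    case (step l)
    have "(\<exists>v \<in> R l. exec x ?W (cs (?s v l)) t) \<longleftrightarrow> (\<exists>v \<in> R (Suc l). exec x ?W (cs (?s v (Suc l))) t)"
      unfolding R.simps using unroll[OF step(2)] by blast
    from this step.IH show ?case by (rule trans)
  qed
  have fin: "exec x ?end (cs (f(gW := v, gL := ?I))) t \<longleftrightarrow> v = f gU \<and> t = cs f" if v: "v \<in> R ?I" for v t
  proof -
    have "exec x ?end (cs (f(gW := v, gL := ?I))) t \<longleftrightarrow>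
      exec x (If (Rg rFL 0) nonzero Fail Skip ;; reset_reg d gW ;; reset_reg d gL)
       (cs (f(gW := v, gL := ?I, rFL := if v = f gU then 0 else 1))) t"
      by (rule acts_Seq_iff, rule acts_target[OF acts_neq_reg[OF d]]) (use f v R_less in \<open>auto simp: fun_eq_iff\<close>)
    also have "\<dots> \<longleftrightarrow> v = f gU \<and> t = cs f"
    proof (cases "v = f gU")
      case True
      have "acts x d (If (Rg rFL 0) nonzero Fail Skip ;; reset_reg d gW ;; reset_reg d gL)
          (f(gW := v, gL := ?I, rFL := if v = f gU then 0 else 1)) f"
      proof (rule acts_target[OF acts_Seq[OF _ acts_Seq[OF acts_reset_reg acts_reset_reg]]])
        let ?f = "f(gW := v, gL := ?I, rFL := if v = f gU then 0 else 1)"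
        show "acts x d (If (Rg rFL 0) nonzero Fail Skip) ?f ?f"
          by (rule acts_If[OF d]) (use True in \<open>simp_all add: acts_Skip\<close>)
      qed (use True f in \<open>auto simp: fun_eq_iff\<close>)
      then show ?thesis using True by (simp add: acts_exec)
    next
      case False
      then show ?thesis
        unfolding exec_Seq_iff[of x "If _ _ _ _"] using exec_If_cstate[OF d, of _ rFL x Fail Skip] by simp
    qed
    finally show ?thesis .
  qed
  have st: "acts x d (init gW) f (f(gW := v0))" by (rule init)
  have "acts x d (neq_reg d gL gI) (f(gW := v0)) (?s v0 0)"
    by (rule acts_target[OF acts_neq_reg[OF d]]) (use f in \<open>auto simp: fun_eq_iff\<close>)
  then have "exec x verify (cs f) t \<longleftrightarrow> exec x (?W ;; ?end) (cs (?s v0 0)) t"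
    unfolding verify_def using acts_Seq_iff[OF st] acts_Seq_iff by blast
  also have "\<dots> \<longleftrightarrow> (\<exists>u. (\<exists>v \<in> R ?I. u = cs (f(gW := v, gL := ?I))) \<and> exec x ?end u t)"
    unfolding exec_Seq_iff[of x ?W] using loop[of 0] by simp
  also have "\<dots> \<longleftrightarrow> f gU \<in> R ?I \<and> t = cs f"
    using fin by blast
  finally show ?thesis .
qed

definition test_eq :: "nat \<Rightarrow> 's com" where
  "test_eq r = (neq_reg d r gV ;; If (Rg rFL 0) nonzero (reset_reg d rFL) (set1 (Rg gF 0)))"

lemma acts_test_eq:
  assumes "f r < B" "f gV < B" "f rFL = 0" "f gF \<le> 1" "r \<in> {gU, gT}"
  shows "acts x d (test_eq r) f (f(gF := if f r = f gV then 1 else f gF))"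
  unfolding test_eq_def
proof (rule acts_Seq)
  let ?f = "f(rFL := if f r = f gV then 0 else 1)"
  show "acts x d (neq_reg d r gV) f ?f"
    by (rule acts_neq_reg[OF d]) (use assms in auto)
  have "acts x d (reset_reg d rFL) ?f f" if "f r \<noteq> f gV"
    by (rule acts_target[OF acts_reset_reg]) (use assms that in \<open>auto simp: fun_eq_iff\<close>)
  moreover have "acts x d (set1 (Rg gF 0)) ?f (f(gF := 1))" if "f r = f gV"
    by (rule acts_target[OF acts_set1[OF d]]) (use assms that in \<open>auto simp: fun_eq_iff\<close>)
  ultimately show "acts x d (If (Rg rFL 0) nonzero (reset_reg d rFL) (set1 (Rg gF 0))) ?f
      (f(gF := if f r = f gV then 1 else f gF))"
    by (intro acts_If[OF d]) auto
qed

definition test_succ :: "'l \<Rightarrow> 's com" where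
  "test_succ a = (copy_reg d gU gT ;; stp a gT ;; test_eq gT ;; reset_reg d gT)"

lemma acts_test_succ:
  assumes "f gU \<in> Val" "f gV < B" "f rFL = 0" "f gF \<le> 1" "f gT = 0" "a \<in> set labels"
  shows "acts x d (test_succ a) f (f(gF := if nxt a (f gU) = f gV then 1 else f gF))"
  unfolding test_succ_def
proof (rule acts_Seq[OF _ acts_Seq[OF _ acts_Seq]])
  let ?v = "nxt a (f gU)"
  have v: "?v < B" using Val assms by blast
  show "acts x d (copy_reg d gU gT) f (f(gT := f gU))" by (rule acts_copy_reg) simp
  show "acts x d (stp a gT) (f(gT := f gU)) (f(gT := ?v))"
    by (rule acts_target[OF stp]) (use assms in \<open>auto simp: fun_eq_iff\<close>)
  show "acts x d (test_eq gT) (f(gT := ?v)) (f(gT := ?v, gF := if ?v = f gV then 1 else f gF))"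
    by (rule acts_target[OF acts_test_eq]) (use assms v in \<open>auto simp: fun_eq_iff\<close>)
  show "acts x d (reset_reg d gT) (f(gT := ?v, gF := if ?v = f gV then 1 else f gF))
     (f(gF := if ?v = f gV then 1 else f gF))"
    by (rule acts_target[OF acts_reset_reg]) (use assms in \<open>auto simp: fun_eq_iff\<close>)
qed

definition hit :: "nat \<Rightarrow> nat \<Rightarrow> bool" where
  "hit u v \<longleftrightarrow> u = v \<or> (\<exists>a \<in> set labels. nxt a u = v)"

definition test_hit :: "'s com" where
  "test_hit = (test_eq gU ;; seqs (map test_succ labels))"

lemma acts_test_hit:
  assumes "f gU \<in> Val" "f gV < B" "f rFL = 0" "f gF \<le> 1" "f gT = 0"
  shows "acts x d test_hit f (f(gF := if hit (f gU) (f gV) then 1 else f gF))"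
proof -
  have "acts x d (seqs (map test_succ as)) g (g(gF := if \<exists>a \<in> set as. nxt a (g gU) = g gV then 1 else g gF))"
    if "set as \<subseteq> set labels" "g gU \<in> Val" "g gV < B" "g rFL = 0" "g gF \<le> 1" "g gT = 0" for as g
    using that
  proof (induction as arbitrary: g)
    case Nil
    then show ?case by (simp add: acts_Skip)
  next
    case (Cons a as)
    let ?g = "g(gF := if nxt a (g gU) = g gV then 1 else g gF)"
    have 1: "acts x d (test_succ a) g ?g" by (rule acts_test_succ) (use Cons.prems in auto)
    have 2: "acts x d (seqs (map test_succ as)) ?g (?g(gF := if \<exists>a \<in> set as. nxt a (?g gU) = ?g gV then 1 else ?g gF))"
      by (rule Cons.IH) (use Cons.prems in auto)
    show ?case unfolding list.map seqs.simps
      by (rule acts_target[OF acts_Seq[OF 1 2]]) (auto simp: fun_eq_iff)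
  qed
  note 2 = this
  let ?f = "f(gF := if f gU = f gV then 1 else f gF)"
  have "acts x d (seqs (map test_succ labels)) ?f (?f(gF := if \<exists>a \<in> set labels. nxt a (?f gU) = ?f gV then 1 else ?f gF))"
    by (rule 2) (use assms in auto)
  moreover have "acts x d (test_eq gU) f ?f"
    by (rule acts_test_eq) (use assms Val in auto)
  ultimately show ?thesis
    unfolding test_hit_def
    by - (rule acts_target[OF acts_Seq], assumption, assumption, auto simp: fun_eq_iff hit_def)
qed

text \<open>\<open>Skip\<close> passes over \<open>gU\<close> without claiming it. A claim fails in
  \<open>verify\<close> if \<open>gU\<close> is no member of the level and fails at the flag if
  \<open>gU\<close> is bad; a member that is passed over makes the final count too small.\<close>

definition check_body :: "'s com" where
  "check_body = Choice Skip (verify ;; badc gU ;; If (Rg rFL 0) nonzero Fail Skip ;;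
     inc_reg d gM ;; reset_reg d rFL ;; test_hit)"

lemma exec_check_body:
  assumes f: "f gW = 0" "f gL = 0" "f rFL = 0" "f gT = 0" "f gF \<le> 1" "f gI < B" "f gU < B" "f gV < B"
    "f gU \<in> R (f gI) \<Longrightarrow> Suc (f gM) < B"
  shows "exec x check_body (cs f) t \<longleftrightarrow> t = cs f \<or> (f gU \<in> R (f gI) \<and> \<not> bad (f gU) \<and>
    t = cs (f(gM := Suc (f gM), gF := if hit (f gU) (f gV) then 1 else f gF)))"
proof -
  let ?c1 = "inc_reg d gM ;; reset_reg d rFL ;; test_hit"
  let ?c2 = "If (Rg rFL 0) nonzero Fail Skip ;; ?c1"
  have "exec x (badc gU ;; ?c2) (cs f) t \<longleftrightarrow> \<not> bad (f gU) \<and>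
      t = cs (f(gM := Suc (f gM), gF := if hit (f gU) (f gV) then 1 else f gF))" if U: "f gU \<in> R (f gI)"
  proof -
    have UV: "f gU \<in> Val" using U R_Val by blast
    let ?f = "f(rFL := if bad (f gU) then 1 else 0)"
    have "exec x (badc gU ;; ?c2) (cs f) t \<longleftrightarrow> exec x ?c2 (cs ?f) t"
      by (rule acts_Seq_iff[OF badc]) (use UV f in auto)
    also have "\<dots> \<longleftrightarrow> \<not> bad (f gU) \<and>
      t = cs (f(gM := Suc (f gM), gF := if hit (f gU) (f gV) then 1 else f gF))"
    proof (cases "bad (f gU)")
      case True
      then show ?thesis
        unfolding exec_Seq_iff[of x "If _ _ _ _"] using exec_If_cstate[OF d, of ?f rFL x Fail Skip] by simp
    next
      case False
      then have ff: "?f = f" using f by (auto simp: fun_eq_iff)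
      have "acts x d ?c2 f (f(gM := Suc (f gM), gF := if hit (f gU) (f gV) then 1 else f gF))"
      proof (rule acts_Seq[OF _ acts_Seq[OF _ acts_Seq]])
        show "acts x d (If (Rg rFL 0) nonzero Fail Skip) f f"
          by (rule acts_If[OF d]) (use f in \<open>simp_all add: acts_Skip\<close>)
        show "acts x d (inc_reg d gM) f (f(gM := Suc (f gM), rFL := 1))"
          by (rule acts_target[OF acts_inc_reg[OF d]]) (use f U in auto)
        show "acts x d (reset_reg d rFL) (f(gM := Suc (f gM), rFL := 1)) (f(gM := Suc (f gM)))"
          by (rule acts_target[OF acts_reset_reg]) (use f in \<open>auto simp: fun_eq_iff\<close>)
        show "acts x d test_hit (f(gM := Suc (f gM))) (f(gM := Suc (f gM), gF := if hit (f gU) (f gV) then 1 else f gF))"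
          by (rule acts_target[OF acts_test_hit]) (use f UV in auto)
      qed
      then show ?thesis unfolding ff using False by (simp only: acts_exec simp_thms)
    qed
    finally show ?thesis .
  qed
  then have "exec x (verify ;; badc gU ;; ?c2) (cs f) t \<longleftrightarrow> f gU \<in> R (f gI) \<and> \<not> bad (f gU) \<and>
    t = cs (f(gM := Suc (f gM), gF := if hit (f gU) (f gV) then 1 else f gF))"
    unfolding exec_Seq_iff[of x verify] exec_verify[OF f(1-3,6,7)] by blast
  then show ?thesis unfolding check_body_def exec_Choice_iff exec_Skip_iff by simp
qed

definition check :: "'s com" where
  "check = (forall_reg d gU check_body ;; neq_reg d gM gC ;;
     If (Rg rFL 0) nonzero Fail Skip ;; reset_reg d gM)"

lemma R_Suc_iff: "v \<in> R (Suc i) \<longleftrightarrow> (\<exists>u \<in> R i. hit u v)"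
  by (auto simp: hit_def)

text \<open>On a surviving path the claimed vertices form a set \<open>X\<close> of good members of
  the level, and a comparison with the known cardinality leaves only \<open>X = R i\<close>. Thus no
  predecessor of \<open>gV\<close> was overlooked, and even the negative answer to membership in the
  next level is certain. This can succeed only if no member is bad.\<close>

lemma exec_check:
  assumes f: "f gU = 0" "f gW = 0" "f gL = 0" "f rFL = 0" "f gT = 0" "f gF = 0" "f gM = 0"
    "f gI < B" "f gV < B" "f gC = card (R (f gI))"
  shows "exec x check (cs f) t \<longleftrightarrow> nobad (f gI) \<and> t = cs (f(gF := if f gV \<in> R (Suc (f gI)) then 1 else 0))"
proof -
  let ?I = "f gI" and ?V = "f gV"
  let ?G = "\<lambda>X. f(gM := card X, gF := if \<exists>u \<in> X. hit u ?V then 1 else 0)"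
  \<comment> \<open>The vertices below \<open>k\<close> that can be claimed with success. The
    register contents before value \<open>k\<close> are determined by the subset that has been
    claimed so far.\<close>
  let ?S = "\<lambda>k. {v \<in> R ?I. \<not> bad v \<and> v < k}"
  let ?P = "\<lambda>k. ?G ` Pow (?S k)"
  let ?Q = "\<lambda>u g. insert g (if u \<in> R ?I \<and> \<not> bad u then {g(gM := Suc (g gM), gF := if hit u ?V then 1 else g gF)} else {})"
  have fin: "finite X" if "X \<subseteq> ?S k" for X k using that finite_R[of ?I] by (auto intro: finite_subset)
  have sub: "X \<subseteq> R ?I" if "X \<subseteq> ?S k" for X k using that by auto
  have "exec x (forall_reg d gU check_body) (cs f) u \<longleftrightarrow> (\<exists>g \<in> ?P B. u = cs g)" for u
  proof (rule exec_forall_reg[where Q = ?Q, OF d])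
    show "?P 0 = {f}" using f by (auto simp: fun_eq_iff)
    show "g gU = 0 \<and> g rFL = 0" if "g \<in> ?P k" for k g using that f by auto
    show "exec x check_body (cs (g(gU := u))) t \<longleftrightarrow> (\<exists>g' \<in> ?Q u g. t = cs (g'(gU := u)))"
      if u: "u < B" and g: "g \<in> ?P u" for u g t
    proof -
      obtain X where X: "X \<subseteq> ?S u" "g = ?G X" using g by auto
      have lt: "Suc (card X) < B" if "u \<in> R ?I"
      proof -
        have "insert u X \<subseteq> R ?I" "u \<notin> X" using X(1) that by auto
        then show ?thesis
          using card_mono[OF finite_R, of "insert u X" ?I] card_R[of ?I] fin[OF X(1)] by simp
      qed
      let ?h = "g(gM := Suc (g gM), gF := if hit u ?V then 1 else g gF)"
      have g: "g gI = ?I" "g gV = ?V" using X(2) by auto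
      have "(g(gU := u))(gM := Suc ((g(gU := u)) gM), gF := if hit ((g(gU := u)) gU) ((g(gU := u)) gV) then 1 else (g(gU := u)) gF) =
         ?h(gU := u)"
        using g by (auto simp: fun_eq_iff)
      then have "exec x check_body (cs (g(gU := u))) t \<longleftrightarrow> t = cs (g(gU := u)) \<or> (u \<in> R ?I \<and> \<not> bad u \<and> t = cs (?h(gU := u)))"
        by (subst exec_check_body) (use X f u lt g in auto)
      then show ?thesis
        by (cases "u \<in> R ?I \<and> \<not> bad u") (simp_all only: if_True if_False bex_simps simp_thms, blast+)
    qed
    show "(\<Union>g \<in> ?P u. ?Q u g) = ?P (Suc u)" if u: "u < B" for u
    proof (cases "u \<in> R ?I \<and> \<not> bad u")
      case True
      then have S: "?S (Suc u) = insert u (?S u)" by (auto simp: less_Suc_eq)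
      have G: "(?G X)(gM := Suc ((?G X) gM), gF := if hit u ?V then 1 else (?G X) gF) = ?G (insert u X)"
        if "X \<subseteq> ?S u" for X
        using that fin[OF that] by (subst card_insert_disjoint) (auto simp: fun_eq_iff)
      \<comment> \<open>The subsets of the larger set are those in which \<open>u\<close> is passed
        over and those in which it is claimed; these are the two branches of the body.\<close>
      have "?P (Suc u) = ?P u \<union> (\<lambda>X. ?G (insert u X)) ` Pow (?S u)"
        unfolding S Pow_insert image_Un image_image ..
      also have "(\<lambda>X. ?G (insert u X)) ` Pow (?S u) =
         (\<lambda>X. (?G X)(gM := Suc ((?G X) gM), gF := if hit u ?V then 1 else (?G X) gF)) ` Pow (?S u)"
        by (rule image_cong[OF refl]) (simp only: G PowD)
      also have "\<dots> = (\<lambda>g. g(gM := Suc (g gM), gF := if hit u ?V then 1 else g gF)) ` ?P u"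
        by (simp only: image_image)
      finally have "?P (Suc u) = ?P u \<union> (\<lambda>g. g(gM := Suc (g gM), gF := if hit u ?V then 1 else g gF)) ` ?P u" .
      moreover have "(\<Union>g \<in> A. insert g {H g}) = A \<union> H ` A" for A and H :: "(nat \<Rightarrow> nat) \<Rightarrow> nat \<Rightarrow> nat" by blast
      ultimately show ?thesis using True by (simp only: if_True simp_thms)
    next
      case False
      then have "?S (Suc u) = ?S u" by (auto simp: less_Suc_eq)
      then show ?thesis using False by auto
    qed
  qed simp
  note fa = this
  let ?rest = "neq_reg d gM gC ;; If (Rg rFL 0) nonzero Fail Skip ;; reset_reg d gM"
  let ?g = "f(gF := if ?V \<in> R (Suc ?I) then 1 else 0)"
  have rest: "exec x ?rest (cs (?G X)) t \<longleftrightarrow> X = R ?I \<and> t = cs ?g" if X: "X \<subseteq> ?S B" for X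
  proof -
    have XR: "card X = card (R ?I) \<longleftrightarrow> X = R ?I" using card_subset_eq[OF finite_R sub[OF X]] by auto
    have lt: "card X < B" using card_mono[OF finite_R sub[OF X]] card_R[of ?I] by simp
    let ?h = "(?G X)(rFL := if card X = card (R ?I) then 0 else 1)"
    have "exec x ?rest (cs (?G X)) t \<longleftrightarrow> exec x (If (Rg rFL 0) nonzero Fail Skip ;; reset_reg d gM) (cs ?h) t"
      by (rule acts_Seq_iff, rule acts_target[OF acts_neq_reg[OF d]]) (use f lt card_R[of ?I] in auto)
    also have "\<dots> \<longleftrightarrow> X = R ?I \<and> t = cs ?g"
    proof (cases "X = R ?I")
      case True
      have "acts x d (If (Rg rFL 0) nonzero Fail Skip ;; reset_reg d gM) ?h ?g"
      proof (rule acts_target[OF acts_Seq[OF _ acts_reset_reg]])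
        show "acts x d (If (Rg rFL 0) nonzero Fail Skip) ?h ?h"
          by (rule acts_If[OF d]) (use True in \<open>simp_all add: acts_Skip\<close>)
        show "?h(gM := 0) = ?g" using True f by (auto simp: fun_eq_iff R_Suc_iff simp del: R.simps)
      qed
      then show ?thesis using True by (simp only: acts_exec simp_thms)
    next
      case False
      then show ?thesis
        unfolding exec_Seq_iff[of x "If _ _ _ _"] using exec_If_cstate[OF d, of ?h rFL x Fail Skip] XR by simp
    qed
    finally show ?thesis .
  qed
  have "R ?I \<subseteq> ?S B \<longleftrightarrow> nobad ?I" using R_less by (auto simp: nobad_def)
  moreover have "exec x check (cs f) t \<longleftrightarrow> (\<exists>g \<in> ?P B. exec x ?rest (cs g) t)"
    unfolding check_def by (rule exec_Seq_set[OF fa])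
  moreover have "(\<exists>g \<in> ?P B. exec x ?rest (cs g) t) \<longleftrightarrow> (\<exists>X \<in> Pow (?S B). X = R ?I \<and> t = cs ?g)"
    unfolding bex_simps(7)[of ?G] using rest by (intro bex_cong[OF refl]) blast
  ultimately show ?thesis by blast
qed

definition round :: "'s com" where
  "round = (forall_reg d gV (check ;;
     If (Rg gF 0) nonzero (reset_reg d gF ;; inc_reg d gN ;; reset_reg d rFL) Skip) ;;
     copy_reg d gN gC ;; reset_reg d gN)"

text \<open>Each candidate \<open>gV\<close> is decided exactly by \<open>check\<close>, so the
  number of positive answers is the cardinality of the next level, and it takes the place of the
  known cardinality.\<close>

lemma exec_round:
  assumes f: "f gU = 0" "f gV = 0" "f gW = 0" "f gL = 0" "f rFL = 0" "f gT = 0" "f gF = 0" "f gM = 0" "f gN = 0"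
    "f gI < B" "f gC = card (R (f gI))"
  shows "exec x round (cs f) t \<longleftrightarrow> nobad (f gI) \<and> t = cs (f(gC := card (R (Suc (f gI)))))"
proof -
  let ?I = "f gI" and ?R' = "R (Suc (f gI))"
  let ?G = "\<lambda>k. f(gN := card {v \<in> ?R'. v < k})"
  \<comment> \<open>Before the first candidate there is a path in any case. Afterwards none is left
    if the current level has a bad vertex, because the first call of \<open>check\<close> has
    failed.\<close>
  let ?P = "\<lambda>k. if k = 0 \<or> nobad ?I then {?G k} else {}"
  let ?Q = "\<lambda>u g. if nobad ?I then {?G (Suc u)} else {}"
  let ?body = "check ;; If (Rg gF 0) nonzero (reset_reg d gF ;; inc_reg d gN ;; reset_reg d rFL) Skip"
  have fin: "finite {v \<in> ?R'. v < k}" for k by simp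
  have lt: "card {v \<in> ?R'. v < k} < B" for k
    using card_mono[OF finite_R, of "{v \<in> ?R'. v < k}" "Suc ?I"] card_R[of "Suc ?I"] by (auto simp del: R.simps)
  have "exec x (forall_reg d gV ?body) (cs f) u \<longleftrightarrow> (\<exists>g \<in> ?P B. u = cs g)" for u
  proof (rule exec_forall_reg[where Q = ?Q, OF d])
    show "?P 0 = {f}" using f by (auto simp: fun_eq_iff)
    show "g gV = 0 \<and> g rFL = 0" if "g \<in> ?P k" for k g using that f by (auto split: if_splits)
    show "(\<Union>g \<in> ?P u. ?Q u g) = ?P (Suc u)" for u by (auto simp del: R.simps)
    show "exec x ?body (cs (g(gV := u))) t \<longleftrightarrow> (\<exists>g' \<in> ?Q u g. t = cs (g'(gV := u)))"
      if u: "u < B" and g: "g \<in> ?P u" for u g t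
    proof -
      have gG: "g = ?G u" using g by (auto split: if_splits simp del: R.simps)
      let ?If = "If (Rg gF 0) nonzero (reset_reg d gF ;; inc_reg d gN ;; reset_reg d rFL) Skip"
      let ?g = "g(gV := u)" and ?g1 = "g(gV := u, gF := if u \<in> ?R' then 1 else 0)"
      have "exec x check (cs ?g) v \<longleftrightarrow> nobad ?I \<and> v = cs ?g1" for v
        by (subst exec_check) (use gG f u in \<open>auto simp del: R.simps\<close>)
      then have 1: "exec x ?body (cs ?g) t \<longleftrightarrow> nobad ?I \<and> exec x ?If (cs ?g1) t"
        by (rule exec_Seq_cond)
      have "acts x d ?If ?g1 ((?G (Suc u))(gV := u))"
      proof (cases "u \<in> ?R'")
        case True
        have "{v \<in> ?R'. v < Suc u} = insert u {v \<in> ?R'. v < u}"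
          using True by (auto simp: less_Suc_eq simp del: R.simps)
        then have c: "card {v \<in> ?R'. v < Suc u} = Suc (g gN)" using gG by (simp del: R.simps)
        then have lt': "Suc (g gN) < B" using lt[of "Suc u"] by (simp del: R.simps)
        have gz: "g rFL = 0" "g gF = 0" using gG f by auto
        have "acts x d (reset_reg d gF ;; inc_reg d gN ;; reset_reg d rFL) ?g1 ((?G (Suc u))(gV := u))"
        proof (rule acts_Seq[OF _ acts_Seq])
          show "acts x d (reset_reg d gF) ?g1 ?g"
            by (rule acts_target[OF acts_reset_reg]) (use gz in \<open>auto simp: fun_eq_iff simp del: R.simps\<close>)
          show "acts x d (inc_reg d gN) ?g (g(gV := u, gN := Suc (g gN), rFL := 1))"
            by (rule acts_target[OF acts_inc_reg[OF d]]) (use gz lt' in auto)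
          show "acts x d (reset_reg d rFL) (g(gV := u, gN := Suc (g gN), rFL := 1)) ((?G (Suc u))(gV := u))"
            by (rule acts_target[OF acts_reset_reg]) (use gz gG c f in \<open>auto simp: fun_eq_iff simp del: R.simps\<close>)
        qed
        then show ?thesis by (intro acts_If[OF d]) (use True in \<open>auto simp del: R.simps\<close>)
      next
        case False
        then have "{v \<in> ?R'. v < Suc u} = {v \<in> ?R'. v < u}" by (auto simp: less_Suc_eq simp del: R.simps)
        then have "?g1 = (?G (Suc u))(gV := u)" using False gG f by (auto simp: fun_eq_iff simp del: R.simps)
        then show ?thesis
          by (intro acts_If[OF d]) (use False f in \<open>auto simp: acts_Skip simp del: R.simps\<close>)
      qed
      then have e: "exec x ?If (cs ?g1) t \<longleftrightarrow> t = cs ((?G (Suc u))(gV := u))" by (rule acts_exec)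
      show ?thesis unfolding 1 e by (cases "nobad ?I") (simp_all only: if_True if_False, blast+)
    qed
  qed simp
  note fa = this
  have SB: "{v \<in> ?R'. v < B} = ?R'" using R_less by (auto simp del: R.simps)
  have rest: "acts x d (copy_reg d gN gC ;; reset_reg d gN) (?G B) (f(gC := card ?R'))"
    by (rule acts_target[OF acts_Seq[OF acts_copy_reg acts_reset_reg]])
      (use f SB in \<open>auto simp: fun_eq_iff simp del: R.simps\<close>)
  have "exec x round (cs f) t \<longleftrightarrow> (\<exists>g \<in> ?P B. exec x (copy_reg d gN gC ;; reset_reg d gN) (cs g) t)"
    unfolding round_def by (rule exec_Seq_set[OF fa])
  also have "\<dots> \<longleftrightarrow> nobad ?I \<and> exec x (copy_reg d gN gC ;; reset_reg d gN) (cs (?G B)) t"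
    by (auto simp del: R.simps)
  also have "\<dots> \<longleftrightarrow> nobad ?I \<and> t = cs (f(gC := card ?R'))"
    by (simp only: acts_exec[OF rest])
  finally show ?thesis .
qed

text \<open>The induction starts with level \<open>0\<close>, whose only member is
  \<open>v0\<close>; hence the initial cardinality \<open>1\<close>.\<close>

definition unreachable_prog :: "'s com" where
  "unreachable_prog = (set1 (Rg gC 0) ;; forall_reg d gI round)"

text \<open>The loop covers the levels below \<open>B\<close>, and a path survives the round of a
  level iff this level has no bad vertex. The remaining levels follow by
  \<open>nobad_all\<close>.\<close>

theorem unreachable_prog: "(\<exists>t. exec x unreachable_prog start t) \<longleftrightarrow> (\<forall>i. nobad i)"
proof -
  let ?z = "\<lambda>_ :: nat. 0 :: nat"
  let ?P = "\<lambda>k. if \<forall>j < k. nobad j then {?z(gC := card (R k))} else {}"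
  let ?Q = "\<lambda>u g. if nobad u then {?z(gC := card (R (Suc u)))} else {}"
  have "exec x (forall_reg d gI round) (cs (?z(gC := 1))) t \<longleftrightarrow> (\<exists>g \<in> ?P B. t = cs g)" for t
  proof (rule exec_forall_reg[where Q = ?Q, OF d])
    show "?P 0 = {?z(gC := 1)}" by simp
    show "g gI = 0 \<and> g rFL = 0" if "g \<in> ?P k" for k g using that by (auto split: if_splits)
    show "(\<Union>g \<in> ?P u. ?Q u g) = ?P (Suc u)" for u by (auto simp: less_Suc_eq simp del: R.simps)
    show "exec x round (cs (g(gI := u))) t \<longleftrightarrow> (\<exists>g' \<in> ?Q u g. t = cs (g'(gI := u)))"
      if u: "u < B" and g: "g \<in> ?P u" for u g t
    proof -
      have gG: "g = ?z(gC := card (R u))" using g by (auto split: if_splits)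
      have "(g(gI := u))(gC := card (R (Suc u))) = (?z(gC := card (R (Suc u))))(gI := u)"
        unfolding gG by (auto simp: fun_eq_iff)
      then show ?thesis
        by (subst exec_round) (use gG u in \<open>auto simp del: R.simps\<close>)
    qed
  qed simp
  note fa = this
  have st: "start = cs ?z" by (auto simp: cstate_def fun_eq_iff split: head.splits)
  have "exec x unreachable_prog start t \<longleftrightarrow> (\<exists>g \<in> ?P B. t = cs g)" for t
    unfolding unreachable_prog_def st fa[symmetric]
    by (rule acts_Seq_iff, rule acts_target[OF acts_set1[OF d]]) auto
  then have "(\<exists>t. exec x unreachable_prog start t) \<longleftrightarrow> (\<exists>g. g \<in> ?P B)"
    by blast
  also have "\<dots> \<longleftrightarrow> (\<forall>j < B. nobad j)" by (auto simp del: R.simps)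
  finally have "(\<exists>t. exec x unreachable_prog start t) \<longleftrightarrow> (\<forall>j < B. nobad j)" .
  then show ?thesis using nobad_all by simp
qed

end

section \<open>Deciding properties of the languages\<close>

text \<open>\<open>Lead\<close> extends the stem by a letter, \<open>Switch\<close> ends the stem,
  \<open>Choose\<close> extends the auxiliary word that leads to the guessed progress states, and
  \<open>Run\<close> extends the period.\<close>

datatype label = Lead nat | Switch | Choose nat | Run nat

text \<open>
  A vertex has twelve digits. Two flags record the phase and whether the period has been started;
  for each of the two FDFAs there are the current and the remembered leading state, and a guessed
  progress state \<open>p\<close> together with the states reached from the initial state and from \<open>p\<close>
  on reading the period. Digits of the second FDFA directly follow those of the first.
\<close>

definition switch_side :: "nat \<Rightarrow> 'a symbol com \<Rightarrow> nat \<Rightarrow> nat \<Rightarrow> nat \<Rightarrow> nat \<Rightarrow> nat \<Rightarrow> nat \<Rightarrow> 'a symbol com" where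
  "switch_side k g q q0 p p1 p2 r = (copy (Rg r q) (Rg r q0) ;;
     get_initial (go_progress k g (Rg r q0)) (Rg r p) ;; copy (Rg r p) (Rg r p1) ;; copy (Rg r p) (Rg r p2))"

text \<open>The second run of the period starts in \<open>p\<close>, so its state \<open>p2\<close>
  has to follow \<open>p\<close> as long as \<open>p\<close> is still being chosen. The first run,
  in \<open>p1\<close>, remains in the initial state.\<close>

definition choose_side :: "nat \<Rightarrow> 'a symbol com \<Rightarrow> nat \<Rightarrow> nat \<Rightarrow> nat \<Rightarrow> nat \<Rightarrow> nat \<Rightarrow> 'a symbol com" where
  "choose_side k g q0 p p2 l r =
     (get_delta k (go_progress k g (Rg r q0)) (Rg r p) l (Rg r p) ;; copy (Rg r p) (Rg r p2))"

definition run_side :: "nat \<Rightarrow> 'a symbol com \<Rightarrow> nat \<Rightarrow> nat \<Rightarrow> nat \<Rightarrow> nat \<Rightarrow> nat \<Rightarrow> nat \<Rightarrow> 'a symbol com" where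
  "run_side k g q q0 p1 p2 l r = (get_delta k g (Rg r q) l (Rg r q) ;;
     get_delta k (go_progress k g (Rg r q0)) (Rg r p1) l (Rg r p1) ;;
     get_delta k (go_progress k g (Rg r q0)) (Rg r p2) l (Rg r p2))"

text \<open>A label that does not fit the phase leaves the vertex unchanged. So successors are total
  functions, and the additional self-loops do not affect reachability.\<close>

fun step_com :: "nat \<Rightarrow> 'a symbol com \<Rightarrow> 'a symbol com \<Rightarrow> label \<Rightarrow> nat \<Rightarrow> 'a symbol com" where
  "step_com k g1 g2 (Lead l) r = If (Rg r 0) nonzero Skip
     (get_delta k g1 (Rg r 2) l (Rg r 2) ;; get_delta k g2 (Rg r 3) l (Rg r 3))"
| "step_com k g1 g2 Switch r = If (Rg r 0) nonzero Skip
     (set1 (Rg r 0) ;; switch_side k g1 2 4 6 8 10 r ;; switch_side k g2 3 5 7 9 11 r)"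
| "step_com k g1 g2 (Choose l) r = If (Rg r 0) nonzero
     (If (Rg r 1) nonzero Skip (choose_side k g1 4 6 10 l r ;; choose_side k g2 5 7 11 l r)) Skip"
| "step_com k g1 g2 (Run l) r = If (Rg r 0) nonzero
     (set1 (Rg r 1) ;; run_side k g1 2 4 8 10 l r ;; run_side k g2 3 5 9 11 l r) Skip"

definition init_com :: "'a symbol com \<Rightarrow> 'a symbol com \<Rightarrow> nat \<Rightarrow> 'a symbol com" where
  "init_com g1 g2 r = (reset_reg 12 r ;; get_initial g1 (Rg r 2) ;; get_initial g2 (Rg r 3))"

abbreviation (input) "aFL \<equiv> Rg rFL 0"

text \<open>The flag register collects the reasons for which a vertex is not bad.\<close>

definition bad_com :: "(bool \<Rightarrow> bool \<Rightarrow> bool) \<Rightarrow> nat \<Rightarrow> 'a symbol com \<Rightarrow> 'a symbol com \<Rightarrow> nat \<Rightarrow> 'a symbol com" where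
  "bad_com \<beta> k g1 g2 r = (If (Rg r 1) nonzero Skip (set1 aFL) ;;
     neq (Rg r 2) (Rg r 4) aFL ;; neq (Rg r 8) (Rg r 6) aFL ;; neq (Rg r 10) (Rg r 6) aFL ;;
     neq (Rg r 3) (Rg r 5) aFL ;; neq (Rg r 9) (Rg r 7) aFL ;; neq (Rg r 11) (Rg r 7) aFL ;;
     get_final (go_progress k g1 (Rg r 4)) (Rg r 6) (Rg rFL 1) ;;
     get_final (go_progress k g2 (Rg r 5)) (Rg r 7) (Rg rFL 2) ;;
     If (Rg rFL 1) nonzero
       (If (Rg rFL 2) nonzero (if \<beta> True True then Skip else set1 aFL) (if \<beta> True False then Skip else set1 aFL))
       (If (Rg rFL 2) nonzero (if \<beta> False True then Skip else set1 aFL) (if \<beta> False False then Skip else set1 aFL)) ;;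
     reset (Rg rFL 1) ;; reset (Rg rFL 2) ;; If aFL nonzero (reset aFL) (set1 aFL))"

definition all_labels :: "nat \<Rightarrow> label list" where
  "all_labels k = Switch # map Lead [0..<k] @ map Choose [0..<k] @ map Run [0..<k]"

text \<open>The commands \<open>go1\<close> and \<open>go2\<close> may lead to the same place. This
  covers the problems for one FDFA, where \<open>F\<close> and \<open>G\<close> coincide and the
  input has a single encoding.\<close>

locale fdfa_pair =
  fixes \<sigma> :: "'a list" and x :: "'a symbol list" and F G :: "'a fdfa" and go1 go2 :: "'a symbol com"
    and ys1 ys2 :: "'a symbol list" and \<beta> :: "bool \<Rightarrow> bool \<Rightarrow> bool"
  assumes \<sigma>: "set \<sigma> = UNIV"
    and wf: "wf_fdfa F" "wf_fdfa G"
    and go: "goes x go1 (enc_fdfa \<sigma> F @ ys1)" "goes x go2 (enc_fdfa \<sigma> G @ ys2)"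
    and ys: "flagless ys1" "flagless ys2"
    and det_go: "det go1" "det go2"
begin

abbreviation "b \<equiv> length x + 2"

section \<open>Effect of the commands on the digits of a vertex\<close>

definition wfl :: "nat list \<Rightarrow> bool" where
  "wfl ds \<longleftrightarrow> length ds = 12 \<and> set ds \<subseteq> {..<b}"

lemma wfl_upd: "wfl ds \<Longrightarrow> v \<le> Suc (length x) \<Longrightarrow> wfl (ds[i := v])"
  using set_update_subset_insert[of ds i v] by (auto simp: wfl_def)

text \<open>The effect on the digit list of one register, all other registers being untouched. This
  form hides the number behind the digits, so that edges can be verified component by
  component.\<close>

definition does :: "nat \<Rightarrow> 'a symbol com \<Rightarrow> nat list \<Rightarrow> nat list \<Rightarrow> bool" where
  "does r c ds ds' \<longleftrightarrow> (\<forall>f. f r = num b ds \<longrightarrow> acts x 12 c f (f(r := num b ds')))"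

lemma does_Skip: "does r Skip ds ds"
  by (auto simp: does_def acts_Skip fun_upd_idem)

lemma does_Seq:
  assumes "does r c1 ds ds1" "does r c2 ds1 ds2"
  shows "does r (c1 ;; c2) ds ds2"
  unfolding does_def
proof (intro allI impI)
  fix f assume "f r = num b ds"
  then have 1: "acts x 12 c1 f (f(r := num b ds1))" using assms(1) by (simp add: does_def)
  have "acts x 12 c2 (f(r := num b ds1)) ((f(r := num b ds1))(r := num b ds2))"
    using assms(2) unfolding does_def by (elim allE) (erule mp, simp)
  then have 2: "acts x 12 c2 (f(r := num b ds1)) (f(r := num b ds2))" by simp
  show "acts x 12 (c1 ;; c2) f (f(r := num b ds2))" by (rule acts_Seq[OF 1 2])
qed

lemma cstate_num: "wfl ds \<Longrightarrow> f r = num b ds \<Longrightarrow> i < 12 \<Longrightarrow> fst (cstate x 12 f) (Rg r i) = ds ! i"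
  using dig_num[of i ds b] by (simp add: wfl_def)

lemma does_If:
  assumes "wfl ds" "i < 12" "does r (if ds ! i = 0 then c2 else c1) ds ds'"
  shows "does r (If (Rg r i) nonzero c1 c2) ds ds'"
  unfolding does_def
proof (intro allI impI)
  fix f assume f: "f r = num b ds"
  note v = cstate_num[OF assms(1), of f r i, OF f assms(2)]
  have "acts x 12 (if ds ! i = 0 then c2 else c1) f (f(r := num b ds'))"
    using assms(3) f by (simp add: does_def)
  then show "acts x 12 (If (Rg r i) nonzero c1 c2) f (f(r := num b ds'))"
    unfolding acts_def exec_If_iff Compl_iff singleton_iff scan_LeftEnd v by (auto split: if_splits)
qed

definition shows_ds :: "(head \<Rightarrow> nat) \<Rightarrow> nat \<Rightarrow> nat list \<Rightarrow> bool" where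
  "shows_ds h r ds \<longleftrightarrow> ok x h \<and> (\<forall>j < 12. h (Rg r j) = ds ! j)"

lemma does_upd:
  assumes "wfl ds" "i < 12" "v \<le> Suc (length x)" "det c"
    and "\<And>h. shows_ds h r ds \<Longrightarrow> exec x c (h, []) (h(Rg r i := v), [])"
  shows "does r c ds (ds[i := v])"
  unfolding does_def
proof (intro allI impI actsI assms(4))
  fix f assume f: "f r = num b ds"
  have "shows_ds (fst (cstate x 12 f)) r ds"
    using cstate_num[OF assms(1), of f r, OF f] ok_cstate[of x 12 f] by (simp add: shows_ds_def del: cstate_simps)
  from assms(5)[OF this] have "exec x c (cstate x 12 f) ((fst (cstate x 12 f))(Rg r i := v), [])"
    by (simp only: cstate_pair[symmetric])
  also have "((fst (cstate x 12 f))(Rg r i := v), []) = cstate x 12 (f(r := num b ((digits b 12 (f r))[i := v])))"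
    by (rule cstate_upd) (use assms in auto)
  also have "digits b 12 (f r) = ds"
    unfolding f using assms(1) dig_num[of _ ds b] by (intro nth_equalityI) (auto simp: wfl_def)
  finally show "exec x c (cstate x 12 f) (cstate x 12 (f(r := num b (ds[i := v]))))" .
qed

lemma does_set1: "wfl ds \<Longrightarrow> i < 12 \<Longrightarrow> does r (set1 (Rg r i)) ds (ds[i := 1])"
  by (rule does_upd) (simp_all only: shows_ds_def ok_def det_set1, auto intro!: exec_target[OF exec_set1])

lemma does_copy:
  assumes "wfl ds" "i < 12" "j < 12" "i \<noteq> j"
  shows "does r (copy (Rg r i) (Rg r j)) ds (ds[j := ds ! i])"
proof (rule does_upd)
  have "ds ! i \<in> set ds" using assms by (simp add: wfl_def)
  then show "ds ! i \<le> Suc (length x)" using assms(1) by (auto simp: wfl_def)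
  show "exec x (copy (Rg r i) (Rg r j)) (h, []) (h(Rg r j := ds ! i), [])" if "shows_ds h r ds" for h
    by (rule exec_target[OF exec_copy]) (use that assms in \<open>auto simp: shows_ds_def ok_def\<close>)
qed (use assms in auto)

text \<open>What is common to both halves of a vertex, so that each macro is verified once and then
  used for either FDFA.\<close>

definition side :: "'a fdfa \<Rightarrow> 'a symbol com \<Rightarrow> bool" where
  "side H g \<longleftrightarrow> wf_fdfa H \<and> det g \<and> (\<exists>ys. goes x g (enc_fdfa \<sigma> H @ ys) \<and> flagless ys)"

lemma sides: "side F go1" "side G go2"
  using wf go ys det_go by (auto simp: side_def)

lemma side_leading: "side H g \<Longrightarrow> ok x h \<Longrightarrow> \<exists>ys. locates \<sigma> x g h (leading H) (dfas \<sigma> H 0 @ ys) \<and> flagless ys"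
  using locates_leading by (fastforce simp: side_def)

lemma side_progress:
  assumes "side H g" "ok x h" "is_Rg q" "h q < nstates (leading H)"
  shows "\<exists>ys. locates \<sigma> x (go_progress (length \<sigma>) g q) h (progress H (h q)) (flags (progress H (h q)) @ ys)"
  using side_leading[OF assms(1,2)] locates_progress[OF _ _ assms(2-4)] assms(1) by (auto simp: side_def)

lemma side_nstates: "side H g \<Longrightarrow> nstates (leading H) \<le> length x"
  using side_leading[OF _ ok_start] locates_nstates by blast

lemma side_nstates_progress:
  assumes "side H g" "q < nstates (leading H)"
  shows "nstates (progress H q) \<le> length x"
proof -
  let ?h = "(\<lambda>_. 0)(Rg 0 0 := q)"
  have "ok x ?h" using ok_start side_nstates[OF assms(1)] assms(2) by - (rule ok_upd; auto)
  from side_progress[OF assms(1) this, of "Rg 0 0"] assms(2) locates_nstates show ?thesis by auto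
qed

lemma does_delta_leading:
  assumes "side H g" "wfl ds" "i < 12" "ds ! i < nstates (leading H)" "l < length \<sigma>"
  shows "does r (get_delta (length \<sigma>) g (Rg r i) l (Rg r i)) ds (ds[i := delta (leading H) (ds ! i) (\<sigma> ! l)])"
proof (rule does_upd)
  have wfH: "wf_aut (leading H)" using assms(1) by (simp add: side_def wf_fdfa_def)
  then have "delta (leading H) (ds ! i) (\<sigma> ! l) < nstates (leading H)" using assms(4) by (simp add: wf_aut_def)
  then show "delta (leading H) (ds ! i) (\<sigma> ! l) \<le> Suc (length x)" using side_nstates[OF assms(1)] by simp
  fix h assume h: "shows_ds h r ds"
  then have okh: "ok x h" by (simp add: shows_ds_def)
  obtain ys where "locates \<sigma> x g h (leading H) ys" using side_leading[OF assms(1) okh] by blast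
  from exec_get_delta[OF this okh, of "Rg r i" "Rg r i" l] h assms
  show "exec x (get_delta (length \<sigma>) g (Rg r i) l (Rg r i)) (h, []) (h(Rg r i := delta (leading H) (ds ! i) (\<sigma> ! l)), [])"
    by (simp add: shows_ds_def)
qed (use assms in \<open>auto simp: side_def\<close>)

lemma does_delta_progress:
  assumes "side H g" "wfl ds" "i < 12" "m < 12" "ds ! m < nstates (leading H)"
    "ds ! i < nstates (progress H (ds ! m))" "l < length \<sigma>"
  shows "does r (get_delta (length \<sigma>) (go_progress (length \<sigma>) g (Rg r m)) (Rg r i) l (Rg r i)) ds
    (ds[i := delta (progress H (ds ! m)) (ds ! i) (\<sigma> ! l)])"
proof (rule does_upd)
  let ?D = "progress H (ds ! m)"
  have wfH: "wf_aut ?D" using assms(1,5) by (simp add: side_def wf_fdfa_def wf_dfa_def)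
  then have "delta ?D (ds ! i) (\<sigma> ! l) < nstates ?D" using assms(6) by (simp add: wf_aut_def)
  then show "delta ?D (ds ! i) (\<sigma> ! l) \<le> Suc (length x)" using side_nstates_progress[OF assms(1,5)] by simp
  fix h assume h: "shows_ds h r ds"
  then have okh: "ok x h" and hm: "h (Rg r m) = ds ! m" "h (Rg r i) = ds ! i" using assms by (simp_all add: shows_ds_def)
  obtain ys where "locates \<sigma> x (go_progress (length \<sigma>) g (Rg r m)) h ?D ys"
    using side_progress[OF assms(1) okh, of "Rg r m"] hm assms by auto
  from exec_get_delta[OF this okh, of "Rg r i" "Rg r i" l] hm assms
  show "exec x (get_delta (length \<sigma>) (go_progress (length \<sigma>) g (Rg r m)) (Rg r i) l (Rg r i)) (h, [])
    (h(Rg r i := delta ?D (ds ! i) (\<sigma> ! l)), [])" by simp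
qed (use assms in \<open>auto simp: side_def\<close>)

lemma does_initial_leading:
  assumes "side H g" "wfl ds" "i < 12"
  shows "does r (get_initial g (Rg r i)) ds (ds[i := initial (leading H)])"
proof (rule does_upd)
  have "initial (leading H) < nstates (leading H)" using assms(1) by (simp add: side_def wf_fdfa_def wf_aut_def)
  then show "initial (leading H) \<le> Suc (length x)" using side_nstates[OF assms(1)] by simp
  fix h assume h: "shows_ds h r ds"
  then have okh: "ok x h" by (simp add: shows_ds_def)
  obtain ys where "locates \<sigma> x g h (leading H) ys" using side_leading[OF assms(1) okh] by blast
  from exec_get_initial[OF this okh, of "Rg r i"]
  show "exec x (get_initial g (Rg r i)) (h, []) (h(Rg r i := initial (leading H)), [])" by simp
qed (use assms in \<open>auto simp: side_def\<close>)

lemma does_initial_progress: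
  assumes "side H g" "wfl ds" "i < 12" "m < 12" "ds ! m < nstates (leading H)"
  shows "does r (get_initial (go_progress (length \<sigma>) g (Rg r m)) (Rg r i)) ds (ds[i := initial (progress H (ds ! m))])"
proof (rule does_upd)
  let ?D = "progress H (ds ! m)"
  have "initial ?D < nstates ?D" using assms(1,5) by (simp add: side_def wf_fdfa_def wf_dfa_def wf_aut_def)
  then show "initial ?D \<le> Suc (length x)" using side_nstates_progress[OF assms(1,5)] by simp
  fix h assume h: "shows_ds h r ds"
  then have okh: "ok x h" and hm: "h (Rg r m) = ds ! m" using assms by (simp_all add: shows_ds_def)
  obtain ys where "locates \<sigma> x (go_progress (length \<sigma>) g (Rg r m)) h ?D ys"
    using side_progress[OF assms(1) okh, of "Rg r m"] hm assms by auto
  from exec_get_initial[OF this okh, of "Rg r i"]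
  show "exec x (get_initial (go_progress (length \<sigma>) g (Rg r m)) (Rg r i)) (h, []) (h(Rg r i := initial ?D), [])" by simp
qed (use assms in \<open>auto simp: side_def\<close>)

lemma does_switch_side:
  assumes H: "side H g" "wfl ds" "ds ! q < nstates (leading H)" and i: "distinct [q, q0, p, p1, p2]" "\<forall>j \<in> {q, q0, p, p1, p2}. j < 12"
  defines "v \<equiv> initial (progress H (ds ! q))"
  shows "does r (switch_side (length \<sigma>) g q q0 p p1 p2 r) ds (ds[q0 := ds ! q, p := v, p1 := v, p2 := v])"
proof -
  have len: "length ds = 12" using H(2) by (simp add: wfl_def)
  let ?d1 = "ds[q0 := ds ! q]" and ?d2 = "ds[q0 := ds ! q, p := v]" and ?d3 = "ds[q0 := ds ! q, p := v, p1 := v]"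
  have "v < nstates (progress H (ds ! q))" using H(1,3) by (simp add: v_def side_def wf_fdfa_def wf_dfa_def wf_aut_def)
  then have v: "v \<le> Suc (length x)" using side_nstates_progress[OF H(1,3)] by simp
  have q: "ds ! q \<le> Suc (length x)" using side_nstates[OF H(1)] H(3) by simp
  have w1: "wfl ?d1" using wfl_upd[OF H(2) q] .
  have w2: "wfl ?d2" using wfl_upd[OF w1 v] .
  have w3: "wfl ?d3" using wfl_upd[OF w2 v] .
  have 1: "does r (copy (Rg r q) (Rg r q0)) ds ?d1" using does_copy[OF H(2), of q q0 r] i by simp
  have "does r (get_initial (go_progress (length \<sigma>) g (Rg r q0)) (Rg r p)) ?d1 (?d1[p := initial (progress H (?d1 ! q0))])"
    by (rule does_initial_progress[OF H(1) w1]) (use i H len in auto)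
  then have 2: "does r (get_initial (go_progress (length \<sigma>) g (Rg r q0)) (Rg r p)) ?d1 ?d2"
    using i len by (simp add: v_def)
  have 3: "does r (copy (Rg r p) (Rg r p1)) ?d2 ?d3" using does_copy[OF w2, of p p1 r] i len by (simp add: nth_list_update)
  have "?d3 ! p = v" using i len by (auto simp: nth_list_update)
  then have 4: "does r (copy (Rg r p) (Rg r p2)) ?d3 (?d3[p2 := v])" using does_copy[OF w3, of p p2 r] i by simp
  show ?thesis unfolding switch_side_def by (rule does_Seq[OF 1 does_Seq[OF 2 does_Seq[OF 3 4]]])
qed

lemma does_choose_side:
  assumes H: "side H g" "wfl ds" "ds ! q0 < nstates (leading H)" "ds ! p < nstates (progress H (ds ! q0))" "l < length \<sigma>"
    and i: "distinct [q0, p, p2]" "\<forall>j \<in> {q0, p, p2}. j < 12"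
  defines "v \<equiv> delta (progress H (ds ! q0)) (ds ! p) (\<sigma> ! l)"
  shows "does r (choose_side (length \<sigma>) g q0 p p2 l r) ds (ds[p := v, p2 := v])"
proof -
  have len: "length ds = 12" using H(2) by (simp add: wfl_def)
  have "v < nstates (progress H (ds ! q0))" using H(1,3,4) by (simp add: v_def side_def wf_fdfa_def wf_dfa_def wf_aut_def)
  then have v: "v \<le> Suc (length x)" using side_nstates_progress[OF H(1,3)] by simp
  have w1: "wfl (ds[p := v])" using wfl_upd[OF H(2) v] .
  have 1: "does r (get_delta (length \<sigma>) (go_progress (length \<sigma>) g (Rg r q0)) (Rg r p) l (Rg r p)) ds (ds[p := v])"
    unfolding v_def by (rule does_delta_progress[OF H(1,2)]) (use H i in auto)
  have 2: "does r (copy (Rg r p) (Rg r p2)) (ds[p := v]) (ds[p := v, p2 := v])" using does_copy[OF w1, of p p2 r] i len by simp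
  show ?thesis unfolding choose_side_def by (rule does_Seq[OF 1 2])
qed

lemma does_run_side:
  assumes H: "side H g" "wfl ds" "ds ! q < nstates (leading H)" "ds ! q0 < nstates (leading H)"
      "ds ! p1 < nstates (progress H (ds ! q0))" "ds ! p2 < nstates (progress H (ds ! q0))" "l < length \<sigma>"
    and i: "distinct [q, q0, p1, p2]" "\<forall>j \<in> {q, q0, p1, p2}. j < 12"
  shows "does r (run_side (length \<sigma>) g q q0 p1 p2 l r) ds (ds[q := delta (leading H) (ds ! q) (\<sigma> ! l),
    p1 := delta (progress H (ds ! q0)) (ds ! p1) (\<sigma> ! l), p2 := delta (progress H (ds ! q0)) (ds ! p2) (\<sigma> ! l)])"
proof -
  have len: "length ds = 12" using H(2) by (simp add: wfl_def)
  let ?a = "\<sigma> ! l" and ?P = "progress H (ds ! q0)"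
  let ?v = "delta (leading H) (ds ! q) ?a" and ?v1 = "delta ?P (ds ! p1) ?a"
  let ?d1 = "ds[q := ?v]" and ?d2 = "ds[q := ?v, p1 := ?v1]"
  have "?v < nstates (leading H)" "?v1 < nstates ?P"
    using H(1,3,4,5) by (simp_all add: side_def wf_fdfa_def wf_dfa_def wf_aut_def)
  then have v: "?v \<le> Suc (length x)" "?v1 \<le> Suc (length x)"
    using side_nstates[OF H(1)] side_nstates_progress[OF H(1,4)] by auto
  have w1: "wfl ?d1" using wfl_upd[OF H(2) v(1)] .
  have w2: "wfl ?d2" using wfl_upd[OF w1 v(2)] .
  have 1: "does r (get_delta (length \<sigma>) g (Rg r q) l (Rg r q)) ds ?d1"
    by (rule does_delta_leading[OF H(1,2)]) (use H i in auto)
  have 2: "does r (get_delta (length \<sigma>) (go_progress (length \<sigma>) g (Rg r q0)) (Rg r p1) l (Rg r p1)) ?d1 ?d2"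
    using does_delta_progress[OF H(1) w1, of p1 q0 l r] H i len by simp
  have 3: "does r (get_delta (length \<sigma>) (go_progress (length \<sigma>) g (Rg r q0)) (Rg r p2) l (Rg r p2)) ?d2
     (?d2[p2 := delta ?P (ds ! p2) ?a])"
    using does_delta_progress[OF H(1) w2, of p2 q0 l r] H i len by simp
  show ?thesis unfolding run_side_def by (rule does_Seq[OF 1 does_Seq[OF 2 3]])
qed

abbreviation "dL H ds q l \<equiv> delta (leading H) (ds ! q) (\<sigma> ! l)"
abbreviation "dP H ds q0 p l \<equiv> delta (progress H (ds ! q0)) (ds ! p) (\<sigma> ! l)"
abbreviation "iP H ds q \<equiv> initial (progress H (ds ! q))"

fun succ :: "label \<Rightarrow> nat list \<Rightarrow> nat list" where
  "succ (Lead l) ds = (if ds ! 0 = 0 then ds[2 := dL F ds 2 l, 3 := dL G ds 3 l] else ds)"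
| "succ Switch ds = (if ds ! 0 = 0 then ds[0 := 1, 4 := ds ! 2, 6 := iP F ds 2, 8 := iP F ds 2, 10 := iP F ds 2,
     5 := ds ! 3, 7 := iP G ds 3, 9 := iP G ds 3, 11 := iP G ds 3] else ds)"
| "succ (Choose l) ds = (if ds ! 0 = 0 \<or> ds ! 1 \<noteq> 0 then ds else
     ds[6 := dP F ds 4 6 l, 10 := dP F ds 4 6 l, 7 := dP G ds 5 7 l, 11 := dP G ds 5 7 l])"
| "succ (Run l) ds = (if ds ! 0 = 0 then ds else ds[1 := 1, 2 := dL F ds 2 l, 8 := dP F ds 4 8 l, 10 := dP F ds 4 10 l,
     3 := dL G ds 3 l, 9 := dP G ds 5 9 l, 11 := dP G ds 5 11 l])"

definition valid :: "nat list \<Rightarrow> bool" where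
  "valid ds \<longleftrightarrow> wfl ds \<and> ds ! 2 < nstates (leading F) \<and> ds ! 3 < nstates (leading G) \<and>
     ds ! 4 < nstates (leading F) \<and> ds ! 5 < nstates (leading G) \<and>
     (\<forall>p \<in> {6, 8, 10}. ds ! p < nstates (progress F (ds ! 4))) \<and> (\<forall>p \<in> {7, 9, 11}. ds ! p < nstates (progress G (ds ! 5)))"

lemma does_step_com:
  assumes "valid ds" "a \<in> set (all_labels (length \<sigma>))"
  shows "does r (step_com (length \<sigma>) go1 go2 a r) ds (succ a ds)"
proof -
  have v: "wfl ds" "ds ! 2 < nstates (leading F)" "ds ! 3 < nstates (leading G)"
     "ds ! 4 < nstates (leading F)" "ds ! 5 < nstates (leading G)"
     "ds ! 6 < nstates (progress F (ds ! 4))" "ds ! 8 < nstates (progress F (ds ! 4))" "ds ! 10 < nstates (progress F (ds ! 4))"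
     "ds ! 7 < nstates (progress G (ds ! 5))" "ds ! 9 < nstates (progress G (ds ! 5))" "ds ! 11 < nstates (progress G (ds ! 5))"
    using assms(1) by (auto simp: valid_def)
  then have len: "length ds = 12" by (simp add: wfl_def)
  have bounds: "ds ! 2 \<le> Suc (length x)" "ds ! 3 \<le> Suc (length x)"
    using v(2,3) side_nstates[OF sides(1)] side_nstates[OF sides(2)] by auto
  have auts: "wf_aut (leading F)" "wf_aut (progress F (ds ! 4))" "wf_aut (progress F (ds ! 2))"
    using wf(1) v by (simp_all add: wf_fdfa_def wf_dfa_def)
  have dLb: "delta (leading F) (ds ! 2) c \<le> Suc (length x)" for c
  proof -
    have "delta (leading F) (ds ! 2) c < nstates (leading F)" using auts(1) v(2) by (simp add: wf_aut_def)
    then show ?thesis using side_nstates[OF sides(1)] by simp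
  qed
  have dPb: "delta (progress F (ds ! 4)) p c \<le> Suc (length x)" if "p < nstates (progress F (ds ! 4))" for p c
  proof -
    have "delta (progress F (ds ! 4)) p c < nstates (progress F (ds ! 4))" using auts(2) that by (simp add: wf_aut_def)
    then show ?thesis using side_nstates_progress[OF sides(1) v(4)] by simp
  qed
  have iPb: "initial (progress F (ds ! 2)) \<le> Suc (length x)"
  proof -
    have "initial (progress F (ds ! 2)) < nstates (progress F (ds ! 2))" using auts(3) by (simp add: wf_aut_def)
    then show ?thesis using side_nstates_progress[OF sides(1) v(2)] by simp
  qed
  show ?thesis
  proof (cases a)
    case (Lead l)
    then have l: "l < length \<sigma>" using assms(2) by (auto simp: all_labels_def)
    have w1: "wfl (ds[2 := dL F ds 2 l])" using wfl_upd[OF v(1) dLb] .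
    have "does r (get_delta (length \<sigma>) go1 (Rg r 2) l (Rg r 2)) ds (ds[2 := dL F ds 2 l])"
      by (rule does_delta_leading[OF sides(1) v(1)]) (use v l in auto)
    moreover have "does r (get_delta (length \<sigma>) go2 (Rg r 3) l (Rg r 3)) (ds[2 := dL F ds 2 l]) (ds[2 := dL F ds 2 l, 3 := dL G ds 3 l])"
      using does_delta_leading[OF sides(2) w1, of 3 l r] v l len by simp
    ultimately show ?thesis
      unfolding Lead step_com.simps by (intro does_If[OF v(1)]) (auto intro: does_Seq does_Skip)
  next
    case Switch
    let ?d0 = "ds[0 := 1]" and ?d1 = "ds[0 := 1, 4 := ds ! 2, 6 := iP F ds 2, 8 := iP F ds 2, 10 := iP F ds 2]"
    have w0: "wfl ?d0" by (rule wfl_upd[OF v(1)]) simp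
    have w1: "wfl ?d1" by (intro wfl_upd[OF wfl_upd[OF wfl_upd[OF wfl_upd[OF w0 bounds(1)] iPb] iPb] iPb])
    have "does r (set1 (Rg r 0)) ds ?d0" by (rule does_set1[OF v(1)]) simp
    moreover have "does r (switch_side (length \<sigma>) go1 2 4 6 8 10 r) ?d0 ?d1"
      using does_switch_side[OF sides(1) w0, of 2 4 6 8 10 r] v len by simp
    moreover have "does r (switch_side (length \<sigma>) go2 3 5 7 9 11 r) ?d1
        (?d1[5 := ds ! 3, 7 := iP G ds 3, 9 := iP G ds 3, 11 := iP G ds 3])"
      using does_switch_side[OF sides(2) w1, of 3 5 7 9 11 r] v len by simp
    ultimately show ?thesis
      unfolding Switch step_com.simps by (intro does_If[OF v(1)]) (auto intro: does_Seq does_Skip)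
  next
    case (Choose l)
    then have l: "l < length \<sigma>" using assms(2) by (auto simp: all_labels_def)
    let ?d1 = "ds[6 := dP F ds 4 6 l, 10 := dP F ds 4 6 l]"
    have w1: "wfl ?d1" by (rule wfl_upd[OF wfl_upd[OF v(1) dPb[OF v(6)]] dPb[OF v(6)]])
    have "does r (choose_side (length \<sigma>) go1 4 6 10 l r) ds ?d1"
      by (rule does_choose_side[OF sides(1) v(1)]) (use v l in auto)
    moreover have "does r (choose_side (length \<sigma>) go2 5 7 11 l r) ?d1 (?d1[7 := dP G ds 5 7 l, 11 := dP G ds 5 7 l])"
      using does_choose_side[OF sides(2) w1, of 5 7 l 11 r] v l len by simp
    ultimately have "does r (choose_side (length \<sigma>) go1 4 6 10 l r ;; choose_side (length \<sigma>) go2 5 7 11 l r) ds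
        (?d1[7 := dP G ds 5 7 l, 11 := dP G ds 5 7 l])"
      by (rule does_Seq)
    then have "does r (If (Rg r 1) nonzero Skip (choose_side (length \<sigma>) go1 4 6 10 l r ;; choose_side (length \<sigma>) go2 5 7 11 l r)) ds
        (if ds ! 1 \<noteq> 0 then ds else ?d1[7 := dP G ds 5 7 l, 11 := dP G ds 5 7 l])"
      by (intro does_If[OF v(1)]) (simp_all add: does_Skip)
    then show ?thesis
      unfolding Choose step_com.simps
      by (intro does_If[OF v(1)]) (simp_all add: does_Skip split: if_splits)
  next
    case (Run l)
    then have l: "l < length \<sigma>" using assms(2) by (auto simp: all_labels_def)
    let ?d0 = "ds[1 := 1]" and ?d1 = "ds[1 := 1, 2 := dL F ds 2 l, 8 := dP F ds 4 8 l, 10 := dP F ds 4 10 l]"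
    have w0: "wfl ?d0" by (rule wfl_upd[OF v(1)]) simp
    have w1: "wfl ?d1" by (rule wfl_upd[OF wfl_upd[OF wfl_upd[OF w0 dLb] dPb[OF v(7)]] dPb[OF v(8)]])
    have "does r (set1 (Rg r 1)) ds ?d0" by (rule does_set1[OF v(1)]) simp
    moreover have "does r (run_side (length \<sigma>) go1 2 4 8 10 l r) ?d0 ?d1"
      using does_run_side[OF sides(1) w0, of 2 4 8 10 l r] v l len by simp
    moreover have "does r (run_side (length \<sigma>) go2 3 5 9 11 l r) ?d1
        (?d1[3 := dL G ds 3 l, 9 := dP G ds 5 9 l, 11 := dP G ds 5 11 l])"
      using does_run_side[OF sides(2) w1, of 3 5 9 11 l r] v l len by simp
    ultimately show ?thesis
      unfolding Run step_com.simps by (intro does_If[OF v(1)]) (auto intro: does_Seq does_Skip)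
  qed
qed

end

lemma exec_branch:
  assumes "exec x (d p q) s t" "(scan x (fst s j) \<in> T) = p" "(scan x (fst s k) \<in> T) = q"
  shows "exec x (If j T (If k T (d True True) (d True False)) (If k T (d False True) (d False False))) s t"
  using assms by (cases p; cases q) (auto simp: exec_If_iff)

context fdfa_pair
begin

text \<open>The equations say that the leading states have returned and that the period leads to
  \<open>p\<close> both from the initial state and from \<open>p\<close>, for either FDFA. The flag
  in position \<open>1\<close> ensures that the period is nonempty.\<close>

definition badl :: "nat list \<Rightarrow> bool" where
  "badl ds \<longleftrightarrow> ds ! 1 \<noteq> 0 \<and> ds ! 2 = ds ! 4 \<and> ds ! 8 = ds ! 6 \<and> ds ! 10 = ds ! 6 \<and>
     ds ! 3 = ds ! 5 \<and> ds ! 9 = ds ! 7 \<and> ds ! 11 = ds ! 7 \<and>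
     \<beta> (ds ! 6 \<in> final (progress F (ds ! 4))) (ds ! 7 \<in> final (progress G (ds ! 5)))"

lemma acts_bad_com:
  assumes ds: "valid ds" "f r = num b ds" "f rFL = 0" "r \<noteq> rFL"
  shows "acts x 12 (bad_com \<beta> (length \<sigma>) go1 go2 r) f (f(rFL := if badl ds then 1 else 0))"
proof (rule actsI)
  let ?g1 = "go_progress (length \<sigma>) go1 (Rg r 4)" and ?g2 = "go_progress (length \<sigma>) go2 (Rg r 5)"
  show "det (bad_com \<beta> (length \<sigma>) go1 go2 r)" using det_go by (simp add: bad_com_def)
  have v: "wfl ds" "ds ! 4 < nstates (leading F)" "ds ! 5 < nstates (leading G)"
     "ds ! 6 < nstates (progress F (ds ! 4))" "ds ! 7 < nstates (progress G (ds ! 5))"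
    using ds(1) by (auto simp: valid_def)
  define h where "h = fst (cstate x 12 f)"
  have okh: "ok x h" unfolding h_def by (rule ok_cstate)
  have hr: "h (Rg r i) = ds ! i" if "i < 12" for i
    unfolding h_def by (rule cstate_num[where f = f and r = r, OF v(1) ds(2) that])
  have h9: "h (Rg rFL i) = 0" for i by (simp add: h_def ds(3))
  have okc: "ok x (h(aFL := c))" if "c \<le> 1" for c using okh that by - (rule ok_upd; auto)
  have neq: "exec x (neq (Rg r i) (Rg r j) aFL) (h(aFL := c), []) (h(aFL := c'), [])"
    if "i < 12" "j < 12" "c \<le> 1" "c' = (if ds ! i = ds ! j then c else 1)" for i j c c'
    by (rule exec_target[OF exec_neq[OF okc[OF that(3)]]]) (use that hr ds(4) in \<open>auto simp: fun_eq_iff\<close>)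
  define c0 :: nat where "c0 = (if ds ! 1 = 0 then 1 else 0)"
  define c1 where "c1 = (if ds ! 2 = ds ! 4 then c0 else 1)"
  define c2 where "c2 = (if ds ! 8 = ds ! 6 then c1 else 1)"
  define c3 where "c3 = (if ds ! 10 = ds ! 6 then c2 else 1)"
  define c4 where "c4 = (if ds ! 3 = ds ! 5 then c3 else 1)"
  define c5 where "c5 = (if ds ! 9 = ds ! 7 then c4 else 1)"
  define c6 where "c6 = (if ds ! 11 = ds ! 7 then c5 else 1)"
  have c: "c0 \<le> 1" "c1 \<le> 1" "c2 \<le> 1" "c3 \<le> 1" "c4 \<le> 1" "c5 \<le> 1" "c6 \<le> 1"
    by (simp_all add: c0_def c1_def c2_def c3_def c4_def c5_def c6_def)
  have e0: "exec x (If (Rg r 1) nonzero Skip (set1 aFL)) (h, []) (h(aFL := c0), [])"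
  proof (cases "ds ! 1 = 0")
    case True
    then show ?thesis
      by (intro exec.IfFalse exec_target[OF exec_set1]) (use hr[of 1] h9[of 0] in \<open>auto simp: c0_def\<close>)
  next
    case False
    then show ?thesis
      by (intro exec.IfTrue exec_target[OF exec.Skip]) (use hr[of 1] h9[of 0] in \<open>auto simp: c0_def fun_eq_iff\<close>)
  qed
  let ?f1 = "ds ! 6 \<in> final (progress F (ds ! 4))" and ?f2 = "ds ! 7 \<in> final (progress G (ds ! 5))"
  let ?v1 = "if ?f1 then 1 else 0 :: nat" and ?v2 = "if ?f2 then 1 else 0 :: nat"
  let ?h6 = "h(aFL := c6)" and ?h7 = "h(aFL := c6, Rg rFL 1 := ?v1)"
    and ?h8 = "h(aFL := c6, Rg rFL 1 := ?v1, Rg rFL 2 := ?v2)"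
  have ok7: "ok x ?h7" using okc[OF c(7)] by - (rule ok_upd; auto)
  have wfP: "wf_dfa (progress F (ds ! 4))" "wf_dfa (progress G (ds ! 5))"
    using wf v by (auto simp: wf_fdfa_def)
  have h64: "?h6 (Rg r 4) = ds ! 4" "?h6 (Rg r 6) = ds ! 6" and h75: "?h7 (Rg r 5) = ds ! 5" "?h7 (Rg r 7) = ds ! 7"
    using hr[of 4] hr[of 6] hr[of 5] hr[of 7] ds(4) by auto
  have e7: "exec x (get_final ?g1 (Rg r 6) (Rg rFL 1)) (?h6, []) (?h7, [])"
  proof -
    obtain ys where "locates \<sigma> x ?g1 ?h6 (progress F (ds ! 4)) (flags (progress F (ds ! 4)) @ ys)"
      using side_progress[OF sides(1) okc[OF c(7)], of "Rg r 4"] h64 v by auto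
    from exec_get_final[OF this okc[OF c(7)], of "Rg rFL 1" "Rg r 6" "[]"] h64 v wfP show ?thesis by simp
  qed
  have e8: "exec x (get_final ?g2 (Rg r 7) (Rg rFL 2)) (?h7, []) (?h8, [])"
  proof -
    obtain ys where "locates \<sigma> x ?g2 ?h7 (progress G (ds ! 5)) (flags (progress G (ds ! 5)) @ ys)"
      using side_progress[OF sides(2) ok7, of "Rg r 5"] h75 v by auto
    from exec_get_final[OF this ok7, of "Rg rFL 2" "Rg r 7" "[]"] h75 v wfP show ?thesis by simp
  qed
  define c9 where "c9 = (if \<beta> ?f1 ?f2 then c6 else 1)"
  let ?h9 = "h(aFL := c9, Rg rFL 1 := ?v1, Rg rFL 2 := ?v2)"
  have e9: "exec x (If (Rg rFL 1) nonzero
       (If (Rg rFL 2) nonzero (if \<beta> True True then Skip else set1 aFL) (if \<beta> True False then Skip else set1 aFL))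
       (If (Rg rFL 2) nonzero (if \<beta> False True then Skip else set1 aFL) (if \<beta> False False then Skip else set1 aFL)))
     (?h8, []) (?h9, [])"
  proof -
    have "exec x (set1 aFL) (?h8, []) (?h8(aFL := 1), [])" by (rule exec_set1) (use c(7) in simp)
    moreover have "?h8(aFL := 1) = h(aFL := 1, Rg rFL 1 := ?v1, Rg rFL 2 := ?v2)" by (auto simp: fun_eq_iff)
    ultimately have "exec x (set1 aFL) (?h8, []) (h(aFL := 1, Rg rFL 1 := ?v1, Rg rFL 2 := ?v2), [])" by (simp only:)
    then have "exec x (if \<beta> ?f1 ?f2 then Skip else set1 aFL) (?h8, []) (?h9, [])"
      unfolding c9_def by (cases "\<beta> ?f1 ?f2") (simp_all only: exec_Skip_iff if_True if_False)
    moreover have "(scan x (fst (?h8, []) (Rg rFL 1)) \<in> nonzero) = ?f1" "(scan x (fst (?h8, []) (Rg rFL 2)) \<in> nonzero) = ?f2"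
      by auto
    ultimately show ?thesis
      by - (rule exec_branch[where d = "\<lambda>p q. if \<beta> p q then Skip else set1 aFL" and p = ?f1 and q = ?f2])
  qed
  have e10: "exec x (reset (Rg rFL 1)) (?h9, []) (h(aFL := c9, Rg rFL 2 := ?v2), [])"
    by (rule exec_target[OF exec_reset]) (use h9 in \<open>auto simp: fun_eq_iff\<close>)
  have e11: "exec x (reset (Rg rFL 2)) (h(aFL := c9, Rg rFL 2 := ?v2), []) (h(aFL := c9), [])"
    by (rule exec_target[OF exec_reset]) (use h9 in \<open>auto simp: fun_eq_iff\<close>)
  have bad: "badl ds \<longleftrightarrow> c9 = 0"
    by (auto simp: badl_def c0_def c1_def c2_def c3_def c4_def c5_def c6_def c9_def)
  let ?c = "if badl ds then 1 else 0 :: nat"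
  have "c9 \<le> 1" using c by (simp add: c9_def)
  have e12: "exec x (If aFL nonzero (reset aFL) (set1 aFL)) (h(aFL := c9), []) (h(aFL := ?c), [])"
  proof (cases "c9 = 0")
    case True
    then show ?thesis
      by (intro exec.IfFalse exec_target[OF exec_set1]) (use bad in \<open>auto simp: fun_eq_iff\<close>)
  next
    case False
    then show ?thesis
      by (intro exec.IfTrue exec_target[OF exec_reset]) (use bad \<open>c9 \<le> 1\<close> in \<open>auto simp: fun_eq_iff\<close>)
  qed
  have n1: "exec x (neq (Rg r 2) (Rg r 4) aFL) (h(aFL := c0), []) (h(aFL := c1), [])"
    by (rule neq[OF _ _ c(1) c1_def]) simp_all
  have n2: "exec x (neq (Rg r 8) (Rg r 6) aFL) (h(aFL := c1), []) (h(aFL := c2), [])"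
    by (rule neq[OF _ _ c(2) c2_def]) simp_all
  have n3: "exec x (neq (Rg r 10) (Rg r 6) aFL) (h(aFL := c2), []) (h(aFL := c3), [])"
    by (rule neq[OF _ _ c(3) c3_def]) simp_all
  have n4: "exec x (neq (Rg r 3) (Rg r 5) aFL) (h(aFL := c3), []) (h(aFL := c4), [])"
    by (rule neq[OF _ _ c(4) c4_def]) simp_all
  have n5: "exec x (neq (Rg r 9) (Rg r 7) aFL) (h(aFL := c4), []) (h(aFL := c5), [])"
    by (rule neq[OF _ _ c(5) c5_def]) simp_all
  have n6: "exec x (neq (Rg r 11) (Rg r 7) aFL) (h(aFL := c5), []) (h(aFL := c6), [])"
    by (rule neq[OF _ _ c(6) c6_def]) simp_all
  have "exec x (bad_com \<beta> (length \<sigma>) go1 go2 r) (h, []) (h(aFL := ?c), [])"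
    unfolding bad_com_def
    by (rule exec.Seq[OF e0 exec.Seq[OF n1 exec.Seq[OF n2 exec.Seq[OF n3 exec.Seq[OF n4 exec.Seq[OF n5 exec.Seq[OF n6
      exec.Seq[OF e7 exec.Seq[OF e8 exec.Seq[OF e9 exec.Seq[OF e10 exec.Seq[OF e11 e12]]]]]]]]]]]])
  moreover have "(h(aFL := ?c), []) = cstate x 12 (f(rFL := ?c))"
  proof -
    have "dig (length x + 2) i ?c = (if i = 0 then ?c else 0)" for i
      by (cases i) (auto simp: dig_0 dig_Suc)
    then show ?thesis using ds(3) by (auto simp: h_def cstate_def fun_eq_iff split: head.splits)
  qed
  ultimately show "exec x (bad_com \<beta> (length \<sigma>) go1 go2 r) (cstate x 12 f) (cstate x 12 (f(rFL := ?c)))"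
    by (simp only: h_def cstate_pair[symmetric])
qed

section \<open>The graph of guessed decompositions\<close>

abbreviation "Q1 \<equiv> reached (leading F)"
abbreviation "Q2 \<equiv> reached (leading G)"
abbreviation "P1 w \<equiv> reached (progress_of F w)"
abbreviation "P2 w \<equiv> reached (progress_of G w)"

text \<open>Vertices are parametrised by the words that produce them: the stem \<open>w\<close>, the
  auxiliary word \<open>z\<close> for the guessed progress states, and the period \<open>y\<close>.
  Each effective edge then appends a letter to one of these words or changes the phase.\<close>

definition vertex0 :: "'a list \<Rightarrow> nat list" where
  "vertex0 w = [0, 0, Q1 w, Q2 w, 0, 0, 0, 0, 0, 0, 0, 0]"

definition vertex1 :: "'a list \<Rightarrow> 'a list \<Rightarrow> nat list" where
  "vertex1 w z = [1, 0, Q1 w, Q2 w, Q1 w, Q2 w, P1 w z, P2 w z, P1 w [], P2 w [], P1 w z, P2 w z]"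

definition vertex2 :: "'a list \<Rightarrow> 'a list \<Rightarrow> 'a list \<Rightarrow> nat list" where
  "vertex2 w z y = [1, 1, Q1 (w @ y), Q2 (w @ y), Q1 w, Q2 w, P1 w z, P2 w z, P1 w y, P2 w y, P1 w (z @ y), P2 w (z @ y)]"

definition vertices :: "nat list set" where
  "vertices = range vertex0 \<union> {vertex1 w z |w z. True} \<union> {vertex2 w z y |w z y. y \<noteq> []}"

lemma reached_Nil: "reached A [] = initial A"
  by (simp add: reached_run)

lemma progress_reached: "progress F (Q1 w) = progress_of F w" "progress G (Q2 w) = progress_of G w"
  by (simp_all add: progress_of_def)

lemma states_less: "Q1 w < nstates (leading F)" "Q2 w < nstates (leading G)"
  "P1 w z < nstates (progress_of F w)" "P2 w z < nstates (progress_of G w)"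
  using wf reached_less wf_progress_of by (auto simp: wf_fdfa_def wf_dfa_def)

lemma states_le: "Q1 w \<le> Suc (length x)" "Q2 w \<le> Suc (length x)" "P1 w z \<le> Suc (length x)" "P2 w z \<le> Suc (length x)"
  using states_less(1,2)[where w = w] states_less(3,4)[where w = w and z = z] side_nstates[OF sides(1)] side_nstates[OF sides(2)]
    side_nstates_progress[OF sides(1), of "Q1 w"] side_nstates_progress[OF sides(2), of "Q2 w"]
  by (auto simp: progress_reached)

text \<open>In the first phase the progress digits and the remembered leading states are filled with
  \<open>0\<close>; these placeholders have to be valid states too.\<close>

lemma zero_less: "0 < nstates (leading F)" "0 < nstates (leading G)"
  "0 < nstates (progress F 0)" "0 < nstates (progress G 0)"
proof -
  show l: "0 < nstates (leading F)" "0 < nstates (leading G)"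
    using wf by (auto simp: wf_fdfa_def wf_aut_def)
  then have "wf_dfa (progress F 0)" "wf_dfa (progress G 0)" using wf by (auto simp: wf_fdfa_def)
  then show "0 < nstates (progress F 0)" "0 < nstates (progress G 0)"
    by (auto simp: wf_dfa_def wf_aut_def)
qed

lemma wfl_vertex: "ds \<in> vertices \<Longrightarrow> wfl ds"
  using states_le
  by (auto simp: vertices_def vertex0_def vertex1_def vertex2_def wfl_def less_Suc_eq_le)

declare add_2_eq_Suc' [simp del]

lemma valid_vertex: "ds \<in> vertices \<Longrightarrow> valid ds"
  using states_less zero_less wfl_vertex[of ds]
  by (auto simp: vertices_def valid_def vertex0_def vertex1_def vertex2_def progress_reached numeral_eq_Suc)

lemma succ_vertex:
  "succ (Lead l) (vertex0 w) = vertex0 (w @ [\<sigma> ! l])"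
  "succ Switch (vertex0 w) = vertex1 w []"
  "succ (Choose l) (vertex0 w) = vertex0 w"
  "succ (Run l) (vertex0 w) = vertex0 w"
  "succ (Lead l) (vertex1 w z) = vertex1 w z"
  "succ Switch (vertex1 w z) = vertex1 w z"
  "succ (Choose l) (vertex1 w z) = vertex1 w (z @ [\<sigma> ! l])"
  "succ (Run l) (vertex1 w z) = vertex2 w z [\<sigma> ! l]"
  "succ (Lead l) (vertex2 w z y) = vertex2 w z y"
  "succ Switch (vertex2 w z y) = vertex2 w z y"
  "succ (Choose l) (vertex2 w z y) = vertex2 w z y"
  "succ (Run l) (vertex2 w z y) = vertex2 w z (y @ [\<sigma> ! l])"
  by (simp_all add: vertex0_def vertex1_def vertex2_def numeral_eq_Suc progress_reached
      progress_reached[unfolded reached_run] reached_run run_append)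

lemma vertex_in_vertices: "vertex0 w \<in> vertices" "vertex1 w z \<in> vertices" "y \<noteq> [] \<Longrightarrow> vertex2 w z y \<in> vertices"
  by (auto simp: vertices_def)

lemma vertices_cases:
  assumes "ds \<in> vertices"
  obtains w where "ds = vertex0 w" | w z where "ds = vertex1 w z" | w z y where "y \<noteq> []" "ds = vertex2 w z y"
  using assms by (auto simp: vertices_def)

lemma succ_vertices: "ds \<in> vertices \<Longrightarrow> succ a ds \<in> vertices"
  by (elim vertices_cases; cases a) (simp_all add: succ_vertex vertex_in_vertices del: succ.simps)

text \<open>In the third part \<open>z\<close> is arbitrary: from \<open>P1 w y = P1 w z\<close> and
  \<open>P1 w (z @ y) = P1 w z\<close> it follows that \<open>P1 w (y @ y) = P1 w y\<close>, and the
  accepting status of the guessed state is that of \<open>y\<close>. Conversely, the guess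
  \<open>z = y\<close> fulfils both equations.\<close>

lemma badl_vertex:
  "\<not> badl (vertex0 w)" "\<not> badl (vertex1 w z)"
  "badl (vertex2 w z y) \<Longrightarrow> duo_normalized F w y \<and> duo_normalized G w y \<and>
     \<beta> (y \<in> dfa_lang (progress_of F w)) (y \<in> dfa_lang (progress_of G w))"
  "duo_normalized F w y \<Longrightarrow> duo_normalized G w y \<Longrightarrow>
     \<beta> (y \<in> dfa_lang (progress_of F w)) (y \<in> dfa_lang (progress_of G w)) \<Longrightarrow> badl (vertex2 w y y)"
  by (auto simp: badl_def vertex0_def vertex1_def vertex2_def numeral_eq_Suc progress_reached
      duo_normalized_def normalized_def dfa_lang_def reached_append)

definition nxt :: "label \<Rightarrow> nat \<Rightarrow> nat" where
  "nxt a v = num b (succ a (digits b 12 v))"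

definition bad :: "nat \<Rightarrow> bool" where
  "bad v \<longleftrightarrow> badl (digits b 12 v)"

lemma digits_num: "wfl ds \<Longrightarrow> digits b 12 (num b ds) = ds"
  using dig_num[of _ ds b] by (intro nth_equalityI) (auto simp: wfl_def)

lemma inj_num: "inj_on (num b) (Collect wfl)"
  by (rule inj_on_inverseI[of _ "digits b 12"]) (simp only: digits_num mem_Collect_eq)

lemma counting: "counting x 12 (init_com go1 go2) (step_com (length \<sigma>) go1 go2) (bad_com \<beta> (length \<sigma>) go1 go2)
   (all_labels (length \<sigma>)) (num b (vertex0 [])) nxt bad (num b ` vertices)"
proof
  have less: "num b ds < b ^ 12" if "wfl ds" for ds
    using num_less[of ds b] that by (simp only: wfl_def)
  show sub: "num b ` vertices \<subseteq> {..<b ^ 12}" using less wfl_vertex by blast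
  show "card (num b ` vertices) < b ^ 12"
  proof -
    \<comment> \<open>All digits are maximal, thus at least \<open>2\<close> as the input is
      nonempty, while the flags of a vertex are at most \<open>1\<close>. So this code is not that
      of a vertex, and the number of vertices is strictly below \<open>b ^ 12\<close>.\<close>
    let ?ds = "replicate 12 (Suc (length x))"
    have "1 < Suc (length x)" using zero_less(1) side_nstates[OF sides(1)] by linarith
    then have nv: "?ds \<notin> vertices"
      by (auto simp: vertices_def vertex0_def vertex1_def vertex2_def numeral_eq_Suc)
    have w: "wfl ?ds" by (simp add: wfl_def)
    have new: "num b ?ds \<notin> num b ` vertices"
      using nv inj_on_image_mem_iff[OF inj_num, of ?ds vertices] w wfl_vertex by blast
    have "num b ?ds \<in> {..<b ^ 12}" using less[OF w] by (simp only: lessThan_iff)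
    then have "num b ` vertices \<subset> {..<b ^ 12}" using sub new by blast
    from psubset_card_mono[OF finite_lessThan this] show ?thesis by (simp only: card_lessThan)
  qed
  show "num b (vertex0 []) \<in> num b ` vertices" by (auto simp: vertices_def)
  show "nxt a v \<in> num b ` vertices" if "a \<in> set (all_labels (length \<sigma>))" "v \<in> num b ` vertices" for a v
    using that succ_vertices by (auto simp: nxt_def digits_num wfl_vertex)
  show "acts x 12 (init_com go1 go2 2) f (f(2 := num b (vertex0 [])))" for f
  proof -
    let ?z = "replicate 12 0"
    have z: "wfl ?z" by (simp add: wfl_def)
    have i: "initial (leading F) \<le> Suc (length x)" using states_le(1)[of "[]"] by (simp add: reached_Nil)
    have 1: "does 2 (get_initial go1 (Rg 2 2)) ?z (?z[2 := initial (leading F)])"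
      by (rule does_initial_leading[OF sides(1) z]) simp
    have 2: "does 2 (get_initial go2 (Rg 2 3)) (?z[2 := initial (leading F)]) (?z[2 := initial (leading F), 3 := initial (leading G)])"
      by (rule does_initial_leading[OF sides(2) wfl_upd[OF z i]]) simp
    have "num b ?z = 0" by (simp add: numeral_eq_Suc)
    moreover have "?z[2 := initial (leading F), 3 := initial (leading G)] = vertex0 []"
      by (simp add: vertex0_def reached_Nil numeral_eq_Suc)
    ultimately have "acts x 12 (get_initial go1 (Rg 2 2) ;; get_initial go2 (Rg 2 3)) (f(2 := 0)) ((f(2 := 0))(2 := num b (vertex0 [])))"
      using does_Seq[OF 1 2] unfolding does_def by (metis fun_upd_same)
    from acts_target[OF acts_Seq[OF acts_reset_reg this]] show ?thesis by (simp add: init_com_def)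
  qed
  show "acts x 12 (step_com (length \<sigma>) go1 go2 a r) f (f(r := nxt a (f r)))"
    if a: "a \<in> set (all_labels (length \<sigma>))" and r: "r \<in> {2, 3}" and f: "f r \<in> num b ` vertices" for a r f
  proof -
    obtain ds where ds: "ds \<in> vertices" "f r = num b ds" using f by auto
    have "does r (step_com (length \<sigma>) go1 go2 a r) ds (succ a ds)"
      by (rule does_step_com[OF valid_vertex[OF ds(1)] a])
    then show ?thesis using ds(2) digits_num[OF wfl_vertex[OF ds(1)]] by (simp add: does_def nxt_def)
  qed
  show "acts x 12 (bad_com \<beta> (length \<sigma>) go1 go2 0) f (f(9 := if bad (f 0) then 1 else 0))"
    if f: "f 0 \<in> num b ` vertices" "f 9 = 0" for f
  proof -
    obtain ds where ds: "ds \<in> vertices" "f 0 = num b ds" using f by auto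
    have "bad (f 0) \<longleftrightarrow> badl ds" using ds digits_num[OF wfl_vertex[OF ds(1)]] by (simp add: bad_def)
    then show ?thesis using acts_bad_com[of ds f 0, OF valid_vertex[OF ds(1)] ds(2)] f(2) by simp
  qed
qed simp

interpretation counting x 12 "init_com go1 go2" "step_com (length \<sigma>) go1 go2" "bad_com \<beta> (length \<sigma>) go1 go2"
   "all_labels (length \<sigma>)" "num b (vertex0 [])" nxt bad "num b ` vertices"
  by (rule counting)

lemma R_succ: "ds \<in> vertices \<Longrightarrow> num b ds \<in> R i \<Longrightarrow> a \<in> set (all_labels (length \<sigma>)) \<Longrightarrow> num b (succ a ds) \<in> R (Suc i)"
proof -
  assume "ds \<in> vertices" "num b ds \<in> R i" "a \<in> set (all_labels (length \<sigma>))"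
  then have "nxt a (num b ds) \<in> R (Suc i)" by auto
  then show ?thesis using digits_num[OF wfl_vertex[OF \<open>ds \<in> vertices\<close>]] by (simp only: nxt_def)
qed

lemma R_vertex2:
  assumes "y \<noteq> []" shows "\<exists>i. num b (vertex2 w z y) \<in> R i"
proof -
  note vs = vertex_in_vertices
  have idx: "\<exists>l < length \<sigma>. \<sigma> ! l = a" for a using \<sigma> by (metis UNIV_I in_set_conv_nth)
  have lab: "Switch \<in> set (all_labels (length \<sigma>))"
    "l < length \<sigma> \<Longrightarrow> {Lead l, Choose l, Run l} \<subseteq> set (all_labels (length \<sigma>))" for l
    by (auto simp: all_labels_def)
  have 0: "\<exists>i. num b (vertex0 w) \<in> R i" for w
  proof (induction w rule: rev_induct)
    case Nil
    then show ?case by (intro exI[of _ 0]) simp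
  next
    case (snoc a w)
    then obtain i where i: "num b (vertex0 w) \<in> R i" by blast
    obtain l where l: "l < length \<sigma>" "\<sigma> ! l = a" using idx by blast
    from R_succ[OF vs(1) i, of "Lead l"] lab(2)[OF l(1)] have "num b (vertex0 (w @ [a])) \<in> R (Suc i)"
      by (simp only: succ_vertex l(2) insert_subset)
    then show ?case by blast
  qed
  have 1: "\<exists>i. num b (vertex1 w z) \<in> R i"
  proof (induction z rule: rev_induct)
    case Nil
    from 0[of w] obtain i where i: "num b (vertex0 w) \<in> R i" by blast
    from R_succ[OF vs(1) i lab(1)] show ?case unfolding succ_vertex by blast
  next
    case (snoc a z)
    then obtain i where i: "num b (vertex1 w z) \<in> R i" by blast
    obtain l where l: "l < length \<sigma>" "\<sigma> ! l = a" using idx by blast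
    from R_succ[OF vs(2) i, of "Choose l"] lab(2)[OF l(1)] have "num b (vertex1 w (z @ [a])) \<in> R (Suc i)"
      by (simp only: succ_vertex l(2) insert_subset)
    then show ?case by blast
  qed
  show ?thesis
    using assms
  proof (induction y rule: rev_induct)
    case (snoc a y)
    obtain l where l: "l < length \<sigma>" "\<sigma> ! l = a" using idx by blast
    show ?case
    proof (cases "y = []")
      case True
      from 1 obtain i where i: "num b (vertex1 w z) \<in> R i" by blast
      from R_succ[OF vs(2) i, of "Run l"] lab(2)[OF l(1)] have "num b (vertex2 w z [a]) \<in> R (Suc i)"
        by (simp only: succ_vertex l(2) insert_subset)
      then show ?thesis using True by (simp del: R.simps) blast
    next
      case False
      then obtain i where i: "num b (vertex2 w z y) \<in> R i" using snoc.IH by blast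
      from R_succ[OF vs(3)[OF False] i, of "Run l"] lab(2)[OF l(1)] have "num b (vertex2 w z (y @ [a])) \<in> R (Suc i)"
        by (simp only: succ_vertex l(2) insert_subset)
      then show ?thesis by blast
    qed
  qed simp
qed

text \<open>A forbidden pair of answers on a word becomes a bad vertex through a decomposition of
  that word, with the auxiliary word equal to the period. A bad vertex in turn exhibits a
  decomposition, and saturation turns the answers on it into answers for its word.\<close>

lemma nobad_iff:
  assumes "saturated F" "saturated G"
  shows "(\<forall>i. nobad i) \<longleftrightarrow> (\<forall>w \<in> up_words. \<not> \<beta> (w \<in> fdfa_lang F) (w \<in> fdfa_lang G))"
proof
  assume nb: "\<forall>i. nobad i"
  show "\<forall>w \<in> up_words. \<not> \<beta> (w \<in> fdfa_lang F) (w \<in> fdfa_lang G)"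
  proof (intro ballI notI)
    fix w assume w: "w \<in> up_words" "\<beta> (w \<in> fdfa_lang F) (w \<in> fdfa_lang G)"
    \<comment> \<open>The product FDFA is used only to obtain one decomposition that is
      duo-normalized for \<open>F\<close> and \<open>G\<close> at once.\<close>
    obtain u y where uy: "decomposition w u y" "duo_normalized (prod_fdfa \<beta> F G) u y"
      using duo_normalized_exists[OF wf_prod_fdfa[OF wf] w(1)] by blast
    then have duo: "duo_normalized F u y" "duo_normalized G u y" using duo_normalized_prod[OF wf(2)] by auto
    have "badl (vertex2 u y y)"
      by (rule badl_vertex(4)[OF duo])
        (use w(2) saturated_lang[OF assms(1) uy(1) duo(1)] saturated_lang[OF assms(2) uy(1) duo(2)] in simp)
    moreover have ne: "y \<noteq> []" using uy(1) by (simp add: decomposition_def)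
    moreover have "wfl (vertex2 u y y)" by (rule wfl_vertex) (use ne in \<open>auto simp: vertices_def\<close>)
    ultimately have "bad (num b (vertex2 u y y))" by (simp add: bad_def digits_num)
    then show False using R_vertex2[OF ne, of u y] nb by (auto simp: nobad_def)
  qed
next
  assume nw: "\<forall>w \<in> up_words. \<not> \<beta> (w \<in> fdfa_lang F) (w \<in> fdfa_lang G)"
  show "\<forall>i. nobad i"
    unfolding nobad_def
  proof (intro allI ballI notI)
    fix i v assume v: "v \<in> R i" "bad v"
    then obtain ds where ds: "ds \<in> vertices" "v = num b ds" using R_Val by blast
    then have "badl ds" using v(2) by (simp add: bad_def digits_num wfl_vertex)
    with ds(1) badl_vertex(1,2) obtain w z y where y: "y \<noteq> []" "badl (vertex2 w z y)"
      by (auto simp: vertices_def)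
    note duo = badl_vertex(3)[OF y(2)]
    have dec: "decomposition (w \<frown> y\<^sup>\<omega>) w y" using y(1) by (simp add: decomposition_def)
    then have "w \<frown> y\<^sup>\<omega> \<in> up_words" by (auto simp: up_words_def)
    with nw duo saturated_lang[OF assms(1) dec] saturated_lang[OF assms(2) dec] show False by auto
  qed
qed

lemma decide:
  assumes "saturated F" "saturated G"
  shows "(\<exists>t. exec x (counting.unreachable_prog 12 (init_com go1 go2) (step_com (length \<sigma>) go1 go2)
      (bad_com \<beta> (length \<sigma>) go1 go2) (all_labels (length \<sigma>))) start t) \<longleftrightarrow>
    (\<forall>w \<in> up_words. \<not> \<beta> (w \<in> fdfa_lang F) (w \<in> fdfa_lang G))"
  using unreachable_prog nobad_iff[OF assms] by simp

end

definition decide_com :: "(bool \<Rightarrow> bool \<Rightarrow> bool) \<Rightarrow> nat \<Rightarrow> 'a symbol com \<Rightarrow> 'a symbol com \<Rightarrow> 'a symbol com" where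
  "decide_com \<beta> k g1 g2 = counting.unreachable_prog 12 (init_com g1 g2) (step_com k g1 g2)
      (bad_com \<beta> k g1 g2) (all_labels k)"

lemma decide_single:
  assumes \<sigma>: "set \<sigma> = UNIV"
  shows "nondet_decidable_in_space log_space (enc_fdfa \<sigma>) sat_fdfas
    (\<lambda>F. \<forall>w \<in> up_words. \<not> \<beta> (w \<in> fdfa_lang F) (w \<in> fdfa_lang F))"
proof (rule nondet_decidable_by_program[where c = "decide_com \<beta> (length \<sigma>) go_first go_first"])
  fix F :: "'a fdfa" assume F: "F \<in> sat_fdfas"
  have g: "goes (enc_fdfa \<sigma> F) go_first (enc_fdfa \<sigma> F @ [])" using goes_first by simp
  interpret fdfa_pair \<sigma> "enc_fdfa \<sigma> F" F F go_first go_first "[]" "[]" \<beta>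
    by unfold_locales (use \<sigma> sat_fdfas_D[OF F] g in \<open>auto simp: flagless_def\<close>)
  show "(\<exists>t. exec (enc_fdfa \<sigma> F) (decide_com \<beta> (length \<sigma>) go_first go_first) start t) \<longleftrightarrow>
    (\<forall>w \<in> up_words. \<not> \<beta> (w \<in> fdfa_lang F) (w \<in> fdfa_lang F))"
    unfolding decide_com_def using decide sat_fdfas_D(2)[OF F] by blast
qed

lemma decide_pair:
  assumes \<sigma>: "set \<sigma> = UNIV"
  shows "nondet_decidable_in_space log_space (enc_fdfa_pair \<sigma>) (sat_fdfas \<times> sat_fdfas)
    (\<lambda>(F, G). \<forall>w \<in> up_words. \<not> \<beta> (w \<in> fdfa_lang F) (w \<in> fdfa_lang G))"
proof (rule nondet_decidable_by_program[where c = "decide_com \<beta> (length \<sigma>) go_first (go_next go_first)"])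
  fix FG :: "'a fdfa \<times> 'a fdfa" assume "FG \<in> sat_fdfas \<times> sat_fdfas"
  then obtain F G where FG: "FG = (F, G)" "F \<in> sat_fdfas" "G \<in> sat_fdfas" by auto
  let ?x = "enc_fdfa_pair \<sigma> FG"
  have x: "?x = enc_fdfa \<sigma> F @ Separator # enc_fdfa \<sigma> G" by (simp add: enc_fdfa_pair_def FG)
  then have g1: "goes ?x go_first (enc_fdfa \<sigma> F @ Separator # enc_fdfa \<sigma> G)" using goes_first by metis
  from goes_next[OF this Separator_enc_fdfa] have g2: "goes ?x (go_next go_first) (enc_fdfa \<sigma> G @ [])" by simp
  interpret fdfa_pair \<sigma> ?x F G go_first "go_next go_first" "Separator # enc_fdfa \<sigma> G" "[]" \<beta>
    by unfold_locales (use \<sigma> sat_fdfas_D[OF FG(2)] sat_fdfas_D[OF FG(3)] g1 g2 in \<open>auto simp: flagless_def\<close>)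
  show "(\<exists>t. exec ?x (decide_com \<beta> (length \<sigma>) go_first (go_next go_first)) start t) \<longleftrightarrow>
    (case FG of (F, G) \<Rightarrow> \<forall>w \<in> up_words. \<not> \<beta> (w \<in> fdfa_lang F) (w \<in> fdfa_lang G))"
    unfolding decide_com_def FG(1) prod.case
    using decide sat_fdfas_D(2)[OF FG(2)] sat_fdfas_D(2)[OF FG(3)] FG(1) by blast
qed

theorem theorem9:
  fixes \<sigma> :: "'a::finite list"
  assumes "distinct \<sigma>" and "set \<sigma> = UNIV"
  shows
    "computable_in_space const_space (enc_fdfa \<sigma>) (enc_fdfa \<sigma>) sat_fdfas
       (\<lambda>F G. G \<in> sat_fdfas \<and> fdfa_lang G = up_words - fdfa_lang F)
   \<and> computable_in_space log_space (enc_fdfa_pair \<sigma>) (enc_fdfa \<sigma>) (sat_fdfas \<times> sat_fdfas)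
       (\<lambda>(F, F') G. G \<in> sat_fdfas \<and> fdfa_lang G = fdfa_lang F \<inter> fdfa_lang F')
   \<and> computable_in_space log_space (enc_fdfa_pair \<sigma>) (enc_fdfa \<sigma>) (sat_fdfas \<times> sat_fdfas)
       (\<lambda>(F, F') G. G \<in> sat_fdfas \<and> fdfa_lang G = fdfa_lang F \<union> fdfa_lang F')
   \<and> decidable_in_space log_space (enc_fdfa_words \<sigma>) {(F, u, v). F \<in> sat_fdfas \<and> v \<noteq> []}
       (\<lambda>(F, u, v). (u, v) \<in> accepted F)
   \<and> nondet_decidable_in_space log_space (enc_fdfa \<sigma>) sat_fdfas
       (\<lambda>F. fdfa_lang F = {})
   \<and> nondet_decidable_in_space log_space (enc_fdfa \<sigma>) sat_fdfas
       (\<lambda>F. fdfa_lang F = up_words)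
   \<and> nondet_decidable_in_space log_space (enc_fdfa_pair \<sigma>) (sat_fdfas \<times> sat_fdfas)
       (\<lambda>(F, F'). fdfa_lang F \<subseteq> fdfa_lang F')
   \<and> nondet_decidable_in_space log_space (enc_fdfa_pair \<sigma>) (sat_fdfas \<times> sat_fdfas)
       (\<lambda>(F, F'). fdfa_lang F = fdfa_lang F')"
proof (intro conjI)
  \<comment> \<open>The forbidden answers are, in turn: accepted, rejected, accepted by the first
    FDFA only, and different. As languages are subsets of \<open>up_words\<close>, these tests on
    ultimately periodic words determine the relations between the sets.\<close>
  have "(\<forall>w \<in> up_words. \<not> w \<in> fdfa_lang F) \<longleftrightarrow> fdfa_lang F = {}" for F :: "'a fdfa"
    using fdfa_lang_up[of F] by auto
  then show "nondet_decidable_in_space log_space (enc_fdfa \<sigma>) sat_fdfas (\<lambda>F. fdfa_lang F = {})"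
    using decide_single[OF assms(2), of "\<lambda>p _. p"] by simp
  have "(\<forall>w \<in> up_words. \<not> w \<notin> fdfa_lang F) \<longleftrightarrow> fdfa_lang F = up_words" for F :: "'a fdfa"
    using fdfa_lang_up[of F] by auto
  then show "nondet_decidable_in_space log_space (enc_fdfa \<sigma>) sat_fdfas (\<lambda>F. fdfa_lang F = up_words)"
    using decide_single[OF assms(2), of "\<lambda>p _. \<not> p"] by simp
  have "(\<forall>w \<in> up_words. \<not> (w \<in> fdfa_lang F \<and> w \<notin> fdfa_lang F')) \<longleftrightarrow> fdfa_lang F \<subseteq> fdfa_lang F'" for F F' :: "'a fdfa"
    using fdfa_lang_up[of F] by auto
  then show "nondet_decidable_in_space log_space (enc_fdfa_pair \<sigma>) (sat_fdfas \<times> sat_fdfas)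
       (\<lambda>(F, F'). fdfa_lang F \<subseteq> fdfa_lang F')"
    using decide_pair[OF assms(2), of "\<lambda>p q. p \<and> \<not> q"] by simp
  have "(\<forall>w \<in> up_words. \<not> (w \<in> fdfa_lang F) \<noteq> (w \<in> fdfa_lang F')) \<longleftrightarrow> fdfa_lang F = fdfa_lang F'" for F F' :: "'a fdfa"
    using fdfa_lang_up[of F] fdfa_lang_up[of F'] by auto
  then show "nondet_decidable_in_space log_space (enc_fdfa_pair \<sigma>) (sat_fdfas \<times> sat_fdfas)
       (\<lambda>(F, F'). fdfa_lang F = fdfa_lang F')"
    using decide_pair[OF assms(2), of "(\<noteq>)"] by simp
qed (rule complement_computable intersection_computable union_computable membership_decidable[OF assms])+

end
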